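(* Let $T$ be a rosy theory. Then þ-independence is an independence relation on (small subsets of) the monster model of $T$; more precisely, the following hold for all tuples $a,b$, all sets $A,B,C$ and all types. 1. Existence: if $p\in S(A)$, then $p$ does not þ-fork over $A$. 2. Extension: every partial type over $B\supseteq A$ which does not þ-fork over $A$ can be extended to a complete type $p(x)$ over $B$ which does not þ-fork over $A$. 3. Reflexivity: $B\perp^{þ}_A B$ if and only if $B\subseteq \mathrm{acl}(A)$. 4. Monotonicity: if $p$ and $q$ are types with $p\supseteq q$ and $p$ does not þ-fork over $A$, then $q$ does not þ-fork over $A$. 5. Finite character: $C\perp^{þ}_A B$ if and only if $c\perp^{þ}_A B$ for every finite $c\subset C$. 6. Symmetry: $C\perp^{þ}_A B$ if and only if $B\perp^{þ}_A C$. 7. Transitivity: if $A\subseteq B\subseteq C$, then $b\perp^{þ}_A C$ if and only if $b\perp^{þ}_A B$ and $b\perp^{þ}_B C$. 8. If $a\perp^{þ}_A b$ and, for some formula $\delta(x,y)$, $\delta(x,a)$ þ-forks over $A$, then $\delta(x,a)$ þ-forks over $Ab$. 9. If $A\subseteq B$ and $a\perp^{þ}_A B$, then $a\perp^{þ}_A \mathrm{acl}(B)$.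
   Context: $T$ is a complete first-order theory with monster model $\mathcal C$ (saturated, of large cardinality); all sets, tuples, types and models are small and live inside $\mathcal C$. One works in $\mathcal C^{eq}$, so tuples are tuples of imaginaries and $\mathrm{acl}$ is computed in $\mathcal C^{eq}$. A family $\{\delta(x,a')\}_{a'\in S}$ is $k$-inconsistent if $\bigwedge_{i=1}^k\delta(x,a_i)$ is inconsistent for all pairwise distinct $a_1,\dots,a_k\in S$. A formula $\delta(x,a)$ strongly divides over $A$ if $tp(a/A)$ is non-algebraic and $\{\delta(x,a')\}_{a'\models tp(a/A)}$ is $k$-inconsistent for some $k\in\mathbb N$. It þ-divides over $A$ if there is a tuple $c$ such that $\delta(x,a)$ strongly divides over $Ac$. A formula þ-forks over $A$ if it implies a finite disjunction of formulas (with parameters) each of which þ-divides over $A$. A type þ-divides (þ-forks) over $A$ if it contains a formula which þ-divides (þ-forks) over $A$; partial types are understood to be closed under finite conjunctions. $a\perp^{þ}_A b$ (þ-independence) means that $tp(a/Ab)$ does not þ-fork over $A$; similarly for sets, using (enumerations of) the sets. þ-rank: for a formula $\phi$ (with parameters) in $x$, a set $\Delta$ of parameter-free formulas in variables $x;y$, a set $\Pi$ of parameter-free formulas in variables $y;z$ ($z$ possibly of infinite length), and $k\in\mathbb N$, define þ$(\phi,\Delta,\Pi,k)$ inductively: (1) þ$(\phi,\Delta,\Pi,k)\ge 0$ if $\phi$ is consistent; (2) for $\lambda$ a limit ordinal, þ$(\phi,\Delta,\Pi,k)\ge\lambda$ iff þ$(\phi,\Delta,\Pi,k)\ge\alpha$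 for all $\alpha<\lambda$; (3) þ$(\phi,\Delta,\Pi,k)\ge\alpha+1$ iff there are $\delta\in\Delta$, $\pi(y;z)\in\Pi$ and parameters $c$ such that þ$(\phi\wedge\delta(x,a),\Delta,\Pi,k)\ge\alpha$ for infinitely many $a\models\pi(y;c)$, and $\{\delta(x,a)\}_{a\models\pi(y;c)}$ is $k$-inconsistent. For a type $p$, þ$(p,\Delta,\Pi,k)=\min\{$þ$(\phi,\Delta,\Pi,k):\phi\in p\}$. $T$ is rosy if þ$(p,\Delta,\Pi,k)$ is finite for every type $p$, all finite sets $\Delta,\Pi$ of formulas and every $k\in\mathbb N$. *)

theory Defs
  imports Main "HOL-Library.FuncSet" "HOL-Library.Extended_Nat"
begin

unbundle cardinal_syntax

section \<open>Many-sorted first-order logic\<close>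

text \<open>A variable is a pair of a sort and a name. Terms may contain constants \<open>Par c\<close> for elements
  \<open>c\<close> of a structure, so that formulas with parameters are literally formulas.\<close>

record ('s, 'f, 'r) signature =
  sorts :: "'s set"
  funs  :: "'f set"
  rels  :: "'r set"
  fargs :: "'f \<Rightarrow> 's list"
  fres  :: "'f \<Rightarrow> 's"
  rargs :: "'r \<Rightarrow> 's list"

record ('s, 'f, 'r, 'm) struc =
  carr :: "'s \<Rightarrow> 'm set"
  fn   :: "'f \<Rightarrow> 'm list \<Rightarrow> 'm"
  rl   :: "'r \<Rightarrow> 'm list set"

datatype ('f, tvars: 'v, 'm) trm =
    Var 'v
  | Par 'm
  | Fn 'f "('f, 'v, 'm) trm list"

datatype ('f, 'r, 'v, 'm) fm =
    Eq "('f, 'v, 'm) trm" "('f, 'v, 'm) trm"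
  | Rl 'r "('f, 'v, 'm) trm list"
  | Neg "('f, 'r, 'v, 'm) fm"
  | Conj "('f, 'r, 'v, 'm) fm" "('f, 'r, 'v, 'm) fm"
  | All 'v "('f, 'r, 'v, 'm) fm"

text \<open>\<open>P s\<close> is the set of parameters of sort \<open>s\<close> that are allowed as constants.\<close>

fun has_sort :: "('s, 'f, 'r) signature \<Rightarrow> ('s \<Rightarrow> 'm set) \<Rightarrow> ('f, 's \<times> 'n, 'm) trm \<Rightarrow> 's \<Rightarrow> bool" where
  "has_sort L P (Var x) s \<longleftrightarrow> fst x = s"
| "has_sort L P (Par c) s \<longleftrightarrow> c \<in> P s"
| "has_sort L P (Fn f ts) s \<longleftrightarrow> f \<in> funs L \<and> fres L f = s \<and> list_all2 (has_sort L P) ts (fargs L f)"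

primrec wff :: "('s, 'f, 'r) signature \<Rightarrow> ('s \<Rightarrow> 'm set) \<Rightarrow> ('f, 'r, 's \<times> 'n, 'm) fm \<Rightarrow> bool" where
  "wff L P (Eq t u) \<longleftrightarrow> (\<exists>s\<in>sorts L. has_sort L P t s \<and> has_sort L P u s)"
| "wff L P (Rl r ts) \<longleftrightarrow> r \<in> rels L \<and> list_all2 (has_sort L P) ts (rargs L r)"
| "wff L P (Neg \<phi>) \<longleftrightarrow> wff L P \<phi>"
| "wff L P (Conj \<phi> \<psi>) \<longleftrightarrow> wff L P \<phi> \<and> wff L P \<psi>"
| "wff L P (All x \<phi>) \<longleftrightarrow> fst x \<in> sorts L \<and> wff L P \<phi>"

primrec FV :: "('f, 'r, 'v, 'm) fm \<Rightarrow> 'v set" where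
  "FV (Eq t u) = tvars t \<union> tvars u"
| "FV (Rl r ts) = (\<Union>t\<in>set ts. tvars t)"
| "FV (Neg \<phi>) = FV \<phi>"
| "FV (Conj \<phi> \<psi>) = FV \<phi> \<union> FV \<psi>"
| "FV (All x \<phi>) = FV \<phi> - {x}"

primrec tinst :: "'v set \<Rightarrow> ('v \<Rightarrow> 'm) \<Rightarrow> ('f, 'v, 'm) trm \<Rightarrow> ('f, 'v, 'm) trm" where
  "tinst Y a (Var x) = (if x \<in> Y then Par (a x) else Var x)"
| "tinst Y a (Par c) = Par c"
| "tinst Y a (Fn f ts) = Fn f (map (tinst Y a) ts)"

text \<open>If \<open>\<delta>\<close> is \<open>\<delta>(x,y)\<close> with \<open>Y\<close> the set of variables \<open>y\<close>, then \<open>inst Y a \<delta>\<close> is \<open>\<delta>(x,a)\<close>.\<close>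

primrec inst :: "'v set \<Rightarrow> ('v \<Rightarrow> 'm) \<Rightarrow> ('f, 'r, 'v, 'm) fm \<Rightarrow> ('f, 'r, 'v, 'm) fm" where
  "inst Y a (Eq t u) = Eq (tinst Y a t) (tinst Y a u)"
| "inst Y a (Rl r ts) = Rl r (map (tinst Y a) ts)"
| "inst Y a (Neg \<phi>) = Neg (inst Y a \<phi>)"
| "inst Y a (Conj \<phi> \<psi>) = Conj (inst Y a \<phi>) (inst Y a \<psi>)"
| "inst Y a (All x \<phi>) = All x (inst (Y - {x}) a \<phi>)"

primrec eval :: "('s, 'f, 'r, 'm) struc \<Rightarrow> ('v \<Rightarrow> 'm) \<Rightarrow> ('f, 'v, 'm) trm \<Rightarrow> 'm" where
  "eval M e (Var x) = e x"
| "eval M e (Par c) = c"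
| "eval M e (Fn f ts) = fn M f (map (eval M e) ts)"

primrec sat :: "('s, 'f, 'r, 'm) struc \<Rightarrow> ('s \<times> 'n \<Rightarrow> 'm) \<Rightarrow> ('f, 'r, 's \<times> 'n, 'm) fm \<Rightarrow> bool" where
  "sat M e (Eq t u) \<longleftrightarrow> eval M e t = eval M e u"
| "sat M e (Rl r ts) \<longleftrightarrow> map (eval M e) ts \<in> rl M r"
| "sat M e (Neg \<phi>) \<longleftrightarrow> \<not> sat M e \<phi>"
| "sat M e (Conj \<phi> \<psi>) \<longleftrightarrow> sat M e \<phi> \<and> sat M e \<psi>"
| "sat M e (All x \<phi>) \<longleftrightarrow> (\<forall>c\<in>carr M (fst x). sat M (e(x := c)) \<phi>)"

definition is_struc :: "('s, 'f, 'r) signature \<Rightarrow> ('s, 'f, 'r, 'm) struc \<Rightarrow> bool" where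
  "is_struc L M \<longleftrightarrow>
     (\<forall>s. carr M s \<noteq> {} \<longleftrightarrow> s \<in> sorts L) \<and>
     (\<forall>f\<in>funs L. \<forall>cs. list_all2 (\<lambda>c s. c \<in> carr M s) cs (fargs L f) \<longrightarrow> fn M f cs \<in> carr M (fres L f)) \<and>
     (\<forall>r\<in>rels L. \<forall>cs\<in>rl M r. list_all2 (\<lambda>c s. c \<in> carr M s) cs (rargs L r))"

definition univ :: "('s, 'f, 'r, 'm) struc \<Rightarrow> 'm set" where
  "univ M = (\<Union>s. carr M s)"

text \<open>Tuples indexed by a set \<open>X\<close> of variables; the tuple respects the sorts of the variables.\<close>

definition tuples :: "('s, 'f, 'r, 'm) struc \<Rightarrow> ('s \<times> 'n) set \<Rightarrow> ('s \<times> 'n \<Rightarrow> 'm) set" where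
  "tuples M X = PiE X (\<lambda>x. carr M (fst x))"

text \<open>Formulas in the variables \<open>X\<close>: without parameters, and over a set \<open>A\<close> of parameters.\<close>

definition fms0 :: "('s, 'f, 'r) signature \<Rightarrow> ('s \<times> 'n) set \<Rightarrow> ('f, 'r, 's \<times> 'n, 'm) fm set" where
  "fms0 L X = {\<phi>. wff L (\<lambda>s. {}) \<phi> \<and> FV \<phi> \<subseteq> X}"

definition fms :: "('s, 'f, 'r) signature \<Rightarrow> ('s, 'f, 'r, 'm) struc \<Rightarrow> ('s \<times> 'n) set \<Rightarrow> 'm set
    \<Rightarrow> ('f, 'r, 's \<times> 'n, 'm) fm set" where
  "fms L M X A = {\<phi>. wff L (\<lambda>s. carr M s \<inter> A) \<phi> \<and> FV \<phi> \<subseteq> X}"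


section \<open>Types, saturation, complete theories, monster models\<close>

text \<open>Partial types are closed under finite conjunctions; consistency of a set of formulas with
  parameters in \<open>M\<close> is then the satisfiability in \<open>M\<close> of each of its members.\<close>

definition partial_type :: "('s, 'f, 'r) signature \<Rightarrow> ('s, 'f, 'r, 'm) struc \<Rightarrow> ('s \<times> 'n) set \<Rightarrow> 'm set
    \<Rightarrow> ('f, 'r, 's \<times> 'n, 'm) fm set \<Rightarrow> bool" where
  "partial_type L M X A p \<longleftrightarrow>
     p \<subseteq> fms L M X A \<and> p \<noteq> {} \<and> (\<forall>\<phi>\<in>p. \<forall>\<psi>\<in>p. Conj \<phi> \<psi> \<in> p) \<and>
     (\<forall>\<phi>\<in>p. \<exists>e\<in>tuples M X. sat M e \<phi>)"

text \<open>The set \<open>S(A)\<close> of complete types over \<open>A\<close> in the variables \<open>X\<close>.\<close>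

definition complete_types :: "('s, 'f, 'r) signature \<Rightarrow> ('s, 'f, 'r, 'm) struc \<Rightarrow> ('s \<times> 'n) set \<Rightarrow> 'm set
    \<Rightarrow> ('f, 'r, 's \<times> 'n, 'm) fm set set" where
  "complete_types L M X A =
     {p. partial_type L M X A p \<and> (\<forall>\<phi>\<in>fms L M X A. \<phi> \<in> p \<or> Neg \<phi> \<in> p)}"

definition realizes :: "('s, 'f, 'r, 'm) struc \<Rightarrow> ('s \<times> 'n) set \<Rightarrow> ('s \<times> 'n \<Rightarrow> 'm)
    \<Rightarrow> ('f, 'r, 's \<times> 'n, 'm) fm set \<Rightarrow> bool" where
  "realizes M X e p \<longleftrightarrow> e \<in> tuples M X \<and> (\<forall>\<phi>\<in>p. sat M e \<phi>)"

text \<open>\<open>tp L M X a A\<close> is \<open>tp(a/A)\<close> for a tuple \<open>a\<close> indexed by \<open>X\<close>.\<close>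

definition tp :: "('s, 'f, 'r) signature \<Rightarrow> ('s, 'f, 'r, 'm) struc \<Rightarrow> ('s \<times> 'n) set \<Rightarrow> ('s \<times> 'n \<Rightarrow> 'm)
    \<Rightarrow> 'm set \<Rightarrow> ('f, 'r, 's \<times> 'n, 'm) fm set" where
  "tp L M X a A = {\<phi> \<in> fms L M X A. sat M a \<phi>}"

definition small_set :: "('s, 'f, 'r, 'm) struc \<Rightarrow> 'm set \<Rightarrow> bool" where
  "small_set M A \<longleftrightarrow> A \<subseteq> univ M \<and> |A| <o |univ M|"

definition small_vars :: "('s, 'f, 'r, 'm) struc \<Rightarrow> ('s \<times> 'n) set \<Rightarrow> bool" where
  "small_vars M X \<longleftrightarrow> |X| <o |univ M|"

text \<open>First-order theories are one-sorted: the type of sorts is \<^typ>\<open>unit\<close>.\<close>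

type_synonym ('f, 'r, 'm) base_fm = "('f, 'r, unit \<times> nat, 'm) fm"

definition models :: "(unit, 'f, 'r) signature \<Rightarrow> (unit, 'f, 'r, 'm) struc
    \<Rightarrow> ('f, 'r, 'm) base_fm set \<Rightarrow> bool" where
  "models L M T \<longleftrightarrow> is_struc L M \<and> (\<forall>\<sigma>\<in>T. \<forall>e. sat M e \<sigma>)"

text \<open>The models range over all structures whose universe is a subset of the type \<open>'m\<close>. When the
  universe of some infinite model has cardinality greater than that of the language (as in
  \<open>monster_model\<close> below), this is semantic consequence, by the Loewenheim-Skolem theorem.\<close>

definition entails :: "(unit, 'f, 'r) signature \<Rightarrow> ('f, 'r, 'm) base_fm set
    \<Rightarrow> ('f, 'r, 'm) base_fm \<Rightarrow> bool" where
  "entails L T \<sigma> \<longleftrightarrow>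
     (\<forall>N :: (unit, 'f, 'r, 'm) struc. models L N T \<longrightarrow> models L N {\<sigma>})"

definition complete_theory :: "(unit, 'f, 'r) signature \<Rightarrow> ('f, 'r, 'm) base_fm set \<Rightarrow> bool" where
  "complete_theory L T \<longleftrightarrow>
     T \<subseteq> fms0 L {} \<and> (\<exists>N :: (unit, 'f, 'r, 'm) struc. models L N T) \<and>
     (\<forall>\<sigma>\<in>fms0 L {}. entails L T \<sigma> \<or> entails L T (Neg \<sigma>))"

text \<open>A saturated model of \<open>T\<close>, of cardinality greater than that of the language (and uncountable).\<close>

definition monster_model :: "(unit, 'f, 'r) signature \<Rightarrow> ('f, 'r, 'm) base_fm set
    \<Rightarrow> (unit, 'f, 'r, 'm) struc \<Rightarrow> bool" where
  "monster_model L T M \<longleftrightarrow>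
     models L M T \<and>
     |funs L <+> rels L <+> (UNIV :: nat set)| <o |univ M| \<and>
     (\<forall>A (X :: (unit \<times> nat) set). small_set M A \<and> finite X \<longrightarrow>
        (\<forall>p\<in>complete_types L M X A. \<exists>e. realizes M X e p))"


section \<open>Imaginaries\<close>

text \<open>For a parameter-free formula \<open>E\<close> in the variables \<open>0,\<dots>,2n-1\<close>, the relation
  \<open>E(x\<^sub>0,\<dots>,x\<^sub>n\<^sub>-\<^sub>1; x\<^sub>n,\<dots>,x\<^sub>2\<^sub>n\<^sub>-\<^sub>1)\<close> on \<open>n\<close>-tuples.\<close>

definition ntuples :: "(unit, 'f, 'r, 'm) struc \<Rightarrow> nat \<Rightarrow> 'm list set" where
  "ntuples M n = {as. length as = n \<and> set as \<subseteq> univ M}"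

definition def_rel :: "(unit, 'f, 'r, 'm) struc \<Rightarrow> nat \<Rightarrow> ('f, 'r, 'm) base_fm
    \<Rightarrow> ('m list \<times> 'm list) set" where
  "def_rel M n E = {(as, bs). as \<in> ntuples M n \<and> bs \<in> ntuples M n \<and> sat M (\<lambda>x. (as @ bs) ! snd x) E}"

definition def_equiv :: "(unit, 'f, 'r) signature \<Rightarrow> (unit, 'f, 'r, 'm) struc \<Rightarrow> nat
    \<Rightarrow> ('f, 'r, 'm) base_fm \<Rightarrow> bool" where
  "def_equiv L M n E \<longleftrightarrow>
     0 < n \<and> E \<in> fms0 L {((), i) |i. i < 2 * n} \<and> equiv (ntuples M n) (def_rel M n E)"

text \<open>The language of \<open>M\<^sup>e\<^sup>q\<close>: the home sort with the original symbols, and for each parameter-free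
  definable equivalence relation \<open>E\<close> on \<open>n\<close>-tuples a sort \<open>Quot n E\<close> with the projection \<open>Proj n E\<close>.\<close>

datatype ('f, 'r, 'm) eq_sort = Home | Quot nat "('f, 'r, 'm) base_fm"

datatype ('f, 'r, 'm) eq_fun = Base 'f | Proj nat "('f, 'r, 'm) base_fm"

datatype ('f, 'r, 'm) eq_elem = Real (real_of: 'm) | Cls nat "('f, 'r, 'm) base_fm" "'m list set"

fun eq_fargs :: "(unit, 'f, 'r) signature \<Rightarrow> ('f, 'r, 'm) eq_fun \<Rightarrow> ('f, 'r, 'm) eq_sort list" where
  "eq_fargs L (Base f) = map (\<lambda>_. Home) (fargs L f)"
| "eq_fargs L (Proj n E) = replicate n Home"

fun eq_fres :: "('f, 'r, 'm) eq_fun \<Rightarrow> ('f, 'r, 'm) eq_sort" where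
  "eq_fres (Base f) = Home"
| "eq_fres (Proj n E) = Quot n E"

definition eq_sig :: "(unit, 'f, 'r) signature \<Rightarrow> (unit, 'f, 'r, 'm) struc
    \<Rightarrow> (('f, 'r, 'm) eq_sort, ('f, 'r, 'm) eq_fun, 'r) signature" where
  "eq_sig L M =
     \<lparr>sorts = {Home} \<union> {Quot n E |n E. def_equiv L M n E},
      funs = Base ` funs L \<union> {Proj n E |n E. def_equiv L M n E},
      rels = rels L,
      fargs = eq_fargs L,
      fres = eq_fres,
      rargs = (\<lambda>r. map (\<lambda>_. Home) (rargs L r))\<rparr>"

fun eq_carr :: "(unit, 'f, 'r) signature \<Rightarrow> (unit, 'f, 'r, 'm) struc
    \<Rightarrow> ('f, 'r, 'm) eq_sort \<Rightarrow> ('f, 'r, 'm) eq_elem set" where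
  "eq_carr L M Home = Real ` univ M"
| "eq_carr L M (Quot n E) =
     (if def_equiv L M n E then Cls n E ` (ntuples M n // def_rel M n E) else {})"

fun eq_fn :: "(unit, 'f, 'r, 'm) struc \<Rightarrow> ('f, 'r, 'm) eq_fun
    \<Rightarrow> ('f, 'r, 'm) eq_elem list \<Rightarrow> ('f, 'r, 'm) eq_elem" where
  "eq_fn M (Base f) cs = Real (fn M f (map real_of cs))"
| "eq_fn M (Proj n E) cs = Cls n E (def_rel M n E `` {map real_of cs})"

definition eq_struc :: "(unit, 'f, 'r) signature \<Rightarrow> (unit, 'f, 'r, 'm) struc
    \<Rightarrow> (('f, 'r, 'm) eq_sort, ('f, 'r, 'm) eq_fun, 'r, ('f, 'r, 'm) eq_elem) struc" where
  "eq_struc L M =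
     \<lparr>carr = eq_carr L M,
      fn = eq_fn M,
      rl = (\<lambda>r. map Real ` rl M r)\<rparr>"


section \<open>Algebraic closure and thorn-forking\<close>

definition algebraic_type :: "('s, 'f, 'r, 'm) struc \<Rightarrow> ('s \<times> 'n) set
    \<Rightarrow> ('f, 'r, 's \<times> 'n, 'm) fm set \<Rightarrow> bool" where
  "algebraic_type M X p \<longleftrightarrow> (\<exists>\<phi>\<in>p. finite {e \<in> tuples M X. sat M e \<phi>})"

definition acl :: "('s, 'f, 'r) signature \<Rightarrow> ('s, 'f, 'r, 'm) struc \<Rightarrow> 'm set \<Rightarrow> 'm set" where
  "acl L M A =
     {b. \<exists>(x :: 's \<times> nat). \<exists>e\<in>tuples M {x}. e x = b \<and> algebraic_type M {x} (tp L M {x} e A)}"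

text \<open>\<open>k_inconsistent M X \<delta> Y S k\<close>: the family \<open>\<delta>(x,a)\<close>, \<open>a \<in> S\<close>, is \<open>k\<close>-inconsistent.\<close>

definition k_inconsistent :: "('s, 'f, 'r, 'm) struc \<Rightarrow> ('s \<times> 'n) set \<Rightarrow> ('f, 'r, 's \<times> 'n, 'm) fm
    \<Rightarrow> ('s \<times> 'n) set \<Rightarrow> ('s \<times> 'n \<Rightarrow> 'm) set \<Rightarrow> nat \<Rightarrow> bool" where
  "k_inconsistent M X \<delta> Y S k \<longleftrightarrow>
     (\<forall>F \<subseteq> S. finite F \<and> card F = k \<longrightarrow>
        \<not> (\<exists>e\<in>tuples M X. \<forall>a\<in>F. sat M e (inst Y a \<delta>)))"

text \<open>Strong dividing of \<open>\<delta>(x,a)\<close> depends on the formula \<open>\<delta>(x,y)\<close> together with the tuple \<open>a\<close>.\<close>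

definition strongly_divides :: "('s, 'f, 'r) signature \<Rightarrow> ('s, 'f, 'r, 'm) struc \<Rightarrow> ('s \<times> 'n) set \<Rightarrow> 'm set
    \<Rightarrow> ('f, 'r, 's \<times> 'n, 'm) fm \<Rightarrow> ('s \<times> 'n) set \<Rightarrow> ('s \<times> 'n \<Rightarrow> 'm) \<Rightarrow> bool" where
  "strongly_divides L M X A \<delta> Y a \<longleftrightarrow>
     finite Y \<and> X \<inter> Y = {} \<and> \<delta> \<in> fms0 L (X \<union> Y) \<and> a \<in> tuples M Y \<and>
     \<not> algebraic_type M Y (tp L M Y a A) \<and>
     (\<exists>k. k_inconsistent M X \<delta> Y {a'. realizes M Y a' (tp L M Y a A)} k)"

text \<open>Here \<open>D\<close> is the set of entries of the additional tuple of parameters.\<close>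

definition thorn_divides :: "('s, 'f, 'r) signature \<Rightarrow> ('s, 'f, 'r, 'm) struc \<Rightarrow> ('s \<times> 'n) set \<Rightarrow> 'm set
    \<Rightarrow> ('f, 'r, 's \<times> 'n, 'm) fm \<Rightarrow> bool" where
  "thorn_divides L M X A \<psi> \<longleftrightarrow>
     (\<exists>\<delta> Y a D. \<psi> = inst Y a \<delta> \<and> small_set M D \<and> strongly_divides L M X (A \<union> D) \<delta> Y a)"

definition thorn_forks :: "('s, 'f, 'r) signature \<Rightarrow> ('s, 'f, 'r, 'm) struc \<Rightarrow> ('s \<times> 'n) set \<Rightarrow> 'm set
    \<Rightarrow> ('f, 'r, 's \<times> 'n, 'm) fm \<Rightarrow> bool" where
  "thorn_forks L M X A \<phi> \<longleftrightarrow>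
     (\<exists>\<Psi>. finite \<Psi> \<and> (\<forall>\<psi>\<in>\<Psi>. thorn_divides L M X A \<psi>) \<and>
        (\<forall>e\<in>tuples M X. sat M e \<phi> \<longrightarrow> (\<exists>\<psi>\<in>\<Psi>. sat M e \<psi>)))"

definition type_thorn_forks :: "('s, 'f, 'r) signature \<Rightarrow> ('s, 'f, 'r, 'm) struc \<Rightarrow> ('s \<times> 'n) set
    \<Rightarrow> 'm set \<Rightarrow> ('f, 'r, 's \<times> 'n, 'm) fm set \<Rightarrow> bool" where
  "type_thorn_forks L M X A p \<longleftrightarrow> (\<exists>\<phi>\<in>p. thorn_forks L M X A \<phi>)"

text \<open>Thorn-independence of a tuple \<open>a\<close> indexed by \<open>X\<close> from (the set of entries of a tuple) \<open>B\<close>.\<close>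

definition thorn_indep :: "('s, 'f, 'r) signature \<Rightarrow> ('s, 'f, 'r, 'm) struc \<Rightarrow> ('s \<times> 'n) set
    \<Rightarrow> ('s \<times> 'n \<Rightarrow> 'm) \<Rightarrow> 'm set \<Rightarrow> 'm set \<Rightarrow> bool" where
  "thorn_indep L M X a A B \<longleftrightarrow> \<not> type_thorn_forks L M X A (tp L M X a (A \<union> B))"

text \<open>A set \<open>C\<close> is enumerated by itself: the variable for \<open>c \<in> C\<close> has the sort of \<open>c\<close> and name \<open>c\<close>.
  Since names are elements of \<open>M\<close>, there are enough variables for all small tuples.\<close>

definition enum_vars :: "('s, 'f, 'r, 'm) struc \<Rightarrow> 'm set \<Rightarrow> ('s \<times> 'm) set" where
  "enum_vars M C = {(s, c). c \<in> C \<and> c \<in> carr M s}"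

definition thorn_indep_set :: "('s, 'f, 'r) signature \<Rightarrow> ('s, 'f, 'r, 'm) struc
    \<Rightarrow> 'm set \<Rightarrow> 'm set \<Rightarrow> 'm set \<Rightarrow> bool" where
  "thorn_indep_set L M C A B \<longleftrightarrow>
     thorn_indep L M (enum_vars M C) (restrict snd (enum_vars M C)) A B"


section \<open>Thorn-rank and rosiness\<close>

text \<open>The sets \<open>\<Delta>\<close>, \<open>\<Theta>\<close> consist of formulas in \<open>x;y\<close> and in \<open>y;z\<close>, respectively.
  \<open>rank_ge M X Y Z \<Delta> \<Theta> k \<alpha> \<phi>\<close>: the rank of \<open>\<phi>\<close> is at least \<open>\<alpha>\<close>, for finite ordinals \<open>\<alpha>\<close>; \<open>X\<close>, \<open>Y\<close>, \<open>Z\<close> are the variables \<open>x\<close>, \<open>y\<close>, \<open>z\<close>.\<close>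

primrec rank_ge :: "('s, 'f, 'r, 'm) struc \<Rightarrow> ('s \<times> 'n) set \<Rightarrow> ('s \<times> 'n) set \<Rightarrow> ('s \<times> 'n) set
    \<Rightarrow> ('f, 'r, 's \<times> 'n, 'm) fm set \<Rightarrow> ('f, 'r, 's \<times> 'n, 'm) fm set \<Rightarrow> nat \<Rightarrow> nat
    \<Rightarrow> ('f, 'r, 's \<times> 'n, 'm) fm \<Rightarrow> bool" where
  "rank_ge M X Y Z \<Delta> \<Theta> k 0 \<phi> \<longleftrightarrow> (\<exists>e\<in>tuples M X. sat M e \<phi>)"
| "rank_ge M X Y Z \<Delta> \<Theta> k (Suc \<alpha>) \<phi> \<longleftrightarrow>
     (\<exists>\<delta>\<in>\<Delta>. \<exists>\<theta>\<in>\<Theta>. \<exists>c\<in>tuples M Z.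
        infinite {a \<in> tuples M Y. sat M a (inst Z c \<theta>) \<and>
          rank_ge M X Y Z \<Delta> \<Theta> k \<alpha> (Conj \<phi> (inst Y a \<delta>))} \<and>
        k_inconsistent M X \<delta> Y {a \<in> tuples M Y. sat M a (inst Z c \<theta>)} k)"

text \<open>A rank is at least the limit ordinal \<open>\<omega>\<close> iff it is at least every finite ordinal; all ranks
  at least \<open>\<omega>\<close> are given the value \<open>\<infinity>\<close>, since only the finiteness of the rank is used.
  Inconsistent formulas, which have no rank, do not occur in types.\<close>

definition thorn_rank :: "('s, 'f, 'r, 'm) struc \<Rightarrow> ('s \<times> 'n) set \<Rightarrow> ('s \<times> 'n) set \<Rightarrow> ('s \<times> 'n) set
    \<Rightarrow> ('f, 'r, 's \<times> 'n, 'm) fm set \<Rightarrow> ('f, 'r, 's \<times> 'n, 'm) fm set \<Rightarrow> nat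
    \<Rightarrow> ('f, 'r, 's \<times> 'n, 'm) fm \<Rightarrow> enat" where
  "thorn_rank M X Y Z \<Delta> \<Theta> k \<phi> = (SUP \<alpha>\<in>{\<alpha>. rank_ge M X Y Z \<Delta> \<Theta> k \<alpha> \<phi>}. enat \<alpha>)"

definition type_thorn_rank :: "('s, 'f, 'r, 'm) struc \<Rightarrow> ('s \<times> 'n) set \<Rightarrow> ('s \<times> 'n) set \<Rightarrow> ('s \<times> 'n) set
    \<Rightarrow> ('f, 'r, 's \<times> 'n, 'm) fm set \<Rightarrow> ('f, 'r, 's \<times> 'n, 'm) fm set \<Rightarrow> nat
    \<Rightarrow> ('f, 'r, 's \<times> 'n, 'm) fm set \<Rightarrow> enat" where
  "type_thorn_rank M X Y Z \<Delta> \<Theta> k p = (INF \<phi>\<in>p. thorn_rank M X Y Z \<Delta> \<Theta> k \<phi>)"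

text \<open>As in \<open>thorn_indep_set\<close>, the names of variables are elements of \<open>M\<close>.\<close>

definition rosy :: "('s, 'f, 'r) signature \<Rightarrow> ('s, 'f, 'r, 'm) struc \<Rightarrow> bool" where
  "rosy L M \<longleftrightarrow>
     (\<forall>(X :: ('s \<times> 'm) set) Y Z A p \<Delta> \<Theta> k.
        small_vars M X \<and> finite Y \<and> small_vars M Z \<and> X \<inter> Y = {} \<and> Y \<inter> Z = {} \<and>
        small_set M A \<and> partial_type L M X A p \<and>
        finite \<Delta> \<and> \<Delta> \<subseteq> fms0 L (X \<union> Y) \<and> finite \<Theta> \<and> \<Theta> \<subseteq> fms0 L (Y \<union> Z) \<longrightarrow>
        type_thorn_rank M X Y Z \<Delta> \<Theta> k p < \<infinity>)"

end

theory Submission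
  imports Defs
begin

text \<open>\<open>M\<^sup>e\<^sup>q\<close> inherits saturation from \<open>M\<close>, because its formulas translate into formulas about
  representatives; hence it is strongly homogeneous, and types become orbits of automorphism groups.
  A formula \<open>\<delta>(x,e)\<close> that strongly divides over \<open>Ad\<close> and holds of \<open>b\<close> makes \<open>e\<close> algebraic over \<open>Adb\<close> but not
  over \<open>Ad\<close>, and conversely. So thorn-independence of \<open>b\<close> from \<open>B\<close> over \<open>A\<close> means: for every small \<open>E\<close>
  there is a conjugate \<open>b'\<close> of \<open>b\<close> over \<open>AB\<close> such that, for all \<open>d \<subseteq> E\<close>, all elements of \<open>E\<close> that are
  algebraic over \<open>Adb'\<close> are algebraic over \<open>Ad\<close>. Extension is compactness, and left transitivity is
  immediate from this description. Rosiness enters twice, through the finiteness of the thorn-rank: a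
  formula of minimal rank in a type over \<open>A\<close> cannot be covered by formulas thorn-dividing over \<open>A\<close>
  (existence), and a failure of symmetry yields, along a reversed independent sequence, a formula of
  infinite rank. Transitivity and the remaining properties follow formally.\<close>

section \<open>Substitution\<close>

text \<open>The argument runs in any many-sorted structure as in \<open>saturated_struc\<close>;
  only the last part is about \<open>Meq\<close>. The main obstacle is that thorn-dividing and the
  thorn-rank concern a fixed parameter-free formula and a fixed k, whereas algebraicity concerns
  single elements. The bridge is a formula \<chi>(x,y) over the base that has at most m solutions y
  for every x, not only for the tuple at hand: then any m+1 instances with distinct y are jointly
  inconsistent. For the rank, the parameters of \<chi> become coordinates of y as well, and
  \<theta>(y;z) says that y agrees with z except at one coordinate. So all conjugates of \<chi>
  share one \<delta>, one \<theta> and one k, and a rank step is one element running through an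
  infinite orbit while the other parameters stay fixed. In \<open>tind\<close> it is the test set E
  that moves, not the independent set; inverting the automorphism shows that this amounts to the
  same. Moves of E can be composed, and this is all that left transitivity takes.\<close>

abbreviation pars :: "('f, 'r, 'v, 'm) fm \<Rightarrow> 'm set" where
  "pars \<equiv> set4_fm"

abbreviation pmap :: "('m \<Rightarrow> 'l) \<Rightarrow> ('f, 'r, 'v, 'm) fm \<Rightarrow> ('f, 'r, 'v, 'l) fm" where
  "pmap g \<equiv> map_fm (\<lambda>x. x) (\<lambda>x. x) (\<lambda>x. x) g"

lemma finite_tvars [simp]: "finite (tvars t)"
  by (induction t) auto

lemma finite_set3_trm [simp]: "finite (set3_trm t)"
  by (induction t) auto

lemma finite_FV [simp]: "finite (FV \<phi>)"
  by (induction \<phi>) auto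

lemma finite_pars [simp]: "finite (pars \<phi>)"
  by (induction \<phi>) auto

lemma eval_cong: "(\<And>x. x \<in> tvars t \<Longrightarrow> e x = e' x) \<Longrightarrow> eval M e t = eval M e' t"
proof (induction t)
  case (Fn f ts)
  then have "map (eval M e) ts = map (eval M e') ts" by auto
  then show ?case by (simp del: map_eq_conv)
qed auto

lemma sat_cong: "(\<And>x. x \<in> FV \<phi> \<Longrightarrow> e x = e' x) \<Longrightarrow> sat M e \<phi> = sat M e' \<phi>"
proof (induction \<phi> arbitrary: e e')
  case (Eq t u)
  have "eval M e t = eval M e' t" "eval M e u = eval M e' u"
    by (rule eval_cong, rule Eq, simp)+
  then show ?case by simp
next
  case (Rl r ts)
  have "eval M e t = eval M e' t" if "t \<in> set ts" for t
    by (rule eval_cong, rule Rl) (use that in auto)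
  then have "map (eval M e) ts = map (eval M e') ts" by simp
  then show ?case by (simp del: map_eq_conv)
next
  case (Neg \<phi>)
  have "sat M e \<phi> = sat M e' \<phi>" by (rule Neg.IH, rule Neg.prems) simp
  then show ?case by simp
next
  case (Conj \<phi> \<psi>)
  have "sat M e \<phi> = sat M e' \<phi>" by (rule Conj.IH(1), rule Conj.prems) simp
  moreover have "sat M e \<psi> = sat M e' \<psi>" by (rule Conj.IH(2), rule Conj.prems) simp
  ultimately show ?case by simp
next
  case (All x \<phi>)
  have "sat M (e(x := c)) \<phi> = sat M (e'(x := c)) \<phi>" for c
    by (rule All.IH) (auto simp del: split_paired_All intro: All.prems)
  then show ?case by (simp del: fun_upd_apply)
qed

lemma eval_tinst: "eval M e (tinst Y a t) = eval M (override_on e a Y) t"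
  by (induction t) (auto simp: override_on_def intro!: arg_cong[where f = "fn M _"])

lemma sat_inst: "sat M e (inst Y a \<phi>) = sat M (override_on e a Y) \<phi>"
proof (induction \<phi> arbitrary: e Y)
  case (All x \<phi>)
  have "override_on (e(x := c)) a (Y - {x}) = (override_on e a Y)(x := c)" for c
    by (auto simp: override_on_def)
  then show ?case using All by (simp del: fun_upd_apply)
qed (simp_all add: eval_tinst comp_def)

lemma tvars_tinst: "tvars (tinst Y a t) = tvars t - Y"
  by (induction t) auto

lemma FV_inst: "FV (inst Y a \<phi>) = FV \<phi> - Y"
  by (induction \<phi> arbitrary: Y) (auto simp: tvars_tinst)

lemma has_sort_tinst:
  assumes "has_sort L P t s" "\<And>s c. c \<in> P s \<Longrightarrow> c \<in> Q s" "\<And>y. y \<in> Y \<Longrightarrow> a y \<in> Q (fst y)"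
  shows "has_sort L Q (tinst Y a t) s"
  using assms(1)
proof (induction t arbitrary: s)
  case (Fn f ts)
  then show ?case by (auto simp: list_all2_conv_all_nth)
qed (use assms in auto)

lemma wff_inst:
  assumes "wff L P \<phi>" "\<And>s c. c \<in> P s \<Longrightarrow> c \<in> Q s" "\<And>y. y \<in> Y \<Longrightarrow> a y \<in> Q (fst y)"
  shows "wff L Q (inst Y a \<phi>)"
  using assms(1,3)
proof (induction \<phi> arbitrary: Y)
  case (Eq t u)
  then obtain s where s: "s \<in> sorts L" "has_sort L P t s" "has_sort L P u s" by auto
  have "has_sort L Q (tinst Y a t) s" "has_sort L Q (tinst Y a u) s"
    using assms(2) Eq.prems(2) by (auto intro: has_sort_tinst[OF s(2)] has_sort_tinst[OF s(3)])
  then show ?case using s(1) by auto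
next
  case (Rl r ts)
  have "has_sort L Q (tinst Y a t) s" if "has_sort L P t s" for t s
    using that assms(2) Rl.prems(2) by (rule has_sort_tinst)
  then show ?case using Rl.prems(1) by (auto simp: list_all2_conv_all_nth)
next
  case (All x \<phi>)
  show ?case using All.prems by (auto intro: All.IH)
qed auto

lemma FV_pmap [simp]: "FV (pmap g \<phi>) = FV \<phi>"
  by (induction \<phi>) (auto simp: trm.set_map)

primrec tsubst :: "('v \<Rightarrow> ('f, 'w, 'l) trm) \<Rightarrow> ('m \<Rightarrow> ('f, 'w, 'l) trm)
    \<Rightarrow> ('f, 'v, 'm) trm \<Rightarrow> ('f, 'w, 'l) trm" where
  "tsubst \<tau> \<rho> (Var x) = \<tau> x"
| "tsubst \<tau> \<rho> (Par c) = \<rho> c"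
| "tsubst \<tau> \<rho> (Fn f ts) = Fn f (map (tsubst \<tau> \<rho>) ts)"

lemma eval_tsubst:
  "eval M e (tsubst \<tau> \<rho> t) =
    eval M (\<lambda>v. eval M e (\<tau> v)) (map_trm (\<lambda>x. x) (\<lambda>x. x) (\<lambda>c. eval M e (\<rho> c)) t)"
  by (induction t) (auto intro!: arg_cong[where f = "fn M _"])

lemma tvars_tsubst:
  "tvars (tsubst \<tau> \<rho> t) = (\<Union>x\<in>tvars t. tvars (\<tau> x)) \<union> (\<Union>c\<in>set3_trm t. tvars (\<rho> c))"
  by (induction t) auto

lemma has_sort_tsubst:
  assumes "has_sort L P t s" "\<And>x. x \<in> tvars t \<Longrightarrow> has_sort L Q (\<tau> x) (fst x)"
    "\<And>c s. c \<in> P s \<Longrightarrow> c \<in> set3_trm t \<Longrightarrow> has_sort L Q (\<rho> c) s"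
  shows "has_sort L Q (tsubst \<tau> \<rho> t) s"
  using assms
proof (induction t arbitrary: s)
  case (Fn f ts)
  have "has_sort L Q (tsubst \<tau> \<rho> t) s" if "t \<in> set ts" "has_sort L P t s" for t s
    using that by (intro Fn.IH Fn.prems(2,3)) auto
  with Fn.prems(1) show ?case by (auto simp: list_all2_conv_all_nth)
qed auto

lemma infinite_fresh:
  assumes "infinite (UNIV :: 'n set)" "finite V"
  obtains n :: 'n where "(s, n) \<notin> V"
proof -
  have "finite (snd ` V)" using assms(2) by simp
  then obtain n where "n \<notin> snd ` V" using assms(1) ex_new_if_finite by blast
  then show ?thesis using that by force
qed

text \<open>An existence statement, because bound variables have to be renamed to avoid capture. Variables
  and parameters are replaced simultaneously, and the new variables may have another type of names.\<close>

lemma substitution: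
  fixes \<phi> :: "('f, 'r, 's \<times> 'n, 'm) fm" and \<tau> :: "'s \<times> 'n \<Rightarrow> ('f, 's \<times> 'k, 'l) trm"
  assumes inf: "infinite (UNIV :: 'k set)"
    and "wff L P \<phi>"
    and "\<And>x. x \<in> FV \<phi> \<Longrightarrow> has_sort L Q (\<tau> x) (fst x)"
    and "\<And>c s. c \<in> P s \<Longrightarrow> c \<in> pars \<phi> \<Longrightarrow> has_sort L Q (\<rho> c) s"
  shows "\<exists>\<phi>'. wff L Q \<phi>' \<and>
    FV \<phi>' \<subseteq> (\<Union>x\<in>FV \<phi>. tvars (\<tau> x)) \<union> (\<Union>c\<in>pars \<phi>. tvars (\<rho> c)) \<and>
    (\<forall>M e. sat M e \<phi>' \<longleftrightarrow> sat M (\<lambda>x. eval M e (\<tau> x)) (pmap (\<lambda>c. eval M e (\<rho> c)) \<phi>))"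
  using assms(2-)
proof (induction \<phi> arbitrary: \<tau>)
  case (Eq t u)
  then obtain s where s: "s \<in> sorts L" "has_sort L P t s" "has_sort L P u s" by auto
  have "has_sort L Q (tsubst \<tau> \<rho> t) s" "has_sort L Q (tsubst \<tau> \<rho> u) s"
    by (auto intro!: has_sort_tsubst[OF s(2)] has_sort_tsubst[OF s(3)] intro: Eq.prems(2,3) simp del: split_paired_All)
  then show ?case using s
    by (intro exI[of _ "Eq (tsubst \<tau> \<rho> t) (tsubst \<tau> \<rho> u)"]) (auto simp: eval_tsubst tvars_tsubst)
next
  case (Rl r ts)
  have "has_sort L Q (tsubst \<tau> \<rho> t) s" if "t \<in> set ts" "has_sort L P t s" for t s
    using that by (intro has_sort_tsubst[of L P] Rl.prems(2,3)) auto
  then have "list_all2 (has_sort L Q) (map (tsubst \<tau> \<rho>) ts) (rargs L r)"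
    using Rl.prems(1) by (auto simp: list_all2_conv_all_nth)
  then show ?case using Rl.prems
    by (intro exI[of _ "Rl r (map (tsubst \<tau> \<rho>) ts)"])
      (auto simp: eval_tsubst tvars_tsubst comp_def)
next
  case (Neg \<phi>)
  obtain \<phi>' where "wff L Q \<phi>'"
    "FV \<phi>' \<subseteq> (\<Union>x\<in>FV \<phi>. tvars (\<tau> x)) \<union> (\<Union>c\<in>pars \<phi>. tvars (\<rho> c))"
    "\<forall>M e. sat M e \<phi>' \<longleftrightarrow> sat M (\<lambda>x. eval M e (\<tau> x)) (pmap (\<lambda>c. eval M e (\<rho> c)) \<phi>)"
    using Neg.IH[of \<tau>] Neg.prems by auto
  then show ?case by (intro exI[of _ "Neg \<phi>'"]) auto
next
  case (Conj \<phi> \<psi>)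
  obtain \<phi>' where 1: "wff L Q \<phi>'"
    "FV \<phi>' \<subseteq> (\<Union>x\<in>FV \<phi>. tvars (\<tau> x)) \<union> (\<Union>c\<in>pars \<phi>. tvars (\<rho> c))"
    "\<forall>M e. sat M e \<phi>' \<longleftrightarrow> sat M (\<lambda>x. eval M e (\<tau> x)) (pmap (\<lambda>c. eval M e (\<rho> c)) \<phi>)"
    using Conj.IH(1)[of \<tau>] Conj.prems by auto
  obtain \<psi>' where 2: "wff L Q \<psi>'"
    "FV \<psi>' \<subseteq> (\<Union>x\<in>FV \<psi>. tvars (\<tau> x)) \<union> (\<Union>c\<in>pars \<psi>. tvars (\<rho> c))"
    "\<forall>M e. sat M e \<psi>' \<longleftrightarrow> sat M (\<lambda>x. eval M e (\<tau> x)) (pmap (\<lambda>c. eval M e (\<rho> c)) \<psi>)"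
    using Conj.IH(2)[of \<tau>] Conj.prems by auto
  show ?case
    by (intro exI[of _ "Conj \<phi>' \<psi>'"] conjI) (use 1 2 in auto)
next
  case (All x \<phi>)
  let ?V = "(\<Union>v\<in>FV \<phi> - {x}. tvars (\<tau> v)) \<union> (\<Union>c\<in>pars \<phi>. tvars (\<rho> c))"
  \<comment> \<open>The new bound variable must avoid the variables of every term inserted below the
    quantifier, the terms for parameters included, since otherwise it would capture them.\<close>
  obtain n where n: "(fst x, n) \<notin> ?V"
    by (rule infinite_fresh[OF inf, of ?V]) auto
  define y where "y = (fst x, n)"
  have y: "y \<notin> ?V" "fst y = fst x" using n by (auto simp: y_def)
  obtain \<phi>' where \<phi>': "wff L Q \<phi>'"
    "FV \<phi>' \<subseteq> (\<Union>v\<in>FV \<phi>. tvars ((\<tau>(x := Var y)) v)) \<union> (\<Union>c\<in>pars \<phi>. tvars (\<rho> c))"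
    "\<forall>M e. sat M e \<phi>' \<longleftrightarrow>
      sat M (\<lambda>v. eval M e ((\<tau>(x := Var y)) v)) (pmap (\<lambda>c. eval M e (\<rho> c)) \<phi>)"
  proof -
    have "has_sort L Q ((\<tau>(x := Var y)) v) (fst v)" if "v \<in> FV \<phi>" for v
      using that All.prems(2)[of v] y(2) by auto
    then show thesis using that All.IH[of "\<tau>(x := Var y)"] All.prems by auto
  qed
  have "sat M e (All y \<phi>') \<longleftrightarrow>
    sat M (\<lambda>v. eval M e (\<tau> v)) (pmap (\<lambda>c. eval M e (\<rho> c)) (All x \<phi>))" for M e
  proof -
    have "sat M (e(y := d)) \<phi>' \<longleftrightarrow>
      sat M ((\<lambda>v. eval M e (\<tau> v))(x := d)) (pmap (\<lambda>c. eval M e (\<rho> c)) \<phi>)" for d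
    proof -
      have p: "pmap (\<lambda>c. eval M (e(y := d)) (\<rho> c)) \<phi> = pmap (\<lambda>c. eval M e (\<rho> c)) \<phi>"
        using y by (intro fm.map_cong eval_cong) auto
      have ev: "eval M (e(y := d)) ((\<tau>(x := Var y)) v) = ((\<lambda>v. eval M e (\<tau> v))(x := d)) v"
        if "v \<in> FV \<phi>" for v
        using that y by (auto intro!: eval_cong)
      have "sat M (e(y := d)) \<phi>' \<longleftrightarrow> sat M (\<lambda>v. eval M (e(y := d)) ((\<tau>(x := Var y)) v))
          (pmap (\<lambda>c. eval M (e(y := d)) (\<rho> c)) \<phi>)"
        using \<phi>'(3) by blast
      also have "\<dots> \<longleftrightarrow> sat M ((\<lambda>v. eval M e (\<tau> v))(x := d)) (pmap (\<lambda>c. eval M e (\<rho> c)) \<phi>)"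
        unfolding p by (intro sat_cong ev) simp
      finally show ?thesis .
    qed
    then show ?thesis using y by (simp del: fun_upd_apply)
  qed
  moreover have "wff L Q (All y \<phi>')" using \<phi>'(1) All.prems y by simp
  moreover have "FV (All y \<phi>') \<subseteq>
    (\<Union>x\<in>FV (All x \<phi>). tvars (\<tau> x)) \<union> (\<Union>c\<in>pars (All x \<phi>). tvars (\<rho> c))"
  proof
    fix z assume "z \<in> FV (All y \<phi>')"
    then have z: "z \<noteq> y" "z \<in> FV \<phi>'" by auto
    from z(2) \<phi>'(2) consider v where "v \<in> FV \<phi>" "z \<in> tvars ((\<tau>(x := Var y)) v)"
      | c where "c \<in> pars \<phi>" "z \<in> tvars (\<rho> c)" by blast
    then show "z \<in> (\<Union>x\<in>FV (All x \<phi>). tvars (\<tau> x)) \<union> (\<Union>c\<in>pars (All x \<phi>). tvars (\<rho> c))"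
    proof cases
      case 1
      then have "v \<noteq> x" using z(1) by auto
      with 1 show ?thesis by auto
    qed auto
  qed
  ultimately show ?case by blast
qed

lemma has_sort_mono:
  assumes "has_sort L P t s" "\<And>s c. c \<in> P s \<Longrightarrow> c \<in> set3_trm t \<Longrightarrow> c \<in> Q s"
  shows "has_sort L Q t s"
  using assms
proof (induction t arbitrary: s)
  case (Fn f ts)
  have "has_sort L Q t s" if "t \<in> set ts" "has_sort L P t s" for t s
    using that by (intro Fn.IH Fn.prems(2)) auto
  with Fn.prems(1) show ?case by (auto simp: list_all2_conv_all_nth)
qed auto

text \<open>Since only the parameters that occur in \<phi> are tested, this also shrinks the
  parameter set of a formula, as in \<open>fms_restrict_pars\<close>.\<close>

lemma wff_mono:
  assumes "wff L P \<phi>" "\<And>s c. c \<in> P s \<Longrightarrow> c \<in> pars \<phi> \<Longrightarrow> c \<in> Q s"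
  shows "wff L Q \<phi>"
  using assms
proof (induction \<phi>)
  case (Eq t u)
  then obtain s where s: "s \<in> sorts L" "has_sort L P t s" "has_sort L P u s" by auto
  have "has_sort L Q t s"
    using s(2) by (rule has_sort_mono) (simp add: Eq.prems(2))
  moreover have "has_sort L Q u s"
    using s(3) by (rule has_sort_mono) (simp add: Eq.prems(2))
  ultimately show ?case using s(1) by auto
next
  case (Rl r ts)
  have "has_sort L Q t s" if "t \<in> set ts" "has_sort L P t s" for t s
    using that by (intro has_sort_mono[of L P t s Q] Rl.prems(2)) auto
  then show ?case using Rl.prems(1) by (auto simp: list_all2_conv_all_nth)
qed auto

lemma has_sort_map:
  assumes "has_sort L P t s" "\<And>s c. c \<in> P s \<Longrightarrow> c \<in> set3_trm t \<Longrightarrow> g c \<in> Q s"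
  shows "has_sort L Q (map_trm (\<lambda>x. x) (\<lambda>x. x) g t) s"
  using assms
proof (induction t arbitrary: s)
  case (Fn f ts)
  have "has_sort L Q (map_trm (\<lambda>x. x) (\<lambda>x. x) g t) s" if "t \<in> set ts" "has_sort L P t s" for t s
    using that by (intro Fn.IH Fn.prems(2)) auto
  with Fn.prems(1) show ?case by (auto simp: list_all2_conv_all_nth)
qed auto

lemma wff_pmap:
  assumes "wff L P \<phi>" "\<And>s c. c \<in> P s \<Longrightarrow> c \<in> pars \<phi> \<Longrightarrow> g c \<in> Q s"
  shows "wff L Q (pmap g \<phi>)"
  using assms
proof (induction \<phi>)
  case (Eq t u)
  then obtain s where s: "s \<in> sorts L" "has_sort L P t s" "has_sort L P u s" by auto
  have "has_sort L Q (map_trm (\<lambda>x. x) (\<lambda>x. x) g t) s"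
    using s(2) by (rule has_sort_map) (simp add: Eq.prems(2))
  moreover have "has_sort L Q (map_trm (\<lambda>x. x) (\<lambda>x. x) g u) s"
    using s(3) by (rule has_sort_map) (simp add: Eq.prems(2))
  ultimately show ?case using s(1) by auto
next
  case (Rl r ts)
  have "has_sort L Q (map_trm (\<lambda>x. x) (\<lambda>x. x) g t) s" if "t \<in> set ts" "has_sort L P t s" for t s
    using that by (intro has_sort_map[of L P t s g Q] Rl.prems(2)) auto
  then show ?case using Rl.prems(1) by (auto simp: list_all2_conv_all_nth)
qed auto

lemma has_sort_pars: "has_sort L P t s \<Longrightarrow> set3_trm t \<subseteq> (\<Union>s. P s)"
proof (induction t arbitrary: s)
  case (Fn f ts)
  have "set3_trm t \<subseteq> (\<Union>s. P s)" if t: "t \<in> set ts" for t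
  proof -
    obtain s where "has_sort L P t s"
      using t Fn.prems by (auto simp: list_all2_conv_all_nth in_set_conv_nth)
    then show ?thesis by (rule Fn.IH[OF t])
  qed
  then show ?case by auto
qed auto

lemma wff_pars: "wff L P \<phi> \<Longrightarrow> pars \<phi> \<subseteq> (\<Union>s. P s)"
proof (induction \<phi>)
  case (Eq t u)
  then obtain s where "has_sort L P t s" "has_sort L P u s" by auto
  then show ?case using has_sort_pars[of L P t s] has_sort_pars[of L P u s] by auto
next
  case (Rl r ts)
  have "set3_trm t \<subseteq> (\<Union>s. P s)" if t: "t \<in> set ts" for t
  proof -
    obtain s where "has_sort L P t s"
      using t Rl.prems by (auto simp: list_all2_conv_all_nth in_set_conv_nth)
    then show ?thesis by (rule has_sort_pars)
  qed
  then show ?case by auto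
qed auto

section \<open>Compactness\<close>

text \<open>Meant for sets that are not closed under conjunction, where satisfiability of each
  single member would be too weak.\<close>

definition finsat :: "('s, 'f, 'r, 'm) struc \<Rightarrow> ('s \<times> 'n) set \<Rightarrow> ('f, 'r, 's \<times> 'n, 'm) fm set \<Rightarrow> bool" where
  "finsat M X \<Sigma> \<longleftrightarrow> (\<forall>F\<subseteq>\<Sigma>. finite F \<longrightarrow> (\<exists>e\<in>tuples M X. \<forall>\<phi>\<in>F. sat M e \<phi>))"

text \<open>The syntax has no constant for truth, hence the nonempty \<open>F\<close>; where
  \<open>F\<close> might be empty, the valid sentence from \<open>truth\<close> is added
  first.\<close>

lemma conjunction:
  assumes "finite F" "F \<noteq> {}" "\<And>\<phi>. \<phi> \<in> F \<Longrightarrow> wff L P \<phi>"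
  obtains \<chi> where "wff L P \<chi>" "FV \<chi> = (\<Union>\<phi>\<in>F. FV \<phi>)" "\<And>M e. sat M e \<chi> \<longleftrightarrow> (\<forall>\<phi>\<in>F. sat M e \<phi>)"
  using assms
proof (induction F arbitrary: thesis rule: finite_ne_induct)
  case (singleton \<phi>)
  show ?case by (rule singleton(1)[of \<phi>]) (use singleton in auto)
next
  case (insert \<phi> F)
  obtain \<chi> where "wff L P \<chi>" "FV \<chi> = (\<Union>\<phi>\<in>F. FV \<phi>)" "\<And>M e. sat M e \<chi> \<longleftrightarrow> (\<forall>\<phi>\<in>F. sat M e \<phi>)"
    using insert by (metis insertCI)
  then show ?case by (intro insert(5)[of "Conj \<phi> \<chi>"]) (use insert in auto)
qed

text \<open>A maximal finitely satisfiable set exists by Zorn. If it contained neither \<phi> nor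
  its negation, one finite part would refute \<phi> and another its negation, so their union would
  have no solution.\<close>

lemma finsat_extend:
  assumes "finsat M X \<Sigma>" "\<Sigma> \<subseteq> fms L M X A"
  obtains p where "\<Sigma> \<subseteq> p" "p \<subseteq> fms L M X A" "finsat M X p"
    "\<And>\<phi>. \<phi> \<in> fms L M X A \<Longrightarrow> \<phi> \<in> p \<or> Neg \<phi> \<in> p"
proof -
  define S where "S = {p. \<Sigma> \<subseteq> p \<and> p \<subseteq> fms L M X A \<and> finsat M X p}"
  have "S \<noteq> {}" using assms by (auto simp: S_def)
  moreover have "\<Union>C \<in> S" if C: "C \<noteq> {}" "subset.chain S C" for C
  proof -
    have "finsat M X (\<Union>C)" unfolding finsat_def
    proof (intro allI impI)
      fix F assume F: "F \<subseteq> \<Union>C" "finite F"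
      obtain p where "p \<in> C" "F \<subseteq> p"
        using finite_subset_Union_chain[OF F(2,1) C] by auto
      then show "\<exists>e\<in>tuples M X. \<forall>\<phi>\<in>F. sat M e \<phi>"
        using C F by (auto simp: S_def subset.chain_def finsat_def)
    qed
    then show ?thesis using C by (fastforce simp: S_def subset.chain_def)
  qed
  ultimately obtain p where p: "p \<in> S" and max: "\<And>q. q \<in> S \<Longrightarrow> p \<subseteq> q \<Longrightarrow> q = p"
    by (rule subset_Zorn_nonempty[THEN bexE]) auto
  have "\<phi> \<in> p \<or> Neg \<phi> \<in> p" if \<phi>: "\<phi> \<in> fms L M X A" for \<phi>
  proof (rule ccontr)
    assume n: "\<not> (\<phi> \<in> p \<or> Neg \<phi> \<in> p)"
    have N: "Neg \<phi> \<in> fms L M X A" using \<phi> by (simp add: fms_def)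
    have "\<exists>F\<subseteq>p. finite F \<and> (\<forall>e\<in>tuples M X. (\<forall>\<psi>\<in>F. sat M e \<psi>) \<longrightarrow> \<not> sat M e \<chi>)"
      if \<chi>: "\<chi> \<in> fms L M X A" "\<chi> \<notin> p" for \<chi>
    proof -
      have "insert \<chi> p \<notin> S" using max[of "insert \<chi> p"] \<chi> by auto
      then have "\<not> finsat M X (insert \<chi> p)" using p \<chi> by (auto simp: S_def)
      then obtain F where "F \<subseteq> insert \<chi> p" "finite F" "\<forall>e\<in>tuples M X. \<exists>\<psi>\<in>F. \<not> sat M e \<psi>"
        by (auto simp: finsat_def)
      then show ?thesis by (intro exI[of _ "F - {\<chi>}"]) auto
    qed
    from this[OF \<phi>] this[OF N] n obtain F G where
      FG: "F \<subseteq> p" "finite F" "\<forall>e\<in>tuples M X. (\<forall>\<psi>\<in>F. sat M e \<psi>) \<longrightarrow> \<not> sat M e \<phi>"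
      "G \<subseteq> p" "finite G" "\<forall>e\<in>tuples M X. (\<forall>\<psi>\<in>G. sat M e \<psi>) \<longrightarrow> sat M e \<phi>" by auto
    have "finsat M X p" using p by (simp add: S_def)
    then obtain e where "e \<in> tuples M X" "\<forall>\<psi>\<in>F \<union> G. sat M e \<psi>"
      using FG by (metis finsat_def finite_UnI le_sup_iff)
    then show False using FG by auto
  qed
  then show ?thesis using that p by (auto simp: S_def)
qed

text \<open>Otherwise the negation of \<chi> belongs to \<open>p\<close>, and together with
  \<open>F\<close> it has no solution.\<close>

lemma finsat_complete_mem:
  assumes "finsat M X p" "\<And>\<phi>. \<phi> \<in> fms L M X A \<Longrightarrow> \<phi> \<in> p \<or> Neg \<phi> \<in> p"
    and "F \<subseteq> p" "finite F" "\<chi> \<in> fms L M X A"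
    and "\<And>e. e \<in> tuples M X \<Longrightarrow> (\<And>\<phi>. \<phi> \<in> F \<Longrightarrow> sat M e \<phi>) \<Longrightarrow> sat M e \<chi>"
  shows "\<chi> \<in> p"
proof (rule ccontr)
  assume "\<chi> \<notin> p"
  then have "insert (Neg \<chi>) F \<subseteq> p" using assms by auto
  then obtain e where "e \<in> tuples M X" "\<forall>\<phi>\<in>insert (Neg \<chi>) F. sat M e \<phi>"
    using assms(1,4) by (metis finsat_def finite_insert)
  then show False using assms(6) by auto
qed

text \<open>For the transfinite constructions below: a formula has finitely many variables, and the
  greatest of them names the stage at which the formula is taken care of.\<close>

lemma finite_linear_max:
  assumes "Well_order r" "finite S" "S \<noteq> {}" "S \<subseteq> Field r"
  shows "\<exists>y\<in>S. \<forall>z\<in>S. (z, y) \<in> r"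
  using assms(2-)
proof (induction S rule: finite_ne_induct)
  case (singleton x)
  then show ?case using assms(1)
    by (auto simp: well_order_on_def linear_order_on_def partial_order_on_def preorder_on_def refl_on_def)
next
  case (insert x S)
  then obtain y where y: "y \<in> S" "\<forall>z\<in>S. (z, y) \<in> r" by auto
  have r: "refl_on (Field r) r" "trans r" "total_on (Field r) r"
    using assms(1) by (auto simp: well_order_on_def linear_order_on_def partial_order_on_def preorder_on_def)
  consider "(x, y) \<in> r" | "(y, x) \<in> r" "(x, x) \<in> r"
    using r y insert by (metis insert_subset refl_onD subsetD total_on_def)
  then show ?case
  proof cases
    case 1
    then show ?thesis using y by blast
  next
    case 2
    then have "(z, x) \<in> r" if "z \<in> S" for z using transD[OF r(2)] y that by blast
    then show ?thesis using 2 by blast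
  qed
qed

text \<open>Saturation is assumed for a single variable, and \<open>realize\<close> extends it to
  small tuples. Sorts are disjoint so that an element determines the sort of a variable that
  replaces it.\<close>

locale saturated_struc =
  fixes L :: "('s, 'f, 'r) signature" and M :: "('s, 'f, 'r, 'm) struc"
  assumes struc: "is_struc L M"
    and carr_disjoint: "c \<in> carr M s \<Longrightarrow> c \<in> carr M s' \<Longrightarrow> s = s'"
    and infinite_univ: "infinite (univ M)"
    and saturated: "small_set M A \<Longrightarrow> \<Sigma> \<subseteq> fms L M {x :: 's \<times> 'm} A \<Longrightarrow> finsat M {x} \<Sigma> \<Longrightarrow>
      \<exists>e. realizes M {x} e \<Sigma>"
begin

lemma infinite_names: "infinite (UNIV :: 'm set)"
  using infinite_univ infinite_super subset_UNIV by blast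

lemma sort_if_carr: "c \<in> carr M s \<Longrightarrow> s \<in> sorts L"
  using struc by (auto simp: is_struc_def)

lemma carr_univ: "c \<in> carr M s \<Longrightarrow> c \<in> univ M"
  by (auto simp: univ_def)

lemma small_Un: "small_set M A \<Longrightarrow> small_set M B \<Longrightarrow> small_set M (A \<union> B)"
  using infinite_univ by (auto simp: small_set_def intro: card_of_Un_ordLess_infinite)

lemma small_finite: "finite A \<Longrightarrow> A \<subseteq> univ M \<Longrightarrow> small_set M A"
  using infinite_univ by (auto simp: small_set_def Field_card_of intro!: finite_ordLess_infinite[OF card_of_Well_order card_of_Well_order])

lemma small_subset: "small_set M B \<Longrightarrow> A \<subseteq> B \<Longrightarrow> small_set M A"
  by (auto simp: small_set_def intro: ordLeq_ordLess_trans[OF card_of_mono1])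

lemma small_vars_subset: "small_vars M Y \<Longrightarrow> X \<subseteq> Y \<Longrightarrow> small_vars M X"
  by (auto simp: small_vars_def intro: ordLeq_ordLess_trans[OF card_of_mono1])

lemma small_vars_finite: "finite X \<Longrightarrow> small_vars M X"
  using infinite_univ by (auto simp: small_vars_def Field_card_of intro!: finite_ordLess_infinite[OF card_of_Well_order card_of_Well_order])

lemma small_vars_Un: "small_vars M X \<Longrightarrow> small_vars M Y \<Longrightarrow> small_vars M (X \<union> Y)"
  using infinite_univ by (auto simp: small_vars_def intro: card_of_Un_ordLess_infinite)

lemma small_image_vars:
  "small_vars M X \<Longrightarrow> (\<And>x. x \<in> X \<Longrightarrow> f x \<in> univ M) \<Longrightarrow> small_set M (f ` X)"
  by (auto simp: small_set_def small_vars_def intro: ordLeq_ordLess_trans[OF card_of_image])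

lemma small_image:
  "small_set M A \<Longrightarrow> (\<And>x. x \<in> A \<Longrightarrow> f x \<in> univ M) \<Longrightarrow> small_set M (f ` A)"
  by (auto simp: small_set_def intro: ordLeq_ordLess_trans[OF card_of_image])

lemma tuplesD: "e \<in> tuples M X \<Longrightarrow> x \<in> X \<Longrightarrow> e x \<in> carr M (fst x)"
  by (auto simp: tuples_def)

lemma tuples_univ: "e \<in> tuples M X \<Longrightarrow> x \<in> X \<Longrightarrow> e x \<in> univ M"
  using tuplesD carr_univ by blast

text \<open>The variables receive values one after another along a well-order of \<open>X\<close>.
  At each stage the formulas in the variables reached so far, with the earlier values inserted as
  parameters, form a finitely satisfiable set in one variable over a small set. The completion
  \<open>p\<close> is taken beforehand, so that it contains the existential formulas which carry
  satisfiability from one stage to the next.\<close>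

lemma realize:
  fixes X :: "('s \<times> 'm) set"
  assumes A: "small_set M A" and X: "small_vars M X" and "\<Sigma> \<subseteq> fms L M X A" "finsat M X \<Sigma>"
  obtains e where "realizes M X e \<Sigma>"
proof -
  obtain p where p: "\<Sigma> \<subseteq> p" "p \<subseteq> fms L M X A" "finsat M X p"
    "\<And>\<phi>. \<phi> \<in> fms L M X A \<Longrightarrow> \<phi> \<in> p \<or> Neg \<phi> \<in> p"
    using finsat_extend[OF assms(4,3)] by metis
  have wo: "Well_order |X|" by (rule card_of_Well_order)
  define U where "U x = underS |X| x" for x
  have U: "U x \<subseteq> X" "x \<notin> U x" for x
    using Field_card_of[of X] by (auto simp: U_def underS_def Field_def)
  \<comment> \<open>Nothing is asked outside \<open>X\<close>, so that the recursive choice may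
    range over the whole type of variables.\<close>
  define P where "P f x r \<longleftrightarrow> (x \<in> X \<longrightarrow> r \<in> carr M (fst x) \<and>
      (\<forall>\<phi>\<in>p. FV \<phi> \<subseteq> insert x (U x) \<longrightarrow> sat M (f(x := r)) \<phi>))" for f x r
  have max: "\<exists>y\<in>X. FV \<chi> \<subseteq> insert y (U y) \<and> y \<in> FV \<chi>" if "FV \<chi> \<subseteq> X" "FV \<chi> \<noteq> {}" for \<chi> :: "('f, 'r, 's \<times> 'm, 'm) fm"
    using finite_linear_max[OF wo, of "FV \<chi>"] that by (auto simp: U_def underS_def Field_card_of)
  \<comment> \<open>Sentences have no greatest variable, so no stage takes care of them.\<close>
  have sent: "sat M f \<chi>" if "\<chi> \<in> p" "FV \<chi> = {}" for f \<chi>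
  proof -
    have "\<exists>e\<in>tuples M X. \<forall>\<phi>\<in>{\<chi>}. sat M e \<phi>"
      using p(3) that(1) unfolding finsat_def by (meson empty_subsetI finite.emptyI finite_insert insert_subset)
    then show ?thesis using sat_cong[of \<chi> f] that(2) by auto
  qed
  have "\<exists>f. \<forall>x. P f x (f x)"
  proof (rule dependent_wf_choice[of "|X| - Id"])
    show "wf ( |X| - Id)" using wo by (simp add: well_order_on_def)
  next
    fix f g :: "'s \<times> 'm \<Rightarrow> 'm" and x r
    assume eq: "\<And>z. (z, x) \<in> |X| - Id \<Longrightarrow> f z = g z"
    have "sat M (f(x := r)) \<phi> = sat M (g(x := r)) \<phi>" if "FV \<phi> \<subseteq> insert x (U x)" for \<phi> :: "('f, 'r, 's \<times> 'm, 'm) fm"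
      by (rule sat_cong) (use that eq in \<open>auto simp: U_def underS_def\<close>)
    then show "P f x r = P g x r" by (simp add: P_def)
  next
    fix x f assume IH: "\<And>y. (y, x) \<in> |X| - Id \<Longrightarrow> P f y (f y)"
    show "\<exists>r. P f x r"
    proof (cases "x \<in> X")
      case x: True
      have IH: "P f y (f y)" if "y \<in> U x" for y using IH that by (auto simp: U_def underS_def)
      have fy: "f y \<in> carr M (fst y)" if "y \<in> U x" for y
        using IH[OF that] subsetD[OF U(1) that] by (simp add: P_def)
      define G where "G = {\<phi>\<in>p. FV \<phi> \<subseteq> insert x (U x)}"
      let ?I = "inst (U x) f"
      have "small_set M (f ` U x)"
        using small_image_vars small_vars_subset[OF X U(1)] fy carr_univ by blast
      then have small: "small_set M (A \<union> f ` U x)" using A small_Un by blast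
      have sub: "?I ` G \<subseteq> fms L M {x} (A \<union> f ` U x)"
      proof
        fix \<psi> assume "\<psi> \<in> ?I ` G"
        then obtain \<phi> where \<phi>: "\<phi> \<in> p" "FV \<phi> \<subseteq> insert x (U x)" "\<psi> = ?I \<phi>" by (auto simp: G_def)
        have "wff L (\<lambda>s. carr M s \<inter> A) \<phi>" using \<phi>(1) p(2) by (auto simp: fms_def)
        then have "wff L (\<lambda>s. carr M s \<inter> (A \<union> f ` U x)) (?I \<phi>)"
          by (rule wff_inst) (use fy in auto)
        then show "\<psi> \<in> fms L M {x} (A \<union> f ` U x)" using \<phi> by (auto simp: fms_def FV_inst)
      qed
      obtain e0 where e0: "e0 \<in> tuples M X" using p(3) unfolding finsat_def by (metis empty_subsetI finite.emptyI)
      have "finsat M {x} (?I ` G)" unfolding finsat_def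
      proof (intro allI impI)
        fix F assume "F \<subseteq> ?I ` G" "finite F"
        then obtain H where H: "H \<subseteq> G" "finite H" "F = ?I ` H" by (meson finite_subset_image)
        have "\<exists>c\<in>carr M (fst x). \<forall>\<phi>\<in>H. sat M (f(x := c)) \<phi>"
        proof (cases "H = {}")
          case True
          then show ?thesis using e0 x tuplesD by blast
        next
          case False
          have w: "wff L (\<lambda>s. carr M s \<inter> A) \<phi>" if "\<phi> \<in> H" for \<phi>
            using that H p(2) by (auto simp: G_def fms_def)
          obtain \<chi>0 where \<chi>0: "wff L (\<lambda>s. carr M s \<inter> A) \<chi>0" "FV \<chi>0 = (\<Union>\<phi>\<in>H. FV \<phi>)"
            "\<And>e. sat M e \<chi>0 \<longleftrightarrow> (\<forall>\<phi>\<in>H. sat M e \<phi>)"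
            by (rule conjunction[OF H(2) False, of L "\<lambda>s. carr M s \<inter> A"]) (use w in auto)
          \<comment> \<open>This says that some \<open>x\<close> satisfies \<open>\<chi>0\<close>.
            It belongs to \<open>p\<close> by completeness and mentions earlier variables only, so
            the values chosen so far satisfy it.\<close>
          define \<chi> where "\<chi> = Neg (All x (Neg \<chi>0))"
          have FV: "FV \<chi> \<subseteq> U x" using H(1) by (auto simp: \<chi>_def \<chi>0(2) G_def)
          have "fst x \<in> sorts L" using e0 x tuplesD sort_if_carr by blast
          then have \<chi>: "\<chi> \<in> fms L M X A" using \<chi>0(1) FV U(1)[of x] by (auto simp: fms_def \<chi>_def)
          have "\<chi> \<in> p"
          proof (rule finsat_complete_mem[OF p(3,4), where F = H])
            fix e assume "e \<in> tuples M X" "\<And>\<phi>. \<phi> \<in> H \<Longrightarrow> sat M e \<phi>"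
            then show "sat M e \<chi>" using \<chi>0(3) x tuplesD[of e X x]
              by (auto simp: \<chi>_def intro!: bexI[of _ "e x"])
          qed (use H \<chi> in \<open>auto simp: G_def\<close>)
          have "sat M f \<chi>"
          proof (cases "FV \<chi> = {}")
            case True
            then show ?thesis using sent \<open>\<chi> \<in> p\<close> by blast
          next
            case False
            then obtain y where y: "y \<in> FV \<chi>" "FV \<chi> \<subseteq> insert y (U y)"
              using max[of \<chi>] FV U(1) by blast
            then have "P f y (f y)" "y \<in> X" using IH FV U(1)[of x] by blast+
            then have "sat M (f(y := f y)) \<chi>" using y \<open>\<chi> \<in> p\<close> unfolding P_def by blast
            then show ?thesis by simp
          qed
          then show ?thesis using \<chi>0(3) by (auto simp: \<chi>_def simp del: fun_upd_apply)
        qed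
        then obtain c where c: "c \<in> carr M (fst x)" "\<forall>\<phi>\<in>H. sat M (f(x := c)) \<phi>" by blast
        define e where "e = (\<lambda>y\<in>{x}. c)"
        have "sat M e (?I \<phi>)" if "\<phi> \<in> H" for \<phi>
        proof -
          have "FV \<phi> \<subseteq> insert x (U x)" using that H by (auto simp: G_def)
          then have "sat M (override_on e f (U x)) \<phi> = sat M (f(x := c)) \<phi>"
            using U(2)[of x] by (intro sat_cong) (auto simp: override_on_def e_def)
          then show ?thesis using c that by (simp add: sat_inst)
        qed
        moreover have "e \<in> tuples M {x}" using c by (auto simp: e_def tuples_def)
        ultimately show "\<exists>e\<in>tuples M {x}. \<forall>\<phi>\<in>F. sat M e \<phi>" using H by blast
      qed
      then obtain e where e: "realizes M {x} e (?I ` G)" using saturated[OF small sub] by blast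
      have "P f x (e x)" unfolding P_def
      proof (intro impI conjI ballI)
        show "e x \<in> carr M (fst x)" using e tuplesD by (fastforce simp: realizes_def)
        fix \<phi> assume "\<phi> \<in> p" and FV: "FV \<phi> \<subseteq> insert x (U x)"
        then have "sat M e (?I \<phi>)" using e by (auto simp: realizes_def G_def)
        moreover have "sat M (override_on e f (U x)) \<phi> = sat M (f(x := e x)) \<phi>"
          using U(2)[of x] FV by (intro sat_cong) (auto simp: override_on_def)
        ultimately show "sat M (f(x := e x)) \<phi>" by (simp add: sat_inst)
      qed
      then show ?thesis by blast
    qed (auto simp: P_def)
  qed
  then obtain f where f: "\<And>x. P f x (f x)" by blast
  have "sat M (restrict f X) \<phi>" if \<phi>: "\<phi> \<in> p" for \<phi>
  proof -
    have FV: "FV \<phi> \<subseteq> X" using \<phi> p(2) by (auto simp: fms_def)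
    have "sat M f \<phi>"
    proof (cases "FV \<phi> = {}")
      case True
      then show ?thesis using sent \<phi> by blast
    next
      case False
      then obtain y where "y \<in> X" "FV \<phi> \<subseteq> insert y (U y)" using max FV by blast
      then show ?thesis using f[of y] \<phi> by (auto simp: P_def)
    qed
    then show ?thesis using FV by (subst sat_cong[of _ _ f]) auto
  qed
  moreover have "restrict f X \<in> tuples M X" using f by (auto simp: tuples_def P_def)
  ultimately show ?thesis using that p(1) by (auto simp: realizes_def)
qed

end

section \<open>Homogeneity and automorphisms\<close>

lemma pmap_ident: "(\<And>c. c \<in> pars \<phi> \<Longrightarrow> g c = c) \<Longrightarrow> pmap g \<phi> = \<phi>"
  by (subst fm.map_cong[of \<phi> \<phi> "\<lambda>x. x" "\<lambda>x. x" "\<lambda>x. x" "\<lambda>x. x" "\<lambda>x. x" "\<lambda>x. x" g "\<lambda>x. x"])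
    (auto simp: fm.map_ident)

lemma pars_fms0: "\<phi> \<in> fms0 L X \<Longrightarrow> pars \<phi> = {}"
  using wff_pars[of L "\<lambda>s. {}" \<phi>] by (auto simp: fms0_def)

context saturated_struc
begin

definition srt :: "'m \<Rightarrow> 's" where
  "srt c = (THE s. c \<in> carr M s)"

lemma srt_eq: "c \<in> carr M s \<Longrightarrow> srt c = s"
  unfolding srt_def by (rule the_equality) (auto intro: carr_disjoint)

lemma srt_carr: "c \<in> univ M \<Longrightarrow> c \<in> carr M (srt c)"
  using srt_eq by (auto simp: univ_def)

text \<open>A partial elementary map given by its graph. Valuations play the part of tuples from the
  domain, repetitions allowed; applied to an equation, the second clause forces the relation and its
  converse to be single-valued.\<close>

definition elementary :: "('m \<times> 'm) set \<Rightarrow> bool" where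
  "elementary R \<longleftrightarrow> (\<forall>(c, d)\<in>R. \<exists>s. c \<in> carr M s \<and> d \<in> carr M s) \<and>
    (\<forall>\<phi> :: ('f, 'r, 's \<times> 'm, 'm) fm. \<phi> \<in> fms0 L UNIV \<longrightarrow> (\<forall>e e'.
      (\<forall>x\<in>FV \<phi>. e x \<in> carr M (fst x) \<and> (e x, e' x) \<in> R) \<longrightarrow> sat M e \<phi> \<longrightarrow> sat M e' \<phi>))"

lemma elementary_carr: "elementary R \<Longrightarrow> (c, d) \<in> R \<Longrightarrow> c \<in> carr M s \<longleftrightarrow> d \<in> carr M s"
proof -
  assume "elementary R" "(c, d) \<in> R"
  then obtain s' where "c \<in> carr M s'" "d \<in> carr M s'" by (auto simp: elementary_def)
  then show ?thesis using carr_disjoint[of c s s'] carr_disjoint[of d s s'] by blast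
qed

lemma elementary_sat:
  fixes \<phi> :: "('f, 'r, 's \<times> 'm, 'm) fm"
  assumes "elementary R" "\<phi> \<in> fms0 L UNIV" "\<And>x. x \<in> FV \<phi> \<Longrightarrow> e x \<in> carr M (fst x)"
    "\<And>x. x \<in> FV \<phi> \<Longrightarrow> (e x, e' x) \<in> R"
  shows "sat M e \<phi> \<longleftrightarrow> sat M e' \<phi>"
proof -
  have i: "sat M e \<psi> \<longrightarrow> sat M e' \<psi>" if "\<psi> \<in> fms0 L UNIV" "FV \<psi> = FV \<phi>" for \<psi> :: "('f, 'r, 's \<times> 'm, 'm) fm"
  proof -
    have "\<forall>x\<in>FV \<psi>. e x \<in> carr M (fst x) \<and> (e x, e' x) \<in> R" using assms(3,4) that(2) by simp
    then show ?thesis using assms(1) that(1) unfolding elementary_def by blast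
  qed
  show ?thesis using i[of \<phi>] i[of "Neg \<phi>"] assms(2) by (auto simp: fms0_def)
qed

lemma elementary_converse: "elementary R \<Longrightarrow> elementary (R\<inverse>)"
  unfolding elementary_def[of "R\<inverse>"]
proof (intro conjI allI impI)
  assume R: "elementary R"
  then show "\<forall>(c, d)\<in>R\<inverse>. \<exists>s. c \<in> carr M s \<and> d \<in> carr M s" by (auto simp: elementary_def)
  fix \<phi> :: "('f, 'r, 's \<times> 'm, 'm) fm" and e e'
  assume "\<phi> \<in> fms0 L UNIV" and e: "\<forall>x\<in>FV \<phi>. e x \<in> carr M (fst x) \<and> (e x, e' x) \<in> R\<inverse>" and "sat M e \<phi>"
  moreover have "e' x \<in> carr M (fst x)" if "x \<in> FV \<phi>" for x
    using e that elementary_carr[OF R, of "e' x" "e x"] by blast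
  ultimately show "sat M e' \<phi>" using elementary_sat[OF R, of \<phi> e' e] by blast
qed

text \<open>A formula has finitely many free variables and so tests only finitely many pairs. This
  handles the limit stages of the back-and-forth construction.\<close>

lemma elementary_finite:
  assumes "\<And>F. finite F \<Longrightarrow> F \<subseteq> R \<Longrightarrow> elementary F"
  shows "elementary R"
  unfolding elementary_def
proof (intro conjI allI impI ballI)
  fix p assume "p \<in> R"
  then have "elementary {p}" by (intro assms) auto
  then show "case p of (c, d) \<Rightarrow> \<exists>s. c \<in> carr M s \<and> d \<in> carr M s" by (simp add: elementary_def)
next
  fix \<phi> :: "('f, 'r, 's \<times> 'm, 'm) fm" and e e'
  assume *: "\<phi> \<in> fms0 L UNIV" "\<forall>x\<in>FV \<phi>. e x \<in> carr M (fst x) \<and> (e x, e' x) \<in> R" "sat M e \<phi>"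
  have "elementary ((\<lambda>x. (e x, e' x)) ` FV \<phi>)" using *(2) by (intro assms) auto
  from elementary_sat[OF this *(1), of e e'] show "sat M e' \<phi>" using * by auto
qed

lemma elementary_subset: "elementary R \<Longrightarrow> S \<subseteq> R \<Longrightarrow> elementary S"
  unfolding elementary_def by (meson subsetD)

text \<open>The equation of two distinct variables, both with value \<open>a\<close>, is carried to
  the equation of \<open>b\<close> and \<open>c\<close>.\<close>

lemma elementary_unique:
  assumes R: "elementary R" and "(a, b) \<in> R" "(a, c) \<in> R"
  shows "b = c"
proof -
  obtain s where s: "a \<in> carr M s" using assms by (auto simp: elementary_def)
  obtain n m :: 'm where "n \<noteq> m" using ex_new_if_finite[OF infinite_names, of "{a}"] by auto
  define \<phi> :: "('f, 'r, 's \<times> 'm, 'm) fm" where "\<phi> = Eq (Var (s, n)) (Var (s, m))"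
  have "sat M (\<lambda>_. a) \<phi> \<longleftrightarrow> sat M (\<lambda>x. if snd x = n then b else c) \<phi>"
    by (rule elementary_sat[OF R]) (use assms s sort_if_carr[OF s] in \<open>auto simp: \<phi>_def fms0_def\<close>)
  then show ?thesis using \<open>n \<noteq> m\<close> by (simp add: \<phi>_def)
qed

text \<open>The type of \<open>a\<close> over the domain, with its parameters moved along
  \<open>R\<close>, is finitely satisfiable, because \<open>R\<close> preserves the existential
  closure in \<open>x\<close> of each finite part. Saturation realises it, and any realisation can
  serve as the image of \<open>a\<close>.\<close>

lemma elementary_extend:
  assumes R: "elementary R" and small: "|R| <o |univ M|" and a: "a \<in> univ M"
  obtains b where "elementary (insert (a, b) R)"
proof (cases "a \<in> Domain R")
  case True
  then show ?thesis using that R by (metis DomainE insert_absorb)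
next
  case False
  obtain s where s: "a \<in> carr M s" using a by (auto simp: univ_def)
  \<comment> \<open>Variables are named after elements: the valuation \<open>snd\<close> reads the
    variable named c as c itself, and \<open>f\<close> reads it as the image of c under
    \<open>R\<close>.\<close>
  define x where "x = (s, a)"
  define f where "f v = (SOME b. (snd v, b) \<in> R)" for v :: "'s \<times> 'm"
  define V where "V = {v. snd v \<in> Domain R \<and> snd v \<in> carr M (fst v)}"
  have fR: "(snd v, f v) \<in> R" if "v \<in> V" for v
    using that unfolding f_def V_def by (metis (mono_tags, lifting) DomainE mem_Collect_eq someI_ex)
  have fV: "f v \<in> carr M (fst v)" if "v \<in> V" for v
    using elementary_carr[OF R fR[OF that]] that by (auto simp: V_def)
  have xV: "x \<notin> V" using False by (auto simp: x_def V_def)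
  define G where "G = {\<phi> \<in> fms0 L (insert x V). sat M snd \<phi>}"
  have "Range R \<subseteq> univ M" using R by (auto simp: elementary_def univ_def) blast
  moreover have "|Range R| <o |univ M|"
    using small ordLeq_ordLess_trans[OF card_of_image] by (metis snd_eq_Range)
  ultimately have sR: "small_set M (Range R)" by (simp add: small_set_def)
  have sub: "inst V f ` G \<subseteq> fms L M {x} (Range R)"
  proof
    fix \<psi> assume "\<psi> \<in> inst V f ` G"
    then obtain \<phi> where \<phi>: "wff L (\<lambda>s. {}) \<phi>" "FV \<phi> \<subseteq> insert x V" "\<psi> = inst V f \<phi>" by (auto simp: G_def fms0_def)
    have "wff L (\<lambda>s. carr M s \<inter> Range R) (inst V f \<phi>)"
      using \<phi>(1) by (rule wff_inst) (use fV fR in blast)+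
    then show "\<psi> \<in> fms L M {x} (Range R)" using \<phi> by (auto simp: fms_def FV_inst)
  qed
  have "finsat M {x} (inst V f ` G)" unfolding finsat_def
  proof (intro allI impI)
    fix F assume "F \<subseteq> inst V f ` G" "finite F"
    then obtain H where H: "H \<subseteq> G" "finite H" "F = inst V f ` H" by (meson finite_subset_image)
    have "\<exists>c\<in>carr M s. \<forall>\<phi>\<in>H. sat M (f(x := c)) \<phi>"
    proof (cases "H = {}")
      case True
      then show ?thesis using s by blast
    next
      case False
      have w: "wff L (\<lambda>s. {}) \<phi>" if "\<phi> \<in> H" for \<phi> using that H by (auto simp: G_def fms0_def)
      obtain \<chi>0 where \<chi>0: "wff L (\<lambda>s. {}) \<chi>0" "FV \<chi>0 = (\<Union>\<phi>\<in>H. FV \<phi>)"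
        "\<And>e. sat M e \<chi>0 \<longleftrightarrow> (\<forall>\<phi>\<in>H. sat M e \<phi>)"
        by (rule conjunction[OF H(2) False, of L "\<lambda>s. {}"]) (use w in auto)
      define \<chi> where "\<chi> = Neg (All x (Neg \<chi>0))"
      have FV: "FV \<chi> \<subseteq> V" using H(1) by (auto simp: \<chi>_def \<chi>0(2) G_def fms0_def)
      have "\<chi> \<in> fms0 L UNIV" using \<chi>0(1) sort_if_carr[OF s] by (auto simp: fms0_def \<chi>_def x_def)
      moreover have "sat M snd \<chi>"
      proof -
        have "snd(x := a) = snd" by (auto simp: x_def)
        then have "sat M (snd(x := a)) \<chi>0" using \<chi>0(3) H by (auto simp: G_def)
        then show ?thesis using s by (auto simp: \<chi>_def x_def simp del: fun_upd_apply)
      qed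
      ultimately have "sat M f \<chi>"
        using elementary_sat[OF R, of \<chi> snd f] FV fR by (auto simp: V_def)
      then show ?thesis using \<chi>0(3) by (auto simp: \<chi>_def x_def simp del: fun_upd_apply)
    qed
    then obtain c where c: "c \<in> carr M s" "\<forall>\<phi>\<in>H. sat M (f(x := c)) \<phi>" by blast
    define e where "e = (\<lambda>y\<in>{x}. c)"
    have "sat M e (inst V f \<phi>)" if "\<phi> \<in> H" for \<phi>
    proof -
      have "FV \<phi> \<subseteq> insert x V" using that H by (auto simp: G_def fms0_def)
      then have "sat M (override_on e f V) \<phi> = sat M (f(x := c)) \<phi>"
        using xV by (intro sat_cong) (auto simp: override_on_def e_def)
      then show ?thesis using c that by (simp add: sat_inst)
    qed
    moreover have "e \<in> tuples M {x}" using c by (auto simp: e_def tuples_def x_def)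
    ultimately show "\<exists>e\<in>tuples M {x}. \<forall>\<phi>\<in>F. sat M e \<phi>" using H by blast
  qed
  then obtain e1 where e1: "realizes M {x} e1 (inst V f ` G)" using saturated[OF sR sub] by blast
  have b: "e1 x \<in> carr M s" using e1 tuplesD[of e1 "{x}" x] by (auto simp: realizes_def x_def)
  have "elementary (insert (a, e1 x) R)" unfolding elementary_def
  proof (intro conjI allI impI)
    show "\<forall>(c, d)\<in>insert (a, e1 x) R. \<exists>s. c \<in> carr M s \<and> d \<in> carr M s"
      using R b s by (auto simp: elementary_def)
    fix \<phi> :: "('f, 'r, 's \<times> 'm, 'm) fm" and e e'
    assume \<phi>: "\<phi> \<in> fms0 L UNIV" and sat: "sat M e \<phi>"
      and ee: "\<forall>y\<in>FV \<phi>. e y \<in> carr M (fst y) \<and> (e y, e' y) \<in> insert (a, e1 x) R"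
    \<comment> \<open>Each variable is renamed after its value under \<open>e\<close>, so that truth
      under \<open>e\<close> becomes truth under \<open>snd\<close>.\<close>
    obtain \<phi>' where \<phi>': "wff L (\<lambda>_. {}) \<phi>'" "FV \<phi>' \<subseteq> (\<Union>v\<in>FV \<phi>. {(fst v, e v)})"
      "\<And>e'. sat M e' \<phi>' \<longleftrightarrow> sat M (\<lambda>v. e' (fst v, e v)) \<phi>"
      using substitution[OF infinite_names, where \<tau> = "\<lambda>v. Var (fst v, e v)" and \<rho> = Par
          and P = "\<lambda>_. {}" and Q = "\<lambda>_. {}" and \<phi> = \<phi> and L = L]
        \<phi> pars_fms0[OF \<phi>] by (auto simp: fms0_def fm.map_ident)
    have "FV \<phi>' \<subseteq> insert x V"
    proof
      fix y assume "y \<in> FV \<phi>'"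
      then obtain v where v: "v \<in> FV \<phi>" "y = (fst v, e v)" using \<phi>'(2) by auto
      then have "e v \<in> carr M (fst v)" "e v = a \<or> e v \<in> Domain R" using ee by auto
      then show "y \<in> insert x V" using v carr_disjoint[OF s] by (auto simp: x_def V_def)
    qed
    then have "\<phi>' \<in> G" using \<phi>' sat by (simp add: G_def fms0_def)
    then have "sat M e1 (inst V f \<phi>')" using e1 by (auto simp: realizes_def)
    then have "sat M (\<lambda>v. override_on e1 f V (fst v, e v)) \<phi>" by (simp add: sat_inst \<phi>'(3))
    moreover have "override_on e1 f V (fst v, e v) = e' v" if v: "v \<in> FV \<phi>" for v
    proof (cases "e v = a")
      case True
      then have "e' v = e1 x" using ee v False by auto
      moreover have "(fst v, e v) = x" using True v ee s carr_disjoint by (auto simp: x_def)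
      ultimately show ?thesis using xV by (simp add: override_on_def)
    next
      case F: False
      then have "(e v, e' v) \<in> R" "(fst v, e v) \<in> V" using ee v by (auto simp: V_def)
      then show ?thesis using fR[of "(fst v, e v)"] elementary_unique[OF R] by (auto simp: override_on_def)
    qed
    ultimately show "sat M e' \<phi>" by (metis (mono_tags, lifting) sat_cong)
  qed
  then show ?thesis by (rule that)
qed

text \<open>Bijectivity on the whole type, and not only on the universe, keeps \<open>inv\<close>
  usable without side conditions.\<close>

definition automorphism :: "('m \<Rightarrow> 'm) \<Rightarrow> bool" where
  "automorphism \<sigma> \<longleftrightarrow> bij \<sigma> \<and> (\<forall>s. \<sigma> ` carr M s = carr M s) \<and>
    (\<forall>\<phi> :: ('f, 'r, 's \<times> 'm, 'm) fm. \<phi> \<in> fms0 L UNIV \<longrightarrow>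
      (\<forall>e. (\<forall>x\<in>FV \<phi>. e x \<in> carr M (fst x)) \<longrightarrow> sat M (\<sigma> \<circ> e) \<phi> = sat M e \<phi>))"

lemma autoI_elementary:
  assumes R: "elementary R" and D: "Domain R = univ M" "Range R = univ M"
  obtains \<sigma> where "automorphism \<sigma>" "\<And>c d. (c, d) \<in> R \<Longrightarrow> \<sigma> c = d"
proof -
  define \<sigma> where "\<sigma> c = (if c \<in> univ M then THE d. (c, d) \<in> R else c)" for c
  have R2: "b = c" if "(b, a) \<in> R" "(c, a) \<in> R" for a b c
    using elementary_unique[OF elementary_converse[OF R]] that by auto
  have \<sigma>: "\<sigma> c = d" if "(c, d) \<in> R" for c d
  proof -
    have "c \<in> univ M" using that D by auto
    moreover have "(THE d. (c, d) \<in> R) = d" using that elementary_unique[OF R] by blast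
    ultimately show ?thesis by (simp add: \<sigma>_def)
  qed
  have \<sigma>R: "(c, \<sigma> c) \<in> R" if "c \<in> univ M" for c
    using that D \<sigma> by (metis DomainE)
  have c: "\<sigma> c \<in> carr M s \<longleftrightarrow> c \<in> carr M s" for c s
  proof (cases "c \<in> univ M")
    case True
    then show ?thesis using elementary_carr[OF R \<sigma>R] by simp
  next
    case False
    then show ?thesis by (simp add: \<sigma>_def)
  qed
  have u: "\<sigma> c \<in> univ M \<longleftrightarrow> c \<in> univ M" for c using c by (simp add: univ_def)
  have "inj \<sigma>"
  proof (rule injI)
    fix x y assume eq: "\<sigma> x = \<sigma> y"
    show "x = y"
    proof (cases "x \<in> univ M")
      case True
      then have "(x, \<sigma> x) \<in> R" "(y, \<sigma> x) \<in> R" using \<sigma>R u eq by metis+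
      then show ?thesis using R2 by blast
    next
      case False
      then have "y \<notin> univ M" using u eq by metis
      then show ?thesis using False eq by (simp add: \<sigma>_def)
    qed
  qed
  have onto: "\<exists>c. \<sigma> c = d" for d
  proof (cases "d \<in> univ M")
    case True
    then show ?thesis using D \<sigma> by (metis RangeE)
  next
    case False
    then show ?thesis by (intro exI[of _ d]) (simp add: \<sigma>_def)
  qed
  then have "bij \<sigma>" using \<open>inj \<sigma>\<close> by (metis bijI surjI)
  moreover have "\<sigma> ` carr M s = carr M s" for s
    using c onto by (auto simp: image_iff) metis
  moreover have "sat M (\<sigma> \<circ> e) \<phi> = sat M e \<phi>"
    if "\<phi> \<in> fms0 L UNIV" "\<forall>x\<in>FV \<phi>. e x \<in> carr M (fst x)"
    for \<phi> :: "('f, 'r, 's \<times> 'm, 'm) fm" and e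
    using elementary_sat[OF R that(1), of e "\<sigma> \<circ> e"] that(2) \<sigma>R carr_univ by (auto simp: comp_def)
  ultimately have "automorphism \<sigma>" by (simp add: automorphism_def)
  then show ?thesis using \<sigma> that by blast
qed

text \<open>Back and forth along a well-order of the universe: stage \<alpha> adds one image and one
  preimage of \<alpha>. Each proper initial segment has smaller cardinality than the universe, so
  before every stage the relation is small enough for \<open>elementary_extend\<close>.\<close>

lemma elementary_auto:
  assumes R0: "elementary R\<^sub>0" and small: "|R\<^sub>0| <o |univ M|"
  obtains \<sigma> where "automorphism \<sigma>" "\<And>c d. (c, d) \<in> R\<^sub>0 \<Longrightarrow> \<sigma> c = d"
proof -
  have wo: "Well_order |univ M|" by (rule card_of_Well_order)
  define U where "U \<alpha> = underS |univ M| \<alpha>" for \<alpha>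
  define pr where "pr f \<beta> = {(\<beta>, fst (f \<beta>)), (snd (f \<beta>), \<beta>)}" for f :: "'m \<Rightarrow> 'm \<times> 'm" and \<beta>
  define E where "E f B = R\<^sub>0 \<union> (\<Union>\<beta>\<in>B. pr f \<beta>)" for f B
  define P where "P f \<alpha> r \<longleftrightarrow> (\<alpha> \<in> univ M \<longrightarrow> elementary (E f (U \<alpha>) \<union> {(\<alpha>, fst r), (snd r, \<alpha>)}))" for f \<alpha> r
  have Uu: "U \<alpha> \<subseteq> univ M" for \<alpha>
    using Field_card_of[of "univ M"] by (auto simp: U_def underS_def Field_def)
  \<comment> \<open>A finite part of the union involves finitely many stages and is contained in the
    relation reached at the greatest of them.\<close>
  have el: "elementary (E f B)" if B: "B \<subseteq> univ M" and IH: "\<And>\<beta>. \<beta> \<in> B \<Longrightarrow> P f \<beta> (f \<beta>)" for f B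
  proof (rule elementary_finite)
    fix F assume F: "finite F" "F \<subseteq> E f B"
    have "\<exists>B'\<subseteq>B. finite B' \<and> F \<subseteq> E f B'" using F
    proof (induction F)
      case empty
      then show ?case by auto
    next
      case (insert p F)
      then obtain B' where B': "B' \<subseteq> B" "finite B'" "F \<subseteq> E f B'" by auto
      from insert.prems have "p \<in> R\<^sub>0 \<or> (\<exists>\<beta>\<in>B. p \<in> pr f \<beta>)" by (auto simp: E_def)
      then show ?case
      proof
        assume "p \<in> R\<^sub>0" then show ?thesis using B' by (intro exI[of _ B']) (auto simp: E_def)
      next
        assume "\<exists>\<beta>\<in>B. p \<in> pr f \<beta>"
        then obtain \<beta> where "\<beta> \<in> B" "p \<in> pr f \<beta>" by blast
        then show ?thesis using B' by (intro exI[of _ "insert \<beta> B'"]) (auto simp: E_def)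
      qed
    qed
    then obtain B' where B': "B' \<subseteq> B" "finite B'" "F \<subseteq> E f B'" by blast
    show "elementary F"
    proof (cases "B' = {}")
      case True
      then show ?thesis using B' elementary_subset[OF R0] by (simp add: E_def)
    next
      case False
      then obtain \<beta> where \<beta>: "\<beta> \<in> B'" "\<forall>\<gamma>\<in>B'. (\<gamma>, \<beta>) \<in> |univ M|"
        using finite_linear_max[OF wo B'(2) False] B' B by (auto simp: Field_card_of)
      then have "B' \<subseteq> insert \<beta> (U \<beta>)" by (auto simp: U_def underS_def)
      then have "F \<subseteq> E f (U \<beta>) \<union> {(\<beta>, fst (f \<beta>)), (snd (f \<beta>), \<beta>)}"
        using B'(3) by (fastforce simp: E_def pr_def)
      moreover have "elementary (E f (U \<beta>) \<union> {(\<beta>, fst (f \<beta>)), (snd (f \<beta>), \<beta>)})"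
        using IH[of \<beta>] \<beta> B' B by (auto simp: P_def)
      ultimately show ?thesis using elementary_subset by blast
    qed
  qed
  have "\<exists>f. \<forall>\<alpha>. P f \<alpha> (f \<alpha>)"
  proof (rule dependent_wf_choice[of "|univ M| - Id"])
    show "wf ( |univ M| - Id)" using wo by (simp add: well_order_on_def)
  next
    fix f g :: "'m \<Rightarrow> 'm \<times> 'm" and \<alpha> r
    assume "\<And>z. (z, \<alpha>) \<in> |univ M| - Id \<Longrightarrow> f z = g z"
    then have "E f (U \<alpha>) = E g (U \<alpha>)" by (auto simp: E_def U_def underS_def pr_def)
    then show "P f \<alpha> r = P g \<alpha> r" by (simp add: P_def)
  next
    fix \<alpha> f assume IH: "\<And>y. (y, \<alpha>) \<in> |univ M| - Id \<Longrightarrow> P f y (f y)"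
    show "\<exists>r. P f \<alpha> r"
    proof (cases "\<alpha> \<in> univ M")
      case True
      have U: "|U \<alpha>| <o |univ M|"
        using card_of_underS[OF card_of_Card_order, of \<alpha> "univ M"] True by (simp add: U_def Field_card_of)
      have "E f (U \<alpha>) = R\<^sub>0 \<union> ((\<lambda>\<beta>. (\<beta>, fst (f \<beta>))) ` U \<alpha> \<union> (\<lambda>\<beta>. (snd (f \<beta>), \<beta>)) ` U \<alpha>)"
        by (auto simp: E_def pr_def)
      then have E1: "|E f (U \<alpha>)| <o |univ M|"
        using small U infinite_univ ordLeq_ordLess_trans[OF card_of_image U]
        by (auto intro!: card_of_Un_ordLess_infinite)
      have E2: "elementary (E f (U \<alpha>))"
        using IH by (intro el Uu) (auto simp: U_def underS_def)
      obtain b where b: "elementary (insert (\<alpha>, b) (E f (U \<alpha>)))"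
        using elementary_extend[OF E2 E1 True] by blast
      let ?R = "insert (\<alpha>, b) (E f (U \<alpha>))"
      have "|{(\<alpha>, b)}| <o |univ M|"
        using infinite_univ by (auto simp: Field_card_of intro!: finite_ordLess_infinite[OF card_of_Well_order card_of_Well_order])
      then have "| {(\<alpha>, b)} \<union> E f (U \<alpha>)| <o |univ M|"
        using E1 infinite_univ card_of_Un_ordLess_infinite by blast
      then have "|?R| <o |univ M|" by simp
      moreover have "?R\<inverse> = prod.swap ` ?R" by force
      ultimately have "|?R\<inverse>| <o |univ M|" using ordLeq_ordLess_trans[OF card_of_image] by metis
      \<comment> \<open>A preimage of \<alpha> is found as an image of \<alpha> under the converse
        relation.\<close>
      then obtain c where "elementary (insert (\<alpha>, c) (?R\<inverse>))"
        using elementary_extend[OF elementary_converse[OF b] _ True] by blast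
      moreover have "(insert (\<alpha>, c) (?R\<inverse>))\<inverse> = insert (c, \<alpha>) ?R" by auto
      ultimately have "elementary (insert (c, \<alpha>) ?R)" using elementary_converse by metis
      moreover have "insert (c, \<alpha>) ?R = E f (U \<alpha>) \<union> {(\<alpha>, fst (b, c)), (snd (b, c), \<alpha>)}" by auto
      ultimately have "P f \<alpha> (b, c)" by (simp add: P_def)
      then show ?thesis by blast
    qed (auto simp: P_def)
  qed
  then obtain f where f: "\<And>\<alpha>. P f \<alpha> (f \<alpha>)" by blast
  have R: "elementary (E f (univ M))" using f by (intro el) auto
  moreover have "Domain (E f (univ M)) \<subseteq> univ M" "Range (E f (univ M)) \<subseteq> univ M"
    using R by (auto simp: elementary_def univ_def) blast+
  then have "Domain (E f (univ M)) = univ M" "Range (E f (univ M)) = univ M"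
    by (auto simp: E_def pr_def)
  ultimately obtain \<sigma> where "automorphism \<sigma>" "\<And>c d. (c, d) \<in> E f (univ M) \<Longrightarrow> \<sigma> c = d"
    using autoI_elementary by blast
  then show ?thesis by (intro that[of \<sigma>]) (auto simp: E_def)
qed

section \<open>The automorphism group and its action on formulas and tuples\<close>

lemma auto_image: "automorphism \<sigma> \<Longrightarrow> \<sigma> ` carr M s = carr M s"
  by (simp add: automorphism_def)

lemma auto_inj: "automorphism \<sigma> \<Longrightarrow> inj \<sigma>"
  by (simp add: automorphism_def bij_def)

lemma auto_carr: "automorphism \<sigma> \<Longrightarrow> \<sigma> c \<in> carr M s \<longleftrightarrow> c \<in> carr M s"
  using inj_image_mem_iff[OF auto_inj, of \<sigma> c "carr M s"] by (simp add: auto_image)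

lemma auto_univ: "automorphism \<sigma> \<Longrightarrow> \<sigma> c \<in> univ M \<longleftrightarrow> c \<in> univ M"
  by (simp add: univ_def auto_carr)

lemma auto_id: "automorphism id"
  by (simp add: automorphism_def)

lemma auto_sat0:
  fixes \<phi> :: "('f, 'r, 's \<times> 'm, 'm) fm"
  assumes "automorphism \<sigma>" "\<phi> \<in> fms0 L UNIV" "\<And>x. x \<in> FV \<phi> \<Longrightarrow> e x \<in> carr M (fst x)"
  shows "sat M (\<sigma> \<circ> e) \<phi> = sat M e \<phi>"
  using assms unfolding automorphism_def by blast

lemma auto_comp:
  assumes "automorphism \<sigma>" "automorphism \<tau>"
  shows "automorphism (\<sigma> \<circ> \<tau>)"
  unfolding automorphism_def
proof (intro conjI allI impI)
  show "bij (\<sigma> \<circ> \<tau>)" using assms by (simp add: automorphism_def bij_comp)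
  show "(\<sigma> \<circ> \<tau>) ` carr M s = carr M s" for s
    using auto_image[OF assms(1), of s] auto_image[OF assms(2), of s] by (metis image_comp)
  fix \<phi> :: "('f, 'r, 's \<times> 'm, 'm) fm" and e
  assume \<phi>: "\<phi> \<in> fms0 L UNIV" "\<forall>x\<in>FV \<phi>. e x \<in> carr M (fst x)"
  have "sat M (\<sigma> \<circ> (\<tau> \<circ> e)) \<phi> = sat M (\<tau> \<circ> e) \<phi>"
    using \<phi> auto_carr[OF assms(2)] by (intro auto_sat0[OF assms(1)]) auto
  also have "\<dots> = sat M e \<phi>"
    using \<phi> by (intro auto_sat0[OF assms(2)]) auto
  finally show "sat M (\<sigma> \<circ> \<tau> \<circ> e) \<phi> = sat M e \<phi>" by (simp add: comp_assoc)
qed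

lemma auto_inv_cancel: "automorphism \<sigma> \<Longrightarrow> inv \<sigma> (\<sigma> x) = x" "automorphism \<sigma> \<Longrightarrow> \<sigma> (inv \<sigma> x) = x"
  by (auto simp: automorphism_def bij_def surj_f_inv_f)

lemma auto_inv: "automorphism \<sigma> \<Longrightarrow> automorphism (inv \<sigma>)"
  unfolding automorphism_def[of "inv \<sigma>"]
proof (intro conjI allI impI)
  assume \<sigma>: "automorphism \<sigma>"
  then show "bij (inv \<sigma>)" by (simp add: automorphism_def bij_imp_bij_inv)
  have c: "inv \<sigma> c \<in> carr M s \<longleftrightarrow> c \<in> carr M s" for c s
    using auto_carr[OF \<sigma>, of "inv \<sigma> c"] auto_inv_cancel[OF \<sigma>] by simp
  show "inv \<sigma> ` carr M s = carr M s" for s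
  proof
    show "inv \<sigma> ` carr M s \<subseteq> carr M s" using c by blast
    show "carr M s \<subseteq> inv \<sigma> ` carr M s"
    proof
      fix y assume "y \<in> carr M s"
      then have "\<sigma> y \<in> carr M s" using auto_carr[OF \<sigma>] by simp
      then show "y \<in> inv \<sigma> ` carr M s" using auto_inv_cancel(1)[OF \<sigma>, of y] by (metis image_eqI)
    qed
  qed
  fix \<phi> :: "('f, 'r, 's \<times> 'm, 'm) fm" and e
  assume "\<phi> \<in> fms0 L UNIV" "\<forall>x\<in>FV \<phi>. e x \<in> carr M (fst x)"
  then have "sat M (\<sigma> \<circ> (inv \<sigma> \<circ> e)) \<phi> = sat M (inv \<sigma> \<circ> e) \<phi>"
    using c by (intro auto_sat0[OF \<sigma>]) auto
  moreover have "\<sigma> \<circ> (inv \<sigma> \<circ> e) = e" using auto_inv_cancel(2)[OF \<sigma>] by auto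
  ultimately show "sat M (inv \<sigma> \<circ> e) \<phi> = sat M e \<phi>" by simp
qed

text \<open>The definition of \<open>automorphism\<close> covers only parameter-free formulas whose
  variables are named by elements. Renaming every variable and every parameter after its value
  reduces the general case to this one, whatever the type of names was.\<close>

lemma auto_sat:
  fixes \<phi> :: "('f, 'r, 's \<times> 'n, 'm) fm"
  assumes \<sigma>: "automorphism \<sigma>" and \<phi>: "wff L (carr M) \<phi>" and e: "\<And>x. x \<in> FV \<phi> \<Longrightarrow> e x \<in> carr M (fst x)"
  shows "sat M (\<lambda>x. \<sigma> (e x)) (pmap \<sigma> \<phi>) \<longleftrightarrow> sat M e \<phi>"
proof -
  obtain \<phi>' :: "('f, 'r, 's \<times> 'm, 'm) fm" where \<phi>': "wff L (\<lambda>_. {}) \<phi>'"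
    "FV \<phi>' \<subseteq> (\<Union>v\<in>FV \<phi>. {(fst v, e v)}) \<union> (\<Union>c\<in>pars \<phi>. {(srt c, c)})"
    "\<And>e'. sat M e' \<phi>' \<longleftrightarrow> sat M (\<lambda>v. e' (fst v, e v)) (pmap (\<lambda>c. e' (srt c, c)) \<phi>)"
    using substitution[OF infinite_names, where \<tau> = "\<lambda>v. Var (fst v, e v)" and \<rho> = "\<lambda>c. Var (srt c, c)"
        and P = "carr M" and Q = "\<lambda>_. {}" and \<phi> = \<phi> and L = L] \<phi>
    by (auto simp: srt_eq)
  have "pars \<phi> \<subseteq> univ M" using wff_pars[OF \<phi>] by (simp add: univ_def)
  then have "\<forall>x\<in>FV \<phi>'. snd x \<in> carr M (fst x)"
    using \<phi>'(2) e srt_carr by fastforce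
  then have "sat M (\<sigma> \<circ> snd) \<phi>' = sat M snd \<phi>'"
    using \<phi>'(1) by (intro auto_sat0[OF \<sigma>]) (auto simp: fms0_def)
  then show ?thesis unfolding \<phi>'(3) by (simp add: pmap_ident)
qed

definition aut :: "'m set \<Rightarrow> ('m \<Rightarrow> 'm) set" where
  "aut A = {\<sigma>. automorphism \<sigma> \<and> (\<forall>c\<in>A. \<sigma> c = c)}"

lemma aut_id: "id \<in> aut A"
  by (simp add: aut_def auto_id)

lemma aut_comp: "\<sigma> \<in> aut A \<Longrightarrow> \<tau> \<in> aut A \<Longrightarrow> \<sigma> \<circ> \<tau> \<in> aut A"
  using auto_comp[of \<sigma> \<tau>] by (simp add: aut_def)

lemma aut_inv: "\<sigma> \<in> aut A \<Longrightarrow> inv \<sigma> \<in> aut A"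
proof -
  assume \<sigma>: "\<sigma> \<in> aut A"
  then have a: "automorphism \<sigma>" and fixes_A: "\<And>c. c \<in> A \<Longrightarrow> \<sigma> c = c" by (auto simp: aut_def)
  have "inv \<sigma> c = c" if "c \<in> A" for c
    using auto_inv_cancel(1)[OF a, of c] fixes_A[OF that] by simp
  with auto_inv[OF a] show ?thesis by (simp add: aut_def)
qed

lemma aut_mono: "A \<subseteq> B \<Longrightarrow> aut B \<subseteq> aut A"
  by (auto simp: aut_def)

lemma autD: "\<sigma> \<in> aut A \<Longrightarrow> automorphism \<sigma>" "\<sigma> \<in> aut A \<Longrightarrow> c \<in> A \<Longrightarrow> \<sigma> c = c"
  by (auto simp: aut_def)

lemma aut_image: "\<sigma> \<in> aut A \<Longrightarrow> S \<subseteq> A \<Longrightarrow> \<sigma> ` S = S"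
proof -
  assume "\<sigma> \<in> aut A" "S \<subseteq> A"
  then have "\<sigma> c = c" if "c \<in> S" for c using that by (auto simp: aut_def)
  then show ?thesis by simp
qed

lemma aut_sat:
  fixes \<phi> :: "('f, 'r, 's \<times> 'n, 'm) fm"
  assumes "\<sigma> \<in> aut A" "\<phi> \<in> fms L M X A" "e \<in> tuples M X"
  shows "sat M (\<lambda>x. \<sigma> (e x)) \<phi> \<longleftrightarrow> sat M e \<phi>"
proof -
  have w: "wff L (\<lambda>s. carr M s \<inter> A) \<phi>" "FV \<phi> \<subseteq> X" using assms(2) by (auto simp: fms_def)
  have "pmap \<sigma> \<phi> = \<phi>" using wff_pars[OF w(1)] assms(1) by (intro pmap_ident) (auto simp: aut_def)
  moreover have "wff L (carr M) \<phi>" by (rule wff_mono[OF w(1)]) auto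
  moreover have "e x \<in> carr M (fst x)" if "x \<in> FV \<phi>" for x using assms(3) w(2) that tuplesD by blast
  ultimately show ?thesis using auto_sat[of \<sigma> \<phi> e] autD(1)[OF assms(1)] by simp
qed

text \<open>Restricted to \<open>X\<close> because tuples are extensional functions: an automorphism
  may move the default value that a tuple takes outside \<open>X\<close>.\<close>

definition act :: "('s \<times> 'n) set \<Rightarrow> ('m \<Rightarrow> 'm) \<Rightarrow> ('s \<times> 'n \<Rightarrow> 'm) \<Rightarrow> 's \<times> 'n \<Rightarrow> 'm" where
  "act X \<sigma> e = (\<lambda>x\<in>X. \<sigma> (e x))"

lemma act_tuples: "automorphism \<sigma> \<Longrightarrow> e \<in> tuples M X \<Longrightarrow> act X \<sigma> e \<in> tuples M X"
  by (auto simp: act_def tuples_def PiE_iff auto_carr)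

lemma act_image: "act X \<sigma> e ` X = \<sigma> ` e ` X"
  by (auto simp: act_def image_image)

lemma sat_act: "FV \<phi> \<subseteq> X \<Longrightarrow> sat M (act X \<sigma> e) \<phi> \<longleftrightarrow> sat M (\<lambda>x. \<sigma> (e x)) \<phi>"
  by (rule sat_cong) (auto simp: act_def)

text \<open>Sending each entry of \<open>a\<close> to the corresponding entry of \<open>b\<close>
  and fixing \<open>A\<close> pointwise is a small elementary relation, so it extends to an
  automorphism.\<close>

lemma tp_eq_conjugate:
  fixes X :: "('s \<times> 'm) set"
  assumes ab: "a \<in> tuples M X" "b \<in> tuples M X" and A: "small_set M A" and X: "small_vars M X"
    and tp: "\<And>\<phi>. \<phi> \<in> fms L M X A \<Longrightarrow> sat M a \<phi> \<Longrightarrow> sat M b \<phi>"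
  obtains \<sigma> where "\<sigma> \<in> aut A" "act X \<sigma> a = b"
proof -
  define R where "R = (\<lambda>x. (a x, b x)) ` X \<union> (\<lambda>c. (c, c)) ` A"
  have "|(\<lambda>x. (a x, b x)) ` X| <o |univ M|"
    by (rule ordLeq_ordLess_trans[OF card_of_image]) (use X in \<open>simp add: small_vars_def\<close>)
  moreover have "|(\<lambda>c. (c, c)) ` A| <o |univ M|"
    by (rule ordLeq_ordLess_trans[OF card_of_image]) (use A in \<open>simp add: small_set_def\<close>)
  ultimately have small: "|R| <o |univ M|"
    unfolding R_def by (rule card_of_Un_ordLess_infinite[OF infinite_univ])
  have "elementary R" unfolding elementary_def
  proof (intro conjI allI impI)
    show "\<forall>(c, d)\<in>R. \<exists>s. c \<in> carr M s \<and> d \<in> carr M s"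
    proof -
      have "\<exists>s. a x \<in> carr M s \<and> b x \<in> carr M s" if "x \<in> X" for x
        using that tuplesD[OF ab(1)] tuplesD[OF ab(2)] by blast
      moreover have "\<exists>s. c \<in> carr M s" if "c \<in> A" for c
        using that A unfolding small_set_def univ_def by blast
      ultimately show ?thesis by (fastforce simp: R_def simp del: split_paired_Ex split_paired_All)
    qed
    fix \<phi> :: "('f, 'r, 's \<times> 'm, 'm) fm" and e e'
    assume \<phi>: "\<phi> \<in> fms0 L UNIV" and sat: "sat M e \<phi>"
      and ee: "\<forall>y\<in>FV \<phi>. e y \<in> carr M (fst y) \<and> (e y, e' y) \<in> R"
    \<comment> \<open>A formula about elements of the domain of \<open>R\<close> is read as a
      formula over \<open>A\<close> in the variables \<open>X\<close>: a pair of values that comes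
      from \<open>a\<close> and \<open>b\<close> becomes a variable, any other pair is a parameter
      from \<open>A\<close>. Both components are compared because an element of \<open>A\<close> may
      also be an entry of \<open>a\<close>.\<close>
    define Q where "Q v x \<longleftrightarrow> x \<in> X \<and> a x = e v \<and> b x = e' v" for v x
    define \<tau> :: "'s \<times> 'm \<Rightarrow> ('f, 's \<times> 'm, 'm) trm"
      where "\<tau> v = (if \<exists>x. Q v x then Var (SOME x. Q v x) else Par (e v))" for v
    have \<tau>: "has_sort L (\<lambda>s. carr M s \<inter> A) (\<tau> v) (fst v) \<and> tvars (\<tau> v) \<subseteq> X \<and>
        eval M a (\<tau> v) = e v \<and> eval M b (\<tau> v) = e' v" if v: "v \<in> FV \<phi>" for v
    proof (cases "\<exists>x. Q v x")
      case True
      then have "Q v (SOME x. Q v x)" by (rule someI_ex)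
      then obtain x where x: "\<tau> v = Var x" "x \<in> X" "a x = e v" "b x = e' v"
        unfolding \<tau>_def if_P[OF True] Q_def[of v "Eps (Q v)"] by blast
      have "e v \<in> carr M (fst x)" using tuplesD[OF ab(1) x(2)] unfolding x(3) .
      moreover have "e v \<in> carr M (fst v)" using bspec[OF ee v] by (rule conjunct1)
      ultimately have "fst x = fst v" by (rule carr_disjoint)
      with x show ?thesis by simp
    next
      case False
      moreover have "Q v x" if "x \<in> X" "(e v, e' v) = (a x, b x)" for x using that by (simp add: Q_def)
      ultimately have "(e v, e' v) \<in> (\<lambda>c. (c, c)) ` A" using conjunct2[OF bspec[OF ee v]] unfolding R_def by blast
      then have "e v \<in> A" "e' v = e v" by auto
      then show ?thesis using bspec[OF ee v] unfolding \<tau>_def if_not_P[OF False] by simp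
    qed
    have w: "wff L (\<lambda>_. {}) \<phi>" using \<phi> by (simp add: fms0_def)
    have \<tau>1: "has_sort L (\<lambda>s. carr M s \<inter> A) (\<tau> v) (fst v)" if "v \<in> FV \<phi>" for v
      using \<tau>[OF that] by blast
    obtain \<phi>' where \<phi>': "wff L (\<lambda>s. carr M s \<inter> A) \<phi>'" "FV \<phi>' \<subseteq> (\<Union>v\<in>FV \<phi>. tvars (\<tau> v))"
      "\<And>e'. sat M e' \<phi>' \<longleftrightarrow> sat M (\<lambda>v. eval M e' (\<tau> v)) \<phi>"
      using substitution[OF infinite_names w \<tau>1, of Par] pars_fms0[OF \<phi>] by (auto simp: fm.map_ident)
    have "sat M (\<lambda>v. eval M a (\<tau> v)) \<phi> = sat M e \<phi>" by (rule sat_cong) (use \<tau> in blast)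
    then have "sat M a \<phi>'" using sat \<phi>'(3) by blast
    moreover have "FV \<phi>' \<subseteq> X" using \<phi>'(2) \<tau> by blast
    then have "\<phi>' \<in> fms L M X A" using \<phi>'(1) by (simp add: fms_def)
    ultimately have "sat M b \<phi>'" using tp by blast
    moreover have "sat M (\<lambda>v. eval M b (\<tau> v)) \<phi> = sat M e' \<phi>" by (rule sat_cong) (use \<tau> in blast)
    ultimately show "sat M e' \<phi>" using \<phi>'(3) by blast
  qed
  then obtain \<sigma> where \<sigma>: "automorphism \<sigma>" "\<And>c d. (c, d) \<in> R \<Longrightarrow> \<sigma> c = d"
    using elementary_auto[OF _ small] by blast
  have "(c, c) \<in> R" if "c \<in> A" for c using that by (auto simp: R_def)
  then have "\<sigma> \<in> aut A" using \<sigma> by (simp add: aut_def)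
  moreover have "act X \<sigma> a x = b x" for x
  proof (cases "x \<in> X")
    case True
    then have "(a x, b x) \<in> R" by (auto simp: R_def)
    then show ?thesis using True \<sigma>(2) by (simp add: act_def)
  next
    case False
    then show ?thesis using ab(2) PiE_arb[of b X] by (simp add: act_def tuples_def)
  qed
  ultimately show ?thesis using that by blast
qed

end

section \<open>Algebraic closure\<close>

lemma not_finsatE:
  assumes "\<not> finsat M X \<Sigma>"
  obtains F where "F \<subseteq> \<Sigma>" "finite F" "\<forall>e\<in>tuples M X. \<exists>\<phi>\<in>F. \<not> sat M e \<phi>"
  using assms by (auto simp: finsat_def)

context saturated_struc
begin

definition orb :: "'m set \<Rightarrow> 'm \<Rightarrow> 'm set" where
  "orb A c = (\<lambda>\<sigma>. \<sigma> c) ` aut A"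

definition cl :: "'m set \<Rightarrow> 'm set" where
  "cl A = {c \<in> univ M. \<exists>A\<^sub>0\<subseteq>A \<inter> univ M. finite A\<^sub>0 \<and> finite (orb A\<^sub>0 c)}"

lemma cl_univ: "cl A \<subseteq> univ M"
  by (auto simp: cl_def)

lemma cl_mono: "A \<subseteq> B \<Longrightarrow> cl A \<subseteq> cl B"
  unfolding cl_def by blast

lemma cl_incl: "c \<in> A \<Longrightarrow> c \<in> univ M \<Longrightarrow> c \<in> cl A"
  unfolding cl_def
proof (intro CollectI conjI exI)
  assume "c \<in> A" "c \<in> univ M"
  then show "{c} \<subseteq> A \<inter> univ M" by simp
  have "orb {c} c \<subseteq> {c}" by (auto simp: orb_def aut_def)
  then show "finite (orb {c} c)" using finite_subset by blast
qed simp_all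

lemma cl_finitary:
  assumes "c \<in> cl A"
  obtains A\<^sub>0 where "A\<^sub>0 \<subseteq> A" "A\<^sub>0 \<subseteq> univ M" "finite A\<^sub>0" "c \<in> cl A\<^sub>0"
  using assms unfolding cl_def by blast

lemma orb_mono: "A \<subseteq> B \<Longrightarrow> orb B c \<subseteq> orb A c"
  unfolding orb_def using aut_mono by blast

text \<open>An automorphism over \<open>A0\<close> has only finitely many possible restrictions to
  \<open>B0\<close>. Two automorphisms with the same restriction differ by one over
  \<open>B0\<close>, so the orbit of \<open>c\<close> over \<open>A0\<close> is covered by finitely
  many translates of its finite orbit over \<open>B0\<close>.\<close>

lemma cl_idem:
  assumes c: "c \<in> cl B" and B: "B \<subseteq> cl A"
  shows "c \<in> cl A"
proof -
  obtain B0 where B0: "B0 \<subseteq> B" "finite B0" "finite (orb B0 c)" "c \<in> univ M"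
    using c unfolding cl_def by blast
  have "\<forall>b\<in>B0. \<exists>A0\<subseteq>A \<inter> univ M. finite A0 \<and> finite (orb A0 b)"
    using B B0(1) unfolding cl_def by blast
  then obtain F where F: "\<And>b. b \<in> B0 \<Longrightarrow> F b \<subseteq> A \<inter> univ M \<and> finite (F b) \<and> finite (orb (F b) b)"
    by metis
  define A0 where "A0 = (\<Union>b\<in>B0. F b)"
  have A0: "A0 \<subseteq> A \<inter> univ M" "finite A0" using F B0(2) unfolding A0_def by blast+
  define T where "T = (\<lambda>\<sigma>. restrict \<sigma> B0) ` aut A0"
  have "T \<subseteq> PiE B0 (\<lambda>b. orb (F b) b)"
  proof -
    have "\<sigma> b \<in> orb (F b) b" if "\<sigma> \<in> aut A0" "b \<in> B0" for \<sigma> b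
      using that aut_mono[of "F b" A0] unfolding orb_def A0_def by blast
    then show ?thesis unfolding T_def by auto
  qed
  moreover have "finite (PiE B0 (\<lambda>b. orb (F b) b))" using F B0(2) by (intro finite_PiE) auto
  ultimately have T: "finite T" using finite_subset by blast
  have "\<forall>t\<in>T. \<exists>\<sigma>\<in>aut A0. t = restrict \<sigma> B0" by (auto simp: T_def)
  then obtain g where g: "\<And>t. t \<in> T \<Longrightarrow> g t \<in> aut A0 \<and> t = restrict (g t) B0" by metis
  have "orb A0 c \<subseteq> (\<Union>t\<in>T. g t ` orb B0 c)"
  proof
    fix d assume "d \<in> orb A0 c"
    then obtain \<sigma> where \<sigma>: "\<sigma> \<in> aut A0" "d = \<sigma> c" by (auto simp: orb_def)
    define t where "t = restrict \<sigma> B0"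
    have t: "t \<in> T" using \<sigma> by (auto simp: T_def t_def)
    have a: "automorphism (g t)" "automorphism \<sigma>" using g[OF t] \<sigma> autD by auto
    have "inv (g t) (\<sigma> b) = b" if "b \<in> B0" for b
    proof -
      have "\<sigma> b = t b" using that by (simp add: t_def)
      also have "\<dots> = restrict (g t) B0 b" using g[OF t] by metis
      also have "\<dots> = g t b" using that by simp
      finally show ?thesis using auto_inv_cancel(1)[OF a(1)] by simp
    qed
    then have "inv (g t) \<circ> \<sigma> \<in> aut B0" using a auto_inv auto_comp by (simp add: aut_def)
    then have "(inv (g t) \<circ> \<sigma>) c \<in> orb B0 c" unfolding orb_def by blast
    moreover have "d = g t ((inv (g t) \<circ> \<sigma>) c)" using auto_inv_cancel(2)[OF a(1)] \<sigma> by simp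
    ultimately show "d \<in> (\<Union>t\<in>T. g t ` orb B0 c)" using t by blast
  qed
  moreover have "finite (\<Union>t\<in>T. g t ` orb B0 c)" using T B0(3) by blast
  ultimately have "finite (orb A0 c)" using finite_subset by blast
  then show ?thesis using A0 B0(4) unfolding cl_def by blast
qed

text \<open>Conjugation by \<sigma> relates the automorphisms over a finite set to those over its
  image, and hence the orbits.\<close>

lemma cl_auto1:
  assumes \<sigma>: "automorphism \<sigma>" and c: "c \<in> cl A"
  shows "\<sigma> c \<in> cl (\<sigma> ` A)"
proof -
  obtain A0 where A0: "A0 \<subseteq> A \<inter> univ M" "finite A0" "finite (orb A0 c)" "c \<in> univ M"
    using c unfolding cl_def by blast
  have "orb (\<sigma> ` A0) (\<sigma> c) \<subseteq> \<sigma> ` orb A0 c"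
  proof
    fix d assume "d \<in> orb (\<sigma> ` A0) (\<sigma> c)"
    then obtain \<tau> where \<tau>: "\<tau> \<in> aut (\<sigma> ` A0)" "d = \<tau> (\<sigma> c)" by (auto simp: orb_def)
    have "inv \<sigma> \<circ> (\<tau> \<circ> \<sigma>) \<in> aut A0"
      using \<tau>(1) \<sigma> auto_inv auto_comp auto_inv_cancel(1)[OF \<sigma>] by (simp add: aut_def)
    then have "(inv \<sigma> \<circ> (\<tau> \<circ> \<sigma>)) c \<in> orb A0 c" unfolding orb_def by blast
    moreover have "d = \<sigma> ((inv \<sigma> \<circ> (\<tau> \<circ> \<sigma>)) c)" using auto_inv_cancel(2)[OF \<sigma>] \<tau>(2) by simp
    ultimately show "d \<in> \<sigma> ` orb A0 c" by blast
  qed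
  then have "finite (orb (\<sigma> ` A0) (\<sigma> c))" using A0(3) finite_subset by blast
  moreover have "\<sigma> ` A0 \<subseteq> \<sigma> ` A \<inter> univ M" using A0(1) auto_univ[OF \<sigma>] by blast
  ultimately show ?thesis using A0(2,4) auto_univ[OF \<sigma>] unfolding cl_def by blast
qed

lemma auto_inv_image: "automorphism \<sigma> \<Longrightarrow> inv \<sigma> ` \<sigma> ` A = A" "automorphism \<sigma> \<Longrightarrow> \<sigma> ` inv \<sigma> ` A = A"
  by (simp_all add: image_image auto_inv_cancel)

lemma cl_auto: "automorphism \<sigma> \<Longrightarrow> \<sigma> c \<in> cl (\<sigma> ` A) \<longleftrightarrow> c \<in> cl A"
  using cl_auto1[of \<sigma> c A] cl_auto1[of "inv \<sigma>" "\<sigma> c" "\<sigma> ` A"] auto_inv[of \<sigma>]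
  by (auto simp: auto_inv_image auto_inv_cancel)

lemma sorts_nonempty: "\<exists>s. s \<in> sorts L"
proof -
  have "univ M \<noteq> {}" using infinite_univ by auto
  then show ?thesis using sort_if_carr unfolding univ_def by blast
qed

lemma truth:
  obtains \<psi> :: "('f, 'r, 's \<times> 'n, 'm) fm" where "\<psi> \<in> fms0 L {}" "\<And>e. sat M e \<psi>"
proof -
  obtain s where s: "s \<in> sorts L" using sorts_nonempty by blast
  define x where "x = (s, undefined :: 'n)"
  have "All x (Eq (Var x) (Var x)) \<in> fms0 L {}" using s by (auto simp: fms0_def x_def)
  then show ?thesis using that by fastforce
qed

lemma fms0_fms: "\<phi> \<in> fms0 L X \<Longrightarrow> \<phi> \<in> fms L M X A"
  unfolding fms0_def fms_def using wff_mono[of L "\<lambda>s. {}" \<phi> "\<lambda>s. carr M s \<inter> A"] by auto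

lemma fms_mono: "\<phi> \<in> fms L M X A \<Longrightarrow> X \<subseteq> Y \<Longrightarrow> A \<subseteq> B \<Longrightarrow> \<phi> \<in> fms L M Y B"
  unfolding fms_def using wff_mono[of L "\<lambda>s. carr M s \<inter> A" \<phi> "\<lambda>s. carr M s \<inter> B"] by auto

lemma fms_pars: "\<phi> \<in> fms L M X A \<Longrightarrow> pars \<phi> \<subseteq> A \<inter> univ M"
  unfolding fms_def univ_def using wff_pars[of L "\<lambda>s. carr M s \<inter> A" \<phi>] by auto

lemma fms_restrict_pars: "\<phi> \<in> fms L M X A \<Longrightarrow> \<phi> \<in> fms L M X (pars \<phi>)"
  unfolding fms_def using wff_mono[of L "\<lambda>s. carr M s \<inter> A" \<phi> "\<lambda>s. carr M s \<inter> pars \<phi>"] by auto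

lemma tuples_single: "c \<in> carr M (fst x) \<Longrightarrow> (\<lambda>y\<in>{x}. c) \<in> tuples M {x}"
  by (auto simp: tuples_def)

lemma sat_single: "FV \<phi> \<subseteq> {x} \<Longrightarrow> sat M e \<phi> = sat M (\<lambda>_. e x) \<phi>"
  by (rule sat_cong) auto

lemma realizes_tp:
  fixes X :: "('s \<times> 'm) set"
  assumes a: "a \<in> tuples M X" and A: "small_set M A" and X: "small_vars M X"
  shows "realizes M X b (tp L M X a A) \<longleftrightarrow> (\<exists>\<sigma>\<in>aut A. b = act X \<sigma> a)"
proof
  assume "realizes M X b (tp L M X a A)"
  then have "b \<in> tuples M X" "\<And>\<phi>. \<phi> \<in> fms L M X A \<Longrightarrow> sat M a \<phi> \<Longrightarrow> sat M b \<phi>"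
    by (auto simp: realizes_def tp_def)
  then show "\<exists>\<sigma>\<in>aut A. b = act X \<sigma> a" using tp_eq_conjugate[OF a _ A X] by metis
next
  assume "\<exists>\<sigma>\<in>aut A. b = act X \<sigma> a"
  then obtain \<sigma> where \<sigma>: "\<sigma> \<in> aut A" "b = act X \<sigma> a" by blast
  have "sat M b \<phi>" if "\<phi> \<in> fms L M X A" "sat M a \<phi>" for \<phi>
    using aut_sat[OF \<sigma>(1) that(1) a] sat_act[of \<phi> X \<sigma> a] that \<sigma>(2) by (simp add: fms_def)
  then show "realizes M X b (tp L M X a A)"
    using act_tuples[OF autD(1)[OF \<sigma>(1)] a] \<sigma>(2) by (simp add: realizes_def tp_def)
qed

text \<open>By homogeneity every realisation of the type of \<open>e\<close> over \<open>A\<close>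
  lies in the orbit. The orbit is finite and can be named by parameters, so the type together with
  the inequations from all its members is inconsistent; by compactness finitely many formulas of the
  type already confine their solutions to the orbit.\<close>

lemma finite_orbit_formula:
  fixes x :: "'s \<times> 'm"
  assumes A: "small_set M A" and e: "e \<in> carr M (fst x)" and fin: "finite (orb A e)"
  obtains \<phi> where "\<phi> \<in> fms L M {x} A" "sat M (\<lambda>_. e) \<phi>" "finite {c \<in> carr M (fst x). sat M (\<lambda>_. c) \<phi>}"
proof -
  define O' where "O' = orb A e"
  have O: "O' \<subseteq> carr M (fst x)"
    using e auto_carr autD(1) unfolding O'_def orb_def by blast
  define \<Sigma>1 where "\<Sigma>1 = {\<phi> \<in> fms L M {x} A. sat M (\<lambda>_. e) \<phi>}"
  define ne where "ne c = (Neg (Eq (Var x) (Par c)) :: ('f, 'r, 's \<times> 'm, 'm) fm)" for c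
  have "small_set M O'" using fin O carr_univ by (intro small_finite) (auto simp: O'_def)
  then have small: "small_set M (A \<union> O')" using A small_Un by blast
  have s: "fst x \<in> sorts L" using e sort_if_carr by blast
  have ne: "ne c \<in> fms L M {x} (A \<union> O')" if "c \<in> O'" for c
    using that O s by (auto simp: ne_def fms_def)
  have sub: "\<Sigma>1 \<union> ne ` O' \<subseteq> fms L M {x} (A \<union> O')"
    using ne fms_mono[of _ "{x}" A "{x}" "A \<union> O'"] unfolding \<Sigma>1_def by blast
  define e0 where "e0 = (\<lambda>y\<in>{x}. e)"
  have e0: "e0 \<in> tuples M {x}" "e0 x = e" using tuples_single[OF e] by (simp_all add: e0_def)
  have "\<not> finsat M {x} (\<Sigma>1 \<union> ne ` O')"
  proof
    assume "finsat M {x} (\<Sigma>1 \<union> ne ` O')"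
    then obtain e' where e': "realizes M {x} e' (\<Sigma>1 \<union> ne ` O')" using saturated[OF small sub] by blast
    have "sat M e' \<phi>" if "\<phi> \<in> fms L M {x} A" "sat M e0 \<phi>" for \<phi>
    proof -
      have "sat M (\<lambda>_. e) \<phi>" using that sat_single[of \<phi> x e0] e0(2) by (simp add: fms_def)
      then show ?thesis using e' that by (simp add: realizes_def \<Sigma>1_def)
    qed
    then have "realizes M {x} e' (tp L M {x} e0 A)" using e' by (simp add: realizes_def tp_def)
    then obtain \<sigma> where "\<sigma> \<in> aut A" "e' = act {x} \<sigma> e0"
      using realizes_tp[OF e0(1) A small_vars_finite] by blast
    then have "e' x \<in> O'" using e0(2) by (simp add: O'_def orb_def act_def)
    then have "sat M e' (ne (e' x))" using e' by (simp add: realizes_def)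
    then show False by (simp add: ne_def)
  qed
  then obtain F where F: "F \<subseteq> \<Sigma>1 \<union> ne ` O'" "finite F" "\<forall>e\<in>tuples M {x}. \<exists>\<phi>\<in>F. \<not> sat M e \<phi>"
    by (rule not_finsatE)
  obtain \<psi> :: "('f, 'r, 's \<times> 'm, 'm) fm" where \<psi>: "\<psi> \<in> fms0 L {}" "\<And>e. sat M e \<psi>" using truth by blast
  define G where "G = insert \<psi> (F \<inter> \<Sigma>1)"
  have "\<psi> \<in> \<Sigma>1" using fms_mono[OF fms0_fms[OF \<psi>(1), of A], of "{x}" A] \<psi>(2) by (simp add: \<Sigma>1_def)
  then have G: "finite G" "G \<noteq> {}" "G \<subseteq> \<Sigma>1" using F(2) by (auto simp: G_def)
  have w: "wff L (\<lambda>s. carr M s \<inter> A) \<phi>" if "\<phi> \<in> G" for \<phi> using that G(3) by (auto simp: \<Sigma>1_def fms_def)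
  obtain \<chi> where \<chi>: "wff L (\<lambda>s. carr M s \<inter> A) \<chi>" "FV \<chi> = (\<Union>\<phi>\<in>G. FV \<phi>)" "\<And>e. sat M e \<chi> \<longleftrightarrow> (\<forall>\<phi>\<in>G. sat M e \<phi>)"
    by (rule conjunction[OF G(1,2), of L "\<lambda>s. carr M s \<inter> A"]) (use w in auto)
  have FV: "FV \<chi> \<subseteq> {x}" using \<chi>(2) G(3) unfolding \<Sigma>1_def fms_def by blast
  show ?thesis
  proof (rule that)
    show "\<chi> \<in> fms L M {x} A" using \<chi>(1) FV by (simp add: fms_def)
    show "sat M (\<lambda>_. e) \<chi>" using G(3) \<chi>(3) by (auto simp: \<Sigma>1_def)
    have "{c \<in> carr M (fst x). sat M (\<lambda>_. c) \<chi>} \<subseteq> O'"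
    proof
      fix c assume "c \<in> {c \<in> carr M (fst x). sat M (\<lambda>_. c) \<chi>}"
      then have c: "c \<in> carr M (fst x)" "sat M (\<lambda>_. c) \<chi>" by auto
      define ec where "ec = (\<lambda>y\<in>{x}. c)"
      have ec: "ec \<in> tuples M {x}" "ec x = c" using tuples_single[OF c(1)] by (simp_all add: ec_def)
      then obtain \<phi> where \<phi>: "\<phi> \<in> F" "\<not> sat M ec \<phi>" using F(3) by blast
      have "sat M ec \<chi>" using sat_single[OF FV, of ec] ec(2) c(2) by simp
      then have "\<phi> \<notin> \<Sigma>1" using \<phi> \<chi>(3) by (auto simp: G_def)
      then obtain d where "d \<in> O'" "\<phi> = ne d" using \<phi>(1) F(1) by blast
      then show "c \<in> O'" using \<phi>(2) ec(2) by (simp add: ne_def)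
    qed
    then show "finite {c \<in> carr M (fst x). sat M (\<lambda>_. c) \<chi>}"
      using fin finite_subset unfolding O'_def by blast
  qed
qed

lemma cl_formula:
  fixes x :: "'s \<times> 'm"
  assumes "e \<in> cl A" and e: "e \<in> carr M (fst x)"
  obtains \<phi> where "\<phi> \<in> fms L M {x} A" "sat M (\<lambda>_. e) \<phi>" "finite {c \<in> carr M (fst x). sat M (\<lambda>_. c) \<phi>}"
proof -
  obtain A0 where A0: "A0 \<subseteq> A \<inter> univ M" "finite A0" "finite (orb A0 e)"
    using assms(1) unfolding cl_def by blast
  have "small_set M A0" using A0 by (intro small_finite) auto
  from finite_orbit_formula[OF this e A0(3)] show ?thesis
    using that fms_mono[of _ "{x}" A0 "{x}" A] A0(1) by blast
qed

text \<open>Automorphisms that fix the finitely many parameters of \<phi> permute its finite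
  solution set.\<close>

lemma formula_cl:
  assumes \<phi>: "\<phi> \<in> fms L M {x} A" and c: "c \<in> carr M (fst x)" "sat M (\<lambda>_. c) \<phi>"
    and fin: "finite {c \<in> carr M (fst x). sat M (\<lambda>_. c) \<phi>}"
  shows "c \<in> cl A"
proof -
  have p: "pars \<phi> \<subseteq> A \<inter> univ M" "finite (pars \<phi>)" "\<phi> \<in> fms L M {x} (pars \<phi>)"
    using fms_pars[OF \<phi>] fms_restrict_pars[OF \<phi>] by auto
  have "orb (pars \<phi>) c \<subseteq> {c \<in> carr M (fst x). sat M (\<lambda>_. c) \<phi>}"
  proof
    fix d assume "d \<in> orb (pars \<phi>) c"
    then obtain \<sigma> where \<sigma>: "\<sigma> \<in> aut (pars \<phi>)" "d = \<sigma> c" by (auto simp: orb_def)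
    have FV: "FV \<phi> \<subseteq> {x}" using \<phi> by (simp add: fms_def)
    have "sat M (\<lambda>y. \<sigma> ((\<lambda>y\<in>{x}. c) y)) \<phi> = sat M (\<lambda>y\<in>{x}. c) \<phi>"
      by (rule aut_sat[OF \<sigma>(1) p(3) tuples_single[OF c(1)]])
    then have "sat M (\<lambda>_. d) \<phi>"
      using sat_single[OF FV, of "\<lambda>y. \<sigma> ((\<lambda>y\<in>{x}. c) y)"] sat_single[OF FV, of "\<lambda>y\<in>{x}. c"] c(2) \<sigma>(2) by simp
    then show "d \<in> {c \<in> carr M (fst x). sat M (\<lambda>_. c) \<phi>}"
      using c(1) \<sigma> auto_carr[OF autD(1)[OF \<sigma>(1)]] by simp
  qed
  then have "finite (orb (pars \<phi>) c)" using fin finite_subset by blast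
  then show ?thesis using p c(1) carr_univ unfolding cl_def by blast
qed

text \<open>Passing through a formula replaces the small set \<open>A\<close> by the finitely many
  parameters that \<open>cl\<close> asks for.\<close>

lemma finite_orbit_cl:
  assumes "small_set M A" "c \<in> univ M" "finite (orb A c)"
  shows "c \<in> cl A"
proof -
  define x where "x = (srt c, c)"
  have c: "c \<in> carr M (fst x)" unfolding x_def fst_conv by (rule srt_carr[OF assms(2)])
  obtain \<phi> where "\<phi> \<in> fms L M {x} A" "sat M (\<lambda>_. c) \<phi>" "finite {c \<in> carr M (fst x). sat M (\<lambda>_. c) \<phi>}"
    using finite_orbit_formula[OF assms(1) c assms(3)] by blast
  then show ?thesis using formula_cl[OF _ c] by blast
qed

lemma acl_eq_cl: "acl L M A = cl A"
proof (intro equalityI subsetI)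
  fix b assume "b \<in> acl L M A"
  then obtain x :: "'s \<times> nat" and e \<phi> where *: "e \<in> tuples M {x}" "e x = b"
    "\<phi> \<in> fms L M {x} A" "sat M e \<phi>" "finite {e \<in> tuples M {x}. sat M e \<phi>}"
    unfolding acl_def algebraic_type_def tp_def by blast
  have b: "b \<in> carr M (fst x)" using tuplesD[OF *(1), of x] *(2) by simp
  have FV: "FV \<phi> \<subseteq> {x}" using *(3) by (simp add: fms_def)
  have "{c \<in> carr M (fst x). sat M (\<lambda>_. c) \<phi>} \<subseteq> (\<lambda>e. e x) ` {e \<in> tuples M {x}. sat M e \<phi>}"
  proof
    fix c assume c: "c \<in> {c \<in> carr M (fst x). sat M (\<lambda>_. c) \<phi>}"
    then have "sat M (\<lambda>y\<in>{x}. c) \<phi>" using sat_single[OF FV, of "\<lambda>y\<in>{x}. c"] by simp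
    moreover have "c = (\<lambda>y\<in>{x}. c) x" by simp
    ultimately show "c \<in> (\<lambda>e. e x) ` {e \<in> tuples M {x}. sat M e \<phi>}"
      using tuples_single[of c x] c by blast
  qed
  then have "finite {c \<in> carr M (fst x). sat M (\<lambda>_. c) \<phi>}"
    using *(5) by (meson finite_imageI finite_subset)
  moreover have "sat M (\<lambda>_. b) \<phi>" using sat_single[OF FV, of e] *(2,4) by simp
  ultimately show "b \<in> cl A" using formula_cl[OF *(3) b] by blast
next
  fix b assume b: "b \<in> cl A"
  then have bu: "b \<in> univ M" using cl_univ by blast
  define x where "x = (srt b, b)"
  have bx: "b \<in> carr M (fst x)" unfolding x_def fst_conv by (rule srt_carr[OF bu])
  obtain \<phi> where \<phi>: "\<phi> \<in> fms L M {x} A" "sat M (\<lambda>_. b) \<phi>" "finite {c \<in> carr M (fst x). sat M (\<lambda>_. c) \<phi>}"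
    using cl_formula[OF b bx] by blast
  \<comment> \<open>\<open>acl\<close> asks for a variable named by a natural number, so the formula
    is carried over to such a variable.\<close>
  define y where "y = (srt b, 0 :: nat)"
  have FV: "FV \<phi> \<subseteq> {x}" "wff L (\<lambda>s. carr M s \<inter> A) \<phi>" using \<phi>(1) by (auto simp: fms_def)
  have so: "has_sort L (\<lambda>s. carr M s \<inter> A) (Var y) (fst v)" if "v \<in> FV \<phi>" for v
    using that FV(1) by (auto simp: x_def y_def)
  obtain \<phi>' where \<phi>': "wff L (\<lambda>s. carr M s \<inter> A) \<phi>'" "FV \<phi>' \<subseteq> (\<Union>v\<in>FV \<phi>. {y})"
    "\<And>e. sat M e \<phi>' \<longleftrightarrow> sat M (\<lambda>v. e y) \<phi>"
    using substitution[OF infinite_UNIV_nat FV(2) so, of Par] by (auto simp: fm.map_ident)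
  define e where "e = (\<lambda>z\<in>{y}. b)"
  have e: "e \<in> tuples M {y}" "e y = b" using bx tuples_single[of b y] by (auto simp: e_def x_def y_def)
  have "{e \<in> tuples M {y}. sat M e \<phi>'} \<subseteq> (\<lambda>c. \<lambda>z\<in>{y}. c) ` {c \<in> carr M (fst x). sat M (\<lambda>_. c) \<phi>}"
  proof
    fix f assume "f \<in> {e \<in> tuples M {y}. sat M e \<phi>'}"
    then have f: "f \<in> tuples M {y}" "sat M (\<lambda>_. f y) \<phi>" using \<phi>'(3) by auto
    have "f = (\<lambda>z\<in>{y}. f y)"
    proof
      fix z show "f z = (\<lambda>z\<in>{y}. f y) z"
        using f(1) PiE_arb[of f "{y}" _ z] by (cases "z = y") (simp_all add: tuples_def)
    qed
    moreover have "f y \<in> carr M (fst x)" using tuplesD[OF f(1), of y] unfolding x_def y_def fst_conv by simp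
    ultimately show "f \<in> (\<lambda>c. \<lambda>z\<in>{y}. c) ` {c \<in> carr M (fst x). sat M (\<lambda>_. c) \<phi>}" using f(2) by blast
  qed
  then have "finite {e \<in> tuples M {y}. sat M e \<phi>'}" using \<phi>(3) by (meson finite_imageI finite_subset)
  moreover have "FV \<phi>' \<subseteq> {y}" using \<phi>'(2) by blast
  then have "\<phi>' \<in> tp L M {y} e A"
    using \<phi>'(1) \<phi>'(3)[of e] e(2) \<phi>(2) by (simp add: tp_def fms_def)
  ultimately have "algebraic_type M {y} (tp L M {y} e A)" unfolding algebraic_type_def by blast
  then show "b \<in> acl L M A" using e unfolding acl_def by blast
qed

text \<open>A formula with finitely many solutions leaves finitely many values for each coordinate.
  Conversely, the conjunction of algebraic formulas for the coordinates has its solutions in a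
  finite product.\<close>

lemma algebraic_tuple:
  fixes Y :: "('s \<times> 'm) set"
  assumes Y: "finite Y" and A: "small_set M A" and a: "a \<in> tuples M Y"
  shows "algebraic_type M Y (tp L M Y a A) \<longleftrightarrow> a ` Y \<subseteq> cl A"
proof
  assume "algebraic_type M Y (tp L M Y a A)"
  then obtain \<phi> where \<phi>: "\<phi> \<in> fms L M Y A" "sat M a \<phi>" "finite {e \<in> tuples M Y. sat M e \<phi>}"
    unfolding algebraic_type_def tp_def by blast
  have "a y \<in> cl A" if y: "y \<in> Y" for y
  proof (rule finite_orbit_cl[OF A tuples_univ[OF a y]])
    have "orb A (a y) \<subseteq> (\<lambda>e. e y) ` {e \<in> tuples M Y. sat M e \<phi>}"
    proof
      fix d assume "d \<in> orb A (a y)"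
      then obtain \<sigma> where \<sigma>: "\<sigma> \<in> aut A" "d = \<sigma> (a y)" by (auto simp: orb_def)
      have "sat M (act Y \<sigma> a) \<phi>"
        using aut_sat[OF \<sigma>(1) \<phi>(1) a] sat_act[of \<phi> Y \<sigma> a] \<phi>(1,2) by (simp add: fms_def)
      moreover have "act Y \<sigma> a \<in> tuples M Y" using act_tuples autD(1) \<sigma>(1) a by blast
      moreover have "d = act Y \<sigma> a y" using y \<sigma>(2) by (simp add: act_def)
      ultimately show "d \<in> (\<lambda>e. e y) ` {e \<in> tuples M Y. sat M e \<phi>}" by blast
    qed
    then show "finite (orb A (a y))" using \<phi>(3) by (meson finite_imageI finite_subset)
  qed
  then show "a ` Y \<subseteq> cl A" by blast
next
  assume cl: "a ` Y \<subseteq> cl A"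
  have "\<forall>y\<in>Y. \<exists>\<phi>. \<phi> \<in> fms L M {y} A \<and> sat M (\<lambda>_. a y) \<phi> \<and>
      finite {c \<in> carr M (fst y). sat M (\<lambda>_. c) \<phi>}"
  proof
    fix y assume y: "y \<in> Y"
    then have "a y \<in> cl A" using cl by blast
    from cl_formula[OF this tuplesD[OF a y]]
    show "\<exists>\<phi>. \<phi> \<in> fms L M {y} A \<and> sat M (\<lambda>_. a y) \<phi> \<and>
      finite {c \<in> carr M (fst y). sat M (\<lambda>_. c) \<phi>}" by blast
  qed
  from bchoice[OF this] obtain f where f: "\<forall>y\<in>Y. f y \<in> fms L M {y} A \<and> sat M (\<lambda>_. a y) (f y) \<and>
      finite {c \<in> carr M (fst y). sat M (\<lambda>_. c) (f y)}" ..
  obtain \<psi> :: "('f, 'r, 's \<times> 'm, 'm) fm" where \<psi>: "\<psi> \<in> fms0 L {}" "\<And>e. sat M e \<psi>" using truth by blast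
  define G where "G = insert \<psi> (f ` Y)"
  have "\<psi> \<in> fms L M Y A" using fms_mono[OF fms0_fms[OF \<psi>(1), of A], of Y A] by simp
  moreover have "f y \<in> fms L M Y A" if "y \<in> Y" for y
    using fms_mono[of "f y" "{y}" A Y A] bspec[OF f that] that by simp
  ultimately have G: "finite G" "G \<noteq> {}" "G \<subseteq> fms L M Y A" using Y by (auto simp: G_def)
  have w: "wff L (\<lambda>s. carr M s \<inter> A) \<phi>" if "\<phi> \<in> G" for \<phi> using that G(3) by (auto simp: fms_def)
  obtain \<chi> where \<chi>: "wff L (\<lambda>s. carr M s \<inter> A) \<chi>" "FV \<chi> = (\<Union>\<phi>\<in>G. FV \<phi>)" "\<And>e. sat M e \<chi> \<longleftrightarrow> (\<forall>\<phi>\<in>G. sat M e \<phi>)"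
    by (rule conjunction[OF G(1,2), of L "\<lambda>s. carr M s \<inter> A"]) (use w in auto)
  have fv: "FV (f y) \<subseteq> {y}" if "y \<in> Y" for y using bspec[OF f that] by (simp add: fms_def)
  have "sat M a (f y)" if "y \<in> Y" for y using sat_single[OF fv[OF that], of a] bspec[OF f that] by simp
  then have "sat M a \<chi>" using \<chi>(3) \<psi>(2) by (simp add: G_def)
  moreover have "FV \<chi> \<subseteq> Y" using \<chi>(2) G(3) unfolding fms_def by blast
  ultimately have "\<chi> \<in> tp L M Y a A" using \<chi>(1) by (simp add: tp_def fms_def)
  moreover have "{e \<in> tuples M Y. sat M e \<chi>} \<subseteq> PiE Y (\<lambda>y. {c \<in> carr M (fst y). sat M (\<lambda>_. c) (f y)})"
  proof
    fix e assume e: "e \<in> {e \<in> tuples M Y. sat M e \<chi>}"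
    have "sat M (\<lambda>_. e y) (f y)" if "y \<in> Y" for y
      using e \<chi>(3) that sat_single[OF fv[OF that], of e] by (auto simp: G_def)
    then show "e \<in> PiE Y (\<lambda>y. {c \<in> carr M (fst y). sat M (\<lambda>_. c) (f y)})"
      using e by (auto simp: tuples_def PiE_iff)
  qed
  moreover have "finite (PiE Y (\<lambda>y. {c \<in> carr M (fst y). sat M (\<lambda>_. c) (f y)}))"
    using Y f by (intro finite_PiE) auto
  ultimately show "algebraic_type M Y (tp L M Y a A)"
    unfolding algebraic_type_def using finite_subset by blast
qed

end

section \<open>Thorn-independence in terms of algebraic closure\<close>

context saturated_struc
begin

text \<open>A set has at most \<open>Suc m\<close> elements iff deleting a suitable element leaves
  at most \<open>m\<close>; the quantified variable \<open>w\<close> stands for the deleted element.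
  If the set is empty, any element of the carrier will do, which is why the carrier must be
  nonempty.\<close>

lemma at_most:
  fixes \<chi> :: "('f, 'r, 's \<times> 'm, 'm) fm"
  assumes "wff L P \<chi>" "carr M (fst y) \<noteq> {}"
  shows "\<exists>\<delta>. wff L P \<delta> \<and> FV \<delta> \<subseteq> FV \<chi> - {y} \<and>
    (\<forall>u. sat M u \<delta> \<longleftrightarrow> finite {c \<in> carr M (fst y). sat M (u(y := c)) \<chi>} \<and>
      card {c \<in> carr M (fst y). sat M (u(y := c)) \<chi>} \<le> m)"
  using assms
proof (induction m arbitrary: \<chi>)
  case 0
  have s: "fst y \<in> sorts L" using 0(2) sort_if_carr by blast
  have "sat M u (All y (Neg \<chi>)) \<longleftrightarrow> finite {c \<in> carr M (fst y). sat M (u(y := c)) \<chi>} \<and>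
      card {c \<in> carr M (fst y). sat M (u(y := c)) \<chi>} \<le> 0" for u
  proof -
    have card0: "S = {} \<longleftrightarrow> finite S \<and> card S \<le> 0" for S :: "'m set"
      by (cases "finite S") auto
    have "sat M u (All y (Neg \<chi>)) \<longleftrightarrow> {c \<in> carr M (fst y). sat M (u(y := c)) \<chi>} = {}" by auto
    also note card0
    finally show ?thesis .
  qed
  then show ?case using 0(1) s by (intro exI[of _ "All y (Neg \<chi>)"]) (simp del: fun_upd_apply)
next
  case (Suc m)
  have s: "fst y \<in> sorts L" using Suc.prems(2) sort_if_carr by blast
  obtain n where n: "(fst y, n) \<notin> insert y (FV \<chi>)"
    using infinite_fresh[OF infinite_names, of "insert y (FV \<chi>)" "fst y"] by auto
  define w where "w = (fst y, n)"
  have w: "w \<noteq> y" "w \<notin> FV \<chi>" "fst w = fst y" using n by (auto simp: w_def)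
  define \<chi>' where "\<chi>' = Conj \<chi> (Neg (Eq (Var y) (Var w)))"
  have "wff L P \<chi>'" using Suc.prems(1) s w(3) by (auto simp: \<chi>'_def)
  from Suc.IH[OF this Suc.prems(2)] obtain \<delta>' where \<delta>': "wff L P \<delta>'" "FV \<delta>' \<subseteq> FV \<chi>' - {y}"
    "\<And>u. sat M u \<delta>' \<longleftrightarrow> finite {c \<in> carr M (fst y). sat M (u(y := c)) \<chi>'} \<and>
      card {c \<in> carr M (fst y). sat M (u(y := c)) \<chi>'} \<le> m" by blast
  define \<delta> where "\<delta> = Neg (All w (Neg \<delta>'))"
  have "sat M u \<delta> \<longleftrightarrow> finite {c \<in> carr M (fst y). sat M (u(y := c)) \<chi>} \<and>
      card {c \<in> carr M (fst y). sat M (u(y := c)) \<chi>} \<le> Suc m" for u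
  proof -
    define S where "S = {c \<in> carr M (fst y). sat M (u(y := c)) \<chi>}"
    have eq: "{c \<in> carr M (fst y). sat M (u(w := d, y := c)) \<chi>'} = S - {d}" for d
    proof -
      have "sat M (u(w := d, y := c)) \<chi> = sat M (u(y := c)) \<chi>" for c
        by (rule sat_cong) (use w in auto)
      then show ?thesis using w by (auto simp: S_def \<chi>'_def)
    qed
    have "sat M u \<delta> \<longleftrightarrow> (\<exists>d\<in>carr M (fst y). finite (S - {d}) \<and> card (S - {d}) \<le> m)"
      by (simp add: \<delta>_def \<delta>'(3) eq w(3) del: fun_upd_apply)
    also have "\<dots> \<longleftrightarrow> finite S \<and> card S \<le> Suc m"
    proof
      assume "\<exists>d\<in>carr M (fst y). finite (S - {d}) \<and> card (S - {d}) \<le> m"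
      then show "finite S \<and> card S \<le> Suc m" by (auto simp: card_Diff_singleton_if split: if_splits)
    next
      assume *: "finite S \<and> card S \<le> Suc m"
      obtain d where "d \<in> carr M (fst y)" "S = {} \<or> d \<in> S"
        using Suc.prems(2) by (cases "S = {}") (auto simp: S_def)
      then show "\<exists>d\<in>carr M (fst y). finite (S - {d}) \<and> card (S - {d}) \<le> m"
        using * by (intro bexI[of _ d]) auto
    qed
    finally show ?thesis by (simp add: S_def)
  qed
  moreover have "wff L P \<delta>" using \<delta>'(1) s w(3) by (simp add: \<delta>_def)
  moreover have "FV \<delta> \<subseteq> FV \<chi> - {y}" using \<delta>'(2) by (auto simp: \<delta>_def \<chi>'_def)
  ultimately show ?case by blast
qed

text \<open>Every element of \<open>M\<close> is the name of a variable of each sort, so a small set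
  of variables cannot exhaust a sort, even when it is infinite.\<close>

lemma fresh_vars:
  fixes V :: "('s \<times> 'm) set"
  assumes "finite F" "small_vars M V"
  obtains g where "inj_on g F" "\<And>c. c \<in> F \<Longrightarrow> fst (g c) = srt c" "\<And>c. c \<in> F \<Longrightarrow> g c \<notin> V"
proof -
  have one: "\<exists>x. fst x = s \<and> x \<notin> W" if "small_vars M W" for s and W :: "('s \<times> 'm) set"
  proof (rule ccontr)
    assume "\<not> (\<exists>x. fst x = s \<and> x \<notin> W)"
    then have "Pair s ` univ M \<subseteq> W" by force
    then have "|Pair s ` univ M| \<le>o |W|" by (rule card_of_mono1)
    moreover have "|univ M| \<le>o |Pair s ` univ M|"
      by (rule card_of_ordLeq[THEN iffD1]) (rule exI[of _ "Pair s"], auto simp: inj_on_def)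
    ultimately have "|univ M| \<le>o |W|" using ordLeq_transitive by blast
    moreover have "|W| <o |univ M|" using that by (simp add: small_vars_def)
    ultimately show False using not_ordLess_ordLeq by blast
  qed
  have "\<exists>g. inj_on g F \<and> (\<forall>c\<in>F. fst (g c) = srt c \<and> g c \<notin> V)"
    using assms(1)
  proof (induction F)
    case (insert c F)
    then obtain g where g: "inj_on g F" "\<forall>c\<in>F. fst (g c) = srt c \<and> g c \<notin> V" by blast
    have "small_vars M (V \<union> g ` F)" using assms(2) insert(1) small_vars_Un small_vars_finite by blast
    then obtain x where x: "fst x = srt c" "x \<notin> V \<union> g ` F" using one by blast
    have "inj_on (g(c := x)) (insert c F)"
      using g(1) x insert(2) by (auto simp: inj_on_def)
    moreover have "\<forall>d\<in>insert c F. fst ((g(c := x)) d) = srt d \<and> (g(c := x)) d \<notin> V"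
      using g(2) x by auto
    ultimately show ?case by blast
  qed auto
  then show ?thesis using that by blast
qed

text \<open>That \<open>m\<close> does not depend on \<open>u\<close> is what turns algebraicity into \<open>k\<close>-inconsistency.\<close>

lemma bounded_formula:
  fixes X :: "('s \<times> 'm) set"
  assumes b: "b \<in> tuples M X" and P: "P \<subseteq> univ M" and e: "e \<in> cl (P \<union> b ` X)"
    and y: "y \<notin> X" "e \<in> carr M (fst y)"
  obtains \<chi> m where "\<chi> \<in> fms L M (insert y X) P" "sat M (b(y := e)) \<chi>"
    "\<And>u. finite {c \<in> carr M (fst y). sat M (u(y := c)) \<chi>}"
    "\<And>u. card {c \<in> carr M (fst y). sat M (u(y := c)) \<chi>} \<le> m"
proof -
  obtain \<chi> where \<chi>: "\<chi> \<in> fms L M {y} (P \<union> b ` X)" "sat M (\<lambda>_. e) \<chi>"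
    "finite {c \<in> carr M (fst y). sat M (\<lambda>_. c) \<chi>}"
    using cl_formula[OF e y(2)] by blast
  have w: "wff L (\<lambda>s. carr M s \<inter> (P \<union> b ` X)) \<chi>" and FV: "FV \<chi> \<subseteq> {y}"
    using \<chi>(1) by (auto simp: fms_def)
  define v where "v c = (SOME x. x \<in> X \<and> b x = c)" for c
  have v: "v c \<in> X" "b (v c) = c" if "c \<in> b ` X" for c
  proof -
    have "\<exists>x. x \<in> X \<and> b x = c" using that by blast
    then have "v c \<in> X \<and> b (v c) = c" unfolding v_def by (rule someI_ex)
    then show "v c \<in> X" "b (v c) = c" by auto
  qed
  \<comment> \<open>Parameters from \<open>P\<close> stay, and the other ones, which are entries of
    \<open>b\<close>, become variables of \<open>X\<close>.\<close>
  define \<rho> :: "'m \<Rightarrow> ('f, 's \<times> 'm, 'm) trm" where "\<rho> c = (if c \<in> P then Par c else Var (v c))" for c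
  have \<rho>: "has_sort L (\<lambda>s. carr M s \<inter> P) (\<rho> c) s" if "c \<in> carr M s \<inter> (P \<union> b ` X)" for c s
  proof (cases "c \<in> P")
    case True
    then show ?thesis using that by (simp add: \<rho>_def)
  next
    case False
    then have "c \<in> b ` X" using that by blast
    then have "c \<in> carr M (fst (v c))" using v tuplesD[OF b] by metis
    then show ?thesis using False that carr_disjoint[of c s "fst (v c)"] by (simp add: \<rho>_def)
  qed
  have "\<exists>\<phi>'. wff L (\<lambda>s. carr M s \<inter> P) \<phi>' \<and>
    FV \<phi>' \<subseteq> (\<Union>x\<in>FV \<chi>. tvars (Var x :: ('f, 's \<times> 'm, 'm) trm)) \<union> (\<Union>c\<in>pars \<chi>. tvars (\<rho> c)) \<and>
    (\<forall>M e. sat M e \<phi>' \<longleftrightarrow> sat M (\<lambda>x. eval M e (Var x)) (pmap (\<lambda>c. eval M e (\<rho> c)) \<chi>))"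
    by (rule substitution[OF infinite_names w]) (use \<rho> in auto)
  then obtain \<chi>1 where \<chi>1: "wff L (\<lambda>s. carr M s \<inter> P) \<chi>1"
    "FV \<chi>1 \<subseteq> FV \<chi> \<union> (\<Union>c\<in>pars \<chi>. tvars (\<rho> c))"
    "\<And>u. sat M u \<chi>1 \<longleftrightarrow> sat M u (pmap (\<lambda>c. eval M u (\<rho> c)) \<chi>)" by auto
  have p: "pars \<chi> \<subseteq> P \<union> b ` X" using fms_pars[OF \<chi>(1)] by blast
  have "tvars (\<rho> c) \<subseteq> X" if "c \<in> pars \<chi>" for c
    using that p v(1)[of c] by (auto simp: \<rho>_def)
  then have FV1: "FV \<chi>1 \<subseteq> insert y X" using \<chi>1(2) FV by blast
  have sat1: "sat M (b(y := c)) \<chi>1 \<longleftrightarrow> sat M (\<lambda>_. c) \<chi>" for c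
  proof -
    have "eval M (b(y := c)) (\<rho> d) = d" if "d \<in> pars \<chi>" for d
    proof (cases "d \<in> P")
      case False
      then have "d \<in> b ` X" using that p by blast
      from v[OF this] show ?thesis using y(1) False by (auto simp: \<rho>_def)
    qed (simp add: \<rho>_def)
    then have "sat M (b(y := c)) \<chi>1 \<longleftrightarrow> sat M (b(y := c)) \<chi>"
      unfolding \<chi>1(3) by (subst pmap_ident) auto
    also have "\<dots> \<longleftrightarrow> sat M (\<lambda>_. c) \<chi>" using sat_single[OF FV, of "b(y := c)"] by simp
    finally show ?thesis .
  qed
  \<comment> \<open>The bound is the number of solutions at \<open>b\<close> itself. Adding
    \<delta>, which says that there are at most \<open>m\<close> solutions, makes it uniform: where
    \<delta> fails, the conjunction has no solution at all.\<close>
  define m where "m = card {c \<in> carr M (fst y). sat M (\<lambda>_. c) \<chi>}"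
  have ne: "carr M (fst y) \<noteq> {}" using y(2) by blast
  from at_most[OF \<chi>1(1) ne, of m] obtain \<delta> where \<delta>: "wff L (\<lambda>s. carr M s \<inter> P) \<delta>" "FV \<delta> \<subseteq> FV \<chi>1 - {y}"
    "\<And>u. sat M u \<delta> \<longleftrightarrow> finite {c \<in> carr M (fst y). sat M (u(y := c)) \<chi>1} \<and>
      card {c \<in> carr M (fst y). sat M (u(y := c)) \<chi>1} \<le> m" by blast
  have \<delta>y: "sat M (u(y := c)) \<delta> \<longleftrightarrow> sat M u \<delta>" for u c
    by (rule sat_cong) (use \<delta>(2) in auto)
  have eq: "{c \<in> carr M (fst y). sat M (u(y := c)) (Conj \<chi>1 \<delta>)} =
      (if sat M u \<delta> then {c \<in> carr M (fst y). sat M (u(y := c)) \<chi>1} else {})" for u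
    using \<delta>y by (auto simp del: fun_upd_apply)
  show ?thesis
  proof (rule that[of "Conj \<chi>1 \<delta>" m])
    show "Conj \<chi>1 \<delta> \<in> fms L M (insert y X) P"
      using \<chi>1(1) \<delta>(1,2) FV1 by (auto simp: fms_def)
    have "sat M b \<delta>" unfolding \<delta>(3) sat1 using \<chi>(3) by (simp add: m_def)
    then show "sat M (b(y := e)) (Conj \<chi>1 \<delta>)" using sat1 \<chi>(2) \<delta>y by simp
    show "finite {c \<in> carr M (fst y). sat M (u(y := c)) (Conj \<chi>1 \<delta>)}" for u
      unfolding eq using \<delta>(3) by simp
    show "card {c \<in> carr M (fst y). sat M (u(y := c)) (Conj \<chi>1 \<delta>)} \<le> m" for u
      unfolding eq using \<delta>(3) by simp
  qed
qed

lemma parameters_to_variables: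
  fixes \<chi> :: "('f, 'r, 's \<times> 'm, 'm) fm"
  assumes "\<chi> \<in> fms L M X P" "\<And>c. c \<in> pars \<chi> \<Longrightarrow> fst (g c) = srt c"
  obtains \<delta> where "\<delta> \<in> fms0 L (X \<union> g ` pars \<chi>)" "\<And>u. sat M u \<delta> \<longleftrightarrow> sat M u (pmap (\<lambda>c. u (g c)) \<chi>)"
proof -
  have w: "wff L (\<lambda>s. carr M s \<inter> P) \<chi>" and FV: "FV \<chi> \<subseteq> X" using assms(1) by (auto simp: fms_def)
  have so: "has_sort L (\<lambda>s. {}) (Var (g c)) s" if "c \<in> carr M s \<inter> P" "c \<in> pars \<chi>" for c s
    using that assms(2)[of c] srt_eq[of c s] by simp
  obtain \<delta> :: "('f, 'r, 's \<times> 'm, 'm) fm" where \<delta>: "wff L (\<lambda>s. {}) \<delta>" "FV \<delta> \<subseteq> FV \<chi> \<union> (\<Union>c\<in>pars \<chi>. {g c})"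
    "\<And>u. sat M u \<delta> \<longleftrightarrow> sat M u (pmap (\<lambda>c. u (g c)) \<chi>)"
    using substitution[where \<tau> = Var and \<rho> = "\<lambda>c. Var (g c)", OF infinite_names w _ so] by auto
  have "\<delta> \<in> fms0 L (X \<union> g ` pars \<chi>)" using \<delta>(1,2) FV by (auto simp: fms0_def)
  then show ?thesis using \<delta>(3) that by blast
qed

text \<open>The bounded formula that makes \<open>e\<close> algebraic over \<open>A\<close>,
  \<open>d\<close> and \<open>b\<close> thorn-divides over \<open>A\<close>, with \<open>d\<close>
  as the additional parameters: \<open>e\<close> is not algebraic over \<open>A\<close> and
  \<open>d\<close>, and no tuple satisfies more than \<open>m\<close> instances with distinct
  conjugates of \<open>e\<close>.\<close>

lemma thorn_divides_if_cl:
  fixes X :: "('s \<times> 'm) set"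
  assumes b: "b \<in> tuples M X" and X: "small_vars M X" and A: "small_set M A" and d: "small_set M d"
    and e: "e \<in> cl (A \<union> d \<union> b ` X)" "e \<notin> cl (A \<union> d)"
  obtains \<psi> where "\<psi> \<in> fms L M X (A \<union> (d \<union> {e}))" "thorn_divides L M X A \<psi>" "sat M b \<psi>"
proof -
  have Ad: "small_set M (A \<union> d)" using A d small_Un by blast
  then have Adu: "A \<union> d \<subseteq> univ M" by (simp add: small_set_def)
  have eu: "e \<in> univ M" using e(1) cl_univ by blast
  obtain g1 where g1: "fst (g1 e) = srt e" "g1 e \<notin> X"
    using fresh_vars[OF _ X, of "{e}"] by auto
  define y where "y = g1 e"
  have y: "y \<notin> X" "e \<in> carr M (fst y)" using g1 srt_carr[OF eu] by (auto simp: y_def)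
  obtain \<chi> m where \<chi>: "\<chi> \<in> fms L M (insert y X) (A \<union> d)" "sat M (b(y := e)) \<chi>"
    "\<And>u. finite {c \<in> carr M (fst y). sat M (u(y := c)) \<chi>}"
    "\<And>u. card {c \<in> carr M (fst y). sat M (u(y := c)) \<chi>} \<le> m"
    using bounded_formula[OF b Adu e(1) y] by blast
  define p where "p = pars \<chi>"
  have p: "finite p" "p \<subseteq> A \<union> d" "p \<subseteq> univ M" using fms_pars[OF \<chi>(1)] by (auto simp: p_def)
  have "small_vars M (insert y X)" using small_vars_Un[OF small_vars_finite[of "{y}"] X] by simp
  from fresh_vars[OF p(1) this] obtain g where
    g: "inj_on g p" "\<And>c. c \<in> p \<Longrightarrow> fst (g c) = srt c" "\<And>c. c \<in> p \<Longrightarrow> g c \<notin> insert y X" by blast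
  obtain \<delta> where \<delta>: "\<delta> \<in> fms0 L (insert y X \<union> g ` p)" "\<And>u. sat M u \<delta> \<longleftrightarrow> sat M u (pmap (\<lambda>c. u (g c)) \<chi>)"
    using parameters_to_variables[OF \<chi>(1), of g] g(2) unfolding p_def by blast
  \<comment> \<open>The dividing tuple \<open>a\<close> consists of \<open>e\<close> and the
    parameters of \<chi>, because strong dividing is about a parameter-free formula. The latter lie
    in \<open>A \<union> d\<close> and do not change when \<open>a\<close> is conjugated.\<close>
  define Y where "Y = insert y (g ` p)"
  define a where "a = (\<lambda>v\<in>Y. if v = y then e else inv_into p g v)"
  have ag: "a (g c) = c" if "c \<in> p" for c
    using that g(1) g(3)[OF that] by (auto simp: a_def Y_def)
  have ay: "a y = e" by (simp add: a_def Y_def)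
  have a: "a \<in> tuples M Y"
  proof -
    have "a v \<in> carr M (fst v)" if "v \<in> Y" for v
    proof -
      from that consider "v = y" | c where "c \<in> p" "v = g c" unfolding Y_def by blast
      then show ?thesis
      proof cases
        case 1
        then show ?thesis using ay y by simp
      next
        case 2
        then show ?thesis using ag g(2) srt_carr[of c] p(3) by auto
      qed
    qed
    then show ?thesis by (auto simp: tuples_def a_def)
  qed
  have Y: "finite Y" "X \<inter> Y = {}" using p(1) y(1) g(3) by (auto simp: Y_def)
  have inst: "sat M u (inst Y a' \<delta>) \<longleftrightarrow> sat M (u(y := a' y)) \<chi>" if "\<And>c. c \<in> p \<Longrightarrow> a' (g c) = c" for u a'
  proof -
    have "sat M u (inst Y a' \<delta>) \<longleftrightarrow> sat M (override_on u a' Y) (pmap (\<lambda>c. override_on u a' Y (g c)) \<chi>)"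
      by (simp add: sat_inst \<delta>(2))
    also have "\<dots> \<longleftrightarrow> sat M (override_on u a' Y) \<chi>"
      using that by (subst pmap_ident) (auto simp: Y_def p_def)
    also have "\<dots> \<longleftrightarrow> sat M (u(y := a' y)) \<chi>"
      by (rule sat_cong) (use \<chi>(1) Y in \<open>auto simp: fms_def override_on_def Y_def\<close>)
    finally show ?thesis .
  qed
  have "k_inconsistent M X \<delta> Y {a'. realizes M Y a' (tp L M Y a (A \<union> d))} (Suc m)"
    unfolding k_inconsistent_def
  proof (intro allI impI notI)
    fix F assume F: "F \<subseteq> {a'. realizes M Y a' (tp L M Y a (A \<union> d))}" "finite F \<and> card F = Suc m"
      and "\<exists>u\<in>tuples M X. \<forall>a\<in>F. sat M u (inst Y a \<delta>)"
    then obtain u where u: "\<forall>a\<in>F. sat M u (inst Y a \<delta>)" by blast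
    have F2: "a' \<in> tuples M Y \<and> (\<forall>c\<in>p. a' (g c) = c)" if a': "a' \<in> F" for a'
    proof -
      from F(1) a' obtain \<sigma> where \<sigma>: "\<sigma> \<in> aut (A \<union> d)" "a' = act Y \<sigma> a"
        using realizes_tp[OF a Ad small_vars_finite[OF Y(1)]] by blast
      have "a' (g c) = c" if "c \<in> p" for c
        using that ag[OF that] autD(2)[OF \<sigma>(1)] p(2) \<sigma>(2) by (auto simp: act_def Y_def)
      then show ?thesis using act_tuples[OF autD(1)[OF \<sigma>(1)] a] \<sigma>(2) by blast
    qed
    \<comment> \<open>Conjugates of \<open>a\<close> over \<open>A \<union> d\<close> agree at the
      coordinates for parameters, so distinct ones have distinct values at \<open>y\<close>;
      \<open>Suc m\<close> of them would give \<open>Suc m\<close> solutions of \<chi>.\<close>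
    have inj: "inj_on (\<lambda>a'. a' y) F"
    proof (rule inj_onI)
      fix a1 a2 assume *: "a1 \<in> F" "a2 \<in> F" "a1 y = a2 y"
      show "a1 = a2"
      proof
        fix v show "a1 v = a2 v"
        proof (cases "v \<in> Y")
          case True
          then show ?thesis using F2[OF *(1)] F2[OF *(2)] *(3) by (auto simp: Y_def)
        next
          case False
          then show ?thesis using F2[OF *(1)] F2[OF *(2)] PiE_arb unfolding tuples_def by metis
        qed
      qed
    qed
    have "(\<lambda>a'. a' y) ` F \<subseteq> {c \<in> carr M (fst y). sat M (u(y := c)) \<chi>}"
    proof
      fix c assume "c \<in> (\<lambda>a'. a' y) ` F"
      then obtain a' where a': "a' \<in> F" "c = a' y" by blast
      have "sat M (u(y := a' y)) \<chi>" using inst[of a' u] u a'(1) F2[OF a'(1)] by blast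
      moreover have "a' y \<in> carr M (fst y)" using tuplesD[of a' Y y] F2[OF a'(1)] by (simp add: Y_def)
      ultimately show "c \<in> {c \<in> carr M (fst y). sat M (u(y := c)) \<chi>}" using a'(2) by blast
    qed
    from order_trans[OF card_mono[OF \<chi>(3) this] \<chi>(4)] have "card ((\<lambda>a'. a' y) ` F) \<le> m" .
    then show False using card_image[OF inj] F(2) by simp
  qed
  moreover have "\<not> algebraic_type M Y (tp L M Y a (A \<union> d))"
    using algebraic_tuple[OF Y(1) Ad a] ay e(2) by (auto simp: Y_def)
  ultimately have "strongly_divides L M X (A \<union> d) \<delta> Y a"
    using Y a \<delta>(1) unfolding strongly_divides_def Y_def by (auto simp: Un_commute Un_assoc)
  then have "thorn_divides L M X A (inst Y a \<delta>)" using d unfolding thorn_divides_def by blast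
  moreover have "sat M b (inst Y a \<delta>)" using inst[of a b] ag ay \<chi>(2) by simp
  moreover have "inst Y a \<delta> \<in> fms L M X (A \<union> (d \<union> {e}))"
  proof -
    have "a v \<in> carr M (fst v) \<inter> (A \<union> (d \<union> {e}))" if "v \<in> Y" for v
      using tuplesD[OF a that] that ay ag p(2) by (auto simp: Y_def)
    then have "wff L (\<lambda>s. carr M s \<inter> (A \<union> (d \<union> {e}))) (inst Y a \<delta>)"
      using \<delta>(1) by (intro wff_inst[of L "\<lambda>s. {}"]) (auto simp: fms0_def)
    then show ?thesis using \<delta>(1) by (auto simp: fms_def FV_inst fms0_def Y_def)
  qed
  ultimately show ?thesis using that by blast
qed

text \<open>Every conjugate of \<open>a\<close> over \<open>A\<close> and the entries of
  \<open>b\<close> gives an instance satisfied by \<open>b\<close>. By k-inconsistency there are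
  only finitely many such conjugates, so all entries of \<open>a\<close> are algebraic over
  \<open>A\<close> and \<open>b\<close>, while nonalgebraicity of the type of \<open>a\<close>
  provides an entry that is not algebraic over \<open>A\<close>.\<close>

lemma cl_if_strongly_divides:
  fixes X :: "('s \<times> 'm) set"
  assumes sd: "strongly_divides L M X A \<delta> Y a" and A: "small_set M A" and X: "small_vars M X"
    and b: "b \<in> tuples M X" and sat: "sat M b (inst Y a \<delta>)"
  obtains e where "e \<in> a ` Y" "e \<in> cl (A \<union> b ` X)" "e \<notin> cl A"
proof -
  obtain k where Y: "finite Y" "X \<inter> Y = {}" and \<delta>: "\<delta> \<in> fms0 L (X \<union> Y)" and a: "a \<in> tuples M Y"
    and na: "\<not> algebraic_type M Y (tp L M Y a A)"
    and k: "k_inconsistent M X \<delta> Y {a'. realizes M Y a' (tp L M Y a A)} k"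
    using sd unfolding strongly_divides_def by blast
  obtain y where y: "y \<in> Y" "a y \<notin> cl A" using na algebraic_tuple[OF Y(1) A a] by blast
  have small: "small_set M (A \<union> b ` X)"
    using small_Un[OF A small_image_vars[OF X, of b]] tuples_univ[OF b] by blast
  define T where "T = (\<lambda>\<sigma>. act Y \<sigma> a) ` aut (A \<union> b ` X)"
  have T: "realizes M Y a' (tp L M Y a A)" "sat M b (inst Y a' \<delta>)" if a': "a' \<in> T" for a'
  proof -
    obtain \<sigma> where \<sigma>: "\<sigma> \<in> aut (A \<union> b ` X)" "a' = act Y \<sigma> a" using a' by (auto simp: T_def)
    have "\<sigma> \<in> aut A" using \<sigma>(1) aut_mono[of A "A \<union> b ` X"] by blast
    then show "realizes M Y a' (tp L M Y a A)"
      using realizes_tp[OF a A small_vars_finite[OF Y(1)]] \<sigma>(2) by blast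
    define u where "u = override_on b a Y"
    have w: "wff L (carr M) \<delta>" "FV \<delta> \<subseteq> X \<union> Y"
      using \<delta> wff_mono[of L "\<lambda>s. {}" \<delta> "carr M"] by (auto simp: fms0_def)
    have "u x \<in> carr M (fst x)" if "x \<in> FV \<delta>" for x
      using that w(2) tuplesD[OF a] tuplesD[OF b] unfolding u_def override_on_def by (metis Un_iff subsetD)
    then have "sat M (\<lambda>x. \<sigma> (u x)) (pmap \<sigma> \<delta>) \<longleftrightarrow> sat M u \<delta>"
      using auto_sat[OF autD(1)[OF \<sigma>(1)] w(1)] by blast
    moreover have "pmap \<sigma> \<delta> = \<delta>" using pars_fms0[OF \<delta>] by (intro pmap_ident) auto
    moreover have "sat M u \<delta>" using sat by (simp add: sat_inst u_def)
    moreover have "sat M (\<lambda>x. \<sigma> (u x)) \<delta> = sat M (override_on b a' Y) \<delta>"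
    proof (rule sat_cong)
      fix x assume "x \<in> FV \<delta>"
      then consider "x \<in> Y" | "x \<in> X" "x \<notin> Y" using w(2) by blast
      then show "\<sigma> (u x) = override_on b a' Y x"
        using autD(2)[OF \<sigma>(1)] \<sigma>(2) by cases (auto simp: u_def override_on_def act_def)
    qed
    ultimately show "sat M b (inst Y a' \<delta>)" by (simp add: sat_inst)
  qed
  have "finite T"
  proof (rule ccontr)
    assume "infinite T"
    then obtain F where F: "F \<subseteq> T" "finite F" "card F = k" using infinite_arbitrarily_large by blast
    have "F \<subseteq> {a'. realizes M Y a' (tp L M Y a A)}" using F(1) T(1) by blast
    then show False using k F(2,3) b T(2) F(1) unfolding k_inconsistent_def by blast
  qed
  have "orb (A \<union> b ` X) (a y) \<subseteq> (\<lambda>a'. a' y) ` T"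
    using y(1) by (auto simp: orb_def T_def act_def image_iff)
  then have "finite (orb (A \<union> b ` X) (a y))" using \<open>finite T\<close> by (meson finite_imageI finite_subset)
  then have "a y \<in> cl (A \<union> b ` X)" using finite_orbit_cl[OF small tuples_univ[OF a y(1)]] by blast
  then show ?thesis using that y by blast
qed

text \<open>\<open>mind\<close> is Adler's M-independence, the geometric form of ``no formula over \<open>E\<close> in the type of \<open>S\<close>
  thorn-divides over \<open>A\<close>''; \<open>tind\<close> imposes it on all extensions of the base, as thorn-forking does
  for thorn-dividing. Both depend only on sets, not on the way in which they are enumerated.\<close>

definition mind :: "'m set \<Rightarrow> 'm set \<Rightarrow> 'm set \<Rightarrow> bool" where
  "mind S A E \<longleftrightarrow> (\<forall>d\<subseteq>E. \<forall>e\<in>E. e \<in> cl (A \<union> d \<union> S) \<longrightarrow> e \<in> cl (A \<union> d))"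

definition tind :: "'m set \<Rightarrow> 'm set \<Rightarrow> 'm set \<Rightarrow> bool" where
  "tind S A B \<longleftrightarrow> (\<forall>E. small_set M E \<longrightarrow> (\<exists>\<sigma>\<in>aut (A \<union> B). mind S A (\<sigma> ` E)))"

section \<open>Formal rules for \<open>mind\<close> and \<open>tind\<close>\<close>

lemma mindD: "mind S A E \<Longrightarrow> d \<subseteq> E \<Longrightarrow> e \<in> E \<Longrightarrow> e \<in> cl (A \<union> d \<union> S) \<Longrightarrow> e \<in> cl (A \<union> d)"
  by (simp add: mind_def)

lemma mind_mono: "mind S A E \<Longrightarrow> S' \<subseteq> S \<Longrightarrow> E' \<subseteq> E \<Longrightarrow> mind S' A E'"
  unfolding mind_def
proof (intro allI impI ballI)
  fix d e assume *: "\<forall>d\<subseteq>E. \<forall>e\<in>E. e \<in> cl (A \<union> d \<union> S) \<longrightarrow> e \<in> cl (A \<union> d)"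
    "S' \<subseteq> S" "E' \<subseteq> E" "d \<subseteq> E'" "e \<in> E'" "e \<in> cl (A \<union> d \<union> S')"
  have "A \<union> d \<union> S' \<subseteq> A \<union> d \<union> S" using *(2) by blast
  then have "e \<in> cl (A \<union> d \<union> S)" using cl_mono *(6) by blast
  then show "e \<in> cl (A \<union> d)" using * by blast
qed

lemma mind_auto1:
  assumes \<sigma>: "automorphism \<sigma>" and m: "mind S A E"
  shows "mind (\<sigma> ` S) (\<sigma> ` A) (\<sigma> ` E)"
  unfolding mind_def
proof (intro allI impI ballI)
  fix d' e' assume d': "d' \<subseteq> \<sigma> ` E" and e': "e' \<in> \<sigma> ` E" "e' \<in> cl (\<sigma> ` A \<union> d' \<union> \<sigma> ` S)"
  obtain d where d: "d \<subseteq> E" "d' = \<sigma> ` d" using d' by (meson subset_imageE)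
  obtain e where e: "e \<in> E" "e' = \<sigma> e" using e'(1) by blast
  have "\<sigma> e \<in> cl (\<sigma> ` (A \<union> d \<union> S))" using e'(2) d(2) e(2) by (simp add: image_Un)
  then have "e \<in> cl (A \<union> d)" using mindD[OF m d(1) e(1)] cl_auto[OF \<sigma>] by simp
  then have "\<sigma> e \<in> cl (\<sigma> ` (A \<union> d))" using cl_auto[OF \<sigma>] by simp
  then show "e' \<in> cl (\<sigma> ` A \<union> d')" using d(2) e(2) by (simp add: image_Un)
qed

lemma mind_auto: "automorphism \<sigma> \<Longrightarrow> mind (\<sigma> ` S) (\<sigma> ` A) (\<sigma> ` E) \<longleftrightarrow> mind S A E"
  using mind_auto1[of \<sigma> S A E] mind_auto1[OF auto_inv, of \<sigma> "\<sigma> ` S" "\<sigma> ` A" "\<sigma> ` E"]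
  by (auto simp: auto_inv_image)

lemma mind_aut: "\<sigma> \<in> aut A \<Longrightarrow> mind (\<sigma> ` S) A (\<sigma> ` E) \<longleftrightarrow> mind S A E"
  using mind_auto[of \<sigma> S A E] autD(1)[of \<sigma> A] aut_image[of \<sigma> A A] by simp

text \<open>By finite character of the closure, a failure already occurs with a finite
  \<open>d\<close>, which is small and so may serve as a tuple of parameters for
  thorn-dividing.\<close>

lemma not_mindE:
  assumes "\<not> mind S A E"
  obtains d e where "finite d" "d \<subseteq> E" "d \<subseteq> univ M" "e \<in> E" "e \<in> cl (A \<union> d \<union> S)" "e \<notin> cl (A \<union> d)"
proof -
  obtain d e where de: "d \<subseteq> E" "e \<in> E" "e \<in> cl (A \<union> d \<union> S)" "e \<notin> cl (A \<union> d)"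
    using assms unfolding mind_def by blast
  obtain F where F: "F \<subseteq> A \<union> d \<union> S" "F \<subseteq> univ M" "finite F" "e \<in> cl F"
    using cl_finitary[OF de(3)] by blast
  have "F \<subseteq> A \<union> (F \<inter> d) \<union> S" using F(1) by blast
  then have "e \<in> cl (A \<union> (F \<inter> d) \<union> S)" using cl_mono F(4) by blast
  moreover have "A \<union> (F \<inter> d) \<subseteq> A \<union> d" by blast
  then have "e \<notin> cl (A \<union> (F \<inter> d))" using cl_mono de(4) by blast
  ultimately show ?thesis using that[of "F \<inter> d" e] F(2,3) de(1,2) by blast
qed

lemma small_auto_image: "automorphism \<sigma> \<Longrightarrow> small_set M E \<Longrightarrow> small_set M (\<sigma> ` E)"
proof -
  assume "automorphism \<sigma>" "small_set M E"
  then have "\<sigma> x \<in> univ M" if "x \<in> E" for x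
    using that auto_univ unfolding small_set_def by blast
  then show ?thesis using small_image[of E \<sigma>] \<open>small_set M E\<close> by blast
qed

lemma tindD: "tind S A B \<Longrightarrow> small_set M E \<Longrightarrow> \<exists>\<sigma>\<in>aut (A \<union> B). mind S A (\<sigma> ` E)"
  by (simp add: tind_def)

lemma tind_mono: "tind S A B \<Longrightarrow> S' \<subseteq> S \<Longrightarrow> A \<union> B' \<subseteq> A \<union> B \<Longrightarrow> tind S' A B'"
  unfolding tind_def
proof (intro allI impI)
  fix E assume *: "\<forall>E. small_set M E \<longrightarrow> (\<exists>\<sigma>\<in>aut (A \<union> B). mind S A (\<sigma> ` E))"
    "S' \<subseteq> S" "A \<union> B' \<subseteq> A \<union> B" "small_set M E"
  then obtain \<sigma> where "\<sigma> \<in> aut (A \<union> B)" "mind S A (\<sigma> ` E)" by blast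
  then show "\<exists>\<sigma>\<in>aut (A \<union> B'). mind S' A (\<sigma> ` E)"
    using aut_mono[OF *(3)] mind_mono[OF _ *(2)] by blast
qed

lemma tind_mind: "tind S A B \<Longrightarrow> small_set M B \<Longrightarrow> mind S A B"
proof -
  assume "tind S A B" "small_set M B"
  then obtain \<sigma> where \<sigma>: "\<sigma> \<in> aut (A \<union> B)" "mind S A (\<sigma> ` B)" using tindD by blast
  have "\<sigma> ` B = B" using aut_image[OF \<sigma>(1)] by blast
  with \<sigma>(2) show ?thesis by simp
qed

text \<open>The hypothesis is applied to the test set \<open>E \<union> B\<close>. Since \<sigma>
  fixes \<open>B\<close>, all of \<open>B\<close> can be absorbed into the set \<open>d\<close> of
  additional parameters.\<close>

lemma tind_base_mono:
  assumes t: "tind S A C" and AB: "A \<subseteq> B" "B \<subseteq> C" and small: "small_set M B"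
  shows "tind S B C"
  unfolding tind_def
proof (intro allI impI)
  fix E assume E: "small_set M E"
  obtain \<sigma> where \<sigma>: "\<sigma> \<in> aut (A \<union> C)" "mind S A (\<sigma> ` (E \<union> B))"
    using tindD[OF t small_Un[OF E small]] by blast
  have \<sigma>': "\<sigma> \<in> aut (B \<union> C)" using aut_mono[of "B \<union> C" "A \<union> C"] \<sigma>(1) AB by blast
  have B: "\<sigma> ` B = B" using aut_image[OF \<sigma>'] by blast
  have "mind S B (\<sigma> ` E)" unfolding mind_def
  proof (intro allI impI ballI)
    fix d e assume de: "d \<subseteq> \<sigma> ` E" "e \<in> \<sigma> ` E" "e \<in> cl (B \<union> d \<union> S)"
    have eq: "A \<union> (B \<union> d) = B \<union> d" using AB by blast
    have "B \<union> d \<subseteq> \<sigma> ` (E \<union> B)" "e \<in> \<sigma> ` (E \<union> B)" using de B by (auto simp: image_Un)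
    from mindD[OF \<sigma>(2) this] show "e \<in> cl (B \<union> d)" using de(3) unfolding eq by blast
  qed
  then show "\<exists>\<sigma>\<in>aut (B \<union> C). mind S B (\<sigma> ` E)" using \<sigma>' by blast
qed

text \<open>\<sigma> first brings \<open>E\<close> into good position with respect to
  \<open>S\<close>. Then \<tau> does so with respect to \<open>T\<close> over
  \<open>A \<union> S\<close>, and because \<tau> fixes \<open>A\<close> and \<open>S\<close> it
  preserves what \<sigma> achieved. An element algebraic over \<open>A\<close>, \<open>d\<close>,
  \<open>S\<close> and \<open>T\<close> thus becomes algebraic over \<open>A\<close>,
  \<open>d\<close> and \<open>S\<close>, and then over \<open>A\<close> and
  \<open>d\<close>.\<close>

lemma tind_left_trans:
  assumes S: "tind S A B" and T: "tind T (A \<union> S) B"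
  shows "tind (S \<union> T) A B"
  unfolding tind_def
proof (intro allI impI)
  fix E assume E: "small_set M E"
  obtain \<sigma> where \<sigma>: "\<sigma> \<in> aut (A \<union> B)" "mind S A (\<sigma> ` E)" using tindD[OF S E] by blast
  obtain \<tau> where \<tau>: "\<tau> \<in> aut (A \<union> S \<union> B)" "mind T (A \<union> S) (\<tau> ` \<sigma> ` E)"
    using tindD[OF T small_auto_image[OF autD(1)[OF \<sigma>(1)] E]] by blast
  have \<tau>A: "\<tau> \<in> aut (A \<union> B)" "\<tau> \<in> aut A" using \<tau>(1) aut_mono[of _ "A \<union> S \<union> B"] by blast+
  have "\<tau> ` S = S" using aut_image[OF \<tau>(1)] by blast
  then have S': "mind S A (\<tau> ` \<sigma> ` E)" using mind_aut[OF \<tau>A(2), of S "\<sigma> ` E"] \<sigma>(2) by simp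
  have "mind (S \<union> T) A (\<tau> ` \<sigma> ` E)" unfolding mind_def
  proof (intro allI impI ballI)
    fix d e assume de: "d \<subseteq> \<tau> ` \<sigma> ` E" "e \<in> \<tau> ` \<sigma> ` E" "e \<in> cl (A \<union> d \<union> (S \<union> T))"
    have "e \<in> cl (A \<union> S \<union> d \<union> T)" using de(3) by (simp add: Un_ac)
    then have "e \<in> cl (A \<union> S \<union> d)" using mindD[OF \<tau>(2) de(1,2)] by blast
    then have "e \<in> cl (A \<union> d \<union> S)" by (simp add: Un_ac)
    then show "e \<in> cl (A \<union> d)" using mindD[OF S' de(1,2)] by blast
  qed
  moreover have "\<tau> ` \<sigma> ` E = (\<tau> \<circ> \<sigma>) ` E" by (simp add: image_comp)
  ultimately show "\<exists>\<sigma>\<in>aut (A \<union> B). mind (S \<union> T) A (\<sigma> ` E)" using aut_comp[OF \<tau>A(1) \<sigma>(1)] by metis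
qed

lemma tind_auto1:
  assumes \<sigma>: "automorphism \<sigma>" and t: "tind S A B"
  shows "tind (\<sigma> ` S) (\<sigma> ` A) (\<sigma> ` B)"
  unfolding tind_def
proof (intro allI impI)
  fix E assume E: "small_set M E"
  obtain \<tau> where \<tau>: "\<tau> \<in> aut (A \<union> B)" "mind S A (\<tau> ` inv \<sigma> ` E)"
    using tindD[OF t small_auto_image[OF auto_inv[OF \<sigma>] E]] by blast
  have "mind (\<sigma> ` S) (\<sigma> ` A) (\<sigma> ` \<tau> ` inv \<sigma> ` E)" using mind_auto[OF \<sigma>] \<tau>(2) by blast
  moreover have "\<sigma> \<circ> (\<tau> \<circ> inv \<sigma>) \<in> aut (\<sigma> ` A \<union> \<sigma> ` B)"
  proof -
    have "(\<sigma> \<circ> (\<tau> \<circ> inv \<sigma>)) c = c" if c: "c \<in> \<sigma> ` A \<union> \<sigma> ` B" for c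
    proof -
      obtain b where "b \<in> A \<union> B" "c = \<sigma> b" using c by blast
      then show ?thesis using autD(2)[OF \<tau>(1)] auto_inv_cancel(1)[OF \<sigma>] by simp
    qed
    moreover have "automorphism (\<sigma> \<circ> (\<tau> \<circ> inv \<sigma>))"
      using \<sigma> autD(1)[OF \<tau>(1)] auto_inv auto_comp by blast
    ultimately show ?thesis by (simp add: aut_def)
  qed
  moreover have "\<sigma> ` \<tau> ` inv \<sigma> ` E = (\<sigma> \<circ> (\<tau> \<circ> inv \<sigma>)) ` E" by (simp add: image_comp comp_assoc)
  ultimately show "\<exists>\<tau>\<in>aut (\<sigma> ` A \<union> \<sigma> ` B). mind (\<sigma> ` S) (\<sigma> ` A) (\<tau> ` E)" by metis
qed

lemma tind_auto: "automorphism \<sigma> \<Longrightarrow> tind (\<sigma> ` S) (\<sigma> ` A) (\<sigma> ` B) \<longleftrightarrow> tind S A B"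
  using tind_auto1[of \<sigma> S A B] tind_auto1[OF auto_inv, of \<sigma> "\<sigma> ` S" "\<sigma> ` A" "\<sigma> ` B"]
  by (auto simp: auto_inv_image)

section \<open>From thorn-forking of types to \<open>tind\<close>\<close>

lemma thorn_divides_forks: "thorn_divides L M X A \<psi> \<Longrightarrow> thorn_forks L M X A \<psi>"
  unfolding thorn_forks_def by (intro exI[of _ "{\<psi>}"]) simp

lemma thorn_forks_finite_union:
  assumes "finite F" "\<And>\<psi>. \<psi> \<in> F \<Longrightarrow> thorn_forks L M X A \<psi>"
    and imp: "\<And>e. e \<in> tuples M X \<Longrightarrow> sat M e \<phi> \<Longrightarrow> \<exists>\<psi>\<in>F. sat M e \<psi>"
  shows "thorn_forks L M X A \<phi>"
proof -
  have "\<forall>\<psi>\<in>F. \<exists>\<Psi>. finite \<Psi> \<and> (\<forall>\<psi>\<in>\<Psi>. thorn_divides L M X A \<psi>) \<and>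
      (\<forall>e\<in>tuples M X. sat M e \<psi> \<longrightarrow> (\<exists>\<psi>\<in>\<Psi>. sat M e \<psi>))"
    using assms(2) unfolding thorn_forks_def by blast
  from bchoice[OF this] obtain P where P: "\<forall>\<psi>\<in>F. finite (P \<psi>) \<and> (\<forall>\<psi>\<in>P \<psi>. thorn_divides L M X A \<psi>) \<and>
      (\<forall>e\<in>tuples M X. sat M e \<psi> \<longrightarrow> (\<exists>\<psi>\<in>P \<psi>. sat M e \<psi>))" ..
  show ?thesis unfolding thorn_forks_def
  proof (intro exI conjI ballI impI)
    show "finite (\<Union>\<psi>\<in>F. P \<psi>)" using P assms(1) by simp
    show "thorn_divides L M X A \<psi>" if "\<psi> \<in> (\<Union>\<psi>\<in>F. P \<psi>)" for \<psi> using P that by blast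
    show "\<exists>\<psi>\<in>\<Union>\<psi>\<in>F. P \<psi>. sat M e \<psi>" if e: "e \<in> tuples M X" "sat M e \<phi>" for e
    proof -
      obtain \<psi> where "\<psi> \<in> F" "sat M e \<psi>" using imp[OF e] by blast
      then show ?thesis using P e(1) by blast
    qed
  qed
qed

text \<open>The negations of all formulas over \<open>B\<close> that thorn-fork over
  \<open>A\<close> are added to \<open>q\<close>. If a finite part had no solution, a member of
  \<open>q\<close> would imply a finite disjunction of forking formulas and so fork itself. The
  condition \<open>conj\<close> is semantic so that \<open>q\<close> may consist of a single
  formula.\<close>

lemma nonforking_realization:
  fixes X :: "('s \<times> 'm) set"
  assumes X: "small_vars M X" and B: "small_set M B" and q: "q \<subseteq> fms L M X B" "q \<noteq> {}"
    and conj: "\<And>\<phi> \<psi>. \<phi> \<in> q \<Longrightarrow> \<psi> \<in> q \<Longrightarrow> \<exists>\<chi>\<in>q. \<forall>e\<in>tuples M X. sat M e \<chi> \<longrightarrow> sat M e \<phi> \<and> sat M e \<psi>"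
    and nf: "\<And>\<phi>. \<phi> \<in> q \<Longrightarrow> \<not> thorn_forks L M X A \<phi>"
  obtains e where "e \<in> tuples M X" "\<And>\<phi>. \<phi> \<in> q \<Longrightarrow> sat M e \<phi>" "\<not> type_thorn_forks L M X A (tp L M X e B)"
proof -
  define N where "N = {\<psi> \<in> fms L M X B. thorn_forks L M X A \<psi>}"
  have "Neg ` N \<subseteq> fms L M X B" by (auto simp: N_def fms_def)
  then have sub: "q \<union> Neg ` N \<subseteq> fms L M X B" using q(1) by blast
  have conj_finite: "\<exists>\<chi>\<in>q. \<forall>e\<in>tuples M X. sat M e \<chi> \<longrightarrow> (\<forall>\<phi>\<in>F. sat M e \<phi>)" if "finite F" "F \<subseteq> q" for F
    using that
  proof (induction F)
    case empty
    then show ?case using q(2) by blast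
  next
    case (insert \<phi> F)
    then obtain \<chi> where \<chi>: "\<chi> \<in> q" "\<forall>e\<in>tuples M X. sat M e \<chi> \<longrightarrow> (\<forall>\<phi>\<in>F. sat M e \<phi>)" by blast
    obtain \<chi>' where "\<chi>' \<in> q" "\<forall>e\<in>tuples M X. sat M e \<chi>' \<longrightarrow> sat M e \<phi> \<and> sat M e \<chi>"
      using conj[of \<phi> \<chi>] insert.prems \<chi>(1) by blast
    then show ?case using \<chi>(2) by blast
  qed
  have "finsat M X (q \<union> Neg ` N)" unfolding finsat_def
  proof (intro allI impI)
    fix F assume F: "F \<subseteq> q \<union> Neg ` N" "finite F"
    have "finite (F \<inter> q)" "F \<inter> q \<subseteq> q" using F(2) by auto
    then obtain \<chi> where \<chi>: "\<chi> \<in> q" "\<forall>e\<in>tuples M X. sat M e \<chi> \<longrightarrow> (\<forall>\<phi>\<in>F \<inter> q. sat M e \<phi>)"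
      using conj_finite by blast
    define N' where "N' = {\<psi>. Neg \<psi> \<in> F \<and> \<psi> \<in> N}"
    have "finite (Neg -` F)" using F(2) by (intro finite_vimageI) (auto simp: inj_def)
    then have N': "finite N'" "\<And>\<psi>. \<psi> \<in> N' \<Longrightarrow> thorn_forks L M X A \<psi>"
      by (auto simp: N'_def N_def intro: finite_subset)
    have "\<not> (\<forall>e\<in>tuples M X. sat M e \<chi> \<longrightarrow> (\<exists>\<psi>\<in>N'. sat M e \<psi>))"
      using thorn_forks_finite_union[OF N', of \<chi>] nf[OF \<chi>(1)] by blast
    then obtain e where e: "e \<in> tuples M X" "sat M e \<chi>" "\<And>\<psi>. \<psi> \<in> N' \<Longrightarrow> \<not> sat M e \<psi>" by blast
    have "sat M e \<phi>" if \<phi>: "\<phi> \<in> F" for \<phi>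
    proof (cases "\<phi> \<in> q")
      case True
      then show ?thesis using \<chi>(2) e(1,2) \<phi> by blast
    next
      case False
      then obtain \<psi> where "\<psi> \<in> N" "\<phi> = Neg \<psi>" using F(1) \<phi> by blast
      then show ?thesis using e(3)[of \<psi>] \<phi> by (simp add: N'_def)
    qed
    then show "\<exists>e\<in>tuples M X. \<forall>\<phi>\<in>F. sat M e \<phi>" using e(1) by blast
  qed
  from realize[OF B X sub this] obtain e where e: "realizes M X e (q \<union> Neg ` N)" .
  show ?thesis
  proof (rule that)
    show "e \<in> tuples M X" "\<And>\<phi>. \<phi> \<in> q \<Longrightarrow> sat M e \<phi>" using e by (auto simp: realizes_def)
    have "\<not> sat M e \<psi>" if "\<psi> \<in> N" for \<psi>
    proof -
      have "sat M e (Neg \<psi>)" using e that unfolding realizes_def by blast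
      then show ?thesis by simp
    qed
    then show "\<not> type_thorn_forks L M X A (tp L M X e B)"
      unfolding type_thorn_forks_def tp_def N_def by blast
  qed
qed

lemma tp_conj: "\<phi> \<in> tp L M X b B \<Longrightarrow> \<psi> \<in> tp L M X b B \<Longrightarrow> Conj \<phi> \<psi> \<in> tp L M X b B"
  by (simp add: tp_def fms_def)

lemma tp_nonempty:
  fixes X :: "('s \<times> 'n) set"
  shows "tp L M X b B \<noteq> {}"
proof -
  obtain \<psi> :: "('f, 'r, 's \<times> 'n, 'm) fm" where \<psi>: "\<psi> \<in> fms0 L {}" "\<And>e. sat M e \<psi>" using truth by blast
  have "\<psi> \<in> tp L M X b B" using fms_mono[OF fms0_fms[OF \<psi>(1)], of X B B] \<psi>(2) by (simp add: tp_def)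
  then show ?thesis by blast
qed

text \<open>A non-forking realisation over the larger set has the same type over
  \<open>A \<union> B\<close> as \<open>b\<close>, so it is a conjugate of \<open>b\<close>.\<close>

lemma thorn_indep_extension:
  fixes X :: "('s \<times> 'm) set"
  assumes X: "small_vars M X" and b: "b \<in> tuples M X" and A: "small_set M A" and B: "small_set M B"
    and B': "small_set M B'" and BB: "A \<union> B \<subseteq> A \<union> B'" and ind: "thorn_indep L M X b A B"
  obtains \<sigma> where "\<sigma> \<in> aut (A \<union> B)" "thorn_indep L M X (act X \<sigma> b) A B'"
proof -
  have AB: "small_set M (A \<union> B)" "small_set M (A \<union> B')" using A B B' small_Un by auto
  have "tp L M X b (A \<union> B) \<subseteq> fms L M X (A \<union> B')"
    using fms_mono[OF _ subset_refl BB] by (auto simp: tp_def)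
  then obtain e where e: "e \<in> tuples M X" "\<And>\<phi>. \<phi> \<in> tp L M X b (A \<union> B) \<Longrightarrow> sat M e \<phi>"
    "\<not> type_thorn_forks L M X A (tp L M X e (A \<union> B'))"
  proof (rule nonforking_realization[OF X AB(2) _ tp_nonempty])
    fix \<phi> \<psi> assume "\<phi> \<in> tp L M X b (A \<union> B)" "\<psi> \<in> tp L M X b (A \<union> B)"
    from tp_conj[OF this]
    show "\<exists>\<chi>\<in>tp L M X b (A \<union> B). \<forall>e\<in>tuples M X. sat M e \<chi> \<longrightarrow> sat M e \<phi> \<and> sat M e \<psi>" by (intro bexI) auto
  next
    fix \<phi> assume "\<phi> \<in> tp L M X b (A \<union> B)"
    then show "\<not> thorn_forks L M X A \<phi>" using ind unfolding thorn_indep_def type_thorn_forks_def by blast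
  qed blast
  have "realizes M X e (tp L M X b (A \<union> B))" using e(1,2) by (simp add: realizes_def)
  then obtain \<sigma> where "\<sigma> \<in> aut (A \<union> B)" "e = act X \<sigma> b" using realizes_tp[OF b AB(1) X] by blast
  then show ?thesis using that e(3) unfolding thorn_indep_def by blast
qed

text \<open>Forwards, \<open>B\<close> is enlarged by the test set \<open>E\<close>; a failure of
  \<open>mind\<close> would put a formula that thorn-divides over \<open>A\<close> into the extended
  type. Backwards, \<open>E\<close> collects the parameters of finitely many thorn-dividing formulas
  that cover \<phi>. The conjugate of \<open>b\<close> in good position to \<open>E\<close> still
  satisfies \<phi>, hence one of these formulas, and \<open>cl_if_strongly_divides\<close>
  contradicts \<open>mind\<close>.\<close>

lemma thorn_indep_iff:
  fixes X :: "('s \<times> 'm) set"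
  assumes X: "small_vars M X" and b: "b \<in> tuples M X" and A: "small_set M A" and B: "small_set M B"
  shows "thorn_indep L M X b A B \<longleftrightarrow> tind (b ` X) A B"
proof
  assume ind: "thorn_indep L M X b A B"
  show "tind (b ` X) A B" unfolding tind_def
  proof (intro allI impI)
    fix E assume E: "small_set M E"
    have BE: "small_set M (B \<union> E)" using B E small_Un by blast
    obtain \<sigma> where \<sigma>: "\<sigma> \<in> aut (A \<union> B)" "thorn_indep L M X (act X \<sigma> b) A (B \<union> E)"
      using thorn_indep_extension[OF X b A B BE _ ind] by blast
    have e: "act X \<sigma> b \<in> tuples M X" using act_tuples[OF autD(1)[OF \<sigma>(1)] b] .
    have "mind (\<sigma> ` b ` X) A E"
    proof (rule ccontr)
      assume "\<not> mind (\<sigma> ` b ` X) A E"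
      then obtain d c where dc: "finite d" "d \<subseteq> E" "d \<subseteq> univ M" "c \<in> E" "c \<in> cl (A \<union> d \<union> \<sigma> ` b ` X)" "c \<notin> cl (A \<union> d)"
        by (rule not_mindE)
      have "c \<in> cl (A \<union> d \<union> act X \<sigma> b ` X)" using dc(5) by (simp add: act_image)
      from thorn_divides_if_cl[OF e X A small_finite[OF dc(1,3)] this dc(6)]
      obtain \<psi> where \<psi>: "\<psi> \<in> fms L M X (A \<union> (d \<union> {c}))" "thorn_divides L M X A \<psi>" "sat M (act X \<sigma> b) \<psi>" .
      have "A \<union> (d \<union> {c}) \<subseteq> A \<union> (B \<union> E)" using dc by blast
      then have "\<psi> \<in> tp L M X (act X \<sigma> b) (A \<union> (B \<union> E))"
        using fms_mono[OF \<psi>(1) subset_refl] \<psi>(3) by (simp add: tp_def)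
      then show False using \<sigma>(2) thorn_divides_forks[OF \<psi>(2)]
        unfolding thorn_indep_def type_thorn_forks_def by blast
    qed
    \<comment> \<open>The extension moved \<open>b\<close> and kept \<open>E\<close>; the inverse
      brings \<open>b\<close> back and moves \<open>E\<close> instead, as \<open>tind\<close> wants
      it.\<close>
    moreover have "inv \<sigma> \<in> aut (A \<union> B)" using aut_inv[OF \<sigma>(1)] .
    moreover from this have "inv \<sigma> \<in> aut A" using aut_mono[of A "A \<union> B"] by blast
    ultimately show "\<exists>\<tau>\<in>aut (A \<union> B). mind (b ` X) A (\<tau> ` E)"
      using mind_aut[of "inv \<sigma>" A "\<sigma> ` b ` X" E] auto_inv_image(1)[OF autD(1)[OF \<sigma>(1)]] by metis
  qed
next
  assume t: "tind (b ` X) A B"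
  show "thorn_indep L M X b A B" unfolding thorn_indep_def
  proof
    assume "type_thorn_forks L M X A (tp L M X b (A \<union> B))"
    then obtain \<phi> \<Psi> where \<phi>: "\<phi> \<in> fms L M X (A \<union> B)" "sat M b \<phi>" and \<Psi>: "finite \<Psi>"
      "\<forall>\<psi>\<in>\<Psi>. thorn_divides L M X A \<psi>" "\<forall>e\<in>tuples M X. sat M e \<phi> \<longrightarrow> (\<exists>\<psi>\<in>\<Psi>. sat M e \<psi>)"
      unfolding type_thorn_forks_def thorn_forks_def tp_def by blast
    \<comment> \<open>\<open>E\<close> contains the dividing tuple \<open>a\<close> as well as the
      additional parameters \<open>D\<close>: the former supplies the element \<open>e\<close>, the
      latter the set \<open>d\<close> for \<open>mind\<close>.\<close>
    define W where "W \<psi> E \<longleftrightarrow> small_set M E \<and> (\<exists>\<delta> Y a D. \<psi> = inst Y a \<delta> \<and> D \<subseteq> E \<and> a ` Y \<subseteq> E \<and> small_set M D \<and>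
      strongly_divides L M X (A \<union> D) \<delta> Y a)" for \<psi> E
    have "\<forall>\<psi>\<in>\<Psi>. \<exists>E. W \<psi> E"
    proof
      fix \<psi> assume "\<psi> \<in> \<Psi>"
      then obtain \<delta> Y a D where *: "\<psi> = inst Y a \<delta>" "small_set M D" "strongly_divides L M X (A \<union> D) \<delta> Y a"
        using \<Psi>(2) unfolding thorn_divides_def by blast
      then have "finite Y" "a \<in> tuples M Y" unfolding strongly_divides_def by blast+
      then have "small_set M (D \<union> a ` Y)"
        using small_Un[OF *(2) small_image_vars[OF small_vars_finite]] tuples_univ by blast
      then show "\<exists>E. W \<psi> E" unfolding W_def using * by (intro exI[of _ "D \<union> a ` Y"]) blast
    qed
    from bchoice[OF this] obtain f where f: "\<forall>\<psi>\<in>\<Psi>. W \<psi> (f \<psi>)" ..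
    have small: "small_set M (\<Union>\<psi>\<in>\<Psi>'. f \<psi>)" if "finite \<Psi>'" "\<Psi>' \<subseteq> \<Psi>" for \<Psi>'
      using that
    proof (induction \<Psi>')
      case empty
      then show ?case using small_finite[of "{}"] by simp
    next
      case (insert \<psi> \<Psi>')
      then show ?case using small_Un[of "f \<psi>"] f by (simp add: W_def)
    qed
    obtain \<sigma> where \<sigma>: "\<sigma> \<in> aut (A \<union> B)" "mind (b ` X) A (\<sigma> ` (\<Union>\<psi>\<in>\<Psi>. f \<psi>))"
      using tindD[OF t small[OF \<Psi>(1) subset_refl]] by blast
    define \<tau> where "\<tau> = inv \<sigma>"
    have \<tau>: "\<tau> \<in> aut (A \<union> B)" "\<tau> \<in> aut A" "automorphism \<tau>"
      using aut_inv[OF \<sigma>(1)] aut_mono[of A "A \<union> B"] autD(1) unfolding \<tau>_def by blast+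
    have m: "mind (\<tau> ` b ` X) A (\<Union>\<psi>\<in>\<Psi>. f \<psi>)"
      using mind_aut[OF \<tau>(2), of "b ` X" "\<sigma> ` (\<Union>\<psi>\<in>\<Psi>. f \<psi>)"] \<sigma>(2) auto_inv_image(1)[OF autD(1)[OF \<sigma>(1)]]
      unfolding \<tau>_def by metis
    have b': "act X \<tau> b \<in> tuples M X" using act_tuples[OF \<tau>(3) b] .
    have "sat M (act X \<tau> b) \<phi>"
      using aut_sat[OF \<tau>(1) \<phi>(1) b] sat_act[of \<phi> X \<tau> b] \<phi> by (simp add: fms_def)
    then obtain \<psi> where \<psi>: "\<psi> \<in> \<Psi>" "sat M (act X \<tau> b) \<psi>" using \<Psi>(3) b' by blast
    from bspec[OF f \<psi>(1)] obtain \<delta> Y a D where *: "\<psi> = inst Y a \<delta>" "D \<subseteq> f \<psi>" "a ` Y \<subseteq> f \<psi>" "small_set M D"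
      "strongly_divides L M X (A \<union> D) \<delta> Y a" unfolding W_def by blast
    obtain e where e: "e \<in> a ` Y" "e \<in> cl (A \<union> D \<union> act X \<tau> b ` X)" "e \<notin> cl (A \<union> D)"
      using cl_if_strongly_divides[OF *(5) small_Un[OF A *(4)] X b' \<psi>(2)[unfolded *(1)]] by blast
    have "e \<in> (\<Union>\<psi>\<in>\<Psi>. f \<psi>)" "D \<subseteq> (\<Union>\<psi>\<in>\<Psi>. f \<psi>)" using * e(1) \<psi>(1) by blast+
    from mindD[OF m this(2,1)] e(2,3) show False by (simp add: act_image)
  qed
qed

lemma enum_props:
  assumes "S \<subseteq> univ M"
  shows "restrict snd (enum_vars M S) \<in> tuples M (enum_vars M S)"
    "restrict snd (enum_vars M S) ` enum_vars M S = S"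
proof -
  show "restrict snd (enum_vars M S) \<in> tuples M (enum_vars M S)"
    by (auto simp: tuples_def enum_vars_def)
  have "(srt c, c) \<in> enum_vars M S" if "c \<in> S" for c
    using that assms srt_carr by (auto simp: enum_vars_def)
  then have "S \<subseteq> snd ` enum_vars M S" by force
  then show "restrict snd (enum_vars M S) ` enum_vars M S = S" by (auto simp: enum_vars_def)
qed

lemma enum_small: "small_set M S \<Longrightarrow> small_vars M (enum_vars M S)"
proof -
  assume S: "small_set M S"
  have "enum_vars M S \<subseteq> (\<lambda>c. (srt c, c)) ` S" using srt_eq by (auto simp: enum_vars_def)
  then have "|enum_vars M S| \<le>o |S|"
    using ordLeq_transitive[OF card_of_mono1 card_of_image] by blast
  then show ?thesis using S ordLeq_ordLess_trans by (auto simp: small_vars_def small_set_def)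
qed

lemma thorn_indep_set_iff:
  assumes "small_set M S" "small_set M A" "small_set M B"
  shows "thorn_indep_set L M S A B \<longleftrightarrow> tind S A B"
proof -
  have "S \<subseteq> univ M" using assms(1) by (simp add: small_set_def)
  from thorn_indep_iff[OF enum_small[OF assms(1)] enum_props(1)[OF this] assms(2,3)] enum_props(2)[OF this]
  show ?thesis by (simp add: thorn_indep_set_def)
qed

text \<open>\<open>tind\<close> is about sets, whereas extension concerns types; the set is
  enumerated by itself to pass from one to the other.\<close>

lemma tind_extension:
  assumes S: "small_set M S" and A: "small_set M A" and B: "small_set M B" and B': "small_set M B'"
    and BB: "A \<union> B \<subseteq> A \<union> B'" and t: "tind S A B"
  obtains \<sigma> where "\<sigma> \<in> aut (A \<union> B)" "tind (\<sigma> ` S) A B'"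
proof -
  let ?X = "enum_vars M S" let ?b = "restrict snd ?X"
  have Su: "S \<subseteq> univ M" using S by (simp add: small_set_def)
  note X = enum_small[OF S] and b = enum_props[OF Su]
  have "thorn_indep L M ?X ?b A B" using thorn_indep_iff[OF X b(1) A B] t b(2) by simp
  from thorn_indep_extension[OF X b(1) A B B' BB this] obtain \<sigma> where
    \<sigma>: "\<sigma> \<in> aut (A \<union> B)" "thorn_indep L M ?X (act ?X \<sigma> ?b) A B'" .
  have "tind (act ?X \<sigma> ?b ` ?X) A B'"
    using thorn_indep_iff[OF X act_tuples[OF autD(1)[OF \<sigma>(1)] b(1)] A B'] \<sigma>(2) by blast
  then have "tind (\<sigma> ` S) A B'" unfolding act_image b(2) .
  then show ?thesis using that \<sigma>(1) by blast
qed

end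

section \<open>The thorn-rank of a set of tuples\<close>

text \<open>\<open>rank_ge\<close> with the formula replaced by its solution set. Sets can be
  intersected, compared by inclusion and moved by automorphisms without any syntax.\<close>

primrec srk :: "('s, 'f, 'r, 'm) struc \<Rightarrow> ('s \<times> 'n) set \<Rightarrow> ('s \<times> 'n) set \<Rightarrow> ('s \<times> 'n) set
    \<Rightarrow> ('f, 'r, 's \<times> 'n, 'm) fm set \<Rightarrow> ('f, 'r, 's \<times> 'n, 'm) fm set \<Rightarrow> nat \<Rightarrow> nat
    \<Rightarrow> ('s \<times> 'n \<Rightarrow> 'm) set \<Rightarrow> bool" where
  "srk M X Y Z \<Delta> \<Theta> k 0 D \<longleftrightarrow> D \<noteq> {}"
| "srk M X Y Z \<Delta> \<Theta> k (Suc n) D \<longleftrightarrow>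
     (\<exists>\<delta>\<in>\<Delta>. \<exists>\<theta>\<in>\<Theta>. \<exists>c\<in>tuples M Z.
        infinite {a \<in> tuples M Y. sat M a (inst Z c \<theta>) \<and>
          srk M X Y Z \<Delta> \<Theta> k n (D \<inter> {u. sat M u (inst Y a \<delta>)})} \<and>
        k_inconsistent M X \<delta> Y {a \<in> tuples M Y. sat M a (inst Z c \<theta>)} k)"

lemma rank_ge_srk: "rank_ge M X Y Z \<Delta> \<Theta> k n \<phi> \<longleftrightarrow> srk M X Y Z \<Delta> \<Theta> k n {u \<in> tuples M X. sat M u \<phi>}"
proof (induction n arbitrary: \<phi>)
  case (Suc n)
  have "{u \<in> tuples M X. sat M u (Conj \<phi> \<psi>)} = {u \<in> tuples M X. sat M u \<phi>} \<inter> {u. sat M u \<psi>}" for \<psi>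
    by auto
  then show ?case by (simp only: rank_ge.simps srk.simps Suc.IH)
qed auto

lemma srk_mono: "srk M X Y Z \<Delta> \<Theta> k n D \<Longrightarrow> D \<subseteq> D' \<Longrightarrow> srk M X Y Z \<Delta> \<Theta> k n D'"
proof (induction n arbitrary: D D')
  case (Suc n)
  obtain \<delta> \<theta> c where *: "\<delta> \<in> \<Delta>" "\<theta> \<in> \<Theta>" "c \<in> tuples M Z"
    "infinite {a \<in> tuples M Y. sat M a (inst Z c \<theta>) \<and> srk M X Y Z \<Delta> \<Theta> k n (D \<inter> {u. sat M u (inst Y a \<delta>)})}"
    "k_inconsistent M X \<delta> Y {a \<in> tuples M Y. sat M a (inst Z c \<theta>)} k"
    using Suc.prems(1) by auto
  have "srk M X Y Z \<Delta> \<Theta> k n (D' \<inter> {u. sat M u (inst Y a \<delta>)})"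
    if "srk M X Y Z \<Delta> \<Theta> k n (D \<inter> {u. sat M u (inst Y a \<delta>)})" for a
    using Suc.IH[OF that] Suc.prems(2) by blast
  then have "{a \<in> tuples M Y. sat M a (inst Z c \<theta>) \<and> srk M X Y Z \<Delta> \<Theta> k n (D \<inter> {u. sat M u (inst Y a \<delta>)})}
    \<subseteq> {a \<in> tuples M Y. sat M a (inst Z c \<theta>) \<and> srk M X Y Z \<Delta> \<Theta> k n (D' \<inter> {u. sat M u (inst Y a \<delta>)})}" by blast
  then have "infinite {a \<in> tuples M Y. sat M a (inst Z c \<theta>) \<and> srk M X Y Z \<Delta> \<Theta> k n (D' \<inter> {u. sat M u (inst Y a \<delta>)})}"
    using *(4) infinite_super by blast
  then show ?case unfolding srk.simps using *(1-3,5) by blast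
qed auto

text \<open>In a rank step each of the infinitely many parameters \<open>a\<close> has by induction
  a suitable \<open>i\<close>; by the pigeonhole principle one \<open>i\<close> serves infinitely
  many of them.\<close>

lemma srk_finite_cover:
  assumes "finite I" "D \<subseteq> (\<Union>i\<in>I. C i)" "srk M X Y Z \<Delta> \<Theta> k n D"
  shows "\<exists>i\<in>I. srk M X Y Z \<Delta> \<Theta> k n (D \<inter> C i)"
  using assms(2,3)
proof (induction n arbitrary: D)
  case (Suc n)
  obtain \<delta> \<theta> c where *: "\<delta> \<in> \<Delta>" "\<theta> \<in> \<Theta>" "c \<in> tuples M Z"
    "infinite {a \<in> tuples M Y. sat M a (inst Z c \<theta>) \<and> srk M X Y Z \<Delta> \<Theta> k n (D \<inter> {u. sat M u (inst Y a \<delta>)})}"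
    "k_inconsistent M X \<delta> Y {a \<in> tuples M Y. sat M a (inst Z c \<theta>)} k"
    using Suc.prems(2) by auto
  define W where "W i = {a \<in> tuples M Y. sat M a (inst Z c \<theta>) \<and>
    srk M X Y Z \<Delta> \<Theta> k n (D \<inter> C i \<inter> {u. sat M u (inst Y a \<delta>)})}" for i
  have "\<exists>i\<in>I. srk M X Y Z \<Delta> \<Theta> k n (D \<inter> C i \<inter> {u. sat M u (inst Y a \<delta>)})"
    if "srk M X Y Z \<Delta> \<Theta> k n (D \<inter> {u. sat M u (inst Y a \<delta>)})" for a
  proof -
    have "D \<inter> {u. sat M u (inst Y a \<delta>)} \<subseteq> (\<Union>i\<in>I. C i)" using Suc.prems(1) by blast
    from Suc.IH[OF this that] show ?thesis by (simp add: Int_ac)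
  qed
  then have "{a \<in> tuples M Y. sat M a (inst Z c \<theta>) \<and> srk M X Y Z \<Delta> \<Theta> k n (D \<inter> {u. sat M u (inst Y a \<delta>)})}
    \<subseteq> (\<Union>i\<in>I. W i)" unfolding W_def by blast
  then have "infinite (\<Union>i\<in>I. W i)" using *(4) infinite_super by blast
  then obtain i where "i \<in> I" "infinite (W i)" using assms(1) by blast
  then show ?case unfolding srk.simps W_def using *(1-3,5) by blast
qed auto

lemma type_thorn_rank_finite:
  assumes "type_thorn_rank M X Y Z \<Delta> \<Theta> k p < \<infinity>"
  obtains \<phi> n where "\<phi> \<in> p" "\<not> rank_ge M X Y Z \<Delta> \<Theta> k n \<phi>"
proof -
  obtain \<phi> where \<phi>: "\<phi> \<in> p" "thorn_rank M X Y Z \<Delta> \<Theta> k \<phi> < \<infinity>"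
    using assms unfolding type_thorn_rank_def INF_less_iff by blast
  have "\<exists>n. \<not> rank_ge M X Y Z \<Delta> \<Theta> k n \<phi>"
  proof (rule ccontr)
    assume "\<nexists>n. \<not> rank_ge M X Y Z \<Delta> \<Theta> k n \<phi>"
    then have r: "thorn_rank M X Y Z \<Delta> \<Theta> k \<phi> = (SUP n. enat n)" by (simp add: thorn_rank_def)
    obtain N where "thorn_rank M X Y Z \<Delta> \<Theta> k \<phi> = enat N" using \<phi>(2) by auto
    moreover have "enat (Suc N) \<le> (SUP n. enat n)" by (rule SUP_upper) simp
    ultimately show False using r by simp
  qed
  then show ?thesis using \<phi>(1) that by blast
qed

section \<open>The rank under automorphisms, and the step that raises it\<close>

context saturated_struc
begin

lemma act_inv: "automorphism \<sigma> \<Longrightarrow> e \<in> tuples M X \<Longrightarrow> act X \<sigma> (act X (inv \<sigma>) e) = e"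
proof
  fix x assume "automorphism \<sigma>" "e \<in> tuples M X"
  then show "act X \<sigma> (act X (inv \<sigma>) e) x = e x"
    using PiE_arb[of e X _ x] by (cases "x \<in> X") (simp_all add: act_def tuples_def auto_inv_cancel)
qed

lemma act_inj: "automorphism \<sigma> \<Longrightarrow> inj_on (act X \<sigma>) (tuples M X)"
proof (rule inj_onI)
  fix e e' assume \<sigma>: "automorphism \<sigma>" and e: "e \<in> tuples M X" "e' \<in> tuples M X" "act X \<sigma> e = act X \<sigma> e'"
  show "e = e'"
  proof
    fix x show "e x = e' x"
    proof (cases "x \<in> X")
      case True
      have "act X \<sigma> e x = act X \<sigma> e' x" using e(3) by simp
      then show ?thesis using True injD[OF auto_inj[OF \<sigma>]] by (simp add: act_def)
    next
      case False
      then show ?thesis using e(1,2) PiE_arb[of e X _ x] PiE_arb[of e' X _ x] by (simp add: tuples_def)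
    qed
  qed
qed

lemma sat_inst_act:
  fixes X :: "('s \<times> 'm) set"
  assumes \<sigma>: "automorphism \<sigma>" and \<delta>: "\<delta> \<in> fms0 L (X \<union> Y)" and u: "u \<in> tuples M X" and a: "a \<in> tuples M Y"
  shows "sat M (act X \<sigma> u) (inst Y (act Y \<sigma> a) \<delta>) \<longleftrightarrow> sat M u (inst Y a \<delta>)"
proof -
  define e where "e = override_on u a Y"
  have FV: "FV \<delta> \<subseteq> X \<union> Y" using \<delta> by (simp add: fms0_def)
  have "e x \<in> carr M (fst x)" if "x \<in> FV \<delta>" for x
    using that FV tuplesD[OF a] tuplesD[OF u] unfolding e_def override_on_def by (metis Un_iff subsetD)
  moreover have "\<delta> \<in> fms0 L UNIV" using \<delta> by (simp add: fms0_def)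
  ultimately have "sat M (\<sigma> \<circ> e) \<delta> \<longleftrightarrow> sat M e \<delta>" using auto_sat0[OF \<sigma>] by blast
  moreover have "sat M (\<sigma> \<circ> e) \<delta> = sat M (override_on (act X \<sigma> u) (act Y \<sigma> a) Y) \<delta>"
    by (rule sat_cong) (use FV in \<open>auto simp: e_def override_on_def act_def\<close>)
  ultimately show ?thesis by (simp add: sat_inst e_def)
qed

text \<open>All parameters of the rank step are moved along with \<open>D\<close>; k-inconsistency
  is checked by moving a common solution back.\<close>

lemma srk_act:
  fixes X :: "('s \<times> 'm) set"
  assumes \<sigma>: "automorphism \<sigma>" and \<Delta>: "\<Delta> \<subseteq> fms0 L (X \<union> Y)" and \<Theta>: "\<Theta> \<subseteq> fms0 L (Y \<union> Z)"
  shows "D \<subseteq> tuples M X \<Longrightarrow> srk M X Y Z \<Delta> \<Theta> k n D \<Longrightarrow> srk M X Y Z \<Delta> \<Theta> k n (act X \<sigma> ` D)"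
proof (induction n arbitrary: D)
  case (Suc n)
  obtain \<delta> \<theta> c where *: "\<delta> \<in> \<Delta>" "\<theta> \<in> \<Theta>" "c \<in> tuples M Z"
    "infinite {a \<in> tuples M Y. sat M a (inst Z c \<theta>) \<and> srk M X Y Z \<Delta> \<Theta> k n (D \<inter> {u. sat M u (inst Y a \<delta>)})}"
    "k_inconsistent M X \<delta> Y {a \<in> tuples M Y. sat M a (inst Z c \<theta>)} k"
    using Suc.prems(2) by auto
  have \<delta>: "\<delta> \<in> fms0 L (X \<union> Y)" and \<theta>: "\<theta> \<in> fms0 L (Y \<union> Z)" using * \<Delta> \<Theta> by auto
  define c' where "c' = act Z \<sigma> c"
  define W where "W = {a \<in> tuples M Y. sat M a (inst Z c \<theta>) \<and> srk M X Y Z \<Delta> \<Theta> k n (D \<inter> {u. sat M u (inst Y a \<delta>)})}"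
  have \<theta>c: "sat M (act Y \<sigma> a) (inst Z c' \<theta>) \<longleftrightarrow> sat M a (inst Z c \<theta>)" if "a \<in> tuples M Y" for a
    unfolding c'_def by (rule sat_inst_act[OF \<sigma> \<theta> that *(3)])
  have "act Y \<sigma> ` W \<subseteq> {a \<in> tuples M Y. sat M a (inst Z c' \<theta>) \<and>
      srk M X Y Z \<Delta> \<Theta> k n (act X \<sigma> ` D \<inter> {u. sat M u (inst Y a \<delta>)})}"
  proof
    fix a' assume "a' \<in> act Y \<sigma> ` W"
    then obtain a where a: "a \<in> tuples M Y" "sat M a (inst Z c \<theta>)"
      "srk M X Y Z \<Delta> \<Theta> k n (D \<inter> {u. sat M u (inst Y a \<delta>)})" "a' = act Y \<sigma> a" by (auto simp: W_def)
    have D: "D \<inter> {u. sat M u (inst Y a \<delta>)} \<subseteq> tuples M X" using Suc.prems(1) by blast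
    have "act X \<sigma> u \<in> {u. sat M u (inst Y a' \<delta>)}" if "u \<in> D" "sat M u (inst Y a \<delta>)" for u
      using sat_inst_act[OF \<sigma> \<delta> subsetD[OF Suc.prems(1) that(1)] a(1)] that(2) a(4) by simp
    then have "act X \<sigma> ` (D \<inter> {u. sat M u (inst Y a \<delta>)}) \<subseteq> act X \<sigma> ` D \<inter> {u. sat M u (inst Y a' \<delta>)}" by blast
    then have "srk M X Y Z \<Delta> \<Theta> k n (act X \<sigma> ` D \<inter> {u. sat M u (inst Y a' \<delta>)})"
      by (rule srk_mono[OF Suc.IH[OF D a(3)]])
    then show "a' \<in> {a \<in> tuples M Y. sat M a (inst Z c' \<theta>) \<and>
      srk M X Y Z \<Delta> \<Theta> k n (act X \<sigma> ` D \<inter> {u. sat M u (inst Y a \<delta>)})}"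
      using act_tuples[OF \<sigma> a(1)] \<theta>c[OF a(1)] a(2,4) by simp
  qed
  moreover have "infinite (act Y \<sigma> ` W)"
  proof -
    have "inj_on (act Y \<sigma>) W" using act_inj[OF \<sigma>] by (rule inj_on_subset) (auto simp: W_def)
    then show ?thesis using *(4) finite_imageD unfolding W_def by blast
  qed
  ultimately have i: "infinite {a \<in> tuples M Y. sat M a (inst Z c' \<theta>) \<and>
      srk M X Y Z \<Delta> \<Theta> k n (act X \<sigma> ` D \<inter> {u. sat M u (inst Y a \<delta>)})}" using infinite_super by blast
  have "k_inconsistent M X \<delta> Y {a \<in> tuples M Y. sat M a (inst Z c' \<theta>)} k"
    unfolding k_inconsistent_def
  proof (intro allI impI notI)
    fix F assume F: "F \<subseteq> {a \<in> tuples M Y. sat M a (inst Z c' \<theta>)}" "finite F \<and> card F = k"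
      and "\<exists>e\<in>tuples M X. \<forall>a\<in>F. sat M e (inst Y a \<delta>)"
    then obtain e where e: "e \<in> tuples M X" "\<forall>a\<in>F. sat M e (inst Y a \<delta>)" by blast
    let ?i = "inv \<sigma>"
    note i = auto_inv[OF \<sigma>]
    have Ft: "F \<subseteq> tuples M Y" using F(1) by blast
    have "act Y ?i ` F \<subseteq> {a \<in> tuples M Y. sat M a (inst Z c \<theta>)}"
    proof
      fix a assume "a \<in> act Y ?i ` F"
      then obtain a' where a': "a' \<in> F" "a = act Y ?i a'" by blast
      have t: "a' \<in> tuples M Y" using a'(1) Ft by blast
      have at: "a \<in> tuples M Y" using act_tuples[OF i t] a'(2) by simp
      have "act Y \<sigma> a = a'" using act_inv[OF \<sigma> t] a'(2) by simp
      then have "sat M a (inst Z c \<theta>)" using \<theta>c[OF at] a'(1) F(1) by auto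
      then show "a \<in> {a \<in> tuples M Y. sat M a (inst Z c \<theta>)}" using at by blast
    qed
    moreover have "card (act Y ?i ` F) = k"
      using card_image[OF inj_on_subset[OF act_inj[OF i] Ft]] F(2) by simp
    moreover have "\<forall>a\<in>act Y ?i ` F. sat M (act X ?i e) (inst Y a \<delta>)"
      using sat_inst_act[OF i \<delta> e(1)] e(2) Ft by blast
    moreover have "act X ?i e \<in> tuples M X" by (rule act_tuples[OF i e(1)])
    moreover have "finite (act Y ?i ` F)" using F(2) by blast
    ultimately show False using *(5) unfolding k_inconsistent_def by blast
  qed
  moreover have "c' \<in> tuples M Z" unfolding c'_def by (rule act_tuples[OF \<sigma> *(3)])
  ultimately show ?case unfolding srk.simps using *(1,2) i by blast
qed auto

text \<open>This provides the formula \<theta>(y;z) for the rank, where \<open>h\<close> pairs the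
  variables y with their copies z: for a fixed value of z its solutions are the variants of one
  tuple at the single coordinate \<open>y\<^sub>0\<close>.\<close>

lemma equal_coordinates:
  fixes Y :: "('s \<times> 'm) set"
  assumes "finite Y" "\<And>y. y \<in> Y \<Longrightarrow> fst y \<in> sorts L \<and> fst (h y) = fst y"
  shows "\<exists>\<theta>. \<theta> \<in> fms0 L (Y \<union> h ` Y) \<and> (\<forall>u. sat M u \<theta> \<longleftrightarrow> (\<forall>y\<in>Y - {y\<^sub>0}. u y = u (h y)))"
proof -
  obtain \<psi> :: "('f, 'r, 's \<times> 'm, 'm) fm" where \<psi>: "\<psi> \<in> fms0 L {}" "\<And>e. sat M e \<psi>" using truth by blast
  define G where "G = insert \<psi> ((\<lambda>y. Eq (Var y) (Var (h y))) ` (Y - {y\<^sub>0}))"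
  have G: "finite G" "G \<noteq> {}" using assms(1) by (auto simp: G_def)
  have w: "wff L (\<lambda>s. {}) \<phi> \<and> FV \<phi> \<subseteq> Y \<union> h ` Y" if "\<phi> \<in> G" for \<phi>
  proof -
    from that consider "\<phi> = \<psi>" | y where "y \<in> Y" "\<phi> = Eq (Var y) (Var (h y))" by (auto simp: G_def)
    then show ?thesis
    proof cases
      case 1
      then show ?thesis using \<psi>(1) by (simp add: fms0_def)
    next
      case 2
      then show ?thesis using assms(2)[OF 2(1)] by auto
    qed
  qed
  obtain \<theta> where \<theta>: "wff L (\<lambda>s. {}) \<theta>" "FV \<theta> = (\<Union>\<phi>\<in>G. FV \<phi>)" "\<And>e. sat M e \<theta> \<longleftrightarrow> (\<forall>\<phi>\<in>G. sat M e \<phi>)"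
    by (rule conjunction[OF G, of L "\<lambda>s. {}"]) (use w in auto)
  have "FV \<theta> \<subseteq> Y \<union> h ` Y" using \<theta>(2) w by blast
  then have "\<theta> \<in> fms0 L (Y \<union> h ` Y)" using \<theta>(1) by (simp add: fms0_def)
  moreover have "sat M u \<theta> \<longleftrightarrow> (\<forall>y\<in>Y - {y\<^sub>0}. u y = u (h y))" for u
    using \<theta>(3)[of u] \<psi>(2) by (simp add: G_def)
  ultimately show ?thesis by blast
qed

text \<open>The infinitely many parameters of the new rank step are the variants of \<open>a\<close>
  at \<open>y\<^sub>0\<close> with values in the orbit of \<open>a y\<^sub>0\<close> over
  \<open>Q\<close>. Automorphisms over \<open>Q\<close> map \<open>D\<close> into itself and carry
  the part cut out by \<open>a\<close> into the part cut out by the variant, so the rank n is kept.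
  All solutions of \<theta> differ from \<open>a\<close> only at \<open>y\<^sub>0\<close>, so
  \<open>bound\<close> yields k-inconsistency.\<close>

lemma srk_step:
  fixes X :: "('s \<times> 'm) set"
  assumes XY: "X \<inter> Y = {}" and YZ: "Y \<inter> Z = {}" and h: "inj_on h Y" "Z = h ` Y" "\<And>y. y \<in> Y \<Longrightarrow> fst (h y) = fst y"
    and \<Delta>: "\<Delta> \<subseteq> fms0 L (X \<union> Y)" and \<Theta>: "\<Theta> \<subseteq> fms0 L (Y \<union> Z)"
    and \<delta>: "\<delta> \<in> \<Delta>" and \<theta>: "\<theta> \<in> \<Theta>" "\<And>u. sat M u \<theta> \<longleftrightarrow> (\<forall>y\<in>Y - {y\<^sub>0}. u y = u (h y))"
    and a: "a \<in> tuples M Y" and y0: "y\<^sub>0 \<in> Y" and Q: "small_set M Q"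
    and aQ: "\<And>y. y \<in> FV \<delta> \<Longrightarrow> y \<in> Y \<Longrightarrow> y \<noteq> y\<^sub>0 \<Longrightarrow> a y \<in> Q" and ncl: "a y\<^sub>0 \<notin> cl Q"
    and D: "D \<subseteq> tuples M X" "\<And>\<sigma>. \<sigma> \<in> aut Q \<Longrightarrow> act X \<sigma> ` D \<subseteq> D"
    and bound: "\<And>u. u \<in> tuples M X \<Longrightarrow> finite {c \<in> carr M (fst y\<^sub>0). sat M u (inst Y (a(y\<^sub>0 := c)) \<delta>)} \<and>
      card {c \<in> carr M (fst y\<^sub>0). sat M u (inst Y (a(y\<^sub>0 := c)) \<delta>)} < k"
    and srk: "srk M X Y Z \<Delta> \<Theta> k n (D \<inter> {u. sat M u (inst Y a \<delta>)})"
  shows "srk M X Y Z \<Delta> \<Theta> k (Suc n) D"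
proof -
  \<comment> \<open>The copy of \<open>a\<close> in the variables \<open>Z\<close>, so that \<theta>
    compares with \<open>a\<close>.\<close>
  define c where "c = (\<lambda>z\<in>Z. a (inv_into Y h z))"
  have ch: "c (h y) = a y" if "y \<in> Y" for y
    using that h(1,2) by (simp add: c_def)
  have c: "c \<in> tuples M Z"
  proof -
    have "c z \<in> carr M (fst z)" if "z \<in> Z" for z
    proof -
      obtain y where "y \<in> Y" "z = h y" using \<open>z \<in> Z\<close> h(2) by blast
      then show ?thesis using ch tuplesD[OF a] h(3) by simp
    qed
    then show ?thesis by (simp add: tuples_def c_def)
  qed
  have \<theta>c: "sat M a' (inst Z c \<theta>) \<longleftrightarrow> (\<forall>y\<in>Y - {y\<^sub>0}. a' y = a y)" for a'
  proof -
    have "override_on a' c Z y = a' y" "override_on a' c Z (h y) = a y" if "y \<in> Y" for y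
      using that YZ h(2) ch by (auto simp: override_on_def)
    then show ?thesis by (simp add: sat_inst \<theta>(2))
  qed
  have FV: "FV \<delta> \<subseteq> X \<union> Y" "\<delta> \<in> fms0 L (X \<union> Y)" using \<delta> \<Delta> by (auto simp: fms0_def)
  have "(\<lambda>v. a(y\<^sub>0 := v)) ` orb Q (a y\<^sub>0) \<subseteq> {a' \<in> tuples M Y. sat M a' (inst Z c \<theta>) \<and>
      srk M X Y Z \<Delta> \<Theta> k n (D \<inter> {u. sat M u (inst Y a' \<delta>)})}"
  proof
    fix a' assume "a' \<in> (\<lambda>v. a(y\<^sub>0 := v)) ` orb Q (a y\<^sub>0)"
    then obtain \<sigma> where \<sigma>: "\<sigma> \<in> aut Q" "a' = a(y\<^sub>0 := \<sigma> (a y\<^sub>0))" by (auto simp: orb_def)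
    note \<sigma>a = autD(1)[OF \<sigma>(1)]
    have "\<sigma> (a y\<^sub>0) \<in> carr M (fst y\<^sub>0)" using auto_carr[OF \<sigma>a] tuplesD[OF a y0] by simp
    then have a': "a' \<in> tuples M Y" using a y0 \<sigma>(2) by (auto simp: tuples_def PiE_iff extensional_def)
    \<comment> \<open>The variant of \<open>a\<close> and its image under \<sigma> may differ at
      other coordinates too, since \<open>Q\<close> need not contain all of \<open>a\<close>; but
      these coordinates do not occur in \<delta>.\<close>
    have "sat M u (inst Y a' \<delta>) = sat M u (inst Y (act Y \<sigma> a) \<delta>)" for u
      unfolding sat_inst
    proof (rule sat_cong)
      fix x assume x: "x \<in> FV \<delta>"
      show "override_on u a' Y x = override_on u (act Y \<sigma> a) Y x"
      proof (cases "x \<in> Y")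
        case True
        then have "x \<noteq> y\<^sub>0 \<Longrightarrow> \<sigma> (a x) = a x" using aQ[OF x True] autD(2)[OF \<sigma>(1)] by blast
        then show ?thesis using True \<sigma>(2) by (auto simp: override_on_def act_def)
      qed (simp add: override_on_def)
    qed
    then have eq: "{u. sat M u (inst Y a' \<delta>)} = {u. sat M u (inst Y (act Y \<sigma> a) \<delta>)}" by simp
    have "act X \<sigma> u \<in> {u. sat M u (inst Y a' \<delta>)}" if "u \<in> D" "sat M u (inst Y a \<delta>)" for u
      using sat_inst_act[OF \<sigma>a FV(2) subsetD[OF D(1) that(1)] a] that(2) eq by blast
    then have sub: "act X \<sigma> ` (D \<inter> {u. sat M u (inst Y a \<delta>)}) \<subseteq> D \<inter> {u. sat M u (inst Y a' \<delta>)}"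
      using D(2)[OF \<sigma>(1)] by blast
    have "D \<inter> {u. sat M u (inst Y a \<delta>)} \<subseteq> tuples M X" using D(1) by blast
    from srk_act[OF \<sigma>a \<Delta> \<Theta> this srk]
    have "srk M X Y Z \<Delta> \<Theta> k n (act X \<sigma> ` (D \<inter> {u. sat M u (inst Y a \<delta>)}))" .
    from srk_mono[OF this sub] have "srk M X Y Z \<Delta> \<Theta> k n (D \<inter> {u. sat M u (inst Y a' \<delta>)})" .
    then show "a' \<in> {a' \<in> tuples M Y. sat M a' (inst Z c \<theta>) \<and>
        srk M X Y Z \<Delta> \<Theta> k n (D \<inter> {u. sat M u (inst Y a' \<delta>)})}"
      using a' \<theta>c[of a'] \<sigma>(2) by simp
  qed
  moreover have "infinite ((\<lambda>v. a(y\<^sub>0 := v)) ` orb Q (a y\<^sub>0))"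
  proof -
    have "infinite (orb Q (a y\<^sub>0))" using finite_orbit_cl[OF Q tuples_univ[OF a y0]] ncl by blast
    moreover have "inj_on (\<lambda>v. a(y\<^sub>0 := v)) (orb Q (a y\<^sub>0))"
      by (rule inj_onI) (drule fun_cong[of _ _ y\<^sub>0], simp)
    ultimately show ?thesis using finite_imageD by blast
  qed
  ultimately have i: "infinite {a' \<in> tuples M Y. sat M a' (inst Z c \<theta>) \<and>
      srk M X Y Z \<Delta> \<Theta> k n (D \<inter> {u. sat M u (inst Y a' \<delta>)})}" using infinite_super by blast
  have "k_inconsistent M X \<delta> Y {a' \<in> tuples M Y. sat M a' (inst Z c \<theta>)} k"
    unfolding k_inconsistent_def
  proof (intro allI impI notI)
    fix F assume F: "F \<subseteq> {a' \<in> tuples M Y. sat M a' (inst Z c \<theta>)}" "finite F \<and> card F = k"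
      and "\<exists>u\<in>tuples M X. \<forall>a\<in>F. sat M u (inst Y a \<delta>)"
    then obtain u where u: "u \<in> tuples M X" "\<forall>a\<in>F. sat M u (inst Y a \<delta>)" by blast
    have F2: "a' = a(y\<^sub>0 := a' y\<^sub>0)" "a' y\<^sub>0 \<in> carr M (fst y\<^sub>0)" if a': "a' \<in> F" for a'
    proof -
      have t: "a' \<in> tuples M Y" "\<forall>y\<in>Y - {y\<^sub>0}. a' y = a y" using a' F(1) \<theta>c by auto
      show "a' y\<^sub>0 \<in> carr M (fst y\<^sub>0)" using tuplesD[OF t(1) y0] .
      show "a' = a(y\<^sub>0 := a' y\<^sub>0)"
      proof
        fix y show "a' y = (a(y\<^sub>0 := a' y\<^sub>0)) y"
          using t(2) PiE_arb[of a' Y _ y] PiE_arb[of a Y _ y] t(1) a y0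
          by (cases "y \<in> Y") (auto simp: tuples_def)
      qed
    qed
    have inj: "inj_on (\<lambda>a'. a' y\<^sub>0) F"
    proof (rule inj_onI)
      fix a1 a2 assume "a1 \<in> F" "a2 \<in> F" "a1 y\<^sub>0 = a2 y\<^sub>0"
      then show "a1 = a2" using F2(1)[of a1] F2(1)[of a2] by simp
    qed
    have "(\<lambda>a'. a' y\<^sub>0) ` F \<subseteq> {c \<in> carr M (fst y\<^sub>0). sat M u (inst Y (a(y\<^sub>0 := c)) \<delta>)}"
    proof
      fix d assume "d \<in> (\<lambda>a'. a' y\<^sub>0) ` F"
      then obtain a' where a': "a' \<in> F" "d = a' y\<^sub>0" by blast
      have "sat M u (inst Y (a(y\<^sub>0 := d)) \<delta>)" using bspec[OF u(2) a'(1)] F2(1)[OF a'(1)] a'(2) by simp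
      then show "d \<in> {c \<in> carr M (fst y\<^sub>0). sat M u (inst Y (a(y\<^sub>0 := c)) \<delta>)}"
        using F2(2)[OF a'(1)] a'(2) by simp
    qed
    from card_mono[OF conjunct1[OF bound[OF u(1)]] this] have "card F < k"
      using card_image[OF inj] bound[OF u(1)] by simp
    then show False using F(2) by simp
  qed
  then show ?thesis unfolding srk.simps using \<delta> \<theta>(1) c i by blast
qed

end

section \<open>Existence and symmetry\<close>

context saturated_struc
begin

definition bounded :: "('s \<times> 'm) \<Rightarrow> nat \<Rightarrow> ('f, 'r, 's \<times> 'm, 'm) fm \<Rightarrow> bool" where
  "bounded y m \<chi> \<longleftrightarrow> (\<forall>u. finite {c \<in> carr M (fst y). sat M (u(y := c)) \<chi>} \<and>
     card {c \<in> carr M (fst y). sat M (u(y := c)) \<chi>} \<le> m)"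

text \<open>Solutions of the conjugate formula are images of solutions of \<chi> at the valuation
  moved back by the inverse of \<sigma>; the bound survives because it is uniform in the
  valuation.\<close>

lemma bounded_pmap:
  fixes X :: "('s \<times> 'm) set"
  assumes \<sigma>: "automorphism \<sigma>" and \<chi>: "\<chi> \<in> fms L M (insert y X) P" and b: "bounded y m \<chi>" and u: "u \<in> tuples M X"
    and y: "y \<notin> X"
  shows "finite {c \<in> carr M (fst y). sat M (u(y := c)) (pmap \<sigma> \<chi>)} \<and>
     card {c \<in> carr M (fst y). sat M (u(y := c)) (pmap \<sigma> \<chi>)} \<le> m"
proof -
  have w: "wff L (carr M) \<chi>" "FV \<chi> \<subseteq> insert y X"
    using \<chi> wff_mono[of L "\<lambda>s. carr M s \<inter> P" \<chi> "carr M"] by (auto simp: fms_def)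
  define u' where "u' = (\<lambda>x. inv \<sigma> (u x))"
  have "{c \<in> carr M (fst y). sat M (u(y := c)) (pmap \<sigma> \<chi>)} \<subseteq> \<sigma> ` {c \<in> carr M (fst y). sat M (u'(y := c)) \<chi>}"
  proof
    fix c assume c: "c \<in> {c \<in> carr M (fst y). sat M (u(y := c)) (pmap \<sigma> \<chi>)}"
    define d where "d = inv \<sigma> c"
    have d: "d \<in> carr M (fst y)" "c = \<sigma> d"
      using c auto_carr[OF auto_inv[OF \<sigma>]] auto_inv_cancel(2)[OF \<sigma>] by (auto simp: d_def)
    have e: "(u'(y := d)) x \<in> carr M (fst x)" if "x \<in> FV \<chi>" for x
    proof (cases "x = y")
      case True
      then show ?thesis using d(1) by simp
    next
      case False
      then have "x \<in> X" using that w(2) by blast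
      then show ?thesis using False tuplesD[OF u] auto_carr[OF auto_inv[OF \<sigma>]] by (simp add: u'_def)
    qed
    have "(\<lambda>x. \<sigma> ((u'(y := d)) x)) = u(y := c)"
      using d(2) auto_inv_cancel(2)[OF \<sigma>] by (auto simp: u'_def)
    then have "sat M (u'(y := d)) \<chi>" using auto_sat[OF \<sigma> w(1) e] c by (simp del: fun_upd_apply)
    then show "c \<in> \<sigma> ` {c \<in> carr M (fst y). sat M (u'(y := c)) \<chi>}" using d by blast
  qed
  note sub = this
  have f: "finite {c \<in> carr M (fst y). sat M (u'(y := c)) \<chi>}"
    "card {c \<in> carr M (fst y). sat M (u'(y := c)) \<chi>} \<le> m" using b unfolding bounded_def by blast+
  show ?thesis
  proof
    show "finite {c \<in> carr M (fst y). sat M (u(y := c)) (pmap \<sigma> \<chi>)}"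
      by (rule finite_subset[OF sub finite_imageI[OF f(1)]])
    show "card {c \<in> carr M (fst y). sat M (u(y := c)) (pmap \<sigma> \<chi>)} \<le> m"
      by (rule order_trans[OF card_mono[OF finite_imageI[OF f(1)] sub] order_trans[OF card_image_le[OF f(1)] f(2)]])
  qed
qed

text \<open>This makes all conjugates of the formula instances of one parameter-free \<delta>, so
  that a single \<Delta> serves for all of them: \<open>f\<close> is the conjugating map, and
  \<open>z\<close> takes the place of \<open>y\<close>.\<close>

lemma all_parameters_to_variables:
  fixes \<chi> :: "('f, 'r, 's \<times> 'm, 'm) fm"
  assumes \<chi>: "\<chi> \<in> fms L M (insert y X) P" and g: "\<And>c. c \<in> pars \<chi> \<Longrightarrow> fst (g c) = srt c" and z: "fst z = fst y"
    and XY: "X \<inter> Y = {}" "insert z (g ` pars \<chi>) \<subseteq> Y"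
  shows "\<exists>\<delta>. \<delta> \<in> fms0 L (X \<union> insert z (g ` pars \<chi>)) \<and>
    (\<forall>u a f. (\<forall>c\<in>pars \<chi>. a (g c) = f c) \<longrightarrow> sat M u (inst Y a \<delta>) = sat M (u(y := a z)) (pmap f \<chi>))"
proof -
  have w: "wff L (\<lambda>s. carr M s \<inter> P) \<chi>" and FV: "FV \<chi> \<subseteq> insert y X" using \<chi> by (auto simp: fms_def)
  have so: "has_sort L (\<lambda>s. {}) (Var (g c)) s" if "c \<in> carr M s \<inter> P" "c \<in> pars \<chi>" for c s
    using that g[of c] srt_eq[of c s] by simp
  have st: "has_sort L (\<lambda>s. {}) (Var (if x = y then z else x)) (fst x)" for x using z by simp
  obtain \<delta> :: "('f, 'r, 's \<times> 'm, 'm) fm" where \<delta>: "wff L (\<lambda>s. {}) \<delta>"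
    "FV \<delta> \<subseteq> (\<Union>x\<in>FV \<chi>. {if x = y then z else x}) \<union> (\<Union>c\<in>pars \<chi>. {g c})"
    "\<And>u. sat M u \<delta> \<longleftrightarrow> sat M (\<lambda>x. u (if x = y then z else x)) (pmap (\<lambda>c. u (g c)) \<chi>)"
    using substitution[where \<tau> = "\<lambda>x. Var (if x = y then z else x)" and \<rho> = "\<lambda>c. Var (g c)",
        OF infinite_names w st so] by auto
  have "FV \<delta> \<subseteq> X \<union> insert z (g ` pars \<chi>)" 
  proof
    fix v assume "v \<in> FV \<delta>"
    with \<delta>(2) consider x where "x \<in> FV \<chi>" "v = (if x = y then z else x)" | c where "c \<in> pars \<chi>" "v = g c"
      by blast
    then show "v \<in> X \<union> insert z (g ` pars \<chi>)" using FV by cases (auto split: if_splits)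
  qed
  then have "\<delta> \<in> fms0 L (X \<union> insert z (g ` pars \<chi>))" using \<delta>(1) by (simp add: fms0_def)
  moreover have "sat M u (inst Y a \<delta>) = sat M (u(y := a z)) (pmap f \<chi>)"
    if "\<forall>c\<in>pars \<chi>. a (g c) = f c" for u a f
  proof -
    have "override_on u a Y (g c) = f c" if "c \<in> pars \<chi>" for c
      using that \<open>\<forall>c\<in>pars \<chi>. a (g c) = f c\<close> XY(2) by (auto simp: override_on_def)
    then have p: "pmap (\<lambda>c. override_on u a Y (g c)) \<chi> = pmap f \<chi>" by (intro fm.map_cong) auto
    have "sat M u (inst Y a \<delta>) = sat M (\<lambda>x. override_on u a Y (if x = y then z else x)) (pmap f \<chi>)"
      by (simp add: sat_inst \<delta>(3) p)
    also have "\<dots> = sat M (u(y := a z)) (pmap f \<chi>)"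
    proof (rule sat_cong)
      fix x assume "x \<in> FV (pmap f \<chi>)"
      then have "x = y \<or> x \<in> X" using FV by auto
      then show "override_on u a Y (if x = y then z else x) = (u(y := a z)) x"
        using XY by (auto simp: override_on_def)
    qed
    finally show ?thesis .
  qed
  ultimately show ?thesis by blast
qed

text \<open>Prepares the variables for the rank: \<open>Y\<close> has one variable for each element
  of \<open>P\<close>, \<open>Z\<close> is a disjoint copy of \<open>Y\<close> for use in \<theta>,
  and \<open>a\<close> is \<open>P\<close> as a tuple.\<close>

lemma enumeration:
  fixes V :: "('s \<times> 'm) set"
  assumes P: "finite P" "P \<subseteq> univ M" and V: "small_vars M V"
  obtains g Y h Z a where "inj_on g P" "Y = g ` P" "finite Y" "V \<inter> Y = {}" "\<And>c. c \<in> P \<Longrightarrow> fst (g c) = srt c"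
    "inj_on h Y" "Z = h ` Y" "finite Z" "Y \<inter> Z = {}" "\<And>y. y \<in> Y \<Longrightarrow> fst y \<in> sorts L \<and> fst (h y) = fst y"
    "a \<in> tuples M Y" "\<And>c. c \<in> P \<Longrightarrow> a (g c) = c"
proof -
  obtain g where g: "inj_on g P" "\<And>c. c \<in> P \<Longrightarrow> fst (g c) = srt c" "\<And>c. c \<in> P \<Longrightarrow> g c \<notin> V"
    using fresh_vars[OF P(1) V] by blast
  define Y where "Y = g ` P"
  have Y: "finite Y" using P(1) by (simp add: Y_def)
  obtain k where k: "inj_on k P" "\<And>c. c \<in> P \<Longrightarrow> fst (k c) = srt c" "\<And>c. c \<in> P \<Longrightarrow> k c \<notin> Y"
    using fresh_vars[OF P(1) small_vars_finite[OF Y]] by blast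
  define h where "h y = k (inv_into P g y)" for y
  have hg: "h (g c) = k c" if "c \<in> P" for c using that g(1) by (simp add: h_def)
  define a where "a = (\<lambda>y\<in>Y. inv_into P g y)"
  have ag: "a (g c) = c" if "c \<in> P" for c using that g(1) by (simp add: a_def Y_def)
  have cs: "c \<in> carr M (srt c)" if "c \<in> P" for c using that P(2) srt_carr by blast
  show ?thesis
  proof (rule that[of g Y h "h ` Y" a])
    show "V \<inter> Y = {}" using g(3) by (auto simp: Y_def)
    show "inj_on h Y" using k(1) hg by (auto simp: Y_def inj_on_def)
    show "Y \<inter> h ` Y = {}" using k(3) hg by (force simp: Y_def)
    show "fst y \<in> sorts L \<and> fst (h y) = fst y" if y: "y \<in> Y" for y
    proof -
      obtain c where c: "c \<in> P" "y = g c" using y by (auto simp: Y_def)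
      then show ?thesis using g(2) k(2) hg sort_if_carr[OF cs[OF c(1)]] by simp
    qed
    have "a y \<in> carr M (fst y)" if y: "y \<in> Y" for y
    proof -
      obtain c where c: "c \<in> P" "y = g c" using y by (auto simp: Y_def)
      then show ?thesis using ag g(2) cs by simp
    qed
    then show "a \<in> tuples M Y" by (simp add: tuples_def a_def)
  qed (use g Y Y_def ag in auto)
qed

lemma tp_partial_type: "b \<in> tuples M X \<Longrightarrow> partial_type L M X A (tp L M X b A)"
  using tp_nonempty[of X b A] unfolding partial_type_def by (auto simp: tp_conj) (auto simp: tp_def)

lemma rosy_rank:
  fixes X :: "('s \<times> 'm) set"
  assumes "rosy L M" "small_vars M X" "finite Y" "finite Z" "X \<inter> Y = {}" "Y \<inter> Z = {}" "small_set M A"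
    "b \<in> tuples M X" "finite \<Delta>" "\<Delta> \<subseteq> fms0 L (X \<union> Y)" "finite \<Theta>" "\<Theta> \<subseteq> fms0 L (Y \<union> Z)"
  obtains \<phi> n where "\<phi> \<in> tp L M X b A" "\<not> srk M X Y Z \<Delta> \<Theta> k n {u \<in> tuples M X. sat M u \<phi>}"
proof -
  have "type_thorn_rank M X Y Z \<Delta> \<Theta> k (tp L M X b A) < \<infinity>"
    by (rule assms(1)[unfolded rosy_def, rule_format, of X Y Z A _ \<Delta> \<Theta> k], intro conjI)
      (fact assms(2-7,9-12) tp_partial_type[OF assms(8)] small_vars_finite[OF assms(4)])+
  then obtain \<phi> n where "\<phi> \<in> tp L M X b A" "\<not> rank_ge M X Y Z \<Delta> \<Theta> k n \<phi>"
    by (rule type_thorn_rank_finite)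
  then show ?thesis unfolding rank_ge_srk by (rule that)
qed

lemma sat_set_invariant:
  assumes "\<sigma> \<in> aut Q" "\<phi> \<in> fms L M X Q"
  shows "act X \<sigma> ` {u \<in> tuples M X. sat M u \<phi>} \<subseteq> {u \<in> tuples M X. sat M u \<phi>}"
proof
  fix v assume "v \<in> act X \<sigma> ` {u \<in> tuples M X. sat M u \<phi>}"
  then obtain u where u: "u \<in> tuples M X" "sat M u \<phi>" "v = act X \<sigma> u" by blast
  then show "v \<in> {u \<in> tuples M X. sat M u \<phi>}"
    using act_tuples[OF autD(1)[OF assms(1)] u(1)] aut_sat[OF assms u(1)] sat_act[of \<phi> X \<sigma> u] assms(2)
    by (simp add: fms_def)
qed

lemma tp_forall: "(\<And>\<phi>. \<phi> \<in> F \<Longrightarrow> \<phi> \<in> tp L M X b A) \<Longrightarrow> finite F \<Longrightarrow>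
  \<exists>\<chi>\<in>tp L M X b A. \<forall>u. sat M u \<chi> \<longrightarrow> (\<forall>\<phi>\<in>F. sat M u \<phi>)"
proof (induction F rule: infinite_finite_induct)
  case empty
  then show ?case using tp_nonempty[of X b A] by blast
next
  case (insert \<phi> F)
  then obtain \<chi> where "\<chi> \<in> tp L M X b A" "\<forall>u. sat M u \<chi> \<longrightarrow> (\<forall>\<phi>\<in>F. sat M u \<phi>)" by blast
  then show ?case using tp_conj[of \<phi> X b A \<chi>] insert.prems by (intro bexI[of _ "Conj \<phi> \<chi>"]) auto
qed simp

lemma fms_inst_single:
  assumes "\<chi> \<in> fms L M (insert y X) P" "e \<in> carr M (fst y)" "y \<notin> X"
  shows "inst {y} (\<lambda>_. e) \<chi> \<in> fms L M X (insert e P)"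
proof -
  have w: "wff L (\<lambda>s. carr M s \<inter> P) \<chi>" "FV \<chi> \<subseteq> insert y X" using assms(1) by (auto simp: fms_def)
  have "wff L (\<lambda>s. carr M s \<inter> insert e P) (inst {y} (\<lambda>_. e) \<chi>)"
    using w(1) by (rule wff_inst) (use assms(2) in auto)
  then show ?thesis using w(2) by (auto simp: fms_def FV_inst)
qed

lemma sat_inst_single: "sat M u (inst {y} (\<lambda>_. e) \<chi>) = sat M (u(y := e)) \<chi>"
proof -
  have "override_on u (\<lambda>_. e) {y} = u(y := e)" by (auto simp: override_on_def)
  then show ?thesis by (simp add: sat_inst)
qed

text \<open>Compactness first turns the failure for all conjugates into a cover of one formula of
  the type by finitely many bounded formulas. These determine \<Delta>, \<Theta> and k, and only
  then does rosiness provide a formula of finite rank. On a set \<open>D\<close> of exact rank n,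
  some member of the cover cuts out a subset of rank at least n, and \<open>srk_step\<close> raises
  the rank of \<open>D\<close> to n+1.\<close>

theorem tind_existence:
  assumes rosy: "rosy L M" and S: "small_set M S" and A: "small_set M A"
  shows "tind S A {}"
proof (rule ccontr)
  assume "\<not> tind S A {}"
  then obtain E where E: "small_set M E" and no: "\<And>\<sigma>. \<sigma> \<in> aut A \<Longrightarrow> \<not> mind S A (\<sigma> ` E)"
    unfolding tind_def by auto
  define X where "X = enum_vars M S"
  define b where "b = restrict snd X"
  have X: "small_vars M X" using enum_small[OF S] by (simp add: X_def)
  have "S \<subseteq> univ M" using S by (simp add: small_set_def)
  note b = enum_props[OF this, folded X_def, folded b_def]
  have Au: "A \<subseteq> univ M" "E \<subseteq> univ M" using A E by (simp_all add: small_set_def)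
  \<comment> \<open>The possible witnesses for a failure of \<open>mind\<close>: an element
    \<open>e\<close> not algebraic over \<open>A\<close> and the parameters of \<chi>, and a formula
    \<chi> that makes it algebraic over a tuple. The bound \<open>m\<close> is recorded so that a
    common k can be found later.\<close>
  define good where "good = (\<lambda>(\<chi>, y, e, m). y \<notin> X \<and> e \<in> carr M (fst y) \<and> e \<in> E \<and>
    \<chi> \<in> fms L M (insert y X) (A \<union> E) \<and> e \<notin> cl (A \<union> pars \<chi>) \<and> bounded y m \<chi>)"
  define fml where "fml = (\<lambda>(\<chi>, y, e :: 'm, m :: nat). inst {y :: 's \<times> 'm} (\<lambda>_. e) \<chi> :: ('f, 'r, 's \<times> 'm, 'm) fm)"
  define \<Gamma> where "\<Gamma> = {\<gamma>. good \<gamma>}"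
  have AE: "small_set M (A \<union> E)" using A E small_Un by blast
  have "fml \<gamma> \<in> fms L M X (A \<union> E)" if \<gamma>: "\<gamma> \<in> \<Gamma>" for \<gamma>
  proof -
    obtain \<chi> y e m where eq: "\<gamma> = (\<chi>, y, e, m)" by (cases \<gamma>) auto
    have "insert e (A \<union> E) = A \<union> E" using \<gamma> by (auto simp: \<Gamma>_def good_def eq)
    then show ?thesis using fms_inst_single[of \<chi> y X "A \<union> E" e] \<gamma> by (simp add: \<Gamma>_def good_def eq fml_def)
  qed
  then have "Neg (fml \<gamma>) \<in> fms L M X (A \<union> E)" if "\<gamma> \<in> \<Gamma>" for \<gamma> using that by (simp add: fms_def)
  then have "(\<lambda>\<gamma>. Neg (fml \<gamma>)) ` \<Gamma> \<subseteq> fms L M X (A \<union> E)" by blast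
  moreover have "tp L M X b A \<subseteq> fms L M X (A \<union> E)"
    using fms_mono[of _ X A X "A \<union> E"] by (auto simp: tp_def)
  ultimately have sub: "tp L M X b A \<union> (\<lambda>\<gamma>. Neg (fml \<gamma>)) ` \<Gamma> \<subseteq> fms L M X (A \<union> E)" by blast
  \<comment> \<open>A solution would be a conjugate of \<open>b\<close> over \<open>A\<close> that
    satisfies none of the witnessing formulas, and so one in good position to
    \<open>E\<close>.\<close>
  have "\<not> finsat M X (tp L M X b A \<union> (\<lambda>\<gamma>. Neg (fml \<gamma>)) ` \<Gamma>)"
  proof
    assume "finsat M X (tp L M X b A \<union> (\<lambda>\<gamma>. Neg (fml \<gamma>)) ` \<Gamma>)"
    from realize[OF AE X sub this] obtain u where u: "realizes M X u (tp L M X b A \<union> (\<lambda>\<gamma>. Neg (fml \<gamma>)) ` \<Gamma>)" .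
    then have "realizes M X u (tp L M X b A)" by (simp add: realizes_def)
    then obtain \<sigma> where \<sigma>: "\<sigma> \<in> aut A" "u = act X \<sigma> b" using realizes_tp[OF b(1) A X] by blast
    have ut: "u \<in> tuples M X" using u by (simp add: realizes_def)
    have uX: "u ` X = \<sigma> ` S" unfolding \<sigma>(2) act_image b(2) ..
    have "\<not> mind (u ` X) A E"
      using no[OF aut_inv[OF \<sigma>(1)]] mind_aut[OF \<sigma>(1), of S "inv \<sigma> ` E"] auto_inv_image(2)[OF autD(1)[OF \<sigma>(1)]] uX
      by metis
    then obtain d e where de: "finite d" "d \<subseteq> E" "d \<subseteq> univ M" "e \<in> E" "e \<in> cl (A \<union> d \<union> u ` X)" "e \<notin> cl (A \<union> d)"
      by (rule not_mindE)
    have eu: "e \<in> univ M" using de(4) Au by blast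
    obtain g1 where g1: "fst (g1 e) = srt e" "g1 e \<notin> X"
      using fresh_vars[OF _ X, of "{e}"] by auto
    define y where "y = g1 e"
    have y: "y \<notin> X" "e \<in> carr M (fst y)" using g1 srt_carr[OF eu] by (simp_all add: y_def)
    have Ad: "A \<union> d \<subseteq> univ M" using Au(1) de(3) by blast
    obtain \<chi> m where \<chi>: "\<chi> \<in> fms L M (insert y X) (A \<union> d)" "sat M (u(y := e)) \<chi>"
      "\<And>u. finite {c \<in> carr M (fst y). sat M (u(y := c)) \<chi>}"
      "\<And>u. card {c \<in> carr M (fst y). sat M (u(y := c)) \<chi>} \<le> m"
      by (rule bounded_formula[OF ut Ad de(5) y]) (rule that)
    have "pars \<chi> \<subseteq> A \<union> d" using fms_pars[OF \<chi>(1)] by blast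
    then have "e \<notin> cl (A \<union> pars \<chi>)" using de(6) cl_mono[of "A \<union> pars \<chi>" "A \<union> d"] by blast
    moreover have "\<chi> \<in> fms L M (insert y X) (A \<union> E)" using fms_mono[OF \<chi>(1) subset_refl] de(2) by blast
    ultimately have "(\<chi>, y, e, m) \<in> \<Gamma>" using y de(4) \<chi>(3,4) by (simp add: \<Gamma>_def good_def bounded_def)
    then have "sat M u (Neg (fml (\<chi>, y, e, m)))" using u unfolding realizes_def by blast
    then show False using \<chi>(2) by (simp add: fml_def sat_inst_single)
  qed
  then obtain F where F: "F \<subseteq> tp L M X b A \<union> (\<lambda>\<gamma>. Neg (fml \<gamma>)) ` \<Gamma>" "finite F"
    "\<forall>u\<in>tuples M X. \<exists>\<phi>\<in>F. \<not> sat M u \<phi>" by (rule not_finsatE)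
  have "finite (F - tp L M X b A)" "F - tp L M X b A \<subseteq> (\<lambda>\<gamma>. Neg (fml \<gamma>)) ` \<Gamma>" using F(1,2) by blast+
  from finite_subset_image[OF this] obtain I where
    I: "finite I" "I \<subseteq> \<Gamma>" "F - tp L M X b A = (\<lambda>\<gamma>. Neg (fml \<gamma>)) ` I" by blast
  have "finite (F \<inter> tp L M X b A)" using F(2) by blast
  from tp_forall[OF _ this, of X b A] obtain \<phi>\<^sub>0 where \<phi>0: "\<phi>\<^sub>0 \<in> tp L M X b A"
    "\<forall>u. sat M u \<phi>\<^sub>0 \<longrightarrow> (\<forall>\<phi>\<in>F \<inter> tp L M X b A. sat M u \<phi>)" by blast
  have cover: "\<exists>\<gamma>\<in>I. sat M u (fml \<gamma>)" if u: "u \<in> tuples M X" "sat M u \<phi>\<^sub>0" for u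
  proof -
    obtain \<phi> where \<phi>: "\<phi> \<in> F" "\<not> sat M u \<phi>" using F(3) u(1) by blast
    then have "\<phi> \<in> (\<lambda>\<gamma>. Neg (fml \<gamma>)) ` I" using \<phi>0(2) u(2) I(3) by blast
    then show ?thesis using \<phi>(2) by auto
  qed
  define par where "par = (\<lambda>(\<chi> :: ('f, 'r, 's \<times> 'm, 'm) fm, y :: 's \<times> 'm, e, m :: nat). insert e (pars \<chi>))"
  define P where "P = (\<Union>\<gamma>\<in>I. par \<gamma>)"
  have parI: "par \<gamma> \<subseteq> univ M" if \<gamma>: "\<gamma> \<in> I" for \<gamma>
  proof -
    obtain \<chi> y e m where eq: "\<gamma> = (\<chi>, y, e, m)" by (cases \<gamma>) auto
    have "good \<gamma>" using \<gamma> I(2) by (auto simp: \<Gamma>_def)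
    then have "\<chi> \<in> fms L M (insert y X) (A \<union> E)" "e \<in> E" by (simp_all add: good_def eq)
    then have "pars \<chi> \<subseteq> univ M" "e \<in> univ M" using fms_pars[of \<chi> "insert y X" "A \<union> E"] Au(2) by blast+
    then show ?thesis by (simp add: par_def eq)
  qed
  have "finite (par \<gamma>)" for \<gamma> by (auto simp: par_def split: prod.split)
  then have P: "finite P" "P \<subseteq> univ M" unfolding P_def using I(1) parI by blast+
  obtain g Y h Z a where *: "inj_on g P" "Y = g ` P" "finite Y" "X \<inter> Y = {}" "\<And>c. c \<in> P \<Longrightarrow> fst (g c) = srt c"
    "inj_on h Y" "Z = h ` Y" "finite Z" "Y \<inter> Z = {}" "\<And>y. y \<in> Y \<Longrightarrow> fst y \<in> sorts L \<and> fst (h y) = fst y"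
    "a \<in> tuples M Y" "\<And>c. c \<in> P \<Longrightarrow> a (g c) = c" by (rule enumeration[OF P X]) (rule that)
  define rep where "rep \<delta> \<gamma> = (case \<gamma> of (\<chi>, y, e, m) \<Rightarrow> \<delta> \<in> fms0 L (X \<union> g ` par \<gamma>) \<and>
    (\<forall>u a f. (\<forall>c\<in>pars \<chi>. a (g c) = f c) \<longrightarrow> sat M u (inst Y a \<delta>) = sat M (u(y := a (g e))) (pmap f \<chi>)))" for \<delta> \<gamma>
  have "\<forall>\<gamma>\<in>I. \<exists>\<delta>. rep \<delta> \<gamma>"
  proof
    fix \<gamma> assume \<gamma>: "\<gamma> \<in> I"
    obtain \<chi> y e m where eq: "\<gamma> = (\<chi>, y, e, m)" by (cases \<gamma>) auto
    have "good \<gamma>" using \<gamma> I(2) by (auto simp: \<Gamma>_def)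
    then have G: "\<chi> \<in> fms L M (insert y X) (A \<union> E)" "e \<in> carr M (fst y)" by (simp_all add: good_def eq)
    have sub: "insert e (pars \<chi>) \<subseteq> P" using \<gamma> by (auto simp: P_def par_def eq)
    then have "fst (g e) = fst y" "insert (g e) (g ` pars \<chi>) \<subseteq> Y" "\<And>c. c \<in> pars \<chi> \<Longrightarrow> fst (g c) = srt c"
      using *(2,5) srt_eq[OF G(2)] by auto
    from all_parameters_to_variables[OF G(1) this(3,1) *(4) this(2)] show "\<exists>\<delta>. rep \<delta> \<gamma>"
      by (simp add: rep_def eq par_def)
  qed
  from bchoice[OF this] obtain \<delta> where \<delta>: "\<forall>\<gamma>\<in>I. rep (\<delta> \<gamma>) \<gamma>" ..
  have "\<forall>y\<^sub>0. \<exists>\<theta>. \<theta> \<in> fms0 L (Y \<union> h ` Y) \<and> (\<forall>u. sat M u \<theta> \<longleftrightarrow> (\<forall>y\<in>Y - {y\<^sub>0}. u y = u (h y)))"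
    using equal_coordinates[OF *(3,10)] by blast
  from choice[OF this] obtain \<theta> where \<theta>: "\<And>y\<^sub>0. \<theta> y\<^sub>0 \<in> fms0 L (Y \<union> h ` Y)"
    "\<And>y\<^sub>0 u. sat M u (\<theta> y\<^sub>0) \<longleftrightarrow> (\<forall>y\<in>Y - {y\<^sub>0}. u y = u (h y))" by blast
  define \<Delta> where "\<Delta> = \<delta> ` I"
  define \<Theta> where "\<Theta> = \<theta> ` Y"
  define mm where "mm = (\<lambda>(\<chi> :: ('f, 'r, 's \<times> 'm, 'm) fm, y :: 's \<times> 'm, e :: 'm, m :: nat). m)"
  \<comment> \<open>One k must do for the whole cover: it exceeds the bound of each of the finitely
    many formulas.\<close>
  define k where "k = Suc (\<Sum>\<gamma>\<in>I. mm \<gamma>)"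
  have \<Delta>: "finite \<Delta>" "\<Delta> \<subseteq> fms0 L (X \<union> Y)"
  proof -
    show "finite \<Delta>" using I(1) by (simp add: \<Delta>_def)
    have "\<delta> \<gamma> \<in> fms0 L (X \<union> Y)" if \<gamma>: "\<gamma> \<in> I" for \<gamma>
    proof -
      have "\<delta> \<gamma> \<in> fms0 L (X \<union> g ` par \<gamma>)" using \<delta> \<gamma> by (auto simp: rep_def split: prod.splits)
      moreover have "g ` par \<gamma> \<subseteq> Y" using \<gamma> *(2) by (auto simp: P_def)
      ultimately show ?thesis unfolding fms0_def by blast
    qed
    then show "\<Delta> \<subseteq> fms0 L (X \<union> Y)" unfolding \<Delta>_def by blast
  qed
  have \<Theta>: "finite \<Theta>" "\<Theta> \<subseteq> fms0 L (Y \<union> Z)" using *(3,7) \<theta>(1) by (auto simp: \<Theta>_def)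
  obtain \<phi>\<^sub>1 N where \<phi>1: "\<phi>\<^sub>1 \<in> tp L M X b A" "\<not> srk M X Y Z \<Delta> \<Theta> k N {u \<in> tuples M X. sat M u \<phi>\<^sub>1}"
    by (rule rosy_rank[OF rosy X *(3,8,4,9) A b(1) \<Delta> \<Theta>])
  define \<phi> where "\<phi> = Conj \<phi>\<^sub>0 \<phi>\<^sub>1"
  have \<phi>: "\<phi> \<in> tp L M X b A" using tp_conj \<phi>0(1) \<phi>1(1) by (simp add: \<phi>_def)
  define D where "D = {u \<in> tuples M X. sat M u \<phi>}"
  have DN: "\<not> srk M X Y Z \<Delta> \<Theta> k N D"
  proof
    assume "srk M X Y Z \<Delta> \<Theta> k N D"
    then have "srk M X Y Z \<Delta> \<Theta> k N {u \<in> tuples M X. sat M u \<phi>\<^sub>1}" by (rule srk_mono) (auto simp: D_def \<phi>_def)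
    then show False using \<phi>1(2) by blast
  qed
  have D0: "srk M X Y Z \<Delta> \<Theta> k 0 D" using b(1) \<phi> by (auto simp: D_def tp_def)
  \<comment> \<open>The rank is at least 0 because \<open>D\<close> contains \<open>b\<close>, and
    it is not at least \<open>N\<close>, so somewhere in between it stops.\<close>
  have "\<exists>n. srk M X Y Z \<Delta> \<Theta> k n D \<and> \<not> srk M X Y Z \<Delta> \<Theta> k (Suc n) D"
  proof (rule ccontr)
    assume no: "\<nexists>n. srk M X Y Z \<Delta> \<Theta> k n D \<and> \<not> srk M X Y Z \<Delta> \<Theta> k (Suc n) D"
    have "srk M X Y Z \<Delta> \<Theta> k n D" for n
      by (induction n) (use D0 no in blast)+
    then show False using DN by blast
  qed
  then obtain n where n: "srk M X Y Z \<Delta> \<Theta> k n D" "\<not> srk M X Y Z \<Delta> \<Theta> k (Suc n) D" by blast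
  have "D \<subseteq> (\<Union>\<gamma>\<in>I. {u. sat M u (fml \<gamma>)})" using cover by (auto simp: D_def \<phi>_def)
  from srk_finite_cover[OF I(1) this n(1)] obtain \<gamma> where
    \<gamma>: "\<gamma> \<in> I" "srk M X Y Z \<Delta> \<Theta> k n (D \<inter> {u. sat M u (fml \<gamma>)})" by blast
  obtain \<chi> y e m where eq: "\<gamma> = (\<chi>, y, e, m)" by (cases \<gamma>) auto
  have "good \<gamma>" using \<gamma>(1) I(2) by (auto simp: \<Gamma>_def)
  then have G: "y \<notin> X" "e \<in> carr M (fst y)" "\<chi> \<in> fms L M (insert y X) (A \<union> E)" "e \<notin> cl (A \<union> pars \<chi>)" "bounded y m \<chi>"
    by (simp_all add: good_def eq)
  have Pe: "insert e (pars \<chi>) \<subseteq> P" using \<gamma>(1) by (auto simp: P_def par_def eq)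
  \<comment> \<open>\<open>D\<close> is defined over \<open>A\<close> and hence invariant over
    \<open>Q\<close>, while \<open>e\<close> is not algebraic over \<open>Q\<close>; so
    \<open>e\<close> can play the moving coordinate in \<open>srk_step\<close>.\<close>
  define Q where "Q = A \<union> pars \<chi>"
  have "small_set M (pars \<chi>)" using Pe P(2) by (intro small_finite) auto
  then have Q: "small_set M Q" using A small_Un by (simp add: Q_def)
  have "e \<notin> pars \<chi>" using G(4) cl_incl[of e "A \<union> pars \<chi>"] Pe P(2) by auto
  have gne: "g c \<noteq> g e" if "c \<in> pars \<chi>" for c
    using that \<open>e \<notin> pars \<chi>\<close> *(1) Pe by (auto dest: inj_onD)
  have r: "\<delta> \<gamma> \<in> fms0 L (X \<union> insert (g e) (g ` pars \<chi>))"
    "\<And>u a f. \<forall>c\<in>pars \<chi>. a (g c) = f c \<Longrightarrow> sat M u (inst Y a (\<delta> \<gamma>)) = sat M (u(y := a (g e))) (pmap f \<chi>)"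
    using bspec[OF \<delta> \<gamma>(1)] by (auto simp: rep_def eq par_def)
  have r2: "sat M u (inst Y (a(g e := c)) (\<delta> \<gamma>)) = sat M (u(y := c)) \<chi>" for u c
    using r(2)[of "a(g e := c)" "\<lambda>c. c" u] gne *(12) Pe by (auto simp: fm.map_ident)
  have r3: "sat M u (inst Y a (\<delta> \<gamma>)) = sat M u (fml \<gamma>)" for u
    using r(2)[of a "\<lambda>c. c" u] *(12) Pe by (auto simp: fm.map_ident fml_def eq sat_inst_single)
  have ge: "g e \<in> Y" using Pe *(2) by blast
  have "srk M X Y Z \<Delta> \<Theta> k (Suc n) D"
  proof (rule srk_step[OF *(4,9,6,7) _ \<Delta>(2) \<Theta>(2), of "\<delta> \<gamma>" "\<theta> (g e)" "g e" a Q])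
    show "\<delta> \<gamma> \<in> \<Delta>" using \<gamma>(1) by (simp add: \<Delta>_def)
    show "\<theta> (g e) \<in> \<Theta>" using ge by (simp add: \<Theta>_def)
    show "sat M u (\<theta> (g e)) \<longleftrightarrow> (\<forall>y\<in>Y - {g e}. u y = u (h y))" for u by (rule \<theta>(2))
    show "a (g e) \<notin> cl Q" using G(4) *(12)[of e] Pe by (simp add: Q_def)
    show "a y' \<in> Q" if y': "y' \<in> FV (\<delta> \<gamma>)" "y' \<in> Y" "y' \<noteq> g e" for y'
    proof -
      have "FV (\<delta> \<gamma>) \<subseteq> X \<union> insert (g e) (g ` pars \<chi>)" using r(1) by (simp add: fms0_def)
      then obtain c where "c \<in> pars \<chi>" "y' = g c" using y' *(4) by blast
      then show ?thesis using *(12) Pe by (auto simp: Q_def)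
    qed
    show "act X \<sigma> ` D \<subseteq> D" if \<sigma>: "\<sigma> \<in> aut Q" for \<sigma>
    proof -
      have "\<phi> \<in> fms L M X Q" using \<phi> fms_mono[of \<phi> X A X Q] by (auto simp: tp_def Q_def)
      from sat_set_invariant[OF \<sigma> this] show ?thesis by (simp add: D_def)
    qed
    show "finite {c \<in> carr M (fst (g e)). sat M u (inst Y (a(g e := c)) (\<delta> \<gamma>))} \<and>
      card {c \<in> carr M (fst (g e)). sat M u (inst Y (a(g e := c)) (\<delta> \<gamma>))} < k" for u
    proof -
      have "fst (g e) = fst y" using *(5)[of e] Pe srt_eq[OF G(2)] by simp
      moreover have "m \<le> (\<Sum>\<gamma>\<in>I. mm \<gamma>)" using member_le_sum[OF \<gamma>(1), of mm] I(1) by (simp add: mm_def eq)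
      moreover have "finite {c \<in> carr M (fst y). sat M (u(y := c)) \<chi>}"
        "card {c \<in> carr M (fst y). sat M (u(y := c)) \<chi>} \<le> m" using G(5) unfolding bounded_def by blast+
      ultimately show ?thesis unfolding r2 k_def by simp
    qed
    show "srk M X Y Z \<Delta> \<Theta> k n (D \<inter> {u. sat M u (inst Y a (\<delta> \<gamma>))})" using \<gamma>(2) unfolding r3 .
  qed (use * ge Q D_def in auto)
  then show False using n(2) by blast
qed

lemma tind_empty: "tind {} A B"
  unfolding tind_def mind_def using aut_id[of "A \<union> B"] by auto

text \<open>Repeated use of \<open>tind_extension\<close>, each time over all conjugates found
  before. A finite length is enough, since the number of rank steps to be reached is known
  beforehand.\<close>

lemma independent_sequence:
  fixes n :: nat
  assumes F: "small_set M F" and A: "small_set M A" and B: "small_set M B" and t: "tind F A B"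
  shows "\<exists>f. \<forall>i<n. f i \<in> aut (A \<union> B) \<and> tind (f i ` F) A (B \<union> (\<Union>j<i. f j ` F))"
proof (induction n)
  case (Suc n)
  then obtain f where f: "\<And>i. i < n \<Longrightarrow> f i \<in> aut (A \<union> B) \<and> tind (f i ` F) A (B \<union> (\<Union>j<i. f j ` F))" by blast
  have small: "small_set M (\<Union>j<i. f j ` F)" if "i \<le> n" for i
    using that
  proof (induction i)
    case 0
    then show ?case using small_finite[of "{}"] by simp
  next
    case (Suc i)
    then have "small_set M (f i ` F)" using small_auto_image[OF autD(1) F] f[of i] by auto
    with Suc have "small_set M (f i ` F \<union> (\<Union>j<i. f j ` F))" using small_Un by simp
    then show ?case by (simp add: lessThan_Suc)
  qed
  let ?B = "B \<union> (\<Union>j<n. f j ` F)"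
  have "small_set M ?B" using small_Un[OF B small] by blast
  from tind_extension[OF F A B this _ t] obtain \<sigma> where \<sigma>: "\<sigma> \<in> aut (A \<union> B)" "tind (\<sigma> ` F) A ?B" by blast
  define f' where "f' = f(n := \<sigma>)"
  have eq: "(\<Union>j<i. f' j ` F) = (\<Union>j<i. f j ` F)" if "i \<le> n" for i
    using that by (auto simp: f'_def)
  have "f' i \<in> aut (A \<union> B) \<and> tind (f' i ` F) A (B \<union> (\<Union>j<i. f' j ` F))" if "i < Suc n" for i
  proof (cases "i = n")
    case True
    then show ?thesis using \<sigma> eq[of n] by (simp add: f'_def)
  next
    case False
    then show ?thesis using f[of i] eq[of i] that by (simp add: f'_def)
  qed
  then show ?case by blast
qed simp

text \<open>If \<open>e \<in> cl (A \<union> d \<union> B) - cl (A \<union> d)\<close>, take conjugates \<open>(e\<^sub>i, d\<^sub>i)\<close> over \<open>A \<union> B\<close>, each independent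
  from the previous ones. Left transitivity makes blocks of later members independent from earlier
  members, so \<open>e\<^sub>i\<close> is not algebraic over \<open>A\<close>, \<open>d\<^sub>i\<close> and the later members. Read backwards, the formula
  witnessing the algebraicity of \<open>e\<close> thus forces the thorn-rank of the type of \<open>B\<close> to be infinite.\<close>

theorem tind_sym:
  assumes rosy: "rosy L M" and S: "small_set M S" and A: "small_set M A" and B: "small_set M B"
    and t: "tind S A B"
  shows "tind B A S"
proof (rule ccontr)
  assume "\<not> tind B A S"
  then obtain E where E: "small_set M E" and no: "\<And>\<sigma>. \<sigma> \<in> aut (A \<union> S) \<Longrightarrow> \<not> mind B A (\<sigma> ` E)"
    unfolding tind_def by auto
  have AS: "small_set M (A \<union> S)" using A S small_Un by blast
  have e0: "small_set M {}" by (rule small_finite) auto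
  \<comment> \<open>By existence and extension, some conjugate of \<open>E\<close> over
    \<open>A \<union> S\<close> is independent from \<open>B\<close> over
    \<open>A \<union> S\<close>; by left transitivity it is so together with \<open>S\<close> over
    \<open>A\<close>. The failure of \<open>mind\<close> is then sought inside this conjugate, where
    it is itself independent from \<open>B\<close>.\<close>
  have "A \<union> S \<union> {} \<subseteq> A \<union> S \<union> B" by blast
  from tind_extension[OF E AS e0 B this tind_existence[OF rosy E AS]]
  obtain \<sigma> where \<sigma>: "\<sigma> \<in> aut (A \<union> S)" "tind (\<sigma> ` E) (A \<union> S) B" by auto
  have tE: "tind (S \<union> \<sigma> ` E) A B" by (rule tind_left_trans[OF t \<sigma>(2)])
  obtain d e where de: "finite d" "d \<subseteq> \<sigma> ` E" "d \<subseteq> univ M" "e \<in> \<sigma> ` E" "e \<in> cl (A \<union> d \<union> B)" "e \<notin> cl (A \<union> d)"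
    using not_mindE[OF no[OF \<sigma>(1)]] by blast
  define X where "X = enum_vars M B"
  define b where "b = restrict snd X"
  have X: "small_vars M X" using enum_small[OF B] by (simp add: X_def)
  have "B \<subseteq> univ M" using B by (simp add: small_set_def)
  note b = enum_props[OF this, folded X_def, folded b_def]
  have Au: "A \<union> d \<subseteq> univ M" using A de(3) by (simp add: small_set_def)
  have eu: "e \<in> univ M" using de(5) cl_univ by blast
  obtain g1 where g1: "fst (g1 e) = srt e" "g1 e \<notin> X"
    using fresh_vars[OF _ X, of "{e}"] by auto
  define y where "y = g1 e"
  have y: "y \<notin> X" "e \<in> carr M (fst y)" using g1 srt_carr[OF eu] by (simp_all add: y_def)
  have ecl: "e \<in> cl (A \<union> d \<union> b ` X)" using de(5) b(2) by simp
  obtain \<chi> m where \<chi>: "\<chi> \<in> fms L M (insert y X) (A \<union> d)" "sat M (b(y := e)) \<chi>"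
    "\<And>u. finite {c \<in> carr M (fst y). sat M (u(y := c)) \<chi>}"
    "\<And>u. card {c \<in> carr M (fst y). sat M (u(y := c)) \<chi>} \<le> m"
    by (rule bounded_formula[OF b(1) Au ecl y]) (rule that)
  have bd: "bounded y m \<chi>" using \<chi>(3,4) by (simp add: bounded_def)
  have p: "pars \<chi> \<subseteq> A \<union> d" "pars \<chi> \<subseteq> univ M" using fms_pars[OF \<chi>(1)] by auto
  define d' where "d' = pars \<chi> \<inter> d"
  have pA: "pars \<chi> \<subseteq> A \<union> d'" using p by (auto simp: d'_def)
  define F where "F = insert e d'"
  have ncl: "e \<notin> cl (A \<union> d')" using de(6) cl_mono[of "A \<union> d'" "A \<union> d"] by (auto simp: d'_def)
  have "F \<subseteq> S \<union> \<sigma> ` E" using de(2,4) by (auto simp: F_def d'_def)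
  then have tF: "tind F A B" using tind_mono[OF tE] by blast
  have F: "small_set M F" using eu p(2) by (intro small_finite) (auto simp: F_def d'_def)
  define P where "P = insert e (pars \<chi>)"
  have P: "finite P" "P \<subseteq> univ M" using eu p(2) by (auto simp: P_def)
  obtain g Y h Z a where *: "inj_on g P" "Y = g ` P" "finite Y" "X \<inter> Y = {}" "\<And>c. c \<in> P \<Longrightarrow> fst (g c) = srt c"
    "inj_on h Y" "Z = h ` Y" "finite Z" "Y \<inter> Z = {}" "\<And>y. y \<in> Y \<Longrightarrow> fst y \<in> sorts L \<and> fst (h y) = fst y"
    "a \<in> tuples M Y" "\<And>c. c \<in> P \<Longrightarrow> a (g c) = c" by (rule enumeration[OF P X]) (rule that)
  have gs: "fst (g c) = srt c" if "c \<in> pars \<chi>" for c using *(5) that by (simp add: P_def)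
  have ge: "fst (g e) = fst y" "g e \<in> Y" using *(2,5) srt_eq[OF y(2)] by (auto simp: P_def)
  have sub: "insert (g e) (g ` pars \<chi>) \<subseteq> Y" using *(2) by (auto simp: P_def)
  from all_parameters_to_variables[OF \<chi>(1) gs ge(1) *(4) sub] obtain \<delta> where
    \<delta>: "\<delta> \<in> fms0 L (X \<union> insert (g e) (g ` pars \<chi>))"
    "\<And>u a f. \<forall>c\<in>pars \<chi>. a (g c) = f c \<Longrightarrow> sat M u (inst Y a \<delta>) = sat M (u(y := a (g e))) (pmap f \<chi>)" by blast
  from equal_coordinates[OF *(3,10)] obtain \<theta> where \<theta>: "\<theta> \<in> fms0 L (Y \<union> h ` Y)"
    "\<And>u. sat M u \<theta> \<longleftrightarrow> (\<forall>y\<in>Y - {g e}. u y = u (h y))" by blast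
  have \<Delta>: "{\<delta>} \<subseteq> fms0 L (X \<union> Y)" using \<delta>(1) sub unfolding fms0_def by blast
  have \<Theta>: "{\<theta>} \<subseteq> fms0 L (Y \<union> Z)" using \<theta>(1) *(7) by simp
  define k where "k = Suc m"
  have fin: "finite {\<delta>}" "finite {\<theta>}" by simp_all
  obtain \<phi> n where \<phi>: "\<phi> \<in> tp L M X b A" "\<not> srk M X Y Z {\<delta>} {\<theta>} k n {u \<in> tuples M X. sat M u \<phi>}"
    by (rule rosy_rank[OF rosy X *(3,8,4,9) A b(1) fin(1) \<Delta> fin(2) \<Theta>])
  \<comment> \<open>The length is a number of rank steps that \<phi> does not admit; the sequence
    will supply exactly that many.\<close>
  obtain f where f: "\<And>i. i < n \<Longrightarrow> f i \<in> aut (A \<union> B)"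
    "\<And>i. i < n \<Longrightarrow> tind (f i ` F) A (B \<union> (\<Union>j<i. f j ` F))"
    using independent_sequence[OF F A B tF, of n] by blast
  have fa: "automorphism (f i)" if "i < n" for i using f(1)[OF that] by (rule autD(1))
  have fA: "f i ` A = A" if "i < n" for i using aut_image[OF f(1)[OF that]] by blast
  have fF: "small_set M (f i ` F)" if "i < n" for i using small_auto_image[OF fa[OF that] F] .
  define U where "U i l = (\<Union>j\<in>{i<..<l}. f j ` F)" for i l
  have smallU: "small_set M (U i l)" if "l \<le> n" for i l
    using that
  proof (induction l)
    case 0
    then show ?case using e0 by (simp add: U_def)
  next
    case (Suc l)
    then have "small_set M (f l ` F \<union> U i l)" using small_Un[OF fF] by simp
    moreover have "{i<..<Suc l} \<subseteq> insert l {i<..<l}" by auto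
    then have "U i (Suc l) \<subseteq> (\<Union>j\<in>insert l {i<..<l}. f j ` F)" unfolding U_def by (rule UN_mono) simp
    then have "U i (Suc l) \<subseteq> f l ` F \<union> U i l" by (simp add: U_def)
    ultimately show ?case by (rule small_subset)
  qed
  \<comment> \<open>The block grows by one member at a time: member \<open>l\<close> is independent
    over \<open>A\<close> from all earlier members, hence over \<open>A \<union> U i l\<close> from
    member \<open>i\<close>, and left transitivity joins it to the block. In this way independence
    is reversed along the sequence without an appeal to symmetry.\<close>
  have tU: "tind (U i l) A (f i ` F)" if "i < n" "l \<le> n" for i l
    using that(2)
  proof (induction l)
    case 0
    then show ?case using tind_empty by (simp add: U_def)
  next
    case (Suc l)
    show ?case
    proof (cases "i < l")
      case True
      then have "{i<..<Suc l} = insert l {i<..<l}" by auto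
      then have eq: "U i (Suc l) = U i l \<union> f l ` F" by (simp add: U_def Un_commute)
      have C: "U i l \<subseteq> (\<Union>j<l. f j ` F)" "f i ` F \<subseteq> (\<Union>j<l. f j ` F)" using True by (auto simp: U_def)
      have l: "l < n" using Suc.prems by simp
      have t1: "tind (f l ` F) A (A \<union> (B \<union> (\<Union>j<l. f j ` F)))"
        by (rule tind_mono[OF f(2)[OF l] subset_refl]) blast
      have "small_set M (A \<union> U i l)" using small_Un[OF A smallU] l by simp
      then have t2: "tind (f l ` F) (A \<union> U i l) (A \<union> (B \<union> (\<Union>j<l. f j ` F)))"
        using C(1) by (intro tind_base_mono[OF t1]) blast+
      have t3: "tind (f l ` F) (A \<union> U i l) (f i ` F)"
        using C(2) by (intro tind_mono[OF t2 subset_refl]) blast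
      have "tind (U i l) A (f i ` F)" using Suc.IH l by simp
      from tind_left_trans[OF this t3] show ?thesis unfolding eq .
    next
      case False
      then have "U i (Suc l) = {}" by (auto simp: U_def)
      then show ?thesis using tind_empty by simp
    qed
  qed
  define con where "con i u \<longleftrightarrow> sat M (u(y := f i e)) (pmap (f i) \<chi>)" for i u
  \<comment> \<open>Only the conditions with index at least \<open>r\<close> are kept.
    \<open>D 0\<close> contains \<open>b\<close>, and dropping condition \<open>r\<close> gains one
    rank step, so after \<open>n\<close> steps \<phi> alone remains with rank at least
    \<open>n\<close>.\<close>
  define D where "D r = {u \<in> tuples M X. sat M u \<phi> \<and> (\<forall>l. r \<le> l \<and> l < n \<longrightarrow> con l u)}" for r
  \<comment> \<open>\<open>f i\<close> fixes \<open>B\<close>, which is the set of entries of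
    \<open>b\<close>, so \<open>b\<close> satisfies all conjugates of the formula at once.\<close>
  have conb: "con i b" if i: "i < n" for i
  proof -
    have w: "wff L (carr M) \<chi>" "FV \<chi> \<subseteq> insert y X"
      using \<chi>(1) wff_mono[of L "\<lambda>s. carr M s \<inter> (A \<union> d)" \<chi> "carr M"] by (auto simp: fms_def)
    have c: "(b(y := e)) x \<in> carr M (fst x)" if "x \<in> FV \<chi>" for x
    proof (cases "x = y")
      case True
      then show ?thesis using y(2) by simp
    next
      case False
      then have "x \<in> X" using that w(2) by blast
      then show ?thesis using False tuplesD[OF b(1)] by simp
    qed
    have "sat M (\<lambda>x. f i ((b(y := e)) x)) (pmap (f i) \<chi>)" using auto_sat[OF fa[OF i] w(1) c] \<chi>(2) by blast
    moreover have "sat M (\<lambda>x. f i ((b(y := e)) x)) (pmap (f i) \<chi>) = sat M (b(y := f i e)) (pmap (f i) \<chi>)"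
    proof (rule sat_cong)
      fix x assume "x \<in> FV (pmap (f i) \<chi>)"
      then have "x = y \<or> x \<in> X" using w(2) by auto
      moreover have "f i (b x) = b x" if "x \<in> X" using autD(2)[OF f(1)[OF i]] b(2) that by blast
      ultimately show "f i ((b(y := e)) x) = (b(y := f i e)) x" using y(1) by auto
    qed
    ultimately show ?thesis by (simp add: con_def)
  qed
  have "srk M X Y Z {\<delta>} {\<theta>} k r (D r)" if "r \<le> n" for r
    using that
  proof (induction r)
    case 0
    have "b \<in> D 0" using b(1) \<phi>(1) conb by (simp add: D_def tp_def)
    then show ?case by auto
  next
    case (Suc r)
    then have r: "r < n" by simp
    let ?a = "act Y (f r) a"
    \<comment> \<open>\<open>Q\<close> contains the parameters of all conditions kept in
      \<open>D (Suc r)\<close>, which is therefore invariant over \<open>Q\<close>. As the later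
      members are independent from member \<open>r\<close>, the element \<open>f r e\<close> is
      still not algebraic over \<open>Q\<close>.\<close>
    define Q where "Q = A \<union> f r ` d' \<union> U r n"
    have d'F: "f r ` d' \<subseteq> f r ` F" by (auto simp: F_def)
    have "small_set M (f r ` d')" by (rule small_subset[OF fF[OF r] d'F])
    then have Q: "small_set M Q" unfolding Q_def using A small_Un smallU[OF order_refl] by blast
    have ag: "?a (g c) = f r c" if "c \<in> P" for c
      using that *(2,12) by (simp add: act_def)
    have neQ: "f r e \<notin> cl Q"
    proof
      assume "f r e \<in> cl Q"
      then have "f r e \<in> cl (A \<union> f r ` d')"
        using mindD[OF tind_mind[OF tU[OF r order_refl] fF[OF r]] d'F] by (simp add: Q_def F_def)
      then have "f r e \<in> cl (f r ` (A \<union> d'))" using fA[OF r] by (simp add: image_Un)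
      then show False using cl_auto[OF fa[OF r]] ncl by simp
    qed
    have gne: "g c \<noteq> g e" if "c \<in> pars \<chi>" for c
    proof -
      have "e \<notin> pars \<chi>" using ncl pA cl_incl[of e "A \<union> d'"] eu by blast
      then show ?thesis using that inj_onD[OF *(1), of c e] by (auto simp: P_def)
    qed
    have r2: "sat M u (inst Y (?a(g e := c)) \<delta>) = sat M (u(y := c)) (pmap (f r) \<chi>)" for u c
      using \<delta>(2)[of "?a(g e := c)" "f r" u] gne ag by (simp add: P_def)
    have r3: "sat M u (inst Y ?a \<delta>) \<longleftrightarrow> con r u" for u
      using \<delta>(2)[of ?a "f r" u] ag by (simp add: P_def con_def)
    have "D r \<subseteq> D (Suc r) \<inter> {u. sat M u (inst Y ?a \<delta>)}" unfolding r3 using r by (auto simp: D_def)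
    with Suc.IH r have srk: "srk M X Y Z {\<delta>} {\<theta>} k r (D (Suc r) \<inter> {u. sat M u (inst Y ?a \<delta>)})"
      using srk_mono by (metis less_imp_le_nat)
    show ?case
    proof (rule srk_step[OF *(4,9,6,7) _ \<Delta> \<Theta>, of \<delta> \<theta> "g e" ?a Q])
      show "sat M u \<theta> \<longleftrightarrow> (\<forall>y\<in>Y - {g e}. u y = u (h y))" for u by (rule \<theta>(2))
      show "?a (g e) \<notin> cl Q" using neQ ag[of e] by (simp add: P_def)
      show "?a \<in> tuples M Y" by (rule act_tuples[OF fa[OF r] *(11)])
      show "?a y' \<in> Q" if y': "y' \<in> FV \<delta>" "y' \<in> Y" "y' \<noteq> g e" for y'
      proof -
        have "FV \<delta> \<subseteq> X \<union> insert (g e) (g ` pars \<chi>)" using \<delta>(1) by (simp add: fms0_def)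
        then obtain c where c: "c \<in> pars \<chi>" "y' = g c" using y' *(4) by blast
        then have "?a y' = f r c" using ag by (simp add: P_def)
        moreover have "f r c \<in> A \<union> f r ` d'" using c(1) pA fA[OF r] by blast
        ultimately show ?thesis by (simp add: Q_def)
      qed
      show "finite {c \<in> carr M (fst (g e)). sat M u (inst Y (?a(g e := c)) \<delta>)} \<and>
        card {c \<in> carr M (fst (g e)). sat M u (inst Y (?a(g e := c)) \<delta>)} < k" if "u \<in> tuples M X" for u
        unfolding r2 ge(1) k_def using bounded_pmap[OF fa[OF r] \<chi>(1) bd that y(1)] by simp
      show "act X \<sigma> ` D (Suc r) \<subseteq> D (Suc r)" if \<sigma>: "\<sigma> \<in> aut Q" for \<sigma>
      proof
        fix v assume "v \<in> act X \<sigma> ` D (Suc r)"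
        then obtain u where u: "u \<in> tuples M X" "sat M u \<phi>" "\<And>l. Suc r \<le> l \<Longrightarrow> l < n \<Longrightarrow> con l u" "v = act X \<sigma> u"
          by (auto simp: D_def)
        have "\<phi> \<in> fms L M X Q" using \<phi>(1) fms_mono[of \<phi> X A X Q] by (auto simp: tp_def Q_def)
        from sat_set_invariant[OF \<sigma> this] have v: "v \<in> tuples M X" "sat M v \<phi>" using u by auto
        have "con l v" if l: "Suc r \<le> l" "l < n" for l
        proof -
          have "l \<in> {r<..<n}" using l by simp
          then have "f l ` F \<subseteq> U r n" unfolding U_def by (rule UN_upper)
          then have lF: "f l ` F \<subseteq> Q" unfolding Q_def by blast
          have le: "f l e \<in> Q" using lF by (auto simp: F_def)
          have lp: "f l ` pars \<chi> \<subseteq> Q" 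
          proof -
            have "f l ` pars \<chi> \<subseteq> f l ` A \<union> f l ` d'" using pA by blast
            moreover have "f l ` A \<subseteq> Q" unfolding fA[OF l(2)] Q_def by blast
            moreover have "f l ` d' \<subseteq> Q" using lF by (auto simp: F_def)
            ultimately show ?thesis by blast
          qed
          have w: "wff L (\<lambda>s. carr M s \<inter> (A \<union> d)) \<chi>" "FV \<chi> \<subseteq> insert y X" using \<chi>(1) by (auto simp: fms_def)
          have "wff L (\<lambda>s. carr M s \<inter> Q) (pmap (f l) \<chi>)"
            by (rule wff_pmap[OF w(1)]) (use lp auto_carr[OF fa[OF l(2)]] in auto)
          then have 1: "pmap (f l) \<chi> \<in> fms L M (insert y X) Q" using w(2) by (simp add: fms_def)
          have ly: "f l e \<in> carr M (fst y)" using y(2) auto_carr[OF fa[OF l(2)]] by simp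
          have "insert (f l e) Q = Q" using le by blast
          then have 2: "inst {y} (\<lambda>_. f l e) (pmap (f l) \<chi>) \<in> fms L M X Q"
            using fms_inst_single[OF 1 ly y(1)] by simp
          have "u \<in> {u \<in> tuples M X. sat M u (inst {y} (\<lambda>_. f l e) (pmap (f l) \<chi>))}"
            using u(1) u(3)[of l] l by (simp add: sat_inst_single con_def)
          then have "v \<in> {u \<in> tuples M X. sat M u (inst {y} (\<lambda>_. f l e) (pmap (f l) \<chi>))}"
            using sat_set_invariant[OF \<sigma> 2] u(4) by blast
          then show ?thesis by (simp add: sat_inst_single con_def)
        qed
        then show "v \<in> D (Suc r)" using v by (simp add: D_def)
      qed
      show "srk M X Y Z {\<delta>} {\<theta>} k r (D (Suc r) \<inter> {u. sat M u (inst Y ?a \<delta>)})" by (rule srk)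
    qed (use * ge Q in \<open>auto simp: D_def\<close>)
  qed
  from this[OF order_refl] have "srk M X Y Z {\<delta>} {\<theta>} k n {u \<in> tuples M X. sat M u \<phi>}"
    by (rule srk_mono) (auto simp: D_def)
  then show False using \<phi>(2) by blast
qed

text \<open>Symmetry puts \<open>B\<close> and \<open>C\<close> on the left, where left transitivity
  joins them; symmetry then turns the result back.\<close>

theorem tind_trans:
  assumes rosy: "rosy L M" and S: "small_set M S" and C: "small_set M C" and AB: "A \<subseteq> B" "B \<subseteq> C"
    and t: "tind S A B" "tind S B C"
  shows "tind S A C"
proof -
  have small: "small_set M B" "small_set M A" using small_subset[OF C] AB by auto
  have "tind B A S" by (rule tind_sym[OF rosy S small(2,1) t(1)])
  moreover have "tind C B S" by (rule tind_sym[OF rosy S small(1) C t(2)])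
  moreover have "A \<union> B = B" using AB by blast
  ultimately have "tind (B \<union> C) A S" using tind_left_trans by metis
  moreover have "B \<union> C = C" using AB by blast
  ultimately have "tind C A S" by simp
  then show ?thesis by (rule tind_sym[OF rosy C small(2) S])
qed

end

section \<open>The structure of imaginaries\<close>

lemma card_le_image: "|A| \<le>o r \<Longrightarrow> |f ` A| \<le>o r"
  using ordLeq_transitive[OF card_of_image] .

lemma card_le_subset: "A \<subseteq> B \<Longrightarrow> |B| \<le>o r \<Longrightarrow> |A| \<le>o r"
  using ordLeq_transitive[OF card_of_mono1] .

lemma card_le_Un: "infinite K \<Longrightarrow> |A| \<le>o |K| \<Longrightarrow> |B| \<le>o |K| \<Longrightarrow> |A \<union> B| \<le>o |K|"
  by (rule card_of_Un_ordLeq_infinite_Field) (simp_all add: Field_card_of card_of_card_order_on)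

lemma card_le_Times: "infinite K \<Longrightarrow> |A| \<le>o |K| \<Longrightarrow> |B| \<le>o |K| \<Longrightarrow> |A \<times> B| \<le>o |K|"
  by (rule card_of_Times_ordLeq_infinite_Field) (simp_all add: Field_card_of card_of_card_order_on)

lemma card_le_nat: "infinite K \<Longrightarrow> |UNIV :: nat set| \<le>o |K|"
  by (simp add: infinite_iff_card_of_nat)

lemma card_le_nat_UN:
  fixes A :: "nat \<Rightarrow> 'a set"
  shows "infinite K \<Longrightarrow> (\<And>n. |A n| \<le>o |K| ) \<Longrightarrow> |\<Union>n. A n| \<le>o |K|"
  by (rule card_of_UNION_ordLeq_infinite) (auto intro: card_le_nat)

lemma card_le_lists:
  assumes K: "infinite K" and A: "|A| \<le>o |K|"
  shows "|lists A| \<le>o |K|"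
proof -
  have "|{xs \<in> lists A. length xs = n}| \<le>o |K|" for n
  proof (induction n)
    case 0
    have "{xs \<in> lists A. length xs = 0} \<subseteq> (\<lambda>_. []) ` (UNIV :: nat set)" by auto
    then show ?case using card_le_subset card_le_image card_le_nat[OF K] by blast
  next
    case (Suc n)
    have "{xs \<in> lists A. length xs = Suc n} \<subseteq> (\<lambda>(x, xs). x # xs) ` (A \<times> {xs \<in> lists A. length xs = n})"
    proof
      fix xs assume "xs \<in> {xs \<in> lists A. length xs = Suc n}"
      then obtain y ys where "xs = y # ys" "y \<in> A" "ys \<in> lists A" "length ys = n"
        by (cases xs) auto
      then show "xs \<in> (\<lambda>(x, xs). x # xs) ` (A \<times> {xs \<in> lists A. length xs = n})" by force
    qed
    then show ?case by (rule card_le_subset) (intro card_le_image card_le_Times K A Suc)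
  qed
  then have "|\<Union>n. {xs \<in> lists A. length xs = n}| \<le>o |K|" by (rule card_le_nat_UN[OF K])
  then show ?thesis by (rule card_le_subset[rotated]) auto
qed

lemma list_all2_leftD: "list_all2 R xs ys \<Longrightarrow> x \<in> set xs \<Longrightarrow> \<exists>y. R x y"
  by (induction rule: list_all2_induct) auto

text \<open>Stratified by size: a compound term is a function symbol with a list of smaller terms.
  Only well-sorted terms without parameters are counted, because the types of symbols and of
  elements may be larger than \<open>K\<close>.\<close>

lemma card_le_terms:
  assumes K: "infinite K" and L: "|funs L| \<le>o |K|" and V: "|UNIV :: ('s \<times> 'n) set| \<le>o |K|"
  shows "|{t :: ('f, 's \<times> 'n, 'm) trm. \<exists>s. has_sort L (\<lambda>_. {}) t s}| \<le>o |K|"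
proof -
  define T where "T n = {t :: ('f, 's \<times> 'n, 'm) trm. (\<exists>s. has_sort L (\<lambda>_. {}) t s) \<and> size t < n}" for n
  have "|T n| \<le>o |K|" for n
  proof (induction n)
    case 0
    have "T 0 = {}" by (simp add: T_def)
    then show ?case by (simp add: card_of_empty)
  next
    case (Suc n)
    have "T (Suc n) \<subseteq> Var ` UNIV \<union> (\<lambda>(f, ts). Fn f ts) ` (funs L \<times> lists (T n))"
    proof
      fix t assume t: "t \<in> T (Suc n)"
      show "t \<in> Var ` UNIV \<union> (\<lambda>(f, ts). Fn f ts) ` (funs L \<times> lists (T n))"
      proof (cases t)
        case (Fn f ts)
        have "u \<in> T n" if u: "u \<in> set ts" for u
        proof -
          have "size u < size t" using u unfolding Fn by (simp add: size_list_estimation' less_Suc_eq_le)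
          moreover have "\<exists>s. has_sort L (\<lambda>_. {}) u s"
            using t u list_all2_leftD[of "has_sort L (\<lambda>_. {})" ts] unfolding Fn by (auto simp: T_def)
          ultimately show ?thesis using t by (simp add: T_def)
        qed
        moreover have "f \<in> funs L" using t unfolding Fn by (auto simp: T_def)
        ultimately show ?thesis unfolding Fn by force
      qed (use t in \<open>auto simp: T_def\<close>)
    qed
    then show ?case
      by (rule card_le_subset) (intro card_le_Un card_le_image card_le_Times card_le_lists K L V Suc)
  qed
  then have "|\<Union>n. T n| \<le>o |K|" by (rule card_le_nat_UN[OF K])
  then show ?thesis by (rule card_le_subset[rotated]) (auto simp: T_def)
qed

text \<open>The same stratification by size; needed because every parameter-free formula may define
  a sort of imaginaries.\<close>

lemma card_le_formulas:
  assumes K: "infinite K" and L: "|funs L| \<le>o |K|" "|rels L| \<le>o |K|" and V: "|UNIV :: ('s \<times> 'n) set| \<le>o |K|"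
  shows "|{\<phi> :: ('f, 'r, 's \<times> 'n, 'm) fm. wff L (\<lambda>_. {}) \<phi>}| \<le>o |K|"
proof -
  define T where "T = {t :: ('f, 's \<times> 'n, 'm) trm. \<exists>s. has_sort L (\<lambda>_. {}) t s}"
  have T: "|T| \<le>o |K|" unfolding T_def by (rule card_le_terms[OF K L(1) V])
  define F where "F n = {\<phi> :: ('f, 'r, 's \<times> 'n, 'm) fm. wff L (\<lambda>_. {}) \<phi> \<and> size \<phi> < n}" for n
  have "|F n| \<le>o |K|" for n
  proof (induction n)
    case 0
    have "F 0 = {}" by (simp add: F_def)
    then show ?case by (simp add: card_of_empty)
  next
    case (Suc n)
    have "F (Suc n) \<subseteq> (\<lambda>(t, u). Eq t u) ` (T \<times> T) \<union> ((\<lambda>(r, ts). Rl r ts) ` (rels L \<times> lists T) \<union>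
      (Neg ` F n \<union> ((\<lambda>(\<phi>, \<psi>). Conj \<phi> \<psi>) ` (F n \<times> F n) \<union> (\<lambda>(x, \<phi>). All x \<phi>) ` (UNIV \<times> F n))))"
      (is "_ \<subseteq> ?R")
    proof
      fix \<phi> assume \<phi>: "\<phi> \<in> F (Suc n)"
      show "\<phi> \<in> ?R"
      proof (cases \<phi>)
        case (Eq t u)
        then have "(t, u) \<in> T \<times> T" using \<phi> by (auto simp: F_def T_def)
        then show ?thesis unfolding Eq by force
      next
        case (Rl r ts)
        then have "(r, ts) \<in> rels L \<times> lists T"
          using \<phi> list_all2_leftD[of "has_sort L (\<lambda>_. {})" ts] by (auto simp: F_def T_def)
        then show ?thesis unfolding Rl by force
      next
        case (Neg \<psi>)
        then have "\<psi> \<in> F n" using \<phi> by (auto simp: F_def)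
        then show ?thesis unfolding Neg by blast
      next
        case (Conj \<psi> \<chi>)
        then have "(\<psi>, \<chi>) \<in> F n \<times> F n" using \<phi> by (auto simp: F_def)
        then show ?thesis unfolding Conj by force
      next
        case (All x \<psi>)
        then have "(x, \<psi>) \<in> UNIV \<times> F n" using \<phi> by (auto simp: F_def)
        then show ?thesis unfolding All by force
      qed
    qed
    then show ?case
      by (rule card_le_subset) (intro card_le_Un card_le_image card_le_Times card_le_lists K L V T Suc)
  qed
  then have "|\<Union>n. F n| \<le>o |K|" by (rule card_le_nat_UN[OF K])
  then show ?thesis by (rule card_le_subset[rotated]) (auto simp: F_def)
qed

lemma eval_carr:
  assumes "is_struc L M" "has_sort L P t s" "\<And>s. P s \<subseteq> carr M s" "\<And>x. x \<in> tvars t \<Longrightarrow> e x \<in> carr M (fst x)"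
  shows "eval M e t \<in> carr M s"
  using assms(2,4)
proof (induction t arbitrary: s)
  case (Par c)
  then show ?case using assms(3) by auto
next
  case (Fn f ts)
  have "eval M e t \<in> carr M s" if "t \<in> set ts" "has_sort L P t s" for t s
    using that by (intro Fn.IH Fn.prems(2)) auto
  then have "list_all2 (\<lambda>c s. c \<in> carr M s) (map (eval M e) ts) (fargs L f)"
    using Fn.prems(1) by (auto simp: list_all2_conv_all_nth)
  then show ?case using assms(1) Fn.prems(1) by (auto simp: is_struc_def)
qed auto

section \<open>Blocks of quantifiers\<close>

definition upd :: "('v \<Rightarrow> 'm) \<Rightarrow> 'v list \<Rightarrow> 'm list \<Rightarrow> 'v \<Rightarrow> 'm" where
  "upd e xs cs = (\<lambda>x. case map_of (zip xs cs) x of Some c \<Rightarrow> c | None \<Rightarrow> e x)"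

lemma upd_Cons: "x \<notin> set xs \<Longrightarrow> upd e (x # xs) (c # cs) = upd (e(x := c)) xs cs"
proof
  fix z assume x: "x \<notin> set xs"
  show "upd e (x # xs) (c # cs) z = upd (e(x := c)) xs cs z"
  proof (cases "z = x")
    case True
    then have "map_of (zip xs cs) z = None" using x by (auto simp: map_of_eq_None_iff dest: set_zip_leftD)
    then show ?thesis using True by (simp add: upd_def)
  qed (simp add: upd_def split: option.split)
qed

lemma upd_notin: "x \<notin> set xs \<Longrightarrow> upd e xs cs x = e x"
  by (auto simp: upd_def map_of_eq_None_iff dest: set_zip_leftD split: option.split dest!: map_of_SomeD)

lemma upd_map: "distinct xs \<Longrightarrow> length cs = length xs \<Longrightarrow> map (upd e xs cs) xs = cs"
  by (rule nth_equalityI) (auto simp: upd_def map_of_zip_nth)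

lemma sat_foldr_All:
  fixes M :: "(unit, 'f, 'r, 'm) struc"
  assumes "distinct xs"
  shows "sat M e (foldr All xs \<phi>) \<longleftrightarrow> (\<forall>cs\<in>ntuples M (length xs). sat M (upd e xs cs) \<phi>)"
  using assms
proof (induction xs arbitrary: e)
  case Nil
  have "upd e [] [] = e" by (simp add: upd_def fun_eq_iff)
  then show ?case by (simp add: ntuples_def)
next
  case (Cons x xs)
  have u: "carr M s = univ M" for s by (auto simp: univ_def)
  have "sat M e (foldr All (x # xs) \<phi>) \<longleftrightarrow>
      (\<forall>c\<in>univ M. \<forall>cs\<in>ntuples M (length xs). sat M (upd (e(x := c)) xs cs) \<phi>)"
    using Cons by (simp add: u del: fun_upd_apply)
  also have "\<dots> \<longleftrightarrow> (\<forall>c\<in>univ M. \<forall>cs\<in>ntuples M (length xs). sat M (upd e (x # xs) (c # cs)) \<phi>)"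
    using Cons.prems by (simp add: upd_Cons)
  also have "\<dots> \<longleftrightarrow> (\<forall>cs\<in>ntuples M (length (x # xs)). sat M (upd e (x # xs) cs) \<phi>)"
  proof
    assume a: "\<forall>c\<in>univ M. \<forall>cs\<in>ntuples M (length xs). sat M (upd e (x # xs) (c # cs)) \<phi>"
    show "\<forall>cs\<in>ntuples M (length (x # xs)). sat M (upd e (x # xs) cs) \<phi>"
    proof
      fix cs assume "cs \<in> ntuples M (length (x # xs))"
      then obtain d ds where "cs = d # ds" "d \<in> univ M" "ds \<in> ntuples M (length xs)"
        by (cases cs) (auto simp: ntuples_def)
      then show "sat M (upd e (x # xs) cs) \<phi>" using a by blast
    qed
  qed (auto simp: ntuples_def)
  finally show ?case .
qed

lemma wff_foldr_All: "wff L P (foldr All xs \<phi>) \<longleftrightarrow> (\<forall>x\<in>set xs. fst x \<in> sorts L) \<and> wff L P \<phi>"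
  by (induction xs) auto

lemma FV_foldr_All: "FV (foldr All xs \<phi>) = FV \<phi> - set xs"
  by (induction xs) auto

section \<open>Translation of formulas about imaginaries into the base language\<close>

locale monster =
  fixes L :: "(unit, 'f, 'r) signature" and T :: "('f, 'r, 'm) base_fm set"
    and M :: "(unit, 'f, 'r, 'm) struc"
  assumes monster: "monster_model L T M"
begin

abbreviation Leq :: "(('f, 'r, 'm) eq_sort, ('f, 'r, 'm) eq_fun, 'r) signature" where
  "Leq \<equiv> eq_sig L M"

abbreviation Meq :: "(('f, 'r, 'm) eq_sort, ('f, 'r, 'm) eq_fun, 'r, ('f, 'r, 'm) eq_elem) struc" where
  "Meq \<equiv> eq_struc L M"

lemma struc: "is_struc L M"
  using monster by (simp add: monster_model_def models_def)

lemma carr_univ: "carr M s = univ M"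
  by (auto simp: univ_def)

lemma infinite_univ: "infinite (univ M)"
proof -
  have "|UNIV :: nat set| \<le>o |funs L <+> rels L <+> (UNIV :: nat set)|"
    by (rule card_of_ordLeqI[of "Inr \<circ> Inr"]) (auto simp: inj_on_def)
  also have "|funs L <+> rels L <+> (UNIV :: nat set)| <o |univ M|"
    using monster by (simp add: monster_model_def)
  finally show ?thesis by (simp add: infinite_iff_card_of_nat ordLess_imp_ordLeq)
qed

lemma language_card: "|funs L| \<le>o |univ M|" "|rels L| \<le>o |univ M|"
proof -
  have l: "|funs L <+> rels L <+> (UNIV :: nat set)| \<le>o |univ M|"
    using monster by (simp add: monster_model_def ordLess_imp_ordLeq)
  have "|funs L| \<le>o |funs L <+> rels L <+> (UNIV :: nat set)|"
    by (rule card_of_ordLeqI[of Inl]) (auto simp: inj_on_def)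
  then show "|funs L| \<le>o |univ M|" using l ordLeq_transitive by blast
  have "|rels L| \<le>o |funs L <+> rels L <+> (UNIV :: nat set)|"
    by (rule card_of_ordLeqI[of "Inr \<circ> Inl"]) (auto simp: inj_on_def)
  then show "|rels L| \<le>o |univ M|" using l ordLeq_transitive by blast
qed

lemma sorts: "s \<in> sorts L"
proof -
  have "univ M \<noteq> {}" using infinite_univ by auto
  then have "carr M s \<noteq> {}" by (simp add: carr_univ)
  then show ?thesis using struc by (simp add: is_struc_def)
qed

text \<open>\<open>monster_model\<close> speaks of complete types only, so the set is first
  completed; a complete finitely satisfiable set is closed under conjunction.\<close>

lemma saturation:
  fixes X :: "(unit \<times> nat) set"
  assumes "small_set M A" "finite X" "\<Sigma> \<subseteq> fms L M X A" "finsat M X \<Sigma>"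
  obtains e where "realizes M X e \<Sigma>"
proof -
  obtain p where p: "\<Sigma> \<subseteq> p" "p \<subseteq> fms L M X A" "finsat M X p"
    "\<And>\<phi>. \<phi> \<in> fms L M X A \<Longrightarrow> \<phi> \<in> p \<or> Neg \<phi> \<in> p"
    using finsat_extend[OF assms(4,3)] by metis
  have sat: "\<exists>e\<in>tuples M X. sat M e \<phi>" if "\<phi> \<in> p" for \<phi>
  proof -
    have "\<exists>e\<in>tuples M X. \<forall>\<psi>\<in>{\<phi>}. sat M e \<psi>" using p(3) that unfolding finsat_def by blast
    then show ?thesis by simp
  qed
  have "Conj \<phi> \<psi> \<in> p" if "\<phi> \<in> p" "\<psi> \<in> p" for \<phi> \<psi>
  proof (rule finsat_complete_mem[OF p(3,4), where F = "{\<phi>, \<psi>}"])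
    show "Conj \<phi> \<psi> \<in> fms L M X A" using that p(2) by (auto simp: fms_def)
  qed (use that in auto)
  moreover have "p \<noteq> {}"
  proof -
    have "All ((), 0) (Eq (Var ((), 0)) (Var ((), 0))) \<in> fms L M X A"
      using sorts by (auto simp: fms_def)
    then show ?thesis using p(4) by blast
  qed
  ultimately have "p \<in> complete_types L M X A"
    using p(2,4) sat by (simp add: complete_types_def partial_type_def)
  then obtain e where "realizes M X e p" using monster assms(1,2) unfolding monster_model_def by blast
  then show ?thesis using that p(1) by (auto simp: realizes_def)
qed

text \<open>The number of home elements that represent one element of the sort. \<open>valu\<close>
  leads from a representative to the element, and \<open>rp\<close> chooses a
  representative.\<close>

fun ar :: "('f, 'r, 'm) eq_sort \<Rightarrow> nat" where
  "ar Home = 1"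
| "ar (Quot n E) = n"

fun valu :: "('f, 'r, 'm) eq_sort \<Rightarrow> 'm list \<Rightarrow> ('f, 'r, 'm) eq_elem" where
  "valu Home ms = Real (hd ms)"
| "valu (Quot n E) ms = Cls n E (def_rel M n E `` {ms})"

fun rp :: "('f, 'r, 'm) eq_elem \<Rightarrow> 'm list" where
  "rp (Real m) = [m]"
| "rp (Cls n E C) = (SOME ms. ms \<in> ntuples M n \<and> def_rel M n E `` {ms} = C)"

lemma eq_simps [simp]: "carr Meq = eq_carr L M" "fn Meq = eq_fn M" "rl Meq r = map Real ` rl M r"
  "sorts Leq = {Home} \<union> {Quot n E |n E. def_equiv L M n E}"
  "funs Leq = Base ` funs L \<union> {Proj n E |n E. def_equiv L M n E}" "rels Leq = rels L"
  "fargs Leq = eq_fargs L" "fres Leq = eq_fres" "rargs Leq r = map (\<lambda>_. Home) (rargs L r)"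
  by (simp_all add: eq_struc_def eq_sig_def)

lemma carr_valu:
  assumes "c \<in> eq_carr L M s"
  shows "rp c \<in> ntuples M (ar s)" "valu s (rp c) = c"
proof -
  have "rp c \<in> ntuples M (ar s) \<and> valu s (rp c) = c"
  proof (cases s)
    case Home
    then show ?thesis using assms by (auto simp: ntuples_def)
  next
    case (Quot n E)
    then obtain ms where ms: "ms \<in> ntuples M n" "c = Cls n E (def_rel M n E `` {ms})"
      using assms by (auto simp: quotient_def split: if_splits)
    have "\<exists>ms'. ms' \<in> ntuples M n \<and> def_rel M n E `` {ms'} = def_rel M n E `` {ms}" using ms(1) by blast
    then have "rp c \<in> ntuples M n \<and> def_rel M n E `` {rp c} = def_rel M n E `` {ms}"
      unfolding ms(2) rp.simps by (rule someI_ex)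
    then show ?thesis using Quot ms(2) by simp
  qed
  then show "rp c \<in> ntuples M (ar s)" "valu s (rp c) = c" by auto
qed

lemma valu_carr: "s \<in> sorts Leq \<Longrightarrow> ms \<in> ntuples M (ar s) \<Longrightarrow> valu s ms \<in> eq_carr L M s"
  by (cases s) (auto simp: ntuples_def quotient_def, case_tac ms, auto)

definition trl_ok :: "('s \<times> 'n \<Rightarrow> ('f, unit \<times> nat, 'm) trm list) \<Rightarrow> ('s \<Rightarrow> nat) \<Rightarrow> 'm set \<Rightarrow> 's \<times> 'n \<Rightarrow> bool" where
  "trl_ok \<tau> a A v \<longleftrightarrow> length (\<tau> v) = a (fst v) \<and> (\<forall>u\<in>set (\<tau> v). has_sort L (\<lambda>s. carr M s \<inter> A) u ())"

text \<open>A projection is not applied: the class is represented by the tuple of its arguments.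
  These are of the home sort and translate into singletons, whence \<open>hd\<close>.\<close>

primrec trl :: "('v \<Rightarrow> ('f, unit \<times> nat, 'm) trm list) \<Rightarrow> (('f, 'r, 'm) eq_fun, 'v, ('f, 'r, 'm) eq_elem) trm
    \<Rightarrow> ('f, unit \<times> nat, 'm) trm list" where
  "trl \<tau> (Var v) = \<tau> v"
| "trl \<tau> (Par c) = map Par (rp c)"
| "trl \<tau> (Fn g ts) = (case g of Base f \<Rightarrow> [Fn f (map hd (map (trl \<tau>) ts))] | Proj n E \<Rightarrow> map hd (map (trl \<tau>) ts))"

abbreviation val :: "(('f, 'r, 'm) eq_sort \<times> 'n \<Rightarrow> ('f, unit \<times> nat, 'm) trm list) \<Rightarrow> (unit \<times> nat \<Rightarrow> 'm)
    \<Rightarrow> ('f, 'r, 'm) eq_sort \<times> 'n \<Rightarrow> ('f, 'r, 'm) eq_elem" where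
  "val \<tau> e \<equiv> (\<lambda>v. valu (fst v) (map (eval M e) (\<tau> v)))"

lemma trl_props:
  fixes \<tau> :: "('f, 'r, 'm) eq_sort \<times> 'n \<Rightarrow> ('f, unit \<times> nat, 'm) trm list"
  assumes "has_sort Leq (\<lambda>s. eq_carr L M s \<inter> A) t s" "\<And>v. v \<in> tvars t \<Longrightarrow> trl_ok \<tau> ar (\<Union>c\<in>A. set (rp c)) v"
  shows "length (trl \<tau> t) = ar s \<and> (\<forall>u\<in>set (trl \<tau> t). has_sort L (\<lambda>s. carr M s \<inter> (\<Union>c\<in>A. set (rp c))) u () \<and>
      tvars u \<subseteq> (\<Union>v\<in>tvars t. \<Union>u\<in>set (\<tau> v). tvars u)) \<and>
    (\<forall>e. eval Meq (val \<tau> e) t = valu s (map (eval M e) (trl \<tau> t)))"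
  using assms
proof (induction t arbitrary: s)
  case (Var v)
  then show ?case by (auto simp: trl_ok_def)
next
  case (Par c)
  then have c: "c \<in> eq_carr L M s" "c \<in> A" by auto
  have "rp c \<in> ntuples M (ar s)" "valu s (rp c) = c" by (rule carr_valu[OF c(1)])+
  then show ?case using c(2) by (auto simp: ntuples_def carr_univ comp_def)
next
  case (Fn g ts)
  let ?A = "\<Union>c\<in>A. set (rp c)"
  define W where "W = (\<Union>v\<in>tvars (Fn g ts). \<Union>u\<in>set (\<tau> v). tvars u)"
  have args: "length ts = length (fargs Leq g) \<and> (\<forall>i<length ts. fargs Leq g ! i = Home)"
    using Fn.prems(1) by (cases g) (auto dest: list_all2_lengthD)
  have g: "g \<in> funs Leq" "eq_fres g = s" using Fn.prems(1) by auto
  have arg: "has_sort L (\<lambda>s. carr M s \<inter> ?A) (hd (trl \<tau> t)) () \<and> tvars (hd (trl \<tau> t)) \<subseteq> W \<and>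
    (\<forall>e. eval Meq (val \<tau> e) t = Real (eval M e (hd (trl \<tau> t))))" if t: "t \<in> set ts" for t
  proof -
    have "has_sort Leq (\<lambda>s. eq_carr L M s \<inter> A) t Home"
      using t Fn.prems(1) args by (auto simp: list_all2_conv_all_nth in_set_conv_nth)
    moreover have "trl_ok \<tau> ar ?A v" if "v \<in> tvars t" for v using that t by (intro Fn.prems(2)) auto
    ultimately have IH: "length (trl \<tau> t) = 1" "\<forall>u\<in>set (trl \<tau> t). has_sort L (\<lambda>s. carr M s \<inter> ?A) u () \<and>
      tvars u \<subseteq> (\<Union>v\<in>tvars t. \<Union>u\<in>set (\<tau> v). tvars u)"
      "\<forall>e. eval Meq (val \<tau> e) t = valu Home (map (eval M e) (trl \<tau> t))" using Fn.IH[OF t, of Home] by auto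
    obtain u where u: "trl \<tau> t = [u]" using IH(1) by (cases "trl \<tau> t") auto
    have "tvars u \<subseteq> (\<Union>v\<in>tvars t. \<Union>u\<in>set (\<tau> v). tvars u)" using IH(2) u by simp
    also have "\<dots> \<subseteq> W" unfolding W_def using t by auto
    finally show ?thesis using IH(2,3) u by simp
  qed
  define us where "us = map (\<lambda>t. hd (trl \<tau> t)) ts"
  have us: "length us = length ts" "\<And>u. u \<in> set us \<Longrightarrow> has_sort L (\<lambda>s. carr M s \<inter> ?A) u () \<and> tvars u \<subseteq> W"
    using arg by (auto simp: us_def)
  have ev: "map real_of (map (eval Meq (val \<tau> e)) ts) = map (eval M e) us" for e
    using arg by (auto simp: us_def)
  show ?case
  proof (cases g)
    case (Base f)
    have f: "f \<in> funs L" "length ts = length (fargs L f)" using g Base args by auto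
    have "has_sort L (\<lambda>s. carr M s \<inter> ?A) (Fn f us) ()"
      using f us by (auto simp: list_all2_conv_all_nth)
    moreover have "tvars (Fn f us) \<subseteq> W" using us by auto
    moreover have "trl \<tau> (Fn g ts) = [Fn f us]" by (simp add: Base us_def comp_def)
    moreover have "s = Home" using g Base by simp
    moreover have "eval Meq (val \<tau> e) (Fn g ts) = Real (eval M e (Fn f us))" for e
      using ev[of e] by (simp add: Base)
    ultimately show ?thesis by (simp add: W_def)
  next
    case (Proj n E)
    have "trl \<tau> (Fn g ts) = us" by (simp add: Proj us_def comp_def)
    moreover have "s = Quot n E" using g Proj by simp
    moreover have "length us = n" using us(1) args Proj by simp
    moreover have "eval Meq (val \<tau> e) (Fn g ts) = valu (Quot n E) (map (eval M e) us)" for e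
      using ev[of e] by (simp add: Proj)
    ultimately show ?thesis using us(2) by (simp add: W_def)
  qed
qed

lemma trl_univ:
  assumes "\<forall>u\<in>set us. has_sort L (\<lambda>s. carr M s \<inter> A) u ()" "\<And>x. e x \<in> univ M" "length us = n"
  shows "map (eval M e) us \<in> ntuples M n"
proof -
  have "eval M e u \<in> univ M" if "u \<in> set us" for u
    using eval_carr[OF struc, of "\<lambda>s. carr M s \<inter> A" u "()" e] assms(1,2) that by (simp add: carr_univ)
  then show ?thesis using assms(3) by (auto simp: ntuples_def)
qed

text \<open>A variable \<open>v\<close> of sort \<open>Quot n E\<close> is translated into the list \<open>\<tau> v\<close> of \<open>n\<close> terms of the base language,
  which denote the entries of a representative of the class.\<close>

lemma translate_formula:
  fixes \<tau> :: "('f, 'r, 'm) eq_sort \<times> 'n \<Rightarrow> ('f, unit \<times> nat, 'm) trm list"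
  assumes "wff Leq (\<lambda>s. eq_carr L M s \<inter> A) \<phi>" "\<And>v. v \<in> FV \<phi> \<Longrightarrow> trl_ok \<tau> ar (\<Union>c\<in>A. set (rp c)) v"
  shows "\<exists>\<phi>'. wff L (\<lambda>s. carr M s \<inter> (\<Union>c\<in>A. set (rp c))) \<phi>' \<and> FV \<phi>' \<subseteq> (\<Union>v\<in>FV \<phi>. \<Union>u\<in>set (\<tau> v). tvars u) \<and>
    (\<forall>e. (\<forall>x. e x \<in> univ M) \<longrightarrow> (sat M e \<phi>' \<longleftrightarrow> sat Meq (val \<tau> e) \<phi>))"
  using assms
proof (induction \<phi> arbitrary: \<tau>)
  case (Eq t u)
  let ?A = "\<Union>c\<in>A. set (rp c)" let ?V = "\<Union>v\<in>tvars t \<union> tvars u. \<Union>w\<in>set (\<tau> v). tvars w"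
  obtain s where s: "s \<in> sorts Leq" "has_sort Leq (\<lambda>s. eq_carr L M s \<inter> A) t s"
    "has_sort Leq (\<lambda>s. eq_carr L M s \<inter> A) u s" using Eq.prems(1) by auto
  have t: "length (trl \<tau> t) = ar s" "\<forall>w\<in>set (trl \<tau> t). has_sort L (\<lambda>s. carr M s \<inter> ?A) w () \<and> tvars w \<subseteq> ?V"
    "\<And>e. eval Meq (val \<tau> e) t = valu s (map (eval M e) (trl \<tau> t))"
    using trl_props[OF s(2), of \<tau>] Eq.prems(2) by fastforce+
  have u: "length (trl \<tau> u) = ar s" "\<forall>w\<in>set (trl \<tau> u). has_sort L (\<lambda>s. carr M s \<inter> ?A) w () \<and> tvars w \<subseteq> ?V"
    "\<And>e. eval Meq (val \<tau> e) u = valu s (map (eval M e) (trl \<tau> u))"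
    using trl_props[OF s(3), of \<tau>] Eq.prems(2) by fastforce+
  show ?case
  proof (cases s)
    case Home
    obtain t' u' where eq: "trl \<tau> t = [t']" "trl \<tau> u = [u']"
      using t(1) u(1) Home by (auto simp: length_Suc_conv)
    show ?thesis
      by (intro exI[of _ "Eq t' u'"]) (use t u eq Home sorts in auto)
  next
    case (Quot n E)
    \<comment> \<open>Two classes are equal iff their representatives are related, so the equation
      becomes \<open>E\<close> with its 2n variables replaced by the terms for the two
      representatives.\<close>
    let ?ts = "trl \<tau> t @ trl \<tau> u"
    have E: "E \<in> fms0 L {((), i) |i. i < 2 * n}" "equiv (ntuples M n) (def_rel M n E)"
      using s(1) Quot by (auto simp: def_equiv_def)
    have len: "length ?ts = 2 * n" using t(1) u(1) Quot by simp
    have w: "wff L (\<lambda>_. {}) E" and FV: "FV E \<subseteq> {((), i) |i. i < 2 * n}" using E(1) by (auto simp: fms0_def)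
    have in_ts: "?ts ! snd x \<in> set ?ts" if "x \<in> FV E" for x
      using that FV len by (intro nth_mem) auto
    have so: "has_sort L (\<lambda>s. carr M s \<inter> ?A) (?ts ! snd x) (fst x)" if "x \<in> FV E" for x
      using in_ts[OF that] t(2) u(2) by auto
    have tv: "tvars (?ts ! snd x) \<subseteq> ?V" if "x \<in> FV E" for x
    proof -
      have "?ts ! snd x \<in> set (trl \<tau> t) \<or> ?ts ! snd x \<in> set (trl \<tau> u)" using in_ts[OF that] by simp
      then show ?thesis using t(2) u(2) by blast
    qed
    have p: "pars E = {}" by (rule pars_fms0[OF E(1)])
    obtain E' where E': "wff L (\<lambda>s. carr M s \<inter> ?A) E'" "FV E' \<subseteq> (\<Union>x\<in>FV E. tvars (?ts ! snd x))"
      "\<And>e. sat M e E' \<longleftrightarrow> sat M (\<lambda>x. eval M e (?ts ! snd x)) E"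
      using substitution[where \<tau> = "\<lambda>x. ?ts ! snd x" and \<rho> = Par, OF infinite_UNIV_nat w so] p
      by (auto simp: fm.map_ident)
    \<comment> \<open>The values must lie in the universe: \<open>def_rel\<close> relates no other
      tuples, and two of these would have the same empty class without being related.\<close>
    have "sat M e E' \<longleftrightarrow> sat Meq (val \<tau> e) (Eq t u)" if e: "\<forall>x. e x \<in> univ M" for e
    proof -
      let ?as = "map (eval M e) (trl \<tau> t)" let ?bs = "map (eval M e) (trl \<tau> u)"
      have n: "?as \<in> ntuples M n" "?bs \<in> ntuples M n"
        using trl_univ[of "trl \<tau> t" ?A e n] trl_univ[of "trl \<tau> u" ?A e n] t(1,2) u(1,2) e Quot by auto
      have "sat M e E' \<longleftrightarrow> sat M (\<lambda>x. (?as @ ?bs) ! snd x) E"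
        unfolding E'(3)
      proof (rule sat_cong)
        fix x assume "x \<in> FV E"
        then have "snd x < length ?ts" using FV len by auto
        then show "eval M e (?ts ! snd x) = (?as @ ?bs) ! snd x"
          by (metis map_append nth_map)
      qed
      also have "\<dots> \<longleftrightarrow> (?as, ?bs) \<in> def_rel M n E" using n by (simp add: def_rel_def)
      also have "\<dots> \<longleftrightarrow> def_rel M n E `` {?as} = def_rel M n E `` {?bs}"
        using eq_equiv_class_iff[OF E(2) n] by simp
      also have "\<dots> \<longleftrightarrow> sat Meq (val \<tau> e) (Eq t u)" using t(3) u(3) Quot by simp
      finally show ?thesis .
    qed
    moreover have "FV E' \<subseteq> ?V" using E'(2) UN_least[of "FV E" _ ?V, OF tv] by (rule order_trans)
    ultimately show ?thesis using E'(1) by (intro exI[of _ E']) simp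
  qed
next
  case (Rl r ts)
  let ?A = "\<Union>c\<in>A. set (rp c)" let ?V = "\<Union>v\<in>FV (Rl r ts). \<Union>u\<in>set (\<tau> v). tvars u"
  have r: "r \<in> rels L" "length ts = length (rargs L r)" using Rl.prems(1) by (auto dest: list_all2_lengthD)
  have arg: "has_sort L (\<lambda>s. carr M s \<inter> ?A) (hd (trl \<tau> t)) () \<and> tvars (hd (trl \<tau> t)) \<subseteq> ?V \<and>
    (\<forall>e. eval Meq (val \<tau> e) t = Real (eval M e (hd (trl \<tau> t))))" if t: "t \<in> set ts" for t
  proof -
    have s: "has_sort Leq (\<lambda>s. eq_carr L M s \<inter> A) t Home"
      using t Rl.prems(1) r by (auto simp: list_all2_conv_all_nth in_set_conv_nth)
    have ok: "trl_ok \<tau> ar ?A v" if "v \<in> tvars t" for v using that t by (intro Rl.prems(2)) auto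
    have IH: "length (trl \<tau> t) = 1" "\<forall>u\<in>set (trl \<tau> t). has_sort L (\<lambda>s. carr M s \<inter> ?A) u () \<and>
      tvars u \<subseteq> (\<Union>v\<in>tvars t. \<Union>u\<in>set (\<tau> v). tvars u)"
      "\<forall>e. eval Meq (val \<tau> e) t = valu Home (map (eval M e) (trl \<tau> t))" using trl_props[OF s ok] by auto
    obtain u where u: "trl \<tau> t = [u]" using IH(1) by (cases "trl \<tau> t") auto
    have "tvars u \<subseteq> (\<Union>v\<in>tvars t. \<Union>u\<in>set (\<tau> v). tvars u)" using IH(2) u by simp
    also have "\<dots> \<subseteq> ?V" using t by auto
    finally show ?thesis using IH(2,3) u by simp
  qed
  define us where "us = map (\<lambda>t. hd (trl \<tau> t)) ts"
  have us: "length us = length ts" "\<And>u. u \<in> set us \<Longrightarrow> has_sort L (\<lambda>s. carr M s \<inter> ?A) u () \<and> tvars u \<subseteq> ?V"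
    using arg by (auto simp: us_def)
  have "wff L (\<lambda>s. carr M s \<inter> ?A) (Rl r us)" using r us by (auto simp: list_all2_conv_all_nth)
  moreover have "FV (Rl r us) \<subseteq> ?V" using us(2) by auto
  moreover have "sat M e (Rl r us) \<longleftrightarrow> sat Meq (val \<tau> e) (Rl r ts)" for e
  proof -
    have ev: "map (eval Meq (val \<tau> e)) ts = map Real (map (eval M e) us)" using arg by (simp add: us_def)
    have "inj (map Real :: 'm list \<Rightarrow> ('f, 'r, 'm) eq_elem list)" by (simp add: inj_def)
    from inj_image_mem_iff[OF this, of "map (eval M e) us" "rl M r"]
    show ?thesis unfolding sat.simps eq_simps ev ..
  qed
  ultimately show ?case by blast
next
  case (Neg \<phi>)
  obtain \<phi>' where "wff L (\<lambda>s. carr M s \<inter> (\<Union>c\<in>A. set (rp c))) \<phi>'" "FV \<phi>' \<subseteq> (\<Union>v\<in>FV \<phi>. \<Union>u\<in>set (\<tau> v). tvars u)"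
    "\<forall>e. (\<forall>x. e x \<in> univ M) \<longrightarrow> (sat M e \<phi>' \<longleftrightarrow> sat Meq (val \<tau> e) \<phi>)"
    using Neg.IH[of \<tau>] Neg.prems by auto
  then show ?case by (intro exI[of _ "Neg \<phi>'"]) auto
next
  case (Conj \<phi> \<psi>)
  obtain \<phi>' where 1: "wff L (\<lambda>s. carr M s \<inter> (\<Union>c\<in>A. set (rp c))) \<phi>'" "FV \<phi>' \<subseteq> (\<Union>v\<in>FV \<phi>. \<Union>u\<in>set (\<tau> v). tvars u)"
    "\<forall>e. (\<forall>x. e x \<in> univ M) \<longrightarrow> (sat M e \<phi>' \<longleftrightarrow> sat Meq (val \<tau> e) \<phi>)"
    using Conj.IH(1)[of \<tau>] Conj.prems by auto
  obtain \<psi>' where 2: "wff L (\<lambda>s. carr M s \<inter> (\<Union>c\<in>A. set (rp c))) \<psi>'" "FV \<psi>' \<subseteq> (\<Union>v\<in>FV \<psi>. \<Union>u\<in>set (\<tau> v). tvars u)"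
    "\<forall>e. (\<forall>x. e x \<in> univ M) \<longrightarrow> (sat M e \<psi>' \<longleftrightarrow> sat Meq (val \<tau> e) \<psi>)"
    using Conj.IH(2)[of \<tau>] Conj.prems by auto
  show ?case using 1 2 by (intro exI[of _ "Conj \<phi>' \<psi>'"] conjI) auto
next
  case (All v \<phi>)
  let ?A = "\<Union>c\<in>A. set (rp c)" let ?V = "\<Union>w\<in>FV \<phi> - {v}. \<Union>u\<in>set (\<tau> w). tvars u"
  define n where "n = ar (fst v)"
  have "finite (snd ` ?V)" by auto
  \<comment> \<open>One quantifier over a sort becomes a block of \<open>n\<close> quantifiers over
    the home sort; names from \<open>N\<close> on avoid every variable of the terms that are in
    scope.\<close>
  then obtain N where N: "\<And>x. x \<in> ?V \<Longrightarrow> snd x < N" using finite_nat_set_iff_bounded by (metis imageI)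
  define ys where "ys = map (\<lambda>i. ((), N + i)) [0..<n]"
  have ys: "distinct ys" "length ys = n" by (auto simp: ys_def distinct_map inj_on_def)
  have yV: "set ys \<inter> ?V = {}" using N by (force simp: ys_def)
  define \<tau>' where "\<tau>' = \<tau>(v := map Var ys)"
  have ok: "trl_ok \<tau>' ar ?A w" if "w \<in> FV \<phi>" for w
  proof (cases "w = v")
    case True
    then show ?thesis using ys(2) by (auto simp: \<tau>'_def trl_ok_def n_def)
  next
    case False
    then show ?thesis using All.prems(2)[of w] that by (simp add: \<tau>'_def trl_ok_def)
  qed
  have w: "wff Leq (\<lambda>s. eq_carr L M s \<inter> A) \<phi>" and s: "fst v \<in> sorts Leq" using All.prems(1) by auto
  from All.IH[OF w ok] obtain \<phi>' where \<phi>': "wff L (\<lambda>s. carr M s \<inter> ?A) \<phi>'"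
    "FV \<phi>' \<subseteq> (\<Union>v\<in>FV \<phi>. \<Union>u\<in>set (\<tau>' v). tvars u)"
    "\<And>e. \<forall>x. e x \<in> univ M \<Longrightarrow> sat M e \<phi>' \<longleftrightarrow> sat Meq (val \<tau>' e) \<phi>" by blast
  have "wff L (\<lambda>s. carr M s \<inter> ?A) (foldr All ys \<phi>')" using \<phi>'(1) sorts by (simp add: wff_foldr_All)
  moreover have "FV (foldr All ys \<phi>') \<subseteq> ?V"
  proof
    fix x assume "x \<in> FV (foldr All ys \<phi>')"
    then have x: "x \<in> FV \<phi>'" "x \<notin> set ys" by (auto simp: FV_foldr_All)
    then obtain w u where wu: "w \<in> FV \<phi>" "u \<in> set (\<tau>' w)" "x \<in> tvars u" using \<phi>'(2) by blast
    then have "w \<noteq> v" using x(2) by (auto simp: \<tau>'_def)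
    then show "x \<in> ?V" using wu by (auto simp: \<tau>'_def)
  qed
  moreover have "sat M e (foldr All ys \<phi>') \<longleftrightarrow> sat Meq (val \<tau> e) (All v \<phi>)" if e: "\<forall>x. e x \<in> univ M" for e
  proof -
    have "sat M (upd e ys cs) \<phi>' \<longleftrightarrow> sat Meq ((val \<tau> e)(v := valu (fst v) cs)) \<phi>" if cs: "cs \<in> ntuples M n" for cs
    proof -
      have "upd e ys cs x \<in> univ M" for x
      proof (cases "map_of (zip ys cs) x")
        case None
        then show ?thesis using spec[OF e, of x] by (simp add: upd_def)
      next
        case (Some c)
        then have "c \<in> set cs" by (auto dest!: map_of_SomeD set_zip_rightD)
        then show ?thesis using Some cs by (auto simp: upd_def ntuples_def)
      qed
      then have "sat M (upd e ys cs) \<phi>' \<longleftrightarrow> sat Meq (val \<tau>' (upd e ys cs)) \<phi>" using \<phi>'(3) by blast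
      also have "\<dots> \<longleftrightarrow> sat Meq ((val \<tau> e)(v := valu (fst v) cs)) \<phi>"
      proof (rule sat_cong)
        fix w assume w: "w \<in> FV \<phi>"
        show "val \<tau>' (upd e ys cs) w = ((val \<tau> e)(v := valu (fst v) cs)) w"
        proof (cases "w = v")
          case True
          have "map (eval M (upd e ys cs)) (map Var ys) = map (upd e ys cs) ys" by simp
          also have "\<dots> = cs" by (rule upd_map[OF ys(1)]) (use cs ys(2) in \<open>simp add: ntuples_def\<close>)
          finally show ?thesis using True by (simp add: \<tau>'_def)
        next
          case False
          have "eval M (upd e ys cs) u = eval M e u" if u: "u \<in> set (\<tau> w)" for u
          proof (rule eval_cong)
            fix x assume "x \<in> tvars u"
            then have "x \<in> ?V" using u w False by blast
            then have "x \<notin> set ys" using yV by blast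
            then show "upd e ys cs x = e x" by (rule upd_notin)
          qed
          then have "map (eval M (upd e ys cs)) (\<tau> w) = map (eval M e) (\<tau> w)" by simp
          then show ?thesis using False by (simp add: \<tau>'_def del: map_eq_conv)
        qed
      qed
      finally show ?thesis .
    qed
    then have "sat M e (foldr All ys \<phi>') \<longleftrightarrow> (\<forall>cs\<in>ntuples M n. sat Meq ((val \<tau> e)(v := valu (fst v) cs)) \<phi>)"
      using sat_foldr_All[OF ys(1), of M e \<phi>'] ys(2) by simp
    also have "\<dots> \<longleftrightarrow> (\<forall>c\<in>eq_carr L M (fst v). sat Meq ((val \<tau> e)(v := c)) \<phi>)"
    proof
      assume a: "\<forall>cs\<in>ntuples M n. sat Meq ((val \<tau> e)(v := valu (fst v) cs)) \<phi>"
      show "\<forall>c\<in>eq_carr L M (fst v). sat Meq ((val \<tau> e)(v := c)) \<phi>"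
      proof
        fix c assume c: "c \<in> eq_carr L M (fst v)"
        show "sat Meq ((val \<tau> e)(v := c)) \<phi>" using bspec[OF a, of "rp c"] carr_valu[OF c] by (simp add: n_def)
      qed
    next
      assume a: "\<forall>c\<in>eq_carr L M (fst v). sat Meq ((val \<tau> e)(v := c)) \<phi>"
      show "\<forall>cs\<in>ntuples M n. sat Meq ((val \<tau> e)(v := valu (fst v) cs)) \<phi>"
      proof
        fix cs assume "cs \<in> ntuples M n"
        then have "valu (fst v) cs \<in> eq_carr L M (fst v)" using valu_carr[OF s] by (simp add: n_def)
        then show "sat Meq ((val \<tau> e)(v := valu (fst v) cs)) \<phi>" using a by blast
      qed
    qed
    finally show ?thesis by simp
  qed
  ultimately show ?case by auto
qed

end

section \<open>Properties of thorn-independence\<close>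

context saturated_struc
begin

lemma partial_type_finsat:
  assumes "partial_type L M X A p"
  shows "finsat M X p"
  unfolding finsat_def
proof (intro allI impI)
  have c: "\<exists>\<chi>\<in>p. \<forall>e. sat M e \<chi> \<longrightarrow> (\<forall>\<phi>\<in>F. sat M e \<phi>)" if "finite F" "F \<subseteq> p" for F
    using that
  proof (induction F)
    case empty
    then show ?case using assms by (auto simp: partial_type_def)
  next
    case (insert \<phi> F)
    then obtain \<chi> where \<chi>: "\<chi> \<in> p" "\<forall>e. sat M e \<chi> \<longrightarrow> (\<forall>\<phi>\<in>F. sat M e \<phi>)" by blast
    have "Conj \<phi> \<chi> \<in> p" using assms insert.prems \<chi>(1) unfolding partial_type_def by blast
    then show ?case using \<chi>(2) by (intro bexI[of _ "Conj \<phi> \<chi>"]) auto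
  qed
  fix F assume "F \<subseteq> p" "finite F"
  then obtain \<chi> where "\<chi> \<in> p" "\<forall>e. sat M e \<chi> \<longrightarrow> (\<forall>\<phi>\<in>F. sat M e \<phi>)" using c by blast
  then show "\<exists>e\<in>tuples M X. \<forall>\<phi>\<in>F. sat M e \<phi>" using assms unfolding partial_type_def by blast
qed

lemma tp_complete:
  "e \<in> tuples M X \<Longrightarrow> tp L M X e B \<in> complete_types L M X B"
  using tp_partial_type[of e X B] by (auto simp: complete_types_def tp_def fms_def)

lemma thorn_existence:
  fixes X :: "('s \<times> 'm) set"
  assumes rosy: "rosy L M" and X: "small_vars M X" and A: "small_set M A" and p: "p \<in> complete_types L M X A"
  shows "\<not> type_thorn_forks L M X A p"
proof
  assume f: "type_thorn_forks L M X A p"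
  have pt: "partial_type L M X A p" using p by (simp add: complete_types_def)
  then have sub: "p \<subseteq> fms L M X A" by (simp add: partial_type_def)
  from realize[OF A X sub partial_type_finsat[OF pt]] obtain e where e: "realizes M X e p" .
  then have et: "e \<in> tuples M X" and "p \<subseteq> tp L M X e A" using sub by (auto simp: realizes_def tp_def)
  then have "type_thorn_forks L M X A (tp L M X e (A \<union> {}))" using f unfolding type_thorn_forks_def by auto
  moreover have "small_set M (e ` X)" using small_image_vars[OF X, of e] tuples_univ[OF et] by blast
  then have "tind (e ` X) A {}" by (rule tind_existence[OF rosy _ A])
  then have "thorn_indep L M X e A {}" using thorn_indep_iff[OF X et A small_finite[of "{}"]] by simp
  ultimately show False by (simp add: thorn_indep_def)
qed

lemma thorn_extension:
  fixes X :: "('s \<times> 'm) set"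
  assumes X: "small_vars M X" and B: "small_set M B" and q: "partial_type L M X B q" "\<not> type_thorn_forks L M X A q"
  shows "\<exists>p\<in>complete_types L M X B. q \<subseteq> p \<and> \<not> type_thorn_forks L M X A p"
proof -
  have sub: "q \<subseteq> fms L M X B" "q \<noteq> {}" using q(1) by (simp_all add: partial_type_def)
  obtain e where e: "e \<in> tuples M X" "\<And>\<phi>. \<phi> \<in> q \<Longrightarrow> sat M e \<phi>" "\<not> type_thorn_forks L M X A (tp L M X e B)"
  proof (rule nonforking_realization[OF X B sub])
    fix \<phi> \<psi> assume "\<phi> \<in> q" "\<psi> \<in> q"
    then have "Conj \<phi> \<psi> \<in> q" using q(1) unfolding partial_type_def by blast
    then show "\<exists>\<chi>\<in>q. \<forall>e\<in>tuples M X. sat M e \<chi> \<longrightarrow> sat M e \<phi> \<and> sat M e \<psi>" by (intro bexI) auto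
  next
    fix \<phi> assume "\<phi> \<in> q"
    then show "\<not> thorn_forks L M X A \<phi>" using q(2) unfolding type_thorn_forks_def by blast
  qed (rule that)
  have "q \<subseteq> tp L M X e B" using sub(1) e(2) by (auto simp: tp_def)
  then show ?thesis using tp_complete[OF e(1), of B] e(3) by blast
qed

text \<open>From left to right, \<open>mind\<close> is applied with empty \<open>d\<close> to the
  elements of \<open>B\<close>. Conversely, \<open>B\<close> adds nothing to any closure over
  \<open>A\<close>, so every \<open>E\<close> is in good position as it stands.\<close>

lemma tind_refl:
  assumes A: "small_set M A" and B: "small_set M B"
  shows "tind B A B \<longleftrightarrow> B \<subseteq> cl A"
proof
  assume "tind B A B"
  then have m: "mind B A B" using tind_mind B by blast
  show "B \<subseteq> cl A"
  proof
    fix e assume e: "e \<in> B"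
    then have "e \<in> cl (A \<union> {} \<union> B)" using B by (intro cl_incl) (auto simp: small_set_def)
    from mindD[OF m _ e this] show "e \<in> cl A" by simp
  qed
next
  assume B': "B \<subseteq> cl A"
  show "tind B A B" unfolding tind_def
  proof (intro allI impI)
    fix E assume E: "small_set M E"
    have "mind B A (id ` E)" unfolding mind_def
    proof (intro allI impI ballI)
      fix d e assume d: "d \<subseteq> id ` E" and e: "e \<in> cl (A \<union> d \<union> B)"
      have "A \<union> d \<subseteq> univ M" using A E d by (auto simp: small_set_def)
      then have "A \<union> d \<subseteq> cl (A \<union> d)" using cl_incl by blast
      moreover have "B \<subseteq> cl (A \<union> d)" using B' cl_mono[of A "A \<union> d"] by blast
      ultimately show "e \<in> cl (A \<union> d)" using cl_idem[OF e] by blast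
    qed
    then show "\<exists>\<sigma>\<in>aut (A \<union> B). mind B A (\<sigma> ` E)" using aut_id by blast
  qed
qed

text \<open>\<open>b\<close> supplies values for the variables outside \<open>X\<^sub>0\<close>: a
  tuple on \<open>X\<^sub>0\<close> that refutes k-inconsistency is completed by them to one on
  \<open>X\<close>.\<close>

lemma thorn_divides_restrict:
  fixes X :: "('s \<times> 'm) set"
  assumes div: "thorn_divides L M X A \<psi>" and X0: "X\<^sub>0 \<subseteq> X" "FV \<psi> \<inter> X \<subseteq> X\<^sub>0" and b: "b \<in> tuples M X"
  shows "thorn_divides L M X\<^sub>0 A \<psi>" "FV \<psi> \<subseteq> X\<^sub>0"
proof -
  obtain \<delta> Y a D k where *: "\<psi> = inst Y a \<delta>" "small_set M D" "finite Y" "X \<inter> Y = {}" "\<delta> \<in> fms0 L (X \<union> Y)"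
    "a \<in> tuples M Y" "\<not> algebraic_type M Y (tp L M Y a (A \<union> D))"
    "k_inconsistent M X \<delta> Y {a'. realizes M Y a' (tp L M Y a (A \<union> D))} k"
    using div unfolding thorn_divides_def strongly_divides_def by blast
  have FV: "FV \<delta> - Y \<subseteq> X\<^sub>0" using *(1,5) X0(2) by (auto simp: FV_inst fms0_def)
  then show "FV \<psi> \<subseteq> X\<^sub>0" using *(1) by (simp add: FV_inst)
  have "FV \<delta> \<subseteq> X\<^sub>0 \<union> Y" using FV by blast
  then have \<delta>: "\<delta> \<in> fms0 L (X\<^sub>0 \<union> Y)" using *(5) by (simp add: fms0_def)
  have "k_inconsistent M X\<^sub>0 \<delta> Y {a'. realizes M Y a' (tp L M Y a (A \<union> D))} k"
    unfolding k_inconsistent_def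
  proof (intro allI impI notI)
    fix F assume F: "F \<subseteq> {a'. realizes M Y a' (tp L M Y a (A \<union> D))}" "finite F \<and> card F = k"
      and "\<exists>e\<in>tuples M X\<^sub>0. \<forall>a\<in>F. sat M e (inst Y a \<delta>)"
    then obtain e where e: "e \<in> tuples M X\<^sub>0" "\<forall>a\<in>F. sat M e (inst Y a \<delta>)" by blast
    define e' where "e' = (\<lambda>x\<in>X. if x \<in> X\<^sub>0 then e x else b x)"
    have "e' \<in> tuples M X" using tuplesD[OF e(1)] tuplesD[OF b] by (simp add: e'_def tuples_def)
    moreover have "sat M e' (inst Y a' \<delta>) = sat M e (inst Y a' \<delta>)" for a'
      by (rule sat_cong) (use FV X0(1) in \<open>auto simp: FV_inst e'_def\<close>)
    ultimately show False using *(8) F e(2) unfolding k_inconsistent_def by blast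
  qed
  moreover have "X\<^sub>0 \<inter> Y = {}" using *(4) X0(1) by blast
  ultimately have "strongly_divides L M X\<^sub>0 (A \<union> D) \<delta> Y a"
    using * \<delta> unfolding strongly_divides_def by blast
  then show "thorn_divides L M X\<^sub>0 A \<psi>" using *(1,2) unfolding thorn_divides_def by blast
qed

text \<open>A forking formula and the finitely many thorn-dividing formulas that cover it mention
  finitely many variables. The corresponding elements of \<open>C\<close> form a finite set for
  which forking is already visible.\<close>

lemma thorn_finite_character:
  assumes C: "small_set M C" and fin: "\<And>c. finite c \<Longrightarrow> c \<subseteq> C \<Longrightarrow> thorn_indep_set L M c A B"
  shows "thorn_indep_set L M C A B"
  unfolding thorn_indep_set_def thorn_indep_def
proof
  let ?X = "enum_vars M C"
  define b where "b = restrict snd ?X"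
  have "C \<subseteq> univ M" using C by (simp add: small_set_def)
  then have b: "b \<in> tuples M ?X" using enum_props(1) by (simp add: b_def)
  assume "type_thorn_forks L M ?X A (tp L M ?X (restrict snd ?X) (A \<union> B))"
  then obtain \<phi> \<Psi> where \<phi>: "\<phi> \<in> fms L M ?X (A \<union> B)" "sat M b \<phi>" and \<Psi>: "finite \<Psi>"
    "\<And>\<psi>. \<psi> \<in> \<Psi> \<Longrightarrow> thorn_divides L M ?X A \<psi>" "\<And>e. e \<in> tuples M ?X \<Longrightarrow> sat M e \<phi> \<Longrightarrow> \<exists>\<psi>\<in>\<Psi>. sat M e \<psi>"
    unfolding type_thorn_forks_def thorn_forks_def tp_def b_def by blast
  define W where "W = (FV \<phi> \<union> (\<Union>\<psi>\<in>\<Psi>. FV \<psi>)) \<inter> ?X"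
  define c where "c = snd ` W"
  have c: "finite c" "c \<subseteq> C" using \<Psi>(1) by (auto simp: c_def W_def enum_vars_def)
  define X0 where "X0 = enum_vars M c"
  have X0: "X0 \<subseteq> ?X" using c(2) by (auto simp: X0_def enum_vars_def)
  have WX: "W \<subseteq> X0"
  proof
    fix v assume v: "v \<in> W"
    then have "v \<in> ?X" "snd v \<in> c" by (auto simp: W_def c_def)
    then show "v \<in> X0" by (cases v) (simp add: X0_def enum_vars_def)
  qed
  have "FV \<phi> \<subseteq> ?X" using \<phi>(1) by (simp add: fms_def)
  then have FV: "FV \<phi> \<subseteq> X0" using WX by (auto simp: W_def)
  have div: "thorn_divides L M X0 A \<psi>" "FV \<psi> \<subseteq> X0" if \<psi>: "\<psi> \<in> \<Psi>" for \<psi>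
  proof -
    have "FV \<psi> \<inter> ?X \<subseteq> X0" using WX \<psi> by (auto simp: W_def)
    from thorn_divides_restrict[OF \<Psi>(2)[OF \<psi>] X0 this b]
    show "thorn_divides L M X0 A \<psi>" "FV \<psi> \<subseteq> X0" .
  qed
  have "thorn_forks L M X0 A \<phi>" unfolding thorn_forks_def
  proof (intro exI conjI ballI impI)
    show "finite \<Psi>" by (rule \<Psi>(1))
    show "thorn_divides L M X0 A \<psi>" if "\<psi> \<in> \<Psi>" for \<psi> using div(1)[OF that] .
    fix e assume e: "e \<in> tuples M X0" "sat M e \<phi>"
    define e' where "e' = (\<lambda>x\<in>?X. if x \<in> X0 then e x else b x)"
    have e't: "e' \<in> tuples M ?X" using tuplesD[OF e(1)] tuplesD[OF b] by (simp add: e'_def tuples_def)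
    have eq: "sat M e' \<psi> = sat M e \<psi>" if "FV \<psi> \<subseteq> X0" for \<psi> :: "('f, 'r, 's \<times> 'm, 'm) fm"
      by (rule sat_cong) (use that X0 in \<open>auto simp: e'_def\<close>)
    obtain \<psi> where "\<psi> \<in> \<Psi>" "sat M e' \<psi>" using \<Psi>(3)[OF e't] eq[OF FV] e(2) by blast
    then show "\<exists>\<psi>\<in>\<Psi>. sat M e \<psi>" using eq[OF div(2)] by blast
  qed
  moreover have "\<phi> \<in> tp L M X0 (restrict snd X0) (A \<union> B)"
  proof -
    have "sat M (restrict snd X0) \<phi> = sat M b \<phi>"
      by (rule sat_cong) (use FV X0 in \<open>auto simp: b_def\<close>)
    then show ?thesis using \<phi> FV by (simp add: tp_def fms_def)
  qed
  ultimately show False using fin[OF c]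
    unfolding thorn_indep_set_def thorn_indep_def type_thorn_forks_def X0_def by blast
qed

text \<open>Otherwise some \<open>u\<close> satisfies the formula and is independent from
  \<open>a\<close> over \<open>A\<close> and \<open>b\<close>. By symmetry \<open>b\<close> is
  independent from \<open>a\<close> over \<open>A\<close>, so by left transitivity \<open>b\<close>
  and \<open>u\<close> together are. Then \<open>u\<close> is independent from \<open>a\<close> over
  \<open>A\<close>, although it satisfies a formula over \<open>a\<close> that forks over
  \<open>A\<close>.\<close>

lemma thorn_forks_over_independent:
  fixes X Y Z :: "('s \<times> 'm) set"
  assumes rosy: "rosy L M" and X: "small_vars M X" and Y: "small_vars M Y" and Z: "small_vars M Z" and A: "small_set M A"
    and a: "a \<in> tuples M Y" and b: "b \<in> tuples M Z" and ind: "thorn_indep L M Y a A (b ` Z)"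
    and \<delta>: "\<delta> \<in> fms0 L (X \<union> Y)" and fork: "thorn_forks L M X A (inst Y a \<delta>)"
  shows "thorn_forks L M X (A \<union> b ` Z) (inst Y a \<delta>)"
proof (rule ccontr)
  assume nf: "\<not> thorn_forks L M X (A \<union> b ` Z) (inst Y a \<delta>)"
  have aY: "small_set M (a ` Y)" using small_image_vars[OF Y, of a] tuples_univ[OF a] by blast
  have bZ: "small_set M (b ` Z)" using small_image_vars[OF Z, of b] tuples_univ[OF b] by blast
  have AZ: "small_set M (A \<union> b ` Z)" using A bZ small_Un by blast
  have B: "small_set M (A \<union> b ` Z \<union> a ` Y)" using AZ aY small_Un by blast
  have \<phi>: "inst Y a \<delta> \<in> fms L M X (A \<union> a ` Y)"
  proof -
    have "wff L (\<lambda>s. carr M s \<inter> (A \<union> a ` Y)) (inst Y a \<delta>)"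
      using \<delta> tuplesD[OF a] by (intro wff_inst[of L "\<lambda>s. {}"]) (auto simp: fms0_def)
    then show ?thesis using \<delta> by (auto simp: fms_def FV_inst fms0_def)
  qed
  have \<phi>': "{inst Y a \<delta>} \<subseteq> fms L M X (A \<union> b ` Z \<union> a ` Y)"
    using fms_mono[OF \<phi> subset_refl, of "A \<union> b ` Z \<union> a ` Y"] by blast
  obtain u where u: "u \<in> tuples M X" "\<And>\<phi>. \<phi> \<in> {inst Y a \<delta>} \<Longrightarrow> sat M u \<phi>"
    "\<not> type_thorn_forks L M X (A \<union> b ` Z) (tp L M X u (A \<union> b ` Z \<union> a ` Y))"
  proof (rule nonforking_realization[OF X B \<phi>', of "A \<union> b ` Z"])
    show "\<not> thorn_forks L M X (A \<union> b ` Z) \<phi>" if "\<phi> \<in> {inst Y a \<delta>}" for \<phi> using that nf by simp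
    show "{inst Y a \<delta>} \<noteq> {}" by simp
    show "\<exists>\<chi>\<in>{inst Y a \<delta>}. \<forall>e\<in>tuples M X. sat M e \<chi> \<longrightarrow> sat M e \<phi> \<and> sat M e \<psi>"
      if "\<phi> \<in> {inst Y a \<delta>}" "\<psi> \<in> {inst Y a \<delta>}" for \<phi> \<psi> using that by simp
  qed (rule that)
  have uX: "small_set M (u ` X)" using small_image_vars[OF X, of u] tuples_univ[OF u(1)] by blast
  have "thorn_indep L M X u (A \<union> b ` Z) (a ` Y)" using u(3) by (simp add: thorn_indep_def)
  then have "tind (u ` X) (A \<union> b ` Z) (a ` Y)" using thorn_indep_iff[OF X u(1) AZ aY] by blast
  moreover have "tind (a ` Y) A (b ` Z)" using thorn_indep_iff[OF Y a A bZ] ind by blast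
  then have "tind (b ` Z) A (a ` Y)" by (rule tind_sym[OF rosy aY A bZ])
  ultimately have "tind (b ` Z \<union> u ` X) A (a ` Y)" using tind_left_trans by blast
  then have "tind (u ` X) A (a ` Y)" using tind_mono by blast
  then have "thorn_indep L M X u A (a ` Y)" using thorn_indep_iff[OF X u(1) A aY] by blast
  moreover have "inst Y a \<delta> \<in> tp L M X u (A \<union> a ` Y)" using \<phi> u(2) by (simp add: tp_def)
  ultimately show False using fork unfolding thorn_indep_def type_thorn_forks_def by blast
qed

text \<open>Only finitely many parameters from \<open>cl B\<close> matter, and their conjugates over \<open>B\<close> form a
  finite set that is invariant under the automorphisms fixing \<open>B\<close>.\<close>

lemma thorn_indep_cl:
  fixes X :: "('s \<times> 'm) set"
  assumes X: "small_vars M X" and a: "a \<in> tuples M X" and B: "small_set M B" and AB: "A \<subseteq> B"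
    and ind: "thorn_indep L M X a A B"
  shows "thorn_indep L M X a A (cl B)"
proof (rule ccontr)
  assume "\<not> thorn_indep L M X a A (cl B)"
  then obtain \<phi> where \<phi>: "\<phi> \<in> fms L M X (A \<union> cl B)" "sat M a \<phi>" "thorn_forks L M X A \<phi>"
    unfolding thorn_indep_def type_thorn_forks_def tp_def by blast
  have A: "small_set M A" by (rule small_subset[OF B AB])
  define c where "c = pars \<phi> \<inter> cl B"
  define C where "C = (\<Union>e\<in>c. orb B e)"
  have "finite (orb B e)" if e: "e \<in> c" for e
  proof -
    obtain B0 where B0: "B0 \<subseteq> B" "finite (orb B0 e)" using e unfolding c_def cl_def by blast
    show ?thesis by (rule finite_subset[OF orb_mono[OF B0(1)] B0(2)])
  qed
  then have "finite C" by (simp add: C_def c_def)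
  moreover have "C \<subseteq> univ M"
  proof
    fix d assume "d \<in> C"
    then obtain e \<sigma> where "e \<in> cl B" "\<sigma> \<in> aut B" "d = \<sigma> e" by (auto simp: C_def orb_def c_def)
    then show "d \<in> univ M" using cl_univ auto_univ autD(1) by blast
  qed
  ultimately have C: "small_set M C" by (rule small_finite)
  have sub: "\<sigma> ` C \<subseteq> C" if \<sigma>: "\<sigma> \<in> aut B" for \<sigma>
  proof
    fix d assume "d \<in> \<sigma> ` C"
    then obtain e \<tau> where *: "e \<in> c" "\<tau> \<in> aut B" "d = \<sigma> (\<tau> e)" by (auto simp: C_def orb_def)
    then have "d = (\<sigma> \<circ> \<tau>) e" by simp
    then have "d \<in> orb B e" using aut_comp[OF \<sigma> *(2)] unfolding orb_def by blast
    then show "d \<in> C" using *(1) by (auto simp: C_def)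
  qed
  have BC: "small_set M (B \<union> C)" using B C small_Un by blast
  have "tind (a ` X) A B" using thorn_indep_iff[OF X a A B] ind by blast
  moreover have aX: "small_set M (a ` X)" using small_image_vars[OF X, of a] tuples_univ[OF a] by blast
  \<comment> \<open>Extension gives independence from \<open>B \<union> C\<close> only for a
    conjugate of \<open>a\<close> over \<open>B\<close>. As \<sigma> maps \<open>C\<close> onto
    itself, the move can be undone.\<close>
  ultimately obtain \<sigma> where \<sigma>: "\<sigma> \<in> aut (A \<union> B)" "tind (\<sigma> ` a ` X) A (B \<union> C)"
    using tind_extension[OF aX A B BC] by blast
  have \<sigma>B: "\<sigma> \<in> aut B" using \<sigma>(1) aut_mono[of B "A \<union> B"] by blast
  note \<sigma>a = autD(1)[OF \<sigma>B]
  have "C = \<sigma> ` inv \<sigma> ` C" using auto_inv_image(2)[OF \<sigma>a] by simp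
  also have "\<dots> \<subseteq> \<sigma> ` C" using sub[OF aut_inv[OF \<sigma>B]] by blast
  finally have "\<sigma> ` C = C" using sub[OF \<sigma>B] by blast
  moreover have "\<sigma> ` B = B" "\<sigma> ` A = A" using aut_image[OF \<sigma>B] AB by auto
  ultimately have "\<sigma> ` A = A" "\<sigma> ` (B \<union> C) = B \<union> C" by (simp_all add: image_Un)
  then have "tind (a ` X) A (B \<union> C)" using tind_auto[OF \<sigma>a, of "a ` X" A "B \<union> C"] \<sigma>(2) by simp
  then have i: "thorn_indep L M X a A (B \<union> C)" using thorn_indep_iff[OF X a A BC] by blast
  have "c \<subseteq> C" 
  proof
    fix e assume e: "e \<in> c"
    have "id e \<in> orb B e" unfolding orb_def using aut_id by blast
    then show "e \<in> C" using e by (auto simp: C_def)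
  qed
  then have "pars \<phi> \<subseteq> A \<union> (B \<union> C)" using fms_pars[OF \<phi>(1)] by (auto simp: c_def)
  then have "\<phi> \<in> tp L M X a (A \<union> (B \<union> C))"
    using fms_mono[OF fms_restrict_pars[OF \<phi>(1)] subset_refl] \<phi>(2) by (simp add: tp_def)
  then show False using i \<phi>(3) unfolding thorn_indep_def type_thorn_forks_def by blast
qed

end

section \<open>Saturation of the structure of imaginaries\<close>

context monster
begin

lemma eq_carr_disjoint: "c \<in> eq_carr L M s \<Longrightarrow> c \<in> eq_carr L M s' \<Longrightarrow> s = s'"
  by (cases s; cases s') (auto split: if_splits)

lemma univ_Meq: "univ Meq = (\<Union>s. eq_carr L M s)"
  by (simp add: univ_def)

lemma struc_Meq: "is_struc Leq Meq"
  unfolding is_struc_def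
proof (intro conjI allI ballI impI)
  fix s
  obtain m where m: "m \<in> univ M" using infinite_univ by fastforce
  show "carr Meq s \<noteq> {} \<longleftrightarrow> s \<in> sorts Leq"
  proof (cases s)
    case Home
    then show ?thesis using m by auto
  next
    case (Quot n E)
    have "replicate n m \<in> ntuples M n" using m by (auto simp: ntuples_def)
    then have "ntuples M n // def_rel M n E \<noteq> {}" by (auto simp: quotient_def)
    then show ?thesis using Quot by auto
  qed
next
  fix g cs assume g: "g \<in> funs Leq" and cs: "list_all2 (\<lambda>c s. c \<in> carr Meq s) cs (fargs Leq g)"
  have args: "length cs = length (fargs Leq g) \<and> (\<forall>i<length cs. fargs Leq g ! i = Home)"
    using cs by (cases g) (auto dest: list_all2_lengthD)
  have "real_of c \<in> univ M" if c: "c \<in> set cs" for c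
  proof -
    obtain i where i: "i < length cs" "c = cs ! i" using c by (auto simp: in_set_conv_nth)
    then have "c \<in> eq_carr L M Home" using cs args by (auto simp: list_all2_conv_all_nth)
    then show ?thesis by auto
  qed
  then have r: "set (map real_of cs) \<subseteq> univ M" by auto
  show "fn Meq g cs \<in> carr Meq (fres Leq g)"
  proof (cases g)
    case (Base f)
    have "list_all2 (\<lambda>c s. c \<in> carr M s) (map real_of cs) (fargs L f)"
      using args r Base by (auto simp: list_all2_conv_all_nth carr_univ)
    moreover have "f \<in> funs L" using g Base by auto
    ultimately have "fn M f (map real_of cs) \<in> univ M" using struc unfolding is_struc_def carr_univ by blast
    then show ?thesis using Base by simp
  next
    case (Proj n E)
    have "map real_of cs \<in> ntuples M n" using args r Proj by (simp add: ntuples_def)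
    then show ?thesis using g Proj by (auto simp: quotientI)
  qed
next
  fix r cs assume "r \<in> rels Leq" "cs \<in> rl Meq r"
  then obtain ds where ds: "r \<in> rels L" "ds \<in> rl M r" "cs = map Real ds" by auto
  then have "list_all2 (\<lambda>c s. c \<in> carr M s) ds (rargs L r)" using struc unfolding is_struc_def by blast
  then show "list_all2 (\<lambda>c s. c \<in> carr Meq s) cs (rargs Leq r)"
    using ds(3) by (auto simp: list_all2_conv_all_nth carr_univ)
qed

lemma infinite_Meq: "infinite (univ Meq)"
proof -
  have "Real ` univ M \<subseteq> univ Meq" using univ_Meq eq_carr.simps(1)[of L M] by blast
  moreover have "infinite (Real ` univ M :: ('f, 'r, 'm) eq_elem set)"
    using infinite_univ by (simp add: finite_image_iff inj_on_def)
  ultimately show ?thesis using finite_subset by blast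
qed

text \<open>An imaginary is determined by its arity, a formula and a representative, and there are
  at most as many formulas as elements because the language is smaller than the model.\<close>

lemma card_Meq: "|univ Meq| \<le>o |univ M|"
proof -
  note K = infinite_univ
  let ?F = "{\<phi> :: ('f, 'r, 'm) base_fm. wff L (\<lambda>_. {}) \<phi>}"
  have V: "|UNIV :: (unit \<times> nat) set| \<le>o |univ M|"
  proof -
    have "(UNIV :: (unit \<times> nat) set) \<subseteq> Pair () ` UNIV" by auto
    then show ?thesis using card_le_subset card_le_image[OF card_le_nat[OF K]] by blast
  qed
  have F: "|?F| \<le>o |univ M|" by (rule card_le_formulas[OF K language_card V])
  have "univ Meq \<subseteq> Real ` univ M \<union> (\<lambda>((n, E), ms). Cls n E (def_rel M n E `` {ms})) ` ((UNIV \<times> ?F) \<times> lists (univ M))"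
  proof
    fix c assume "c \<in> univ Meq"
    then obtain s where c: "c \<in> eq_carr L M s" by (auto simp: univ_Meq)
    show "c \<in> Real ` univ M \<union> (\<lambda>((n, E), ms). Cls n E (def_rel M n E `` {ms})) ` ((UNIV \<times> ?F) \<times> lists (univ M))"
    proof (cases s)
      case Home
      then show ?thesis using c by simp
    next
      case (Quot n E)
      then have "def_equiv L M n E" using c by (auto split: if_splits)
      then have "E \<in> ?F" by (auto simp: def_equiv_def fms0_def)
      moreover have "rp c \<in> lists (univ M)" "c = Cls n E (def_rel M n E `` {rp c})"
        using carr_valu[OF c] Quot by (auto simp: ntuples_def)
      ultimately show ?thesis by force
    qed
  qed
  moreover have "|Real ` univ M \<union> (\<lambda>((n, E), ms). Cls n E (def_rel M n E `` {ms})) ` ((UNIV \<times> ?F) \<times> lists (univ M))| \<le>o |univ M|"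
    by (intro card_le_Un card_le_image card_le_Times card_le_lists K F card_le_nat card_of_mono1 subset_refl)
  ultimately show ?thesis by (rule card_le_subset)
qed

text \<open>Each imaginary contributes finitely many home elements, and \<open>card_Meq\<close>
  makes a set that is small for \<open>Meq\<close> small for \<open>M\<close>.\<close>

lemma small_representatives:
  assumes A: "small_set Meq A"
  shows "small_set M (\<Union>c\<in>A. set (rp c))"
proof -
  let ?R = "\<Union>c\<in>A. set (rp c)"
  have "set (rp c) \<subseteq> univ M" if c: "c \<in> A" for c
  proof -
    obtain s where "c \<in> eq_carr L M s" using c A by (auto simp: small_set_def univ_Meq)
    then show ?thesis using carr_valu(1)[of c s] by (auto simp: ntuples_def)
  qed
  then have sub: "?R \<subseteq> univ M" by blast
  have AM: "|A| <o |univ M|" using A ordLess_ordLeq_trans[OF _ card_Meq] by (auto simp: small_set_def)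
  have "|?R| <o |univ M|"
  proof (cases "finite A")
    case True
    then have "finite ?R" by simp
    then show ?thesis using infinite_univ
      by (intro finite_ordLess_infinite[OF card_of_Well_order card_of_Well_order]) (simp_all add: Field_card_of)
  next
    case False
    have "|set xs| \<le>o |A|" for xs :: "'m list"
      by (rule ordLess_imp_ordLeq, rule finite_ordLess_infinite[OF card_of_Well_order card_of_Well_order])
        (simp_all add: Field_card_of False)
    then have "|?R| \<le>o |A|"
      by (intro card_of_UNION_ordLeq_infinite[OF False]) (simp_all add: card_of_mono1)
    then show ?thesis using AM ordLeq_ordLess_trans by blast
  qed
  then show ?thesis using sub by (simp add: small_set_def)
qed

text \<open>A set of formulas in one variable of a quotient sort becomes one in n home variables,
  over representatives of the parameters. The class of a realising n-tuple is the element
  sought.\<close>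

lemma saturation_Meq:
  fixes x :: "('f, 'r, 'm) eq_sort \<times> 'n"
  assumes A: "small_set Meq A" and \<Sigma>: "\<Sigma> \<subseteq> fms Leq Meq {x} A" and fin: "finsat Meq {x} \<Sigma>"
  shows "\<exists>e. realizes Meq {x} e \<Sigma>"
proof -
  let ?A = "\<Union>c\<in>A. set (rp c)"
  define s where "s = fst x"
  define n where "n = ar s"
  have "\<exists>e\<in>tuples Meq {x}. \<forall>\<phi>\<in>{}. sat Meq e \<phi>" using fin unfolding finsat_def by blast
  then have "carr Meq s \<noteq> {}" by (auto simp: tuples_def s_def)
  then have s: "s \<in> sorts Leq" using struc_Meq by (simp add: is_struc_def)
  define X where "X = {((), i) |i. i < n}"
  have "X = Pair () ` {..<n}" by (auto simp: X_def)
  then have X: "finite X" by simp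
  define \<tau> where "\<tau> = (\<lambda>_ :: ('f, 'r, 'm) eq_sort \<times> 'n. map (\<lambda>i. Var ((), i)) [0..<n] :: ('f, unit \<times> nat, 'm) trm list)"
  have ok: "trl_ok \<tau> ar ?A x" by (auto simp: trl_ok_def \<tau>_def n_def s_def)
  define W where "W \<phi> \<phi>' \<longleftrightarrow> \<phi>' \<in> fms L M X ?A \<and>
    (\<forall>e. (\<forall>x. e x \<in> univ M) \<longrightarrow> (sat M e \<phi>' \<longleftrightarrow> sat Meq (val \<tau> e) \<phi>))" for \<phi> :: "(('f, 'r, 'm) eq_fun, 'r, ('f, 'r, 'm) eq_sort \<times> 'n, ('f, 'r, 'm) eq_elem) fm" and \<phi>'
  have "\<forall>\<phi>\<in>\<Sigma>. \<exists>\<phi>'. W \<phi> \<phi>'"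
  proof
    fix \<phi> assume "\<phi> \<in> \<Sigma>"
    then have w: "wff Leq (\<lambda>s. eq_carr L M s \<inter> A) \<phi>" and FV: "FV \<phi> \<subseteq> {x}" using \<Sigma> by (auto simp: fms_def)
    have "trl_ok \<tau> ar ?A v" if "v \<in> FV \<phi>" for v using that FV ok by blast
    from translate_formula[OF w this] obtain \<phi>' where \<phi>': "wff L (\<lambda>s. carr M s \<inter> ?A) \<phi>'"
      "FV \<phi>' \<subseteq> (\<Union>v\<in>FV \<phi>. \<Union>u\<in>set (\<tau> v). tvars u)"
      "\<forall>e. (\<forall>x. e x \<in> univ M) \<longrightarrow> (sat M e \<phi>' \<longleftrightarrow> sat Meq (val \<tau> e) \<phi>)" by blast
    have "(\<Union>v\<in>FV \<phi>. \<Union>u\<in>set (\<tau> v). tvars u) \<subseteq> X" by (auto simp: \<tau>_def X_def)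
    with \<phi>'(2) have "FV \<phi>' \<subseteq> X" by (rule order_trans)
    then have "W \<phi> \<phi>'" using \<phi>'(1,3) by (simp add: W_def fms_def)
    then show "\<exists>\<phi>'. W \<phi> \<phi>'" ..
  qed
  from bchoice[OF this] obtain tr where tr: "\<forall>\<phi>\<in>\<Sigma>. W \<phi> (tr \<phi>)" ..
  obtain m0 where m0: "m0 \<in> univ M" using infinite_univ by fastforce
  have transfer: "sat M e (tr \<phi>) \<longleftrightarrow> sat Meq (\<lambda>y\<in>{x}. valu s (map (\<lambda>i. e ((), i)) [0..<n])) \<phi>"
    if \<phi>: "\<phi> \<in> \<Sigma>" and e: "e \<in> tuples M X" for \<phi> e
  proof -
    \<comment> \<open>\<open>translate_formula\<close> asks for values in the universe at all
      variables, whereas a tuple on \<open>X\<close> is undefined elsewhere; \<open>m0\<close> fills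
      the gap.\<close>
    define e' where "e' = (\<lambda>x. if x \<in> X then e x else m0)"
    have W: "W \<phi> (tr \<phi>)" using tr \<phi> by blast
    have e'u: "\<forall>x. e' x \<in> univ M" using e m0 carr_univ by (auto simp: e'_def tuples_def)
    have "sat M e (tr \<phi>) = sat M e' (tr \<phi>)"
      by (rule sat_cong) (use W in \<open>auto simp: W_def fms_def e'_def\<close>)
    also have "\<dots> = sat Meq (val \<tau> e') \<phi>" using W e'u by (simp add: W_def)
    also have "\<dots> = sat Meq (\<lambda>y\<in>{x}. valu s (map (\<lambda>i. e ((), i)) [0..<n])) \<phi>"
    proof (rule sat_cong)
      fix y assume "y \<in> FV \<phi>"
      then have y: "y = x" using \<phi> \<Sigma> by (auto simp: fms_def)
      have "map (eval M e') (\<tau> y) = map (\<lambda>i. e ((), i)) [0..<n]" by (simp add: \<tau>_def e'_def X_def)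
      then show "val \<tau> e' y = (\<lambda>y\<in>{x}. valu s (map (\<lambda>i. e ((), i)) [0..<n])) y"
        using y by (simp add: s_def del: map_map)
    qed
    finally show ?thesis .
  qed
  have "tr ` \<Sigma> \<subseteq> fms L M X ?A" using tr by (auto simp: W_def)
  moreover have "finsat M X (tr ` \<Sigma>)" unfolding finsat_def
  proof (intro allI impI)
    fix F' assume F': "F' \<subseteq> tr ` \<Sigma>" "finite F'"
    from finite_subset_image[OF F'(2,1)] obtain F where F: "F \<subseteq> \<Sigma>" "finite F" "F' = tr ` F" by blast
    then obtain e where e: "e \<in> tuples Meq {x}" "\<forall>\<phi>\<in>F. sat Meq e \<phi>" using fin unfolding finsat_def by blast
    have ex: "e x \<in> eq_carr L M s" using e(1) by (auto simp: tuples_def s_def)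
    define ms where "ms = rp (e x)"
    have ms: "ms \<in> ntuples M n" "valu s ms = e x" using carr_valu[OF ex] by (simp_all add: ms_def n_def)
    define e' where "e' = (\<lambda>y\<in>X. ms ! snd y)"
    have e't: "e' \<in> tuples M X" using ms(1) by (auto simp: e'_def tuples_def X_def ntuples_def carr_univ)
    have "map (\<lambda>i. e' ((), i)) [0..<n] = ms"
      by (rule nth_equalityI) (use ms(1) in \<open>auto simp: e'_def X_def ntuples_def\<close>)
    then have "(\<lambda>y\<in>{x}. valu s (map (\<lambda>i. e' ((), i)) [0..<n])) = (\<lambda>y\<in>{x}. e x)" using ms(2) by simp
    also have "\<dots> = e"
    proof
      fix y show "(\<lambda>y\<in>{x}. e x) y = e y"
        using e(1) PiE_arb[of e "{x}" _ y] by (cases "y = x") (simp_all add: tuples_def)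
    qed
    finally have "sat M e' (tr \<phi>)" if "\<phi> \<in> F" for \<phi> using transfer[OF _ e't, of \<phi>] that F(1) e(2) by auto
    then show "\<exists>e\<in>tuples M X. \<forall>\<phi>\<in>F'. sat M e \<phi>" using e't F(3) by blast
  qed
  ultimately obtain e where e: "realizes M X e (tr ` \<Sigma>)"
    using saturation[OF small_representatives[OF A] X] by blast
  let ?e = "\<lambda>y\<in>{x}. valu s (map (\<lambda>i. e ((), i)) [0..<n])"
  have et: "e \<in> tuples M X" using e by (simp add: realizes_def)
  have "e ((), i) \<in> univ M" if "i < n" for i
    using et that by (auto simp: tuples_def X_def carr_univ)
  then have "map (\<lambda>i. e ((), i)) [0..<n] \<in> ntuples M n" by (auto simp: ntuples_def)
  then have "?e \<in> tuples Meq {x}" using valu_carr[OF s] by (simp add: tuples_def n_def s_def)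
  moreover have "sat Meq ?e \<phi>" if "\<phi> \<in> \<Sigma>" for \<phi>
    using transfer[OF that et] e that by (simp add: realizes_def)
  ultimately have "realizes Meq {x} ?e \<Sigma>" by (simp add: realizes_def)
  then show ?thesis by blast
qed

lemma saturated_struc_Meq: "saturated_struc Leq Meq"
  by unfold_locales (use struc_Meq eq_carr_disjoint infinite_Meq saturation_Meq in auto)

end

theorem corollary4p1p2:
  fixes L :: "(unit, 'f, 'r) signature"
    and T :: "('f, 'r, 'm) base_fm set"
    and M :: "(unit, 'f, 'r, 'm) struc"
    and Leq :: "(('f, 'r, 'm) eq_sort, ('f, 'r, 'm) eq_fun, 'r) signature"
    and Meq :: "(('f, 'r, 'm) eq_sort, ('f, 'r, 'm) eq_fun, 'r, ('f, 'r, 'm) eq_elem) struc"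
  assumes T: "complete_theory L T"
    and M: "monster_model L T M"
    and Leq: "Leq = eq_sig L M"
    and Meq: "Meq = eq_struc L M"
    and rosy: "rosy Leq Meq"
  shows
    \<comment> \<open>existence\<close>
    "(\<forall>(X :: (('f, 'r, 'm) eq_sort \<times> ('f, 'r, 'm) eq_elem) set) A.
        small_vars Meq X \<and> small_set Meq A \<longrightarrow>
        (\<forall>p\<in>complete_types Leq Meq X A. \<not> type_thorn_forks Leq Meq X A p)) \<and>
     \<comment> \<open>extension\<close>
     (\<forall>(X :: (('f, 'r, 'm) eq_sort \<times> ('f, 'r, 'm) eq_elem) set) A B q.
        small_vars Meq X \<and> small_set Meq B \<and> A \<subseteq> B \<and>
        partial_type Leq Meq X B q \<and> \<not> type_thorn_forks Leq Meq X A q \<longrightarrow>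
        (\<exists>p\<in>complete_types Leq Meq X B. q \<subseteq> p \<and> \<not> type_thorn_forks Leq Meq X A p)) \<and>
     \<comment> \<open>reflexivity\<close>
     (\<forall>A B. small_set Meq A \<and> small_set Meq B \<longrightarrow>
        (thorn_indep_set Leq Meq B A B \<longleftrightarrow> B \<subseteq> acl Leq Meq A)) \<and>
     \<comment> \<open>monotonicity\<close>
     (\<forall>(X :: (('f, 'r, 'm) eq_sort \<times> ('f, 'r, 'm) eq_elem) set) A B C p q.
        small_vars Meq X \<and> small_set Meq A \<and> small_set Meq B \<and> small_set Meq C \<and>
        partial_type Leq Meq X B p \<and> partial_type Leq Meq X C q \<and> q \<subseteq> p \<and>
        \<not> type_thorn_forks Leq Meq X A p \<longrightarrow> \<not> type_thorn_forks Leq Meq X A q) \<and>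
     \<comment> \<open>finite character\<close>
     (\<forall>A B C. small_set Meq A \<and> small_set Meq B \<and> small_set Meq C \<longrightarrow>
        (thorn_indep_set Leq Meq C A B \<longleftrightarrow>
         (\<forall>c. finite c \<and> c \<subseteq> C \<longrightarrow> thorn_indep_set Leq Meq c A B))) \<and>
     \<comment> \<open>symmetry\<close>
     (\<forall>A B C. small_set Meq A \<and> small_set Meq B \<and> small_set Meq C \<longrightarrow>
        (thorn_indep_set Leq Meq C A B \<longleftrightarrow> thorn_indep_set Leq Meq B A C)) \<and>
     \<comment> \<open>transitivity\<close>
     (\<forall>(X :: (('f, 'r, 'm) eq_sort \<times> ('f, 'r, 'm) eq_elem) set) b A B C.
        small_vars Meq X \<and> b \<in> tuples Meq X \<and> small_set Meq C \<and> A \<subseteq> B \<and> B \<subseteq> C \<longrightarrow>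
        (thorn_indep Leq Meq X b A C \<longleftrightarrow>
         thorn_indep Leq Meq X b A B \<and> thorn_indep Leq Meq X b B C)) \<and>
     \<comment> \<open>forking over \<open>A\<close> implies forking over \<open>Ab\<close>\<close>
     (\<forall>(X :: (('f, 'r, 'm) eq_sort \<times> ('f, 'r, 'm) eq_elem) set)
        (Y :: (('f, 'r, 'm) eq_sort \<times> ('f, 'r, 'm) eq_elem) set)
        (Z :: (('f, 'r, 'm) eq_sort \<times> ('f, 'r, 'm) eq_elem) set) a b A \<delta>.
        small_vars Meq X \<and> small_vars Meq Y \<and> small_vars Meq Z \<and> small_set Meq A \<and>
        a \<in> tuples Meq Y \<and> b \<in> tuples Meq Z \<and> thorn_indep Leq Meq Y a A (b ` Z) \<and>
        X \<inter> Y = {} \<and> \<delta> \<in> fms0 Leq (X \<union> Y) \<and> thorn_forks Leq Meq X A (inst Y a \<delta>) \<longrightarrow>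
        thorn_forks Leq Meq X (A \<union> b ` Z) (inst Y a \<delta>)) \<and>
     \<comment> \<open>algebraic closure\<close>
     (\<forall>(X :: (('f, 'r, 'm) eq_sort \<times> ('f, 'r, 'm) eq_elem) set) a A B.
        small_vars Meq X \<and> a \<in> tuples Meq X \<and> small_set Meq B \<and> A \<subseteq> B \<and>
        thorn_indep Leq Meq X a A B \<longrightarrow> thorn_indep Leq Meq X a A (acl Leq Meq B))"
proof -
  interpret monster L T M by unfold_locales (rule M)
  interpret S: saturated_struc Leq Meq unfolding Leq Meq by (rule saturated_struc_Meq)
  have A_small: "small_set Meq A" if "small_set Meq B" "A \<subseteq> B" for A B
    using S.small_subset that by blast
  show ?thesis
  proof (intro conjI allI impI ballI)
    fix X :: "(('f, 'r, 'm) eq_sort \<times> ('f, 'r, 'm) eq_elem) set" and A p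
    assume "small_vars Meq X \<and> small_set Meq A" "p \<in> complete_types Leq Meq X A"
    then show "\<not> type_thorn_forks Leq Meq X A p" by (intro S.thorn_existence[OF rosy]) simp_all
  next
    fix X :: "(('f, 'r, 'm) eq_sort \<times> ('f, 'r, 'm) eq_elem) set" and A B q
    assume "small_vars Meq X \<and> small_set Meq B \<and> A \<subseteq> B \<and>
      partial_type Leq Meq X B q \<and> \<not> type_thorn_forks Leq Meq X A q"
    then show "\<exists>p\<in>complete_types Leq Meq X B. q \<subseteq> p \<and> \<not> type_thorn_forks Leq Meq X A p"
      by (intro S.thorn_extension) simp_all
  next
    fix A B assume "small_set Meq A \<and> small_set Meq B"
    then show "thorn_indep_set Leq Meq B A B \<longleftrightarrow> B \<subseteq> acl Leq Meq A"
      using S.thorn_indep_set_iff[of B A B] S.tind_refl[of A B] by (simp add: S.acl_eq_cl)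
  next
    fix X :: "(('f, 'r, 'm) eq_sort \<times> ('f, 'r, 'm) eq_elem) set" and A B C p q
    assume "small_vars Meq X \<and> small_set Meq A \<and> small_set Meq B \<and> small_set Meq C \<and>
        partial_type Leq Meq X B p \<and> partial_type Leq Meq X C q \<and> q \<subseteq> p \<and>
        \<not> type_thorn_forks Leq Meq X A p"
    then show "\<not> type_thorn_forks Leq Meq X A q" unfolding type_thorn_forks_def by blast
  next
    fix A B C assume small: "small_set Meq A \<and> small_set Meq B \<and> small_set Meq C"
    show "thorn_indep_set Leq Meq C A B \<longleftrightarrow> (\<forall>c. finite c \<and> c \<subseteq> C \<longrightarrow> thorn_indep_set Leq Meq c A B)"
    proof (intro iffI allI impI)
      fix c assume C: "thorn_indep_set Leq Meq C A B" and c: "finite c \<and> c \<subseteq> C"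
      show "thorn_indep_set Leq Meq c A B"
      proof -
        have AB: "small_set Meq C" "small_set Meq A" "small_set Meq B" using small by simp_all
        have "S.tind C A B" using S.thorn_indep_set_iff[OF AB] C by (rule iffD1)
        then have "S.tind c A B" by (rule S.tind_mono) (use c in simp_all)
        then show ?thesis by (rule iffD2[OF S.thorn_indep_set_iff[OF A_small[OF AB(1) conjunct2[OF c]] AB(2,3)]])
      qed
    next
      assume fin: "\<forall>c. finite c \<and> c \<subseteq> C \<longrightarrow> thorn_indep_set Leq Meq c A B"
      show "thorn_indep_set Leq Meq C A B"
      proof (rule S.thorn_finite_character)
        show "small_set Meq C" using small by (elim conjE)
        fix c assume "finite c" "c \<subseteq> C"
        then show "thorn_indep_set Leq Meq c A B" by (intro fin[rule_format] conjI)
      qed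
    qed
  next
    fix A B C assume "small_set Meq A \<and> small_set Meq B \<and> small_set Meq C"
    then have small: "small_set Meq A" "small_set Meq B" "small_set Meq C" by simp_all
    show "thorn_indep_set Leq Meq C A B \<longleftrightarrow> thorn_indep_set Leq Meq B A C"
      unfolding S.thorn_indep_set_iff[OF small(3,1,2)] S.thorn_indep_set_iff[OF small(2,1,3)]
      using S.tind_sym[OF rosy small(3,1,2)] S.tind_sym[OF rosy small(2,1,3)] by (rule iffI)
  next
    fix X :: "(('f, 'r, 'm) eq_sort \<times> ('f, 'r, 'm) eq_elem) set" and b A B C
    assume *: "small_vars Meq X \<and> b \<in> tuples Meq X \<and> small_set Meq C \<and> A \<subseteq> B \<and> B \<subseteq> C"
    then have X: "small_vars Meq X" and b: "b \<in> tuples Meq X" and C: "small_set Meq C"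
      and AB: "A \<subseteq> B" "B \<subseteq> C" by auto
    have B: "small_set Meq B" and A: "small_set Meq A" using A_small[OF C] AB by auto
    have bX: "small_set Meq (b ` X)" using S.small_image_vars[OF X, of b] S.tuples_univ[OF b] by blast
    have "S.tind (b ` X) A C \<longleftrightarrow> S.tind (b ` X) A B \<and> S.tind (b ` X) B C"
    proof
      assume t: "S.tind (b ` X) A C"
      have "A \<union> B \<subseteq> A \<union> C" using AB by blast
      then show "S.tind (b ` X) A B \<and> S.tind (b ` X) B C"
        using S.tind_mono[OF t subset_refl] S.tind_base_mono[OF t AB B] by simp
    next
      assume "S.tind (b ` X) A B \<and> S.tind (b ` X) B C"
      then show "S.tind (b ` X) A C" using S.tind_trans[OF rosy bX C AB] by simp
    qed
    then show "thorn_indep Leq Meq X b A C \<longleftrightarrow> thorn_indep Leq Meq X b A B \<and> thorn_indep Leq Meq X b B C"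
      using S.thorn_indep_iff[OF X b] A B C by simp
  next
    fix X Y Z :: "(('f, 'r, 'm) eq_sort \<times> ('f, 'r, 'm) eq_elem) set" and a b A \<delta>
    assume *: "small_vars Meq X \<and> small_vars Meq Y \<and> small_vars Meq Z \<and> small_set Meq A \<and>
        a \<in> tuples Meq Y \<and> b \<in> tuples Meq Z \<and> thorn_indep Leq Meq Y a A (b ` Z) \<and>
        X \<inter> Y = {} \<and> \<delta> \<in> fms0 Leq (X \<union> Y) \<and> thorn_forks Leq Meq X A (inst Y a \<delta>)"
    show "thorn_forks Leq Meq X (A \<union> b ` Z) (inst Y a \<delta>)"
      by (rule S.thorn_forks_over_independent[OF rosy, of X Y Z]) (use * in auto)
  next
    fix X :: "(('f, 'r, 'm) eq_sort \<times> ('f, 'r, 'm) eq_elem) set" and a A B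
    assume "small_vars Meq X \<and> a \<in> tuples Meq X \<and> small_set Meq B \<and> A \<subseteq> B \<and> thorn_indep Leq Meq X a A B"
    then show "thorn_indep Leq Meq X a A (acl Leq Meq B)"
      unfolding S.acl_eq_cl by (intro S.thorn_indep_cl[of X a B A]) simp_all
  qed
qed

end
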